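(* Suppose $f:\mathbb{R}\times N\to N$ is a $C^1$ flow on a manifold $N$ preserving a Borel probability measure $\mu$ with compact support. If $M$ is a connected complete Riemannian manifold with non-positive sectional curvature and $h:N\to M$ is a $C^1$ map, then for $\mu$-almost every $x\in N$ there exists a unique rotation vector $v_h(x)$.
   Context: Let $\pi:\widetilde{M}\to M$ be the universal Riemannian covering of $M$ (so $\widetilde{M}$ is complete, simply connected, with non-positive sectional curvature) and let $d$ be the Riemannian distance on $\widetilde{M}$. Rotation vector through $h$: a rotation vector $v_h(x)$ of a point $x\in N$ is a vector in the tangent space $T_{h(x)}M$ such that for any lift $\tilde{p}\in\widetilde{M}$ of $p=h(x)$ one has $d(\tilde{\alpha}(t),\tilde{\beta}(t))=o(t)$ when $t\to+\infty$, where $\tilde{\alpha}$ is the lift starting at $\tilde{p}$ of the geodesic $\alpha:[0,+\infty)\to M$, $\alpha(t)=\exp_{h(x)}(t\,v_h(x))$, and $\tilde{\beta}$ is the lift starting at the same point $\tilde{p}$ of the curve $\beta(t)=h(f^t(x))$. *)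

theory Defs
  imports
    "HOL-Probability.Probability"
    "HOL-Library.Landau_Symbols"
    "HOL-Library.Extended_Nat"
begin

section \<open>Functions of class \<open>C\<^sup>k\<close> on open sets\<close>

text \<open>
  Since the target and source are finite-dimensional in all uses below, it suffices to iterate
  directional derivatives \<open>\<lambda>x. Df(x) v\<close> for all fixed \<open>v\<close>. Meant for open \<open>S\<close>.
\<close>

primrec Ck_on :: "nat \<Rightarrow> 'a::euclidean_space set \<Rightarrow> ('a \<Rightarrow> 'b::real_normed_vector) \<Rightarrow> bool" where
  "Ck_on 0 S f \<longleftrightarrow> continuous_on S f"
| "Ck_on (Suc n) S f \<longleftrightarrow>
     (\<forall>x\<in>S. f differentiable (at x)) \<and> (\<forall>v. Ck_on n S (\<lambda>x. frechet_derivative f (at x) v))"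

definition C_on :: "enat \<Rightarrow> 'a::euclidean_space set \<Rightarrow> ('a \<Rightarrow> 'b::real_normed_vector) \<Rightarrow> bool" where
  "C_on k S f \<longleftrightarrow> (\<forall>n. enat n \<le> k \<longrightarrow> Ck_on n S f)"

section \<open>Manifolds\<close>

text \<open>
  A manifold lives on a subset of a Hausdorff second countable type, with the subspace topology.
  Every (Hausdorff, second countable) manifold embeds in such a type, e.g. in \<open>nat \<Rightarrow> real\<close>.
  A chart is a domain together with a coordinate map, which is only relevant on that domain.
  The atlas need not be maximal.
\<close>

type_synonym ('m, 'e) chart = "'m set \<times> ('m \<Rightarrow> 'e)"

record ('m, 'e) mfd =
  points :: "'m set"
  charts :: "('m, 'e) chart set"

definition chart_inv :: "('m, 'e) chart \<Rightarrow> 'e \<Rightarrow> 'm" where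
  "chart_inv c = inv_into (fst c) (snd c)"

definition transition :: "('m, 'e) chart \<Rightarrow> ('m, 'e) chart \<Rightarrow> 'e \<Rightarrow> 'e" where
  "transition c c' = snd c' \<circ> chart_inv c"

definition manifold ::
  "enat \<Rightarrow> ('m::{t2_space,second_countable_topology}, 'e::euclidean_space, 'x) mfd_scheme \<Rightarrow> bool" where
  "manifold k M \<longleftrightarrow>
     \<Union> (fst ` charts M) = points M \<and>
     (\<forall>c\<in>charts M. openin (top_of_set (points M)) (fst c) \<and> open (snd c ` fst c) \<and>
        homeomorphism (fst c) (snd c ` fst c) (snd c) (chart_inv c)) \<and>
     (\<forall>c\<in>charts M. \<forall>c'\<in>charts M. C_on k (snd c ` (fst c \<inter> fst c')) (transition c c'))"

definition C_map ::
  "enat \<Rightarrow> ('m::{t2_space,second_countable_topology}, 'e::euclidean_space, 'x) mfd_scheme \<Rightarrow>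
   ('n::{t2_space,second_countable_topology}, 'd::euclidean_space, 'y) mfd_scheme \<Rightarrow> ('m \<Rightarrow> 'n) \<Rightarrow> bool" where
  "C_map k M N F \<longleftrightarrow>
     continuous_on (points M) F \<and> F ` points M \<subseteq> points N \<and>
     (\<forall>c\<in>charts M. \<forall>c'\<in>charts N.
        C_on k (snd c ` (fst c \<inter> F -` fst c')) (snd c' \<circ> F \<circ> chart_inv c))"

definition real_line :: "(real, real) mfd" where
  "real_line = \<lparr>points = UNIV, charts = {(UNIV, \<lambda>t. t)}\<rparr>"

definition prod_mfd :: "('m, 'e, 'x) mfd_scheme \<Rightarrow> ('n, 'd, 'y) mfd_scheme \<Rightarrow> ('m \<times> 'n, 'e \<times> 'd) mfd" where
  "prod_mfd M N = \<lparr>points = points M \<times> points N,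
     charts = {(fst c \<times> fst c', map_prod (snd c) (snd c')) | c c'. c \<in> charts M \<and> c' \<in> charts N}\<rparr>"

section \<open>Tangent vectors\<close>

text \<open>
  A tangent vector at \<open>p\<close> is the family of its coordinate vectors in all charts around \<open>p\<close>, related
  by the derivatives of the transition maps. The entries at all other charts are \<open>0\<close>, so that equality
  of tangent vectors is equality of functions.
\<close>

type_synonym ('m, 'e) tvec = "('m, 'e) chart \<Rightarrow> 'e"

definition charts_at :: "('m, 'e, 'x) mfd_scheme \<Rightarrow> 'm \<Rightarrow> ('m, 'e) chart set" where
  "charts_at M p = {c \<in> charts M. p \<in> fst c}"

definition tangent_space :: "('m, 'e::euclidean_space, 'x) mfd_scheme \<Rightarrow> 'm \<Rightarrow> ('m, 'e) tvec set" where
  "tangent_space M p =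
     {v. (\<forall>c\<in>charts_at M p. \<forall>c'\<in>charts_at M p.
            v c' = frechet_derivative (transition c c') (at (snd c p)) (v c)) \<and>
         (\<forall>c. c \<notin> charts_at M p \<longrightarrow> v c = 0)}"

definition tscale :: "real \<Rightarrow> ('m, 'e::euclidean_space) tvec \<Rightarrow> ('m, 'e) tvec" where
  "tscale r v = (\<lambda>c. r *\<^sub>R v c)"

definition tadd :: "('m, 'e::euclidean_space) tvec \<Rightarrow> ('m, 'e) tvec \<Rightarrow> ('m, 'e) tvec" where
  "tadd v w = (\<lambda>c. v c + w c)"

text \<open>The tangent vector at \<open>p\<close> whose coordinate vector in the chart \<open>c\<close> is \<open>a\<close>:\<close>

definition coord_vec ::
  "('m, 'e::euclidean_space, 'x) mfd_scheme \<Rightarrow> ('m, 'e) chart \<Rightarrow> 'm \<Rightarrow> 'e \<Rightarrow> ('m, 'e) tvec" where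
  "coord_vec M c p a = (\<lambda>c'. if c' \<in> charts_at M p
     then frechet_derivative (transition c c') (at (snd c p)) a else 0)"

definition differential ::
  "('m, 'e::euclidean_space, 'x) mfd_scheme \<Rightarrow> ('n, 'd::euclidean_space, 'y) mfd_scheme \<Rightarrow> ('m \<Rightarrow> 'n) \<Rightarrow>
   'm \<Rightarrow> ('m, 'e) tvec \<Rightarrow> ('n, 'd) tvec" where
  "differential M N F p v = (\<lambda>c'. if c' \<in> charts_at N (F p)
     then let c = (SOME c. c \<in> charts_at M p)
          in frechet_derivative (snd c' \<circ> F \<circ> chart_inv c) (at (snd c p)) (v c)
     else 0)"

definition velocity :: "('m, 'e::euclidean_space, 'x) mfd_scheme \<Rightarrow> (real \<Rightarrow> 'm) \<Rightarrow> real \<Rightarrow> ('m, 'e) tvec" where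
  "velocity M \<gamma> t = (\<lambda>c. if c \<in> charts_at M (\<gamma> t)
     then vector_derivative (snd c \<circ> \<gamma>) (at t) else 0)"

section \<open>Riemannian manifolds\<close>

record ('m, 'e) riem_mfd = "('m, 'e) mfd" +
  metric :: "'m \<Rightarrow> ('m, 'e) tvec \<Rightarrow> ('m, 'e) tvec \<Rightarrow> real"

text \<open>The coefficients \<open>g\<^sub>y(a, b)\<close> of the metric in the chart \<open>c\<close>, at the coordinate point \<open>y\<close>:\<close>

definition local_metric ::
  "('m, 'e::euclidean_space) riem_mfd \<Rightarrow> ('m, 'e) chart \<Rightarrow> 'e \<Rightarrow> 'e \<Rightarrow> 'e \<Rightarrow> real" where
  "local_metric M c y a b = (let p = chart_inv c y
     in metric M p (coord_vec M c p a) (coord_vec M c p b))"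

definition riemannian_manifold ::
  "('m::{t2_space,second_countable_topology}, 'e::euclidean_space) riem_mfd \<Rightarrow> bool" where
  "riemannian_manifold M \<longleftrightarrow>
     manifold \<infinity> M \<and>
     (\<forall>p\<in>points M.
        (\<forall>u\<in>tangent_space M p. \<forall>v\<in>tangent_space M p. metric M p u v = metric M p v u) \<and>
        (\<forall>u\<in>tangent_space M p. \<forall>v\<in>tangent_space M p. \<forall>w\<in>tangent_space M p. \<forall>r.
           metric M p (tadd (tscale r u) v) w = r * metric M p u w + metric M p v w) \<and>
        (\<forall>u\<in>tangent_space M p. u \<noteq> (\<lambda>_. 0) \<longrightarrow> metric M p u u > 0)) \<and>
     (\<forall>c\<in>charts M. \<forall>a b. C_on \<infinity> (snd c ` fst c) (\<lambda>y. local_metric M c y a b))"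

subsection \<open>Levi-Civita connection, geodesics and curvature\<close>

text \<open>
  The Christoffel symbols \<open>\<Gamma>\<^sub>y(u, v)\<close> of the chart \<open>c\<close> as a bilinear map, without reference to a basis:
  \<open>\<Gamma>\<^sub>y(u, v) = \<nabla>\<^sub>u V\<close> for the constant coordinate field \<open>V = v\<close>. The equation is the Koszul formula
  for constant coordinate fields, whose brackets vanish.
\<close>

definition metric_deriv ::
  "('m, 'e::euclidean_space) riem_mfd \<Rightarrow> ('m, 'e) chart \<Rightarrow> 'e \<Rightarrow> 'e \<Rightarrow> 'e \<Rightarrow> 'e \<Rightarrow> real" where
  "metric_deriv M c y u a b = frechet_derivative (\<lambda>z. local_metric M c z a b) (at y) u"

definition christoffel ::
  "('m, 'e::euclidean_space) riem_mfd \<Rightarrow> ('m, 'e) chart \<Rightarrow> 'e \<Rightarrow> 'e \<Rightarrow> 'e \<Rightarrow> 'e" where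
  "christoffel M c y u v = (THE w. \<forall>z. 2 * local_metric M c y w z =
     metric_deriv M c y u v z + metric_deriv M c y v u z - metric_deriv M c y z u v)"

text \<open>The geodesic equation \<open>x'' + \<Gamma>\<^sub>x(x', x') = 0\<close> in every chart; meant for open intervals \<open>I\<close>.\<close>

definition geodesic_on ::
  "('m::topological_space, 'e::euclidean_space) riem_mfd \<Rightarrow> real set \<Rightarrow> (real \<Rightarrow> 'm) \<Rightarrow> bool" where
  "geodesic_on M I \<gamma> \<longleftrightarrow>
     continuous_on I \<gamma> \<and> \<gamma> ` I \<subseteq> points M \<and>
     (\<forall>c\<in>charts M. \<exists>D. \<forall>t\<in>I. \<gamma> t \<in> fst c \<longrightarrow>
        ((snd c \<circ> \<gamma>) has_vector_derivative D t) (at t) \<and>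
        (D has_vector_derivative - christoffel M c (snd c (\<gamma> t)) (D t) (D t)) (at t))"

definition exp_map ::
  "('m::topological_space, 'e::euclidean_space) riem_mfd \<Rightarrow> 'm \<Rightarrow> ('m, 'e) tvec \<Rightarrow> 'm" where
  "exp_map M p v = (THE q. \<exists>I \<gamma>. open I \<and> is_interval I \<and> {0..1} \<subseteq> I \<and> geodesic_on M I \<gamma> \<and>
     \<gamma> 0 = p \<and> velocity M \<gamma> 0 = v \<and> \<gamma> 1 = q)"

definition complete_riemannian :: "('m::topological_space, 'e::euclidean_space) riem_mfd \<Rightarrow> bool" where
  "complete_riemannian M \<longleftrightarrow>
     (\<forall>p\<in>points M. \<forall>v\<in>tangent_space M p.
        \<exists>\<gamma>. geodesic_on M UNIV \<gamma> \<and> \<gamma> 0 = p \<and> velocity M \<gamma> 0 = v)"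

text \<open>
  The curvature tensor \<open>R(u, v)w = \<nabla>\<^sub>u\<nabla>\<^sub>v W - \<nabla>\<^sub>v\<nabla>\<^sub>u W\<close> in a chart, for constant coordinate fields.
  In this sign convention the sectional curvature of the plane spanned by \<open>u\<close> and \<open>v\<close> is
  \<open>g(R(u, v)v, u)\<close> divided by the squared area of the parallelogram, and round spheres are positive.
\<close>

definition curvature ::
  "('m, 'e::euclidean_space) riem_mfd \<Rightarrow> ('m, 'e) chart \<Rightarrow> 'e \<Rightarrow> 'e \<Rightarrow> 'e \<Rightarrow> 'e \<Rightarrow> 'e" where
  "curvature M c y u v w =
     frechet_derivative (\<lambda>z. christoffel M c z v w) (at y) u
     - frechet_derivative (\<lambda>z. christoffel M c z u w) (at y) v
     + christoffel M c y u (christoffel M c y v w)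
     - christoffel M c y v (christoffel M c y u w)"

definition sectional_curvature ::
  "('m, 'e::euclidean_space) riem_mfd \<Rightarrow> ('m, 'e) chart \<Rightarrow> 'e \<Rightarrow> 'e \<Rightarrow> 'e \<Rightarrow> real" where
  "sectional_curvature M c y u v =
     local_metric M c y (curvature M c y u v v) u /
     (local_metric M c y u u * local_metric M c y v v - (local_metric M c y u v)\<^sup>2)"

definition nonpositive_curvature :: "('m, 'e::euclidean_space) riem_mfd \<Rightarrow> bool" where
  "nonpositive_curvature M \<longleftrightarrow>
     (\<forall>c\<in>charts M. \<forall>y\<in>snd c ` fst c. \<forall>u v. u \<noteq> v \<and> independent {u, v} \<longrightarrow>
        sectional_curvature M c y u v \<le> 0)"

subsection \<open>Riemannian distance\<close>

definition C1_curve_on ::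
  "('m::topological_space, 'e::euclidean_space) riem_mfd \<Rightarrow> real \<Rightarrow> real \<Rightarrow> (real \<Rightarrow> 'm) \<Rightarrow> bool" where
  "C1_curve_on M a b \<gamma> \<longleftrightarrow>
     continuous_on {a..b} \<gamma> \<and> \<gamma> ` {a..b} \<subseteq> points M \<and>
     (\<forall>c\<in>charts M. \<exists>D. continuous_on {t \<in> {a..b}. \<gamma> t \<in> fst c} D \<and>
        (\<forall>t\<in>{a..b}. \<gamma> t \<in> fst c \<longrightarrow>
           ((snd c \<circ> \<gamma>) has_vector_derivative D t) (at t within {a..b})))"

definition piecewise_C1_curve ::
  "('m::topological_space, 'e::euclidean_space) riem_mfd \<Rightarrow> (real \<Rightarrow> 'm) \<Rightarrow> bool" where
  "piecewise_C1_curve M \<gamma> \<longleftrightarrow>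
     (\<exists>S. finite S \<and> {0, 1} \<subseteq> S \<and> S \<subseteq> {0..1} \<and>
        (\<forall>a\<in>S. \<forall>b\<in>S. a < b \<and> {a<..<b} \<inter> S = {} \<longrightarrow> C1_curve_on M a b \<gamma>))"

text \<open>The integrand is irrelevant at the finitely many break points.\<close>

definition curve_length :: "('m, 'e::euclidean_space) riem_mfd \<Rightarrow> (real \<Rightarrow> 'm) \<Rightarrow> real" where
  "curve_length M \<gamma> =
     integral {0..1} (\<lambda>t. sqrt (metric M (\<gamma> t) (velocity M \<gamma> t) (velocity M \<gamma> t)))"

text \<open>Only meaningful on connected manifolds, as \<open>Inf {}\<close> is unspecified for reals.\<close>

definition riemannian_dist ::
  "('m::topological_space, 'e::euclidean_space) riem_mfd \<Rightarrow> 'm \<Rightarrow> 'm \<Rightarrow> real" where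
  "riemannian_dist M p q =
     Inf {curve_length M \<gamma> | \<gamma>. piecewise_C1_curve M \<gamma> \<and> \<gamma> 0 = p \<and> \<gamma> 1 = q}"

subsection \<open>Universal Riemannian covering\<close>

text \<open>
  \<open>Mt\<close> is path connected, since \<open>simply_connected\<close> compares all pairs of loops, constant ones included.
\<close>

definition universal_riemannian_covering ::
  "('c::{t2_space,second_countable_topology}, 'e::euclidean_space) riem_mfd \<Rightarrow> ('c \<Rightarrow> 'm) \<Rightarrow>
   ('m::{t2_space,second_countable_topology}, 'e) riem_mfd \<Rightarrow> bool" where
  "universal_riemannian_covering Mt \<pi> M \<longleftrightarrow>
     riemannian_manifold Mt \<and> simply_connected (points Mt) \<and>
     covering_space (points Mt) \<pi> (points M) \<and> C_map \<infinity> Mt M \<pi> \<and>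
     (\<forall>p\<in>points Mt. \<forall>u\<in>tangent_space Mt p. \<forall>v\<in>tangent_space Mt p.
        metric M (\<pi> p) (differential Mt M \<pi> p u) (differential Mt M \<pi> p v) = metric Mt p u v)"

section \<open>Measure-preserving flows\<close>

definition C1_flow ::
  "('n::{t2_space,second_countable_topology}, 'd::euclidean_space, 'x) mfd_scheme \<Rightarrow>
   (real \<Rightarrow> 'n \<Rightarrow> 'n) \<Rightarrow> bool" where
  "C1_flow N f \<longleftrightarrow>
     C_map 1 (prod_mfd real_line N) N (\<lambda>(t, x). f t x) \<and>
     (\<forall>x\<in>points N. f 0 x = x) \<and>
     (\<forall>s t. \<forall>x\<in>points N. f (s + t) x = f s (f t x))"

definition measure_support :: "'n::topological_space measure \<Rightarrow> 'n set" where
  "measure_support \<mu> = {x \<in> space \<mu>. \<forall>U. open U \<and> x \<in> U \<longrightarrow> emeasure \<mu> (U \<inter> space \<mu>) > 0}"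

definition flow_preserves :: "(real \<Rightarrow> 'n \<Rightarrow> 'n) \<Rightarrow> 'n measure \<Rightarrow> bool" where
  "flow_preserves f \<mu> \<longleftrightarrow> (\<forall>t. f t \<in> measurable \<mu> \<mu> \<and> distr \<mu> \<mu> (f t) = \<mu>)"

section \<open>Rotation vectors\<close>

text \<open>Continuous lift to \<open>Mt\<close>, starting at \<open>pt\<close>, of a curve on \<open>[0, \<infinity>)\<close>:\<close>

definition is_lift_from ::
  "('c::topological_space, 'e) riem_mfd \<Rightarrow> ('c \<Rightarrow> 'm) \<Rightarrow> 'c \<Rightarrow> (real \<Rightarrow> 'm) \<Rightarrow> (real \<Rightarrow> 'c) \<Rightarrow> bool" where
  "is_lift_from Mt \<pi> pt \<alpha> \<alpha>t \<longleftrightarrow>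
     continuous_on {0..} \<alpha>t \<and> \<alpha>t ` {0..} \<subseteq> points Mt \<and> (\<forall>t\<ge>0. \<pi> (\<alpha>t t) = \<alpha> t) \<and> \<alpha>t 0 = pt"

definition rotation_vector ::
  "('c::topological_space, 'e::euclidean_space) riem_mfd \<Rightarrow> ('c \<Rightarrow> 'm) \<Rightarrow>
   ('m::topological_space, 'e) riem_mfd \<Rightarrow> (real \<Rightarrow> 'n \<Rightarrow> 'n) \<Rightarrow> ('n \<Rightarrow> 'm) \<Rightarrow> 'n \<Rightarrow> ('m, 'e) tvec \<Rightarrow> bool" where
  "rotation_vector Mt \<pi> M f h x v \<longleftrightarrow>
     v \<in> tangent_space M (h x) \<and>
     (\<forall>pt\<in>points Mt. \<pi> pt = h x \<longrightarrow>
        (\<exists>\<alpha>t \<beta>t. is_lift_from Mt \<pi> pt (\<lambda>t. exp_map M (h x) (tscale t v)) \<alpha>t \<and>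
                 is_lift_from Mt \<pi> pt (\<lambda>t. h (f t x)) \<beta>t \<and>
                 (\<lambda>t. riemannian_dist Mt (\<alpha>t t) (\<beta>t t)) \<in> o[at_top](\<lambda>t. t)))"

end

theory Submission
  imports Defs
begin

text \<open>
  The lift of \<open>s \<mapsto> h (f\<^sup>s x)\<close> moves its starting point within time \<open>n\<close> by a distance \<open>a n x\<close>, which does
  not depend on the lift and is a subadditive process over the time one map. Following Karlsson and
  Margulis, almost every \<open>x\<close> has a drift \<open>A\<close> and, for every \<open>\<epsilon>\<close>, infinitely many times \<open>n\<close> at which the
  lifted points \<open>y k\<close> satisfy \<open>d (y k) (y n) \<le> d (y 0) (y n) - (A - \<epsilon>) k\<close> for all large \<open>k \<le> n\<close>. The
  inequality of Bruhat and Tits then keeps \<open>y k\<close> within \<open>2 sqrt (A \<epsilon>) k\<close> of the geodesic from \<open>y 0\<close> to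
  \<open>y n\<close>, so that the directions of the \<open>y k\<close> converge.

  Completeness and non-positive curvature enter through the exponential map of \<open>M\<close>: the Jacobi equation
  makes it expanding, hence a covering, and it lifts to a homeomorphism onto the universal covering.
  Lifting curves through it does not increase their length, so that
  \<open>d (exp v) (exp w) \<ge> \<bar>v - w\<bar>\<close> with equality for \<open>v = 0\<close>. Everything else that is needed about the
  distance follows from this by moving the base point.
\<close>

text \<open>A limit of \<open>a n x / n\<close> alone would say nothing about directions. Directions
  converge because of times \<open>n\<close> up to which hardly any progress is wasted at any
  intermediate \<open>k\<close>, and counting leaders of the sequence of increments is what produces
  such times. Ergodicity is not assumed, so \<open>A\<close> varies with \<open>x\<close>.

  Completeness and the sign of the curvature are hypotheses on \<open>M\<close>, not on
  \<open>Mt\<close>. Geodesics of \<open>Mt\<close> are therefore never studied directly; their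
  place is taken by lifts of geodesics of \<open>M\<close>. Since the distance is an infimum over
  piecewise C1 curves, the lower bound has to be shown for every such curve, whereas one ray gives
  the upper bound.

  The Bruhat-Tits inequality becomes Stewart's identity in the tangent space at the intermediate
  point: there the distance to that point is exact and the distances between other points are at
  worst underestimated.

  Compactness of the support enters through one constant: the lifted orbit of a point of the support
  moves by at most \<open>C\<close> within unit time.\<close>

section \<open>Lifting paths and homotopies through coverings\<close>

lemma covering_space_locally_injective:
  assumes "covering_space C p S" "x \<in> C"
  obtains W where "openin (top_of_set C) W" "x \<in> W" "inj_on p W"
proof -
  obtain T u q where "x \<in> T" "openin (top_of_set C) T" "homeomorphism T u p q"
    by (rule covering_space_local_homeomorphism[OF assms])
  moreover from this have "inj_on p T" by (intro inj_on_inverseI[of _ q]) (rule homeomorphism_apply1)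
  ultimately show thesis using that by blast
qed

text \<open>The set of agreement is open because \<open>p\<close> is locally injective, and closed
  because the target is Hausdorff. Asking no more than this of \<open>p\<close> lets
  \<open>section_unique\<close> apply the lemma to the exponential map before that is known to be a
  covering.\<close>

lemma lift_unique:
  fixes g1 g2 :: "'a::topological_space \<Rightarrow> 'c::t2_space"
  assumes loc: "\<And>x. x \<in> C \<Longrightarrow> \<exists>W. openin (top_of_set C) W \<and> x \<in> W \<and> inj_on p W"
    and T: "connected T" and g1: "continuous_on T g1" "g1 ` T \<subseteq> C"
    and g2: "continuous_on T g2" "g2 ` T \<subseteq> C"
    and eq: "\<And>x. x \<in> T \<Longrightarrow> p (g1 x) = p (g2 x)"
    and a: "a \<in> T" "g1 a = g2 a" and x: "x \<in> T"
  shows "g1 x = g2 x"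
proof (rule connected_induction_simple[OF T a(1) x, where P = "\<lambda>x. g1 x = g2 x"])
  fix x assume x: "x \<in> T"
  show "\<exists>V. openin (top_of_set T) V \<and> x \<in> V \<and> (\<forall>y\<in>V. \<forall>z\<in>V. g1 y = g2 y \<longrightarrow> g1 z = g2 z)"
  proof (cases "g1 x = g2 x")
    case True
    obtain W where W: "openin (top_of_set C) W" "g1 x \<in> W" "inj_on p W"
      using loc g1 x by blast
    have "openin (top_of_set T) ((T \<inter> g1 -` W) \<inter> (T \<inter> g2 -` W))"
      using continuous_openin_preimage[OF g1(1) _ W(1)] continuous_openin_preimage[OF g2(1) _ W(1)] g1 g2
      by (simp add: image_subset_iff_funcset openin_Int del: Int_iff)
    then show ?thesis
      using W True x eq by (intro exI[of _ "(T \<inter> g1 -` W) \<inter> (T \<inter> g2 -` W)"]) (auto simp: inj_on_def)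
  next
    case False
    then obtain U V where UV: "open U" "open V" "g1 x \<in> U" "g2 x \<in> V" "U \<inter> V = {}"
      using hausdorff by metis
    have "openin (top_of_set T) ((T \<inter> g1 -` U) \<inter> (T \<inter> g2 -` V))"
      using g1 g2 UV by (intro openin_Int continuous_openin_preimage_gen) auto
    then show ?thesis
      using UV x by (intro exI[of _ "(T \<inter> g1 -` U) \<inter> (T \<inter> g2 -` V)"]) auto
  qed
qed (use a in auto)

lemma covering_lift_unique:
  fixes g1 g2 :: "'a::topological_space \<Rightarrow> 'c::t2_space"
  assumes "covering_space C p S" "connected T" "continuous_on T g1" "g1 ` T \<subseteq> C"
    "continuous_on T g2" "g2 ` T \<subseteq> C" "\<And>x. x \<in> T \<Longrightarrow> p (g1 x) = p (g2 x)"
    "a \<in> T" "g1 a = g2 a" "x \<in> T"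
  shows "g1 x = g2 x"
  using covering_space_locally_injective[OF assms(1)]
  by (intro lift_unique[OF _ assms(2-)]) metis+

text \<open>Having a lift up to time \<open>t\<close> is a locally constant property of
  \<open>t\<close>: a lift can always be restricted, and near \<open>t1\<close>, where
  \<open>g\<close> stays in an evenly covered set, it can be continued by the inverse of the sheet
  that it has reached.\<close>

lemma covering_path_lift:
  fixes p :: "'c::topological_space \<Rightarrow> 'b::topological_space" and g :: "real \<Rightarrow> 'b"
  assumes cov: "covering_space C p S" and g: "continuous_on {0..1} g" "g ` {0..1} \<subseteq> S"
    and a: "a \<in> C" "p a = g 0"
  obtains k where "continuous_on {0..1} k" "k ` {0..1} \<subseteq> C" "k 0 = a"
    "\<And>t. t \<in> {0..1} \<Longrightarrow> p (k t) = g t"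
proof -
  define P where "P T \<longleftrightarrow> (\<exists>k. continuous_on {0..T} k \<and> k ` {0..T} \<subseteq> C \<and> k 0 = a \<and> (\<forall>t\<in>{0..T}. p (k t) = g t))"
    for T
  have "P 1"
  proof (rule connected_induction_simple[of "{0..1}" "0::real" "1::real" P])
    show "P 0" using a by (auto simp: P_def intro!: exI[of _ "\<lambda>_. a"])
    fix t1 :: real assume t1: "t1 \<in> {0..1}"
    then have "g t1 \<in> S" using g by auto
    then obtain U where U: "g t1 \<in> U" "openin (top_of_set S) U"
      and ev: "\<exists>v. \<Union>v = C \<inter> p -` U \<and> (\<forall>u\<in>v. openin (top_of_set C) u) \<and> (\<forall>u\<in>v. \<exists>q. homeomorphism u U p q)"
      using cov unfolding covering_space_def by meson
    have "openin (top_of_set {0..1}) ({0..1} \<inter> g -` U)"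
      using continuous_openin_preimage[OF g(1) _ U(2)] g by blast
    moreover have "t1 \<in> {0..1} \<inter> g -` U" using t1 U(1) by auto
    ultimately obtain e where e: "e > 0" "\<forall>t\<in>{0..1}. dist t t1 < e \<longrightarrow> t \<in> {0..1} \<inter> g -` U"
      unfolding openin_euclidean_subtopology_iff by blast
    have "P s" if t: "t \<in> {0..1} \<inter> ball t1 e" and s: "s \<in> {0..1} \<inter> ball t1 e" and Pt: "P t" for s t
    proof (cases "s \<le> t")
      case True
      then have "{0..s} \<subseteq> {0..t}" by auto
      moreover obtain k where "continuous_on {0..t} k" "k ` {0..t} \<subseteq> C" "k 0 = a" "\<forall>t\<in>{0..t}. p (k t) = g t"
        using Pt unfolding P_def by auto
      ultimately show ?thesis unfolding P_def by (intro exI[of _ k]) (auto intro: continuous_on_subset)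
    next
      case False
      obtain k where k: "continuous_on {0..t} k" "k ` {0..t} \<subseteq> C" "k 0 = a" "\<forall>t\<in>{0..t}. p (k t) = g t"
        using Pt unfolding P_def by auto
      have "k t \<in> C \<inter> p -` U" using k t e by (auto simp: dist_commute)
      then obtain u q where u: "k t \<in> u" "openin (top_of_set C) u" "homeomorphism u U p q"
        using ev by (metis UnionE)
      have gU: "g ` {t..s} \<subseteq> U"
      proof
        fix y assume "y \<in> g ` {t..s}"
        then obtain r where "r \<in> {t..s}" "y = g r" by auto
        then show "y \<in> U" using s t e(2)[rule_format, of r] by (auto simp: dist_real_def)
      qed
      define k' where "k' = (\<lambda>r. if r \<le> t then k r else q (g r))"
      have qg: "q (g t) = k t" using u k t by (metis IntD1 atLeastAtMost_iff homeomorphism_apply1 order_refl)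
      have ivl: "{0..s} = {0..t} \<union> {t..s}" using False t by auto
      have k'1: "continuous_on {0..s} k'" unfolding ivl
        unfolding k'_def
      proof (rule continuous_on_If)
        show "continuous_on {t..s} (\<lambda>r. q (g r))"
        proof (rule continuous_on_compose2[of U q])
          show "continuous_on U q" using u(3) by (rule homeomorphism_cont2)
          show "continuous_on {t..s} g" by (rule continuous_on_subset[OF g(1)]) (use t s in auto)
        qed (use gU in auto)
        show "k r = q (g r)" if "r \<in> {t..s}" "r \<le> t" for r
        proof -
          have "r = t" using that by auto
          then show ?thesis using qg by simp
        qed
      qed (use k in auto)
      have k'2: "k' ` {0..s} \<subseteq> C"
      proof
        fix y assume "y \<in> k' ` {0..s}"
        then obtain r where r: "r \<in> {0..s}" "y = k' r" by auto
        show "y \<in> C"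
        proof (cases "r \<le> t")
          case True then show ?thesis using r k by (auto simp: k'_def)
        next
          case False
          then have "g r \<in> U" using gU r by auto
          then have "q (g r) \<in> u" using u(3) unfolding homeomorphism_def by auto
          then show ?thesis using u(2) r False openin_imp_subset by (auto simp: k'_def)
        qed
      qed
      have k'3: "p (k' r) = g r" if r: "r \<in> {0..s}" for r
      proof (cases "r \<le> t")
        case True then show ?thesis using r k by (auto simp: k'_def)
      next
        case False
        then have "g r \<in> U" using gU r by auto
        then show ?thesis using u(3) False unfolding homeomorphism_def by (auto simp: k'_def)
      qed
      have k'4: "k' 0 = a" using k(3) t by (auto simp: k'_def)
      show ?thesis unfolding P_def using k'1 k'2 k'3 k'4 by (intro exI[of _ k'] conjI ballI)
    qed
    then have "\<forall>x\<in>{0..1} \<inter> ball t1 e. \<forall>y\<in>{0..1} \<inter> ball t1 e. P x \<longrightarrow> P y" by blast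
    moreover have "openin (top_of_set {0..1}) ({0..1} \<inter> ball t1 e)" "t1 \<in> {0..1} \<inter> ball t1 e"
      using e(1) t1 by auto
    ultimately show "\<exists>V. openin (top_of_set {0..1}) V \<and> t1 \<in> V \<and> (\<forall>x\<in>V. \<forall>y\<in>V. P x \<longrightarrow> P y)"
      by blast
  qed auto
  then show thesis using that unfolding P_def by blast
qed

text \<open>
  Library versions of this are restricted to normed vector spaces. The path lifts from each \<open>f y\<close>
  form the only candidate; its continuity near \<open>(t, y)\<close> is a locally constant property of \<open>t\<close>.
\<close>

lemma covering_homotopy_lift:
  fixes p :: "'c::t2_space \<Rightarrow> 'b::topological_space" and h :: "real \<times> 'u::topological_space \<Rightarrow> 'b"
  assumes cov: "covering_space C p S"
    and h: "continuous_on ({0..1} \<times> U) h" "h ` ({0..1} \<times> U) \<subseteq> S"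
    and f: "continuous_on U f" "f ` U \<subseteq> C" "\<And>y. y \<in> U \<Longrightarrow> p (f y) = h (0, y)"
  obtains k where "continuous_on ({0..1} \<times> U) k" "k ` ({0..1} \<times> U) \<subseteq> C"
    "\<And>y. y \<in> U \<Longrightarrow> k (0, y) = f y" "\<And>z. z \<in> {0..1} \<times> U \<Longrightarrow> p (k z) = h z"
proof -
  have "\<exists>k. continuous_on {0..1} k \<and> k 0 = f y \<and> (\<forall>t\<in>{0..1}. k t \<in> C \<and> p (k t) = h (t, y))"
    if y: "y \<in> U" for y
  proof -
    have "continuous_on {0..1} (\<lambda>t. h (t, y))"
      using y by (intro continuous_on_compose2[OF h(1)] continuous_intros) auto
    then obtain k where "continuous_on {0..1} k" "k ` {0..1} \<subseteq> C" "k 0 = f y"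
      "\<And>t. t \<in> {0..1} \<Longrightarrow> p (k t) = h (t, y)"
    proof (rule covering_path_lift[where g = "\<lambda>t. h (t, y)" and a = "f y", OF cov])
      show "(\<lambda>t. h (t, y)) ` {0..1} \<subseteq> S" using h(2) y by auto
    qed (use f y in auto)
    then show ?thesis by blast
  qed
  then have "\<forall>y\<in>U. \<exists>k. continuous_on {0..1} k \<and> k 0 = f y \<and> (\<forall>t\<in>{0..1}. k t \<in> C \<and> p (k t) = h (t, y))"
    by simp
  from bchoice[OF this] obtain K where
    "\<forall>y\<in>U. continuous_on {0..1} (K y) \<and> K y 0 = f y \<and> (\<forall>t\<in>{0..1}. K y t \<in> C \<and> p (K y t) = h (t, y))" ..
  then have K: "\<And>y. y \<in> U \<Longrightarrow> continuous_on {0..1} (K y)"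
    "\<And>y t. y \<in> U \<Longrightarrow> t \<in> {0..1} \<Longrightarrow> K y t \<in> C" "\<And>y. y \<in> U \<Longrightarrow> K y 0 = f y"
    "\<And>y t. y \<in> U \<Longrightarrow> t \<in> {0..1} \<Longrightarrow> p (K y t) = h (t, y)"
    by simp_all
  have loc: "\<exists>J. openin (top_of_set {0..1}) J \<and> t1 \<in> J \<and>
      (\<forall>t\<in>J. \<forall>V. openin (top_of_set U) V \<and> y0 \<in> V \<and> continuous_on V (\<lambda>y. K y t) \<longrightarrow>
        (\<exists>V'. openin (top_of_set U) V' \<and> y0 \<in> V' \<and> continuous_on (J \<times> V') (\<lambda>(t, y). K y t)))"
    if t1: "t1 \<in> {0..1}" and y0: "y0 \<in> U" for t1 y0
  proof -
    have "h (t1, y0) \<in> S" using h t1 y0 by auto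
    then obtain A where A: "h (t1, y0) \<in> A" "openin (top_of_set S) A"
      and ev: "\<exists>v. \<Union>v = C \<inter> p -` A \<and> (\<forall>u\<in>v. openin (top_of_set C) u) \<and> (\<forall>u\<in>v. \<exists>q. homeomorphism u A p q)"
      using cov unfolding covering_space_def by meson
    have "openin (top_of_set ({0..1} \<times> U)) (({0..1} \<times> U) \<inter> h -` A)"
      using continuous_openin_preimage[OF h(1) _ A(2)] h by blast
    then obtain O' where O': "open O'" "({0..1} \<times> U) \<inter> h -` A = ({0..1} \<times> U) \<inter> O'"
      by (auto simp: openin_open)
    have "(t1, y0) \<in> ({0..1} \<times> U) \<inter> h -` A" using A(1) t1 y0 by simp
    then have "(t1, y0) \<in> O'" unfolding O'(2) by simp
    then obtain J0 V0 where JV: "open J0" "open V0" "t1 \<in> J0" "y0 \<in> V0" "J0 \<times> V0 \<subseteq> O'"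
      using O'(1) by (metis open_prod_elim mem_Sigma_iff)
    then obtain e where e: "e > 0" "ball t1 e \<subseteq> J0" by (meson open_contains_ball)
    define J where "J = {0..1} \<inter> ball t1 e"
    have J: "openin (top_of_set {0..1}) J" "t1 \<in> J" "connected J" "J \<subseteq> {0..1}"
      using e t1 by (auto simp: J_def intro!: convex_connected convex_Int)
    have hA: "h (t, y) \<in> A" if "t \<in> J" "y \<in> U" "y \<in> V0" for t y
      using that JV e O'(2) unfolding J_def by blast
    have "\<exists>V'. openin (top_of_set U) V' \<and> y0 \<in> V' \<and> continuous_on (J \<times> V') (\<lambda>(t, y). K y t)"
      if t: "t \<in> J" and V: "openin (top_of_set U) V" "y0 \<in> V" "continuous_on V (\<lambda>y. K y t)" for t V
    proof -
      have "t \<in> {0..1}" using t J by blast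
      then have "K y0 t \<in> C \<inter> p -` A" using K(2,4)[OF y0] hA[OF t y0] JV(4) by simp
      then obtain u q where u: "K y0 t \<in> u" "openin (top_of_set C) u" "homeomorphism u A p q"
        using ev by (metis UnionE)
      have VU: "V \<subseteq> U" using V openin_imp_subset by blast
      \<comment> \<open>On \<open>V\<close> the map \<open>K _ t\<close> is continuous, the preimage
        of \<open>u\<close> keeps it in one sheet, and \<open>V0\<close> keeps \<open>h\<close>
        inside the evenly covered \<open>A\<close> for all times in \<open>J\<close>.\<close>
      define V' where "V' = (V \<inter> (\<lambda>y. K y t) -` u) \<inter> (U \<inter> V0)"
      have "openin (top_of_set V) (V \<inter> (\<lambda>y. K y t) -` u)"
        by (rule continuous_openin_preimage[OF V(3) _ u(2)]) (use VU K(2)[OF _ \<open>t \<in> {0..1}\<close>] in auto)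
      then have V'o: "openin (top_of_set U) V'" unfolding V'_def
        using JV V(1) by (meson openin_Int openin_open openin_trans)
      have V'U: "V' \<subseteq> U" "y0 \<in> V'" using V u JV VU by (auto simp: V'_def)
      have qu: "openin (top_of_set C) u" "q ` A = u" "p ` u = A" using u unfolding homeomorphism_def by auto
      \<comment> \<open>Both sides lift the path \<open>\<lambda>s. h (s, y)\<close> over the
        connected \<open>J\<close>, and at time \<open>t\<close> they agree because
        \<open>K y t\<close> lies in the sheet \<open>u\<close>.\<close>
      have Kq: "K y s = q (h (s, y))" if y: "y \<in> V'" and s: "s \<in> J" for s y
      proof (rule covering_lift_unique[OF cov J(3), where a = t])
        show "continuous_on J (K y)" using K(1) V'U y J continuous_on_subset by blast
        show "continuous_on J (\<lambda>s. q (h (s, y)))"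
        proof (rule continuous_on_compose2[of A q])
          show "continuous_on A q" using u unfolding homeomorphism_def by auto
          show "continuous_on J (\<lambda>s. h (s, y))"
            using y V'U J by (intro continuous_on_compose2[OF h(1)] continuous_intros) auto
        qed (use hA y in \<open>auto simp: V'_def\<close>)
        show "K y ` J \<subseteq> C" using K(2)[of y] y V'U J by (auto simp: image_subset_iff subset_iff)
        have hAy: "h (s, y) \<in> A" if "s \<in> J" for s using hA y that by (auto simp: V'_def)
        then show "(\<lambda>s. q (h (s, y))) ` J \<subseteq> C"
          using qu openin_imp_subset[OF qu(1)] by (auto simp: image_subset_iff)
        show "p (K y s) = p (q (h (s, y)))" if "s \<in> J" for s
        proof -
          have "s \<in> {0..1}" "y \<in> U" using that J(4) y V'U by auto
          then show ?thesis using hAy[OF that] K(4) homeomorphism_apply2[OF u(3)] by metis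
        qed
        show "K y t = q (h (t, y))"
        proof -
          have "K y t \<in> u" using y by (auto simp: V'_def)
          moreover have "h (t, y) = p (K y t)" using K(4)[of y t] y V'U \<open>t \<in> {0..1}\<close> by auto
          ultimately show ?thesis using u(3) unfolding homeomorphism_def by auto
        qed
      qed (use t s in auto)
      have "continuous_on (J \<times> V') (\<lambda>(t, y). q (h (t, y)))"
      proof -
        have "continuous_on (J \<times> V') (\<lambda>z. q (h z))"
        proof (rule continuous_on_compose2[of A q])
          show "continuous_on A q" using u unfolding homeomorphism_def by auto
          show "continuous_on (J \<times> V') h" using h(1) V'U J by (auto intro: continuous_on_subset)
        qed (use hA in \<open>auto simp: V'_def\<close>)
        then show ?thesis by (simp add: case_prod_unfold)
      qed
      then have "continuous_on (J \<times> V') (\<lambda>(t, y). K y t)"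
        by (rule continuous_on_eq) (auto simp: Kq)
      with V'o V'U show ?thesis by blast
    qed
    then show ?thesis using J by blast
  qed
  have glob: "\<exists>J V. openin (top_of_set {0..1}) J \<and> t \<in> J \<and> openin (top_of_set U) V \<and> y0 \<in> V \<and>
      continuous_on (J \<times> V) (\<lambda>(t, y). K y t)" if t: "t \<in> {0..1}" and y0: "y0 \<in> U" for t y0
  proof -
    define P where "P t \<longleftrightarrow> (\<exists>V. openin (top_of_set U) V \<and> y0 \<in> V \<and> continuous_on V (\<lambda>y. K y t))" for t
    have sec: "continuous_on V (\<lambda>y. K y s)" if "continuous_on (J \<times> V) (\<lambda>(t, y). K y t)" "s \<in> J" for J V s
    proof -
      have "continuous_on V (\<lambda>y. (case (s, y) of (t, y) \<Rightarrow> K y t))"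
        by (rule continuous_on_compose2[OF that(1)]) (use that in \<open>auto intro!: continuous_intros\<close>)
      then show ?thesis by simp
    qed
    have "P t"
    proof (rule connected_induction_simple[of "{0..1}" "0::real" t P])
      have "continuous_on U (\<lambda>y. K y 0)" using f(1) K(3) by (auto intro: continuous_on_eq)
      then show "P 0" using y0 by (auto simp: P_def)
      fix t1 :: real assume "t1 \<in> {0..1}"
      from loc[OF this y0] show "\<exists>J. openin (top_of_set {0..1}) J \<and> t1 \<in> J \<and> (\<forall>x\<in>J. \<forall>y\<in>J. P x \<longrightarrow> P y)"
        unfolding P_def using sec by meson
    qed (use t in auto)
    then show ?thesis using loc[OF t y0] unfolding P_def by meson
  qed
  have cont: "continuous_on ({0..1} \<times> U) (\<lambda>(t, y). K y t)"
  proof (subst continuous_on_open_invariant, intro allI impI)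
    fix B :: "'c set" assume B: "open B"
    have "openin (top_of_set ({0..1} \<times> U)) (({0..1} \<times> U) \<inter> (\<lambda>(t, y). K y t) -` B)"
    proof (subst openin_subopen, intro ballI)
      fix z assume z: "z \<in> ({0..1} \<times> U) \<inter> (\<lambda>(t, y). K y t) -` B"
      obtain t y where ty: "z = (t, y)" by (cases z)
      obtain J V where JV: "openin (top_of_set {0..1}) J" "t \<in> J" "openin (top_of_set U) V" "y \<in> V"
        "continuous_on (J \<times> V) (\<lambda>(t, y). K y t)"
        using glob[of t y] z ty by auto
      have "openin (top_of_set (J \<times> V)) ((J \<times> V) \<inter> (\<lambda>(t, y). K y t) -` B)"
        using JV(5) B by (simp add: continuous_openin_preimage_gen)
      moreover have "openin (top_of_set ({0..1} \<times> U)) (J \<times> V)"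
        using JV by (simp add: openin_Times)
      ultimately have "openin (top_of_set ({0..1} \<times> U)) ((J \<times> V) \<inter> (\<lambda>(t, y). K y t) -` B)"
        using openin_trans by blast
      then show "\<exists>T. openin (top_of_set ({0..1} \<times> U)) T \<and> z \<in> T \<and> T \<subseteq> ({0..1} \<times> U) \<inter> (\<lambda>(t, y). K y t) -` B"
        using z ty JV openin_imp_subset[OF JV(1)] openin_imp_subset[OF JV(3)]
        by (intro exI[of _ "(J \<times> V) \<inter> (\<lambda>(t, y). K y t) -` B"]) auto
    qed
    then show "\<exists>A. open A \<and> A \<inter> {0..1} \<times> U = (\<lambda>(t, y). K y t) -` B \<inter> {0..1} \<times> U"
      unfolding openin_open by (metis Int_commute)
  qed
  show thesis
    by (rule that[OF cont]) (use K in auto)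
qed

section \<open>A subadditive ergodic theorem\<close>

text \<open>Riesz's leader lemma.\<close>

lemma sum_le_card_leaders:
  fixes u :: "nat \<Rightarrow> real"
  assumes "\<And>i. u i \<le> C" "0 \<le> C" "m \<le> n"
  shows "sum u {m..<n} \<le> C * card {i \<in> {m..<n}. \<forall>j. i < j \<and> j \<le> n \<longrightarrow> 0 \<le> sum u {i..<j}}"
  using assms(3)
proof (induction "n - m" arbitrary: m rule: less_induct)
  case less
  define G where "G m = {i \<in> {m..<n}. \<forall>j. i < j \<and> j \<le> n \<longrightarrow> 0 \<le> sum u {i..<j}}" for m
  have fin: "finite (G m)" for m by (auto simp: G_def)
  have IH: "sum u {k..<n} \<le> C * card (G k)" if "m < k" "k \<le> n" for k
    using less(1)[of k] that less(2) by (simp add: G_def)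
  show ?case
  proof (cases "m = n")
    case False
    then have mn: "m < n" using less(2) by simp
    show ?thesis
    proof (cases "m \<in> G m")
      case True
      have "G m = insert m (G (Suc m))"
        using True mn by (auto simp: G_def)
      moreover have "m \<notin> G (Suc m)" by (auto simp: G_def)
      ultimately have "card (G m) = Suc (card (G (Suc m)))" using fin by simp
      then have "C * card (G m) = C + C * card (G (Suc m))" by (simp add: algebra_simps)
      moreover have "sum u {m..<n} = u m + sum u {Suc m..<n}" using mn by (rule sum.atLeast_Suc_lessThan)
      ultimately show ?thesis using IH[of "Suc m"] assms(1)[of m] mn by (simp add: G_def)
    next
      case False
      \<comment> \<open>An index that is no leader starts a block of negative sum. The induction
        jumps to the end \<open>j\<close> of this block; leaders from \<open>j\<close> on are
        leaders for \<open>m\<close> as well.\<close>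
      then obtain j where j: "m < j" "j \<le> n" "sum u {m..<j} < 0"
        using mn by (auto simp: G_def)
      have "G j \<subseteq> G m" using j by (auto simp: G_def)
      then have "C * card (G j) \<le> C * card (G m)" using fin assms(2) by (simp add: card_mono mult_left_mono)
      moreover have "sum u {m..<n} = sum u {m..<j} + sum u {j..<n}"
        using j by (simp add: sum.atLeastLessThan_concat)
      ultimately show ?thesis using IH[of j] j by (simp add: G_def)
    qed
  qed simp
qed

section \<open>Measure-preserving maps: recurrence and the maximal inequality\<close>

locale measure_preserving = prob_space M for M :: "'a measure" +
  fixes T :: "'a \<Rightarrow> 'a"
  assumes T_meas[measurable]: "T \<in> measurable M M" and T_distr: "distr M M T = M"
begin

lemma pow_meas[measurable]: "(T ^^ i) \<in> measurable M M"
  by (induction i) (auto simp: measurable_comp)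

lemma pow_distr: "distr M M (T ^^ i) = M"
proof (induction i)
  case (Suc i)
  have "distr M M (T ^^ Suc i) = distr (distr M M (T ^^ i)) M T"
    by (subst distr_distr) (auto simp: comp_def)
  then show ?case using Suc T_distr by metis
qed (simp add: distr_id id_def)

lemma pow_space: "x \<in> space M \<Longrightarrow> (T ^^ i) x \<in> space M"
  using pow_meas measurable_space by metis

lemma integral_pow:
  fixes g :: "'a \<Rightarrow> real"
  assumes [measurable]: "g \<in> borel_measurable M"
  shows "(\<integral>x. g ((T ^^ i) x) \<partial>M) = (\<integral>x. g x \<partial>M)"
  using integral_distr[OF pow_meas assms, of i] by (simp add: pow_distr)

lemma measure_pow:
  assumes "A \<in> sets M"
  shows "measure M {x \<in> space M. (T ^^ i) x \<in> A} = measure M A"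
proof -
  have "measure M A = measure (distr M M (T ^^ i)) A" by (simp add: pow_distr)
  also have "\<dots> = measure M ((T ^^ i) -` A \<inter> space M)" using assms by (simp add: measure_distr)
  finally show ?thesis by (simp add: vimage_def Int_def conj_commute)
qed

lemma bounded_integrable:
  fixes g :: "'a \<Rightarrow> real"
  assumes "g \<in> borel_measurable M" "\<And>x. x \<in> space M \<Longrightarrow> \<bar>g x\<bar> \<le> C"
  shows "integrable M g"
  using assms by (intro integrable_const_bound[of _ C]) auto

text \<open>The points of \<open>B\<close> that never come back form a set \<open>W\<close> whose
  preimages \<open>V j\<close> are disjoint and have equal measure, so they are null. A point with
  finitely many visits lies in \<open>V j\<close> for the time \<open>j\<close> of its last
  visit.\<close>

lemma poincare_recurrence:
  assumes [measurable]: "B \<in> sets M"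
  shows "measure M {x \<in> B. \<exists>N. \<forall>i\<ge>N. (T ^^ i) x \<notin> B} = 0"
proof -
  define W where "W = {x \<in> space M. x \<in> B \<and> (\<forall>i\<ge>1. (T ^^ i) x \<notin> B)}"
  have [measurable]: "W \<in> sets M" unfolding W_def by measurable
  define V where "V j = {x \<in> space M. (T ^^ j) x \<in> W}" for j
  have [measurable]: "V j \<in> sets M" for j unfolding V_def by measurable
  have "V i \<inter> V j = {}" if "i < j" for i j
  proof -
    have "(T ^^ (j - i)) ((T ^^ i) x) = (T ^^ j) x" for x
      using that by (metis comp_apply funpow_add le_add_diff_inverse2 less_imp_le)
    moreover have "(T ^^ (j - i)) ((T ^^ i) x) \<notin> B" if "x \<in> V i" for x
      using that \<open>i < j\<close> by (simp add: V_def W_def)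
    ultimately have "x \<notin> V j" if "x \<in> V i" for x using that by (auto simp: V_def W_def)
    then show ?thesis by blast
  qed
  then have disj: "disjoint_family V" unfolding disjoint_family_on_def by (metis Int_commute nat_neq_iff)
  have mV: "measure M (V j) = measure M W" for j unfolding V_def by (rule measure_pow) simp
  have "real n * measure M W \<le> 1" for n
  proof -
    have "measure M (\<Union>j<n. V j) = (\<Sum>j<n. measure M (V j))"
      using disj by (intro finite_measure_finite_Union) (auto simp: disjoint_family_on_def)
    then show ?thesis using prob_le_1[of "\<Union>j<n. V j"] by (simp add: mV)
  qed
  then have "\<not> 0 < measure M W"
    by (metis ex_less_of_nat_mult not_le)
  then have W0: "measure M (V j) = 0" for j using mV[of j] measure_nonneg[of M W] by linarith
  have "{x \<in> B. \<exists>N. \<forall>i\<ge>N. (T ^^ i) x \<notin> B} \<subseteq> (\<Union>j. V j)"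
  proof
    fix x assume "x \<in> {x \<in> B. \<exists>N. \<forall>i\<ge>N. (T ^^ i) x \<notin> B}"
    then obtain N where x: "x \<in> B" "\<forall>i\<ge>N. (T ^^ i) x \<notin> B" by auto
    then have sp: "x \<in> space M" using sets.sets_into_space[OF assms] by blast
    have fin: "finite {i. (T ^^ i) x \<in> B}"
      by (rule finite_subset[of _ "{..<N}"]) (use x in \<open>auto simp: not_less[symmetric]\<close>)
    define j where "j = Max {i. (T ^^ i) x \<in> B}"
    have "(T ^^ 0) x \<in> B" using x by simp
    then have j: "(T ^^ j) x \<in> B" using fin Max_in[OF fin] unfolding j_def by blast
    have "(T ^^ i) ((T ^^ j) x) \<notin> B" if "i \<ge> 1" for i
    proof
      assume "(T ^^ i) ((T ^^ j) x) \<in> B"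
      then have "(T ^^ (i + j)) x \<in> B" by (simp add: funpow_add)
      then have "i + j \<le> j" using fin unfolding j_def by (intro Max_ge) auto
      then show False using that by simp
    qed
    then show "x \<in> (\<Union>j. V j)" using j sp pow_space by (auto simp: V_def W_def)
  qed
  moreover have VU: "(\<Union>j. V j) \<in> sets M" by measurable
  moreover have "measure M (\<Union>j. V j) = 0"
  proof (rule measure_eq_0_null_sets, rule null_sets_UN)
    show "V j \<in> null_sets M" for j using W0[of j] by (simp add: null_sets_def emeasure_eq_measure)
  qed
  ultimately show ?thesis
    using finite_measure_mono[of _ "\<Union>j. V j"] by (metis (no_types, lifting) VU antisym measure_nonneg)
qed

text \<open>Reverse Fatou lemma, applied to the averages.\<close>

lemma averages_small_if_limsup_null:
  fixes B :: "nat \<Rightarrow> 'a set"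
  assumes [measurable]: "\<And>m. B m \<in> sets M"
    and null: "measure M (\<Inter>N. \<Union>m\<in>{N..}. B m) = 0" and "0 < \<delta>"
  obtains n where "0 < n" "(\<Sum>i<n. measure M (B (n - i))) < \<delta> * real n"
proof -
  define U where "U N = (\<Union>m\<in>{N..}. B m)" for N
  have [measurable]: "U N \<in> sets M" for N unfolding U_def by measurable
  have "(\<lambda>N. measure M (U N)) \<longlonglongrightarrow> measure M (\<Inter>N. U N)"
    proof (rule finite_Lim_measure_decseq)
    show "decseq U" unfolding decseq_def U_def by (intro allI impI UN_mono) auto
  qed auto
  then have "(\<lambda>N. measure M (U N)) \<longlonglongrightarrow> 0" using null by (simp add: U_def)
  then have "eventually (\<lambda>N. measure M (U N) < \<delta> / 2) sequentially"
    using \<open>0 < \<delta>\<close> by (intro order_tendstoD) auto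
  then obtain N where N: "measure M (U N) < \<delta> / 2" by (auto simp: eventually_sequentially)
  \<comment> \<open>At most \<open>N\<close> indices have \<open>n - i < N\<close>, and together
    they add at most \<open>N\<close>, which is less than \<open>\<delta> * n / 2\<close>; the share
    of all others is below \<open>\<delta> / 2\<close> each. The summand 1 keeps \<open>n\<close>
    positive when \<open>N\<close> is 0.\<close>
  obtain n :: nat where n: "real n > 2 * real N / \<delta> + 1" using reals_Archimedean2 by blast
  have n0: "0 < n" using n \<open>0 < \<delta>\<close> by (intro gr0I) (auto simp: divide_simps)
  have "(\<Sum>i<n. measure M (B (n - i))) \<le> (\<Sum>i<n. \<delta> / 2 + (if i \<in> {n - N..<n} then 1 else 0))"
  proof (rule sum_mono)
    fix i assume i: "i \<in> {..<n}"
    show "measure M (B (n - i)) \<le> \<delta> / 2 + (if i \<in> {n - N..<n} then 1 else 0)"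
    proof (cases "N \<le> n - i")
      case True
      then have "measure M (B (n - i)) \<le> measure M (U N)"
        by (intro finite_measure_mono) (auto simp: U_def)
      then show ?thesis using N by auto
    next
      case False
      then have "i \<in> {n - N..<n}" using i by auto
      moreover have "measure M (B (n - i)) \<le> \<delta> / 2 + 1" using prob_le_1[of "B (n - i)"] \<open>0 < \<delta>\<close> by linarith
      ultimately show ?thesis by simp
    qed
  qed
  also have "\<dots> = real n * (\<delta> / 2) + (\<Sum>i<n. if i \<in> {n - N..<n} then 1 else 0)"
    by (simp add: sum.distrib)
  also have "(\<Sum>i<n. if i \<in> {n - N..<n} then 1 else 0) \<le> real N"
  proof -
    have "(\<Sum>i<n. if i \<in> {n - N..<n} then 1 else 0) = (\<Sum>i\<in>{..<n} \<inter> {n - N..<n}. 1 :: real)"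
      by (rule sum.inter_restrict[symmetric]) simp
    moreover have "card ({..<n} \<inter> {n - N..<n}) \<le> card {n - N..<n}" by (intro card_mono) auto
    ultimately show ?thesis by simp
  qed
  also have "real n * (\<delta> / 2) + real N < \<delta> * real n"
  proof -
    have "2 * real N / \<delta> < real n" using n by simp
    then have "2 * real N < real n * \<delta>" using \<open>0 < \<delta>\<close> by (simp add: pos_divide_less_eq)
    then show ?thesis by (simp add: mult.commute)
  qed
  finally have "(\<Sum>i<n. measure M (B (n - i))) < \<delta> * real n" by simp
  with n0 show thesis by (rule that)
qed

context
  fixes Y assumes Y[measurable]: "Y \<in> sets M" and inv: "\<And>x. x \<in> space M \<Longrightarrow> T x \<in> Y \<longleftrightarrow> x \<in> Y"
begin

lemma inv_pow: "x \<in> space M \<Longrightarrow> (T ^^ i) x \<in> Y \<longleftrightarrow> x \<in> Y"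
  by (induction i) (auto simp: inv pow_space)

text \<open>The leader lemma for \<open>u i = b (n - i) ((T ^^ i) x)\<close>, integrated over the
  invariant set \<open>Y\<close>: if \<open>i\<close> is a leader, then \<open>(T ^^ i) x\<close>
  lies in \<open>B (n - i)\<close>, and invariance of the measure removes \<open>T ^^ i\<close>. The
  function may depend on the remaining time \<open>n - i\<close>, as the increments of a subadditive
  process do.\<close>

lemma leader_integral:
  fixes b :: "nat \<Rightarrow> 'a \<Rightarrow> real"
  assumes [measurable]: "\<And>m. b m \<in> borel_measurable M" and C: "\<And>m x. x \<in> space M \<Longrightarrow> \<bar>b m x\<bar> \<le> C"
  defines "B \<equiv> \<lambda>m. {x \<in> space M. \<forall>k\<le>m. 0 \<le> (\<Sum>i<k. b (m - i) ((T ^^ i) x))}"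
  shows "(\<integral>x. indicator Y x * (\<Sum>i<n. b (n - i) ((T ^^ i) x)) \<partial>M) \<le> C * (\<Sum>i<n. measure M (B (n - i) \<inter> Y))"
proof -
  have [measurable]: "B m \<in> sets M" for m unfolding B_def by measurable
  obtain x0 where "x0 \<in> space M" using not_empty by auto
  then have C0: "0 \<le> C" using C[of x0 0] abs_ge_zero order_trans by blast
  have pw: "indicator Y x * (\<Sum>i<n. b (n - i) ((T ^^ i) x)) \<le> (\<Sum>i<n. C * indicator (B (n - i) \<inter> Y) ((T ^^ i) x))"
    if x: "x \<in> space M" for x
  proof (cases "x \<in> Y")
    case True
    define u where "u i = (if i < n then b (n - i) ((T ^^ i) x) else 0)" for i
    define G where "G = {i \<in> {0..<n}. \<forall>j. i < j \<and> j \<le> n \<longrightarrow> 0 \<le> sum u {i..<j}}"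
    have "(\<Sum>i<n. b (n - i) ((T ^^ i) x)) = sum u {0..<n}" by (auto simp: u_def lessThan_atLeast0)
    also have "\<dots> \<le> C * card G" unfolding G_def
    proof (rule sum_le_card_leaders)
      fix i show "u i \<le> C" using C[OF pow_space[OF x], of "n - i" i] C0 by (auto simp: u_def)
    qed (use C0 in auto)
    also have "\<dots> = (\<Sum>i<n. C * indicator G i)"
      by (simp add: sum.If_cases indicator_def Int_def flip: sum_distrib_left) (simp add: G_def)
    also have "\<dots> \<le> (\<Sum>i<n. C * indicator (B (n - i) \<inter> Y) ((T ^^ i) x))"
    proof (intro sum_mono mult_left_mono C0)
      fix i assume i: "i \<in> {..<n}"
      have "(T ^^ i) x \<in> B (n - i)" if "i \<in> G"
      proof -
        have "0 \<le> (\<Sum>l<k. b (n - i - l) ((T ^^ l) ((T ^^ i) x)))" if k: "k \<le> n - i" for k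
        proof (cases "k = 0")
          case False
          have "(\<Sum>l<k. b (n - i - l) ((T ^^ l) ((T ^^ i) x))) = (\<Sum>l<k. u (i + l))"
          proof (rule sum.cong)
            fix l assume "l \<in> {..<k}"
            moreover have "(T ^^ (i + l)) x = (T ^^ l) ((T ^^ i) x)" by (subst add.commute) (simp add: funpow_add)
            ultimately show "b (n - i - l) ((T ^^ l) ((T ^^ i) x)) = u (i + l)" using k i by (simp add: u_def)
          qed simp
          also have "\<dots> = sum u {i..<i + k}"
            by (simp add: sum.atLeastLessThan_shift_0[of u i] lessThan_atLeast0)
          also have "0 \<le> \<dots>" using \<open>i \<in> G\<close> False k i unfolding G_def by auto
          finally show ?thesis .
        qed simp
        then show ?thesis using pow_space[OF x] by (auto simp: B_def)
      qed
      then show "indicator G i \<le> (indicator (B (n - i) \<inter> Y) ((T ^^ i) x) :: real)"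
        using True inv_pow[OF x] by (auto simp: indicator_def)
    qed
    finally show ?thesis using True by simp
  qed (simp add: C0 sum_nonneg)
  have "(\<integral>x. indicator Y x * (\<Sum>i<n. b (n - i) ((T ^^ i) x)) \<partial>M) \<le>
      (\<integral>x. (\<Sum>i<n. C * indicator (B (n - i) \<inter> Y) ((T ^^ i) x)) \<partial>M)"
  proof (rule integral_mono)
    show "integrable M (\<lambda>x. indicator Y x * (\<Sum>i<n. b (n - i) ((T ^^ i) x)))"
    proof (rule bounded_integrable)
      fix x assume x: "x \<in> space M"
      have "\<bar>indicator Y x * (\<Sum>i<n. b (n - i) ((T ^^ i) x))\<bar> \<le> (\<Sum>i<n. \<bar>b (n - i) ((T ^^ i) x)\<bar>)"
        by (auto simp: indicator_def sum_nonneg)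
      also have "\<dots> \<le> (\<Sum>i<n. C)" by (intro sum_mono C pow_space x)
      finally show "\<bar>indicator Y x * (\<Sum>i<n. b (n - i) ((T ^^ i) x))\<bar> \<le> (\<Sum>i<n. C)" .
    qed measurable
    show "integrable M (\<lambda>x. \<Sum>i<n. C * indicator (B (n - i) \<inter> Y) ((T ^^ i) x))"
      by (intro Bochner_Integration.integrable_sum bounded_integrable[where C = C])
        (use C0 in \<open>auto simp: indicator_def\<close>)
  qed (rule pw)
  also have "\<dots> = (\<Sum>i<n. \<integral>x. C * indicator (B (n - i) \<inter> Y) ((T ^^ i) x) \<partial>M)"
    by (intro Bochner_Integration.integral_sum bounded_integrable[where C = C])
      (use C0 in \<open>auto simp: indicator_def\<close>)
  also have "\<dots> = (\<Sum>i<n. C * measure M (B (n - i) \<inter> Y))"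
    by (intro sum.cong refl, subst integral_pow) auto
  finally show ?thesis by (simp add: sum_distrib_left)
qed

text \<open>Leaders of \<open>- \<psi>\<close> are governed by the sets \<open>B m\<close> of points
  whose sums up to \<open>m\<close> are all nonpositive. A point of \<open>Y\<close> lies in
  finitely many of them only, so by \<open>averages_small_if_limsup_null\<close> leaders are too
  rare for a negative integral.\<close>

lemma maximal_ergodic:
  fixes \<psi> :: "'a \<Rightarrow> real"
  assumes [measurable]: "\<psi> \<in> borel_measurable M" and C: "\<And>x. x \<in> space M \<Longrightarrow> \<bar>\<psi> x\<bar> \<le> C"
    and pos: "\<And>x. x \<in> Y \<Longrightarrow> \<exists>n. 0 < (\<Sum>i<n. \<psi> ((T ^^ i) x))"
  shows "0 \<le> (\<integral>x. indicator Y x * \<psi> x \<partial>M)"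
proof (rule ccontr)
  define I where "I = (\<integral>x. indicator Y x * \<psi> x \<partial>M)"
  assume "\<not> ?thesis"
  then have I: "I < 0" by (simp add: I_def)
  obtain x0 where "x0 \<in> space M" using not_empty by auto
  then have C0: "0 \<le> C" using C[of x0] abs_ge_zero order_trans by blast
  define B where "B m = {x \<in> space M. \<forall>k\<le>m. 0 \<le> (\<Sum>i<k. - \<psi> ((T ^^ i) x))}" for m :: nat
  have [measurable]: "B m \<in> sets M" for m unfolding B_def by measurable
  have "(\<Inter>N. \<Union>m\<in>{N..}. B m \<inter> Y) = {}"
  proof (rule ccontr)
    assume "\<not> ?thesis"
    then obtain x where "x \<in> (\<Inter>N. \<Union>m\<in>{N..}. B m \<inter> Y)" by blast
    then have "x \<in> (\<Union>m\<in>{N..}. B m \<inter> Y)" for N by blast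
    then have x: "\<exists>m\<ge>N. x \<in> B m \<inter> Y" for N by auto
    then have "x \<in> Y" by auto
    then obtain n where "0 < (\<Sum>i<n. \<psi> ((T ^^ i) x))" using pos by auto
    moreover obtain m where "m \<ge> n" "x \<in> B m" using x by auto
    ultimately show False unfolding B_def by (auto simp: sum_negf)
  qed
  then have "measure M (\<Inter>N. \<Union>m\<in>{N..}. B m \<inter> Y) = 0" by simp
  \<comment> \<open>The denominator is \<open>C + 1\<close> because \<open>C\<close> may be
    0.\<close>
  moreover have "0 < - I / (C + 1)" using I C0 by (simp add: divide_neg_pos)
  ultimately obtain n where n: "0 < n" "(\<Sum>i<n. measure M (B (n - i) \<inter> Y)) < - I / (C + 1) * real n"
    by (rule averages_small_if_limsup_null[rotated 1]) auto
  have "(\<integral>x. indicator Y x * (\<Sum>i<n. - \<psi> ((T ^^ i) x)) \<partial>M) = (\<integral>x. (\<Sum>i<n. - (indicator Y ((T ^^ i) x) * \<psi> ((T ^^ i) x))) \<partial>M)"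
    by (intro Bochner_Integration.integral_cong refl) (auto simp: indicator_def inv_pow sum_negf)
  also have "\<dots> = (\<Sum>i<n. \<integral>x. - (indicator Y ((T ^^ i) x) * \<psi> ((T ^^ i) x)) \<partial>M)"
    by (intro Bochner_Integration.integral_sum bounded_integrable[where C = C])
      (use C0 C pow_space in \<open>auto simp: indicator_def\<close>)
  also have "\<dots> = (\<Sum>i<n. \<integral>x. - (indicator Y x * \<psi> x) \<partial>M)"
    by (intro sum.cong refl integral_pow) measurable
  also have "\<dots> = - I * real n" by (simp add: I_def)
  finally have "- I * real n \<le> C * (\<Sum>i<n. measure M (B (n - i) \<inter> Y))"
    using leader_integral[of "\<lambda>_ x. - \<psi> x" C n] C by (simp add: B_def)
  also have "\<dots> \<le> (C + 1) * (\<Sum>i<n. measure M (B (n - i) \<inter> Y))"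
    by (intro mult_right_mono sum_nonneg) auto
  also have "\<dots> < (C + 1) * (- I / (C + 1) * real n)" using n C0 by (intro mult_strict_left_mono) auto
  finally show False using C0 by simp
qed

end

end

section \<open>Subadditive processes and the theorem of Karlsson and Margulis\<close>

text \<open>\<open>a n x\<close> models the distance from a starting point to the point reached at
  time \<open>n\<close>. Subadditivity is one triangle inequality; \<open>a_tail\<close> and
  \<open>a_Suc\<close> are the two others for a single step. Together they bound every increment by
  \<open>C\<close> in both directions, so that all functions integrated below are bounded.\<close>

locale subadditive_process = measure_preserving M T for M :: "'a measure" and T +
  fixes a :: "nat \<Rightarrow> 'a \<Rightarrow> real" and C :: real
  assumes a_meas[measurable]: "\<And>n. a n \<in> borel_measurable M"
    and a_nonneg: "\<And>n x. x \<in> space M \<Longrightarrow> 0 \<le> a n x"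
    and a_0: "\<And>x. x \<in> space M \<Longrightarrow> a 0 x = 0"
    and a_1: "\<And>x. x \<in> space M \<Longrightarrow> a 1 x \<le> C"
    and a_subadd: "\<And>m n x. x \<in> space M \<Longrightarrow> a (m + n) x \<le> a m x + a n ((T ^^ m) x)"
    and a_tail: "\<And>n x. x \<in> space M \<Longrightarrow> a n (T x) \<le> a (Suc n) x + C"
    and a_Suc: "\<And>n x. x \<in> space M \<Longrightarrow> a n x \<le> a (Suc n) x + C"
begin

lemma C_nonneg: "0 \<le> C"
  using not_empty a_nonneg[of _ 1] a_1 by (meson all_not_in_conv order_trans)

lemma a_le: "x \<in> space M \<Longrightarrow> a n x \<le> C * real n"
proof (induction n)
  case (Suc n)
  have "a (n + 1) x \<le> a n x + a 1 ((T ^^ n) x)" using Suc by (intro a_subadd)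
  then show ?case using Suc a_1[OF pow_space[of x n]] by (simp add: algebra_simps)
qed (simp add: a_0)

lemma a_tail_pow: "x \<in> space M \<Longrightarrow> a n ((T ^^ k) x) \<le> a (n + k) x + C * real k"
proof (induction k arbitrary: n)
  case (Suc k)
  have "a n ((T ^^ Suc k) x) \<le> a (Suc n) ((T ^^ k) x) + C" using a_tail[OF pow_space[of x k]] Suc by simp
  then show ?case using Suc(1)[OF Suc(2), of "Suc n"] by (simp add: algebra_simps)
qed simp

lemma a_le_add: "x \<in> space M \<Longrightarrow> a n x \<le> a (n + k) x + C * real k"
proof (induction k)
  case (Suc k)
  then show ?case using a_Suc[of x "n + k"] by (simp add: algebra_simps)
qed simp

text \<open>The sums \<open>A n\<close> over windows of length \<open>m\<close> telescope:
  \<open>A (Suc n) - A n\<close> is \<open>a (n + m) x - a n x\<close>, which is at most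
  \<open>a m ((T ^^ n) x)\<close>. Estimating \<open>A 0\<close> and replacing \<open>A n\<close> by
  \<open>m\<close> times \<open>a n x\<close> cost \<open>C * m * m\<close> each.\<close>

lemma a_le_average:
  assumes x: "x \<in> space M"
  shows "real m * a n x \<le> (\<Sum>i<n. a m ((T ^^ i) x)) + 2 * C * real m * real m"
proof -
  define A where "A n = (\<Sum>j<m. a (n + j) x)" for n
  have step: "A (Suc n) \<le> A n + a m ((T ^^ n) x)" for n
  proof -
    have "A (Suc n) + a n x = (\<Sum>j<Suc m. a (n + j) x)"
      by (subst sum.lessThan_Suc_shift) (simp add: A_def)
    also have "\<dots> = A n + a (n + m) x" by (simp add: A_def)
    finally show ?thesis using a_subadd[OF x, of n m] by simp
  qed
  have "A n \<le> A 0 + (\<Sum>i<n. a m ((T ^^ i) x))"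
  proof (induction n)
    case (Suc n) then show ?case using step[of n] by simp
  qed simp
  moreover have "A 0 \<le> (\<Sum>j<m. C * real m)" unfolding A_def
  proof (rule sum_mono)
    fix j assume "j \<in> {..<m}"
    then have "C * real j \<le> C * real m" using C_nonneg by (intro mult_left_mono) auto
    then show "a (0 + j) x \<le> C * real m" using a_le[OF x, of j] by simp
  qed
  moreover have "(\<Sum>j<m. a n x) \<le> (\<Sum>j<m. a (n + j) x + C * real m)"
  proof (rule sum_mono)
    fix j assume "j \<in> {..<m}"
    then have "C * real j \<le> C * real m" using C_nonneg by (intro mult_left_mono) auto
    then show "a n x \<le> a (n + j) x + C * real m" using a_le_add[OF x, of n j] by simp
  qed
  ultimately show ?thesis by (simp add: A_def sum.distrib algebra_simps)
qed

text \<open>This says that the upper limit of \<open>s n / n\<close> exceeds \<open>r\<close>. The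
  rational \<open>q\<close> expresses it by countable operations, which makes the sets below
  measurable.\<close>

definition fast :: "real \<Rightarrow> (nat \<Rightarrow> real) \<Rightarrow> bool" where
  "fast r s \<longleftrightarrow> (\<exists>q::rat. r < of_rat q \<and> (\<forall>N. \<exists>n\<ge>N. of_rat q * real n \<le> s n))"

text \<open>An upper growth rate is insensitive to a time shift by one and to a bounded loss: a
  slightly smaller slope \<open>q'\<close> absorbs both as soon as \<open>n\<close> exceeds
  \<open>(\<bar>q'\<bar> + C) / d\<close>. This yields the invariance of the set \<open>Y\<close> in
  \<open>slow_null\<close>.\<close>

lemma fast_transfer:
  assumes s: "fast r s" and st: "\<And>n. n \<ge> 1 \<Longrightarrow> \<exists>m. n \<le> m + 1 \<and> m \<le> n + 1 \<and> s n - C \<le> t m"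
  shows "fast r t"
proof -
  obtain q :: rat where q: "r < of_rat q" "\<And>N. \<exists>n\<ge>N. of_rat q * real n \<le> s n"
    using s unfolding fast_def by blast
  obtain q' :: rat where q': "r < of_rat q'" "(of_rat q' :: real) < of_rat q" using of_rat_dense q(1) by blast
  have "\<exists>m\<ge>N. of_rat q' * real m \<le> t m" for N
  proof -
    define d :: real where "d = of_rat q - of_rat q'"
    have d: "d > 0" using q' by (simp add: d_def)
    obtain L :: nat where L: "real L > (\<bar>of_rat q'\<bar> + C) / d" using reals_Archimedean2 by blast
    obtain n where n: "n \<ge> max (N + 1) L" "of_rat q * real n \<le> s n" using q(2) by blast
    then obtain m where m: "n \<le> m + 1" "m \<le> n + 1" "s n - C \<le> t m" using st[of n] by auto
    have "\<bar>of_rat q' * (real m - real n)\<bar> \<le> \<bar>of_rat q'\<bar> * (1::real)"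
      unfolding abs_mult using m by (intro mult_left_mono) auto
    then have "of_rat q' * real m \<le> of_rat q' * real n + \<bar>of_rat q'\<bar>" by (simp add: algebra_simps)
    moreover have "d * real L > \<bar>of_rat q'\<bar> + C" using L d by (simp add: field_simps)
    moreover have "d * real L \<le> d * real n" using n d by (intro mult_left_mono) auto
    ultimately have "of_rat q' * real m \<le> t m" using n m by (simp add: d_def algebra_simps)
    then show ?thesis using m n by (intro exI[of _ m]) auto
  qed
  then show ?thesis using q' unfolding fast_def by blast
qed

text \<open>By \<open>telescope\<close> these are the points at which all partial sums of the
  increments minus \<open>r\<close> are nonnegative, that is, the sets \<open>B\<close> of
  \<open>leader_integral\<close>.\<close>

definition good :: "real \<Rightarrow> nat \<Rightarrow> 'a set" where
  "good r m = {x \<in> space M. \<forall>k\<le>m. r * real k \<le> a m x - a (m - k) ((T ^^ k) x)}"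

lemma good_meas[measurable]: "good r m \<in> sets M"
  unfolding good_def by measurable

definition Good :: "real \<Rightarrow> 'a set" where
  "Good r = (\<Inter>N. \<Union>m\<in>{N..}. good r m)"

lemma Good_meas[measurable]: "Good r \<in> sets M"
  unfolding Good_def by measurable

lemma telescope:
  assumes "k \<le> m"
  shows "(\<Sum>i<k. a (m - i) ((T ^^ i) x) - a (m - i - 1) (T ((T ^^ i) x)) - r) = a m x - a (m - k) ((T ^^ k) x) - r * real k"
  using assms by (induction k) (auto simp: algebra_simps)

text \<open>On the invariant set \<open>Y\<close> the integral of \<open>a n - r * n\<close> grows
  at least like \<open>n * (r' - r) * measure M Y\<close>, so by \<open>leader_integral\<close> the
  sets \<open>good r m \<inter> Y\<close> have average measure bounded below. But points of
  \<open>Y\<close> visit \<open>Good r\<close> finitely often, so by Poincare recurrence the upper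
  limit of these sets is null and their average measure becomes arbitrarily small.\<close>

lemma slow_null:
  assumes "r < r'"
  shows "measure M {x \<in> space M. fast r' (\<lambda>n. a n x) \<and> (\<exists>N. \<forall>i\<ge>N. (T ^^ i) x \<notin> Good r)} = 0"
    (is "measure M ?Y = 0")
proof (rule ccontr)
  define Y where "Y = ?Y"
  assume "measure M ?Y \<noteq> 0"
  then have Ypos: "0 < measure M Y" by (simp add: Y_def zero_less_measure_iff)
  have Ym[measurable]: "Y \<in> sets M" unfolding Y_def fast_def by measurable
  have inv: "T x \<in> Y \<longleftrightarrow> x \<in> Y" if x: "x \<in> space M" for x
  proof -
    have Tx: "T x \<in> space M" using pow_space[OF x, of 1] by simp
    have "fast r' (\<lambda>n. a n (T x)) \<longleftrightarrow> fast r' (\<lambda>n. a n x)"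
    proof
      assume *: "fast r' (\<lambda>n. a n (T x))"
      show "fast r' (\<lambda>n. a n x)"
      proof (rule fast_transfer[OF *])
        fix n show "\<exists>m. n \<le> m + 1 \<and> m \<le> n + 1 \<and> a n (T x) - C \<le> a m x"
          using a_tail[OF x, of n] by (intro exI[of _ "Suc n"]) auto
      qed
    next
      assume *: "fast r' (\<lambda>n. a n x)"
      show "fast r' (\<lambda>n. a n (T x))"
      proof (rule fast_transfer[OF *])
        fix n :: nat assume "1 \<le> n"
        then show "\<exists>m. n \<le> m + 1 \<and> m \<le> n + 1 \<and> a n x - C \<le> a m (T x)"
          using a_subadd[OF x, of 1 "n - 1"] a_1[OF x] by (intro exI[of _ "n - 1"]) auto
      qed
    qed
    moreover have "(\<exists>N. \<forall>i\<ge>N. (T ^^ i) (T x) \<notin> Good r) \<longleftrightarrow> (\<exists>N. \<forall>i\<ge>N. (T ^^ i) x \<notin> Good r)"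
    proof
      assume "\<exists>N. \<forall>i\<ge>N. (T ^^ i) (T x) \<notin> Good r"
      then obtain N where N: "\<forall>i\<ge>N. (T ^^ i) (T x) \<notin> Good r" by auto
      have "(T ^^ i) x \<notin> Good r" if i: "i \<ge> Suc N" for i
      proof -
        obtain j where "i = Suc j" using i by (cases i) auto
        then show ?thesis using N i by (simp add: funpow_swap1)
      qed
      then show "\<exists>N. \<forall>i\<ge>N. (T ^^ i) x \<notin> Good r" by blast
    next
      assume "\<exists>N. \<forall>i\<ge>N. (T ^^ i) x \<notin> Good r"
      then obtain N where N: "\<And>i. i\<ge>N \<Longrightarrow> (T ^^ i) x \<notin> Good r" by auto
      have "(T ^^ i) (T x) \<notin> Good r" if i: "i \<ge> N" for i
        using N[of "Suc i"] i by (simp add: funpow_swap1)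
      then show "\<exists>N. \<forall>i\<ge>N. (T ^^ i) (T x) \<notin> Good r" by blast
    qed
    ultimately show ?thesis using x Tx by (auto simp: Y_def)
  qed
  define C' where "C' = C + \<bar>r\<bar>"
  \<comment> \<open>The maximal inequality for \<open>a m / m - r'\<close>;
    \<open>a_le_average\<close> converts fast growth of \<open>a n\<close> into a positive sum along
    the orbit.\<close>
  have lower: "real m * (r' - r) * measure M Y \<le> (\<integral>x. indicator Y x * (a m x - r * real m) \<partial>M)" if m: "m > 0" for m
  proof -
    have "0 \<le> (\<integral>x. indicator Y x * (a m x / real m - r') \<partial>M)"
    proof (rule maximal_ergodic[OF Ym inv, where C = "C + \<bar>r'\<bar>"])
      fix x assume x: "x \<in> space M"
      have "0 \<le> a m x / real m" "a m x / real m \<le> C"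
        using a_nonneg[OF x, of m] a_le[OF x, of m] m by (auto simp: divide_simps)
      then show "\<bar>a m x / real m - r'\<bar> \<le> C + \<bar>r'\<bar>" by linarith
    next
      fix x assume xY: "x \<in> Y"
      then have x: "x \<in> space M" by (auto simp: Y_def)
      obtain q :: rat where q: "r' < of_rat q" "\<And>N. \<exists>n\<ge>N. of_rat q * real n \<le> a n x"
        using xY unfolding Y_def fast_def by blast
      \<comment> \<open>From \<open>L\<close> on the surplus \<open>(of_rat q - r') * n\<close>
        outweighs the boundary error \<open>2 * C * m\<close> of \<open>a_le_average\<close>,
        divided by \<open>m\<close>.\<close>
      obtain L :: nat where L: "real L > 2 * C * real m / (of_rat q - r')" using reals_Archimedean2 by blast
      obtain n where n: "n \<ge> L" "of_rat q * real n \<le> a n x" using q(2) by blast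
      have "2 * C * real m < (of_rat q - r') * real L" using L q(1) by (simp add: field_simps)
      also have "\<dots> \<le> (of_rat q - r') * real n" using n q(1) by (intro mult_left_mono) auto
      finally have 1: "2 * C * real m + r' * real n < a n x" using n by (simp add: algebra_simps)
      have "real m * (2 * C * real m + r' * real n) < real m * a n x"
        using 1 m by (intro mult_strict_left_mono) auto
      also note a_le_average[OF x, of m n]
      finally have 2: "real m * (r' * real n) < (\<Sum>i<n. a m ((T ^^ i) x))" by (simp add: algebra_simps)
      have "(\<Sum>i<n. a m ((T ^^ i) x) / real m - r') = (\<Sum>i<n. a m ((T ^^ i) x)) / real m - r' * real n"
        by (simp add: sum_subtractf sum_divide_distrib)
      also have "\<dots> > 0" using 2 m by (simp add: field_simps)
      finally show "\<exists>n. 0 < (\<Sum>i<n. a m ((T ^^ i) x) / real m - r')" by blast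
    qed measurable
    then have "0 \<le> real m * (\<integral>x. indicator Y x * (a m x / real m - r') \<partial>M)" by simp
    also have "\<dots> = (\<integral>x. indicator Y x * (a m x - r * real m) - (real m * (r' - r)) * indicator Y x \<partial>M)"
      using m by (subst integral_mult_right_zero[symmetric], intro Bochner_Integration.integral_cong refl)
        (auto simp: algebra_simps)
    also have "\<dots> = (\<integral>x. indicator Y x * (a m x - r * real m) \<partial>M) - (real m * (r' - r)) * measure M Y"
    proof (subst Bochner_Integration.integral_diff)
      show "integrable M (\<lambda>x. indicator Y x * (a m x - r * real m))"
      proof (rule bounded_integrable[where C = "C * real m + \<bar>r * real m\<bar>"])
        fix x assume x: "x \<in> space M"
        then show "\<bar>indicator Y x * (a m x - r * real m)\<bar> \<le> C * real m + \<bar>r * real m\<bar>"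
          using a_nonneg[OF x, of m] a_le[OF x, of m] by (auto simp: indicator_def)
      qed measurable
      show "integrable M (\<lambda>x. real m * (r' - r) * indicator Y x)"
        by (intro integrable_mult_right) (simp add: less_top[symmetric])
    qed simp
    finally show ?thesis by simp
  qed
  have null: "measure M (\<Inter>N. \<Union>m\<in>{N..}. good r m \<inter> Y) = 0"
  proof -
    have "(\<Inter>N. \<Union>m\<in>{N..}. good r m \<inter> Y) \<subseteq> {x \<in> Good r. \<exists>N. \<forall>i\<ge>N. (T ^^ i) x \<notin> Good r}"
    proof
      fix x assume x: "x \<in> (\<Inter>N. \<Union>m\<in>{N..}. good r m \<inter> Y)"
      then have "x \<in> Y" "x \<in> Good r" by (auto simp: Good_def)
      then show "x \<in> {x \<in> Good r. \<exists>N. \<forall>i\<ge>N. (T ^^ i) x \<notin> Good r}" by (auto simp: Y_def)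
    qed
    moreover have "{x \<in> Good r. \<exists>N. \<forall>i\<ge>N. (T ^^ i) x \<notin> Good r} \<in> sets M"
    proof -
      have "{x \<in> Good r. \<exists>N. \<forall>i\<ge>N. (T ^^ i) x \<notin> Good r} = {x \<in> space M. x \<in> Good r \<and> (\<exists>N. \<forall>i\<ge>N. (T ^^ i) x \<notin> Good r)}"
        using sets.sets_into_space[OF Good_meas] by auto
      then show ?thesis by simp
    qed
    ultimately have "measure M (\<Inter>N. \<Union>m\<in>{N..}. good r m \<inter> Y) \<le>
        measure M {x \<in> Good r. \<exists>N. \<forall>i\<ge>N. (T ^^ i) x \<notin> Good r}"
      by (rule finite_measure_mono)
    then have "measure M (\<Inter>N. \<Union>m\<in>{N..}. good r m \<inter> Y) \<le> 0"
      using poincare_recurrence[OF Good_meas, of r] by simp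
    then show ?thesis using measure_nonneg antisym by blast
  qed
  have C': "C' \<ge> 0" using C_nonneg by (simp add: C'_def)
  \<comment> \<open>With this value the upper bound \<open>(C' + 1) * (\<delta> * n)\<close>, which
    is strict, coincides with the lower bound from \<open>lower\<close>.\<close>
  define \<delta> where "\<delta> = (r' - r) * measure M Y / (C' + 1)"
  have "\<delta> > 0" using assms Ypos C' by (simp add: \<delta>_def)
  obtain n where n: "0 < n" "(\<Sum>i<n. measure M (good r (n - i) \<inter> Y)) < \<delta> * real n"
    by (rule averages_small_if_limsup_null[OF _ null \<open>\<delta> > 0\<close>]) auto
  \<comment> \<open>The progress made by the first step towards the point of time \<open>m\<close>,
    minus \<open>r\<close>. For \<open>m = 0\<close> the truncated subtraction leaves
    \<open>- r\<close>.\<close>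
  define b where "b m x = a m x - a (m - 1) (T x) - r" for m x
  have bB: "{x \<in> space M. \<forall>k\<le>m. 0 \<le> (\<Sum>i<k. b (m - i) ((T ^^ i) x))} = good r m" for m
  proof -
    have "(0 \<le> (\<Sum>i<k. b (m - i) ((T ^^ i) x))) = (r * real k \<le> a m x - a (m - k) ((T ^^ k) x))" if "k \<le> m" for k x
      using telescope[OF that, of x r] by (simp add: b_def)
    then show ?thesis by (auto simp: good_def)
  qed
  have "(\<integral>x. indicator Y x * (\<Sum>i<n. b (n - i) ((T ^^ i) x)) \<partial>M) \<le> C' * (\<Sum>i<n. measure M (good r (n - i) \<inter> Y))"
    unfolding bB[symmetric]
  proof (rule leader_integral[OF Ym inv])
    show "b m \<in> borel_measurable M" for m unfolding b_def by measurable
    fix m x assume x: "x \<in> space M"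
    show "\<bar>b m x\<bar> \<le> C'"
    proof (cases m)
      case 0 then show ?thesis using x a_0 pow_space[OF x, of 1] C_nonneg by (simp add: b_def C'_def)
    next
      case (Suc l)
      have "a m x \<le> C + a l (T x)" "a l (T x) \<le> a m x + C"
        using a_subadd[OF x, of 1 l] a_1[OF x] a_tail[OF x, of l] Suc by auto
      then show ?thesis using Suc by (auto simp: b_def C'_def)
    qed
  qed
  also have "(\<integral>x. indicator Y x * (\<Sum>i<n. b (n - i) ((T ^^ i) x)) \<partial>M) = (\<integral>x. indicator Y x * (a n x - r * real n) \<partial>M)"
  proof (intro Bochner_Integration.integral_cong refl)
    fix x assume "x \<in> space M"
    then show "indicator Y x * (\<Sum>i<n. b (n - i) ((T ^^ i) x)) = indicator Y x * (a n x - r * real n)"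
      using telescope[of n n x r] a_0[OF pow_space[of x n]] by (simp add: b_def)
  qed
  finally have "real n * (r' - r) * measure M Y \<le> C' * (\<Sum>i<n. measure M (good r (n - i) \<inter> Y))"
    using lower[OF n(1)] by simp
  also have "\<dots> \<le> (C' + 1) * (\<Sum>i<n. measure M (good r (n - i) \<inter> Y))"
    by (intro mult_right_mono sum_nonneg) auto
  also have "\<dots> < (C' + 1) * (\<delta> * real n)" using n C' by (intro mult_strict_left_mono) auto
  also have "\<dots> = real n * (r' - r) * measure M Y" using C' by (simp add: \<delta>_def)
  finally show False by simp
qed

text \<open>Almost every orbit of fast growth enters \<open>Good r\<close> at some time
  \<open>i\<close>. The good times of \<open>(T ^^ i) x\<close>, shifted by \<open>i\<close>, serve
  for \<open>x\<close> itself up to the constant \<open>C * i + \<bar>r\<bar> * i\<close>.\<close>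

lemma AE_good:
  assumes "r < r'"
  shows "AE x in M. fast r' (\<lambda>n. a n x) \<longrightarrow>
    (\<exists>D. \<forall>N. \<exists>n\<ge>N. \<forall>k\<le>n. r * real k - D \<le> a n x - a (n - k) ((T ^^ k) x))"
proof -
  define Y where "Y = {x \<in> space M. fast r' (\<lambda>n. a n x) \<and> (\<exists>N. \<forall>i\<ge>N. (T ^^ i) x \<notin> Good r)}"
  have [measurable]: "Y \<in> sets M" unfolding Y_def fast_def by measurable
  have "AE x in M. x \<notin> Y"
    using slow_null[OF assms] by (intro AE_not_in) (auto simp: Y_def[symmetric] null_sets_def emeasure_eq_measure)
  then show ?thesis
  proof (rule AE_mp, intro AE_I2 impI)
    fix x assume x: "x \<in> space M" "x \<notin> Y" "fast r' (\<lambda>n. a n x)"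
    then obtain i where i: "(T ^^ i) x \<in> Good r" by (auto simp: Y_def)
    show "\<exists>D. \<forall>N. \<exists>n\<ge>N. \<forall>k\<le>n. r * real k - D \<le> a n x - a (n - k) ((T ^^ k) x)"
    proof (rule exI, rule allI)
      fix N
      obtain m where m: "m \<ge> N" "(T ^^ i) x \<in> good r m" using i unfolding Good_def by auto
      have "r * real k - (C * real i + \<bar>r\<bar> * real i) \<le> a (m + i) x - a (m + i - k) ((T ^^ k) x)" if k: "k \<le> m + i" for k
      proof (cases "i \<le> k")
        case True
        define l where "l = k - i"
        have l: "k = l + i" "l \<le> m" using k True by (auto simp: l_def)
        have "r * real l \<le> a m ((T ^^ i) x) - a (m - l) ((T ^^ l) ((T ^^ i) x))"
          using m(2) l unfolding good_def by blast
        moreover have "(T ^^ l) ((T ^^ i) x) = (T ^^ k) x" by (simp add: l funpow_add)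
        moreover have "m - l = m + i - k" using l by simp
        moreover have "r * real i \<le> \<bar>r\<bar> * real i" by (intro mult_right_mono) auto
        moreover have "r * real k = r * real l + r * real i" by (simp add: l algebra_simps)
        ultimately show ?thesis using a_tail_pow[OF x(1), of m i] by simp
      next
        case False
        have "a (m + i - k) ((T ^^ k) x) \<le> a (m + i) x + C * real k" using a_tail_pow[OF x(1), of "m + i - k" k] k by simp
        moreover have "C * real k \<le> C * real i" using False C_nonneg by (intro mult_left_mono) auto
        moreover have "r * real k \<le> \<bar>r\<bar> * real i" using False by (intro mult_mono) auto
        ultimately show ?thesis by linarith
      qed
      then show "\<exists>n\<ge>N. \<forall>k\<le>n. r * real k - (C * real i + \<bar>r\<bar> * real i) \<le> a n x - a (n - k) ((T ^^ k) x)"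
        using m(1) by (intro exI[of _ "m + i"]) auto
    qed
  qed
qed

text \<open>\<open>A\<close> is the upper limit of \<open>a n x / n\<close>. Restricting
  \<open>r < r'\<close> to rationals gives a single null set for all \<open>\<epsilon>\<close>, and
  the constant \<open>D\<close> of \<open>AE_good\<close> disappears behind the threshold
  \<open>K\<close>.\<close>

theorem karlsson_margulis:
  "AE x in M. \<exists>A\<ge>0. \<forall>\<epsilon>>0. \<exists>K. (\<forall>k\<ge>K. a k x \<le> (A + \<epsilon>) * real k) \<and>
     (\<forall>N. \<exists>n\<ge>N. \<forall>k. K \<le> k \<and> k \<le> n \<longrightarrow> (A - \<epsilon>) * real k \<le> a n x - a (n - k) ((T ^^ k) x))"
proof -
  have "AE x in M. \<forall>r r' :: rat. of_rat r < (of_rat r' :: real) \<longrightarrow> fast (of_rat r') (\<lambda>n. a n x) \<longrightarrow>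
    (\<exists>D. \<forall>N. \<exists>n\<ge>N. \<forall>k\<le>n. of_rat r * real k - D \<le> a n x - a (n - k) ((T ^^ k) x))"
    using AE_good by (simp add: AE_all_countable)
  then show ?thesis
  proof (rule AE_mp, intro AE_I2 impI)
    fix x assume x: "x \<in> space M" and *: "\<forall>r r' :: rat. of_rat r < (of_rat r' :: real) \<longrightarrow> fast (of_rat r') (\<lambda>n. a n x) \<longrightarrow>
      (\<exists>D. \<forall>N. \<exists>n\<ge>N. \<forall>k\<le>n. of_rat r * real k - D \<le> a n x - a (n - k) ((T ^^ k) x))"
    define Q where "Q = {q. \<forall>N. \<exists>n\<ge>N. q * real n \<le> a n x}"
    define A where "A = Sup Q"
    have Q0: "0 \<in> Q" using a_nonneg[OF x] by (auto simp: Q_def)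
    have bdd: "bdd_above Q"
    proof (rule bdd_aboveI)
      fix q assume "q \<in> Q"
      then obtain n where "n \<ge> 1" "q * real n \<le> a n x" unfolding Q_def by blast
      then have "q * real n \<le> C * real n" "real n > 0" using a_le[OF x, of n] by linarith+
      then show "q \<le> C" by simp
    qed
    have A0: "0 \<le> A" unfolding A_def by (rule cSup_upper[OF Q0 bdd])
    have "\<exists>K. (\<forall>k\<ge>K. a k x \<le> (A + \<epsilon>) * real k) \<and>
       (\<forall>N. \<exists>n\<ge>N. \<forall>k. K \<le> k \<and> k \<le> n \<longrightarrow> (A - \<epsilon>) * real k \<le> a n x - a (n - k) ((T ^^ k) x))" if e: "\<epsilon> > 0" for \<epsilon>
    proof -
      have "A + \<epsilon> \<notin> Q" using cSup_upper[OF _ bdd, of "A + \<epsilon>"] e by (auto simp: A_def)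
      then obtain K1 where K1: "\<And>n. n \<ge> K1 \<Longrightarrow> a n x < (A + \<epsilon>) * real n" unfolding Q_def using not_le by blast
      obtain s where s: "s \<in> Q" "A - \<epsilon> / 2 < s"
      proof (rule less_cSupE[of "A - \<epsilon> / 2" Q])
        show "A - \<epsilon> / 2 < Sup Q" using e by (simp add: A_def)
      qed (use Q0 in auto)
      \<comment> \<open>The slopes are arranged as
        \<open>A - \<epsilon> < r < r' < A - \<epsilon> / 2 < q < s\<close>, where \<open>s\<close>
        is attained infinitely often: \<open>q\<close> shows growth faster than \<open>r'\<close>,
        and \<open>r\<close> leaves room above \<open>A - \<epsilon>\<close>.\<close>
      obtain r :: rat where r: "A - \<epsilon> < of_rat r" "of_rat r < A - \<epsilon> / 2" using of_rat_dense[of "A - \<epsilon>" "A - \<epsilon> / 2"] e by auto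
      obtain r' :: rat where r': "of_rat r < (of_rat r' :: real)" "of_rat r' < A - \<epsilon> / 2" using of_rat_dense[OF r(2)] by auto
      obtain q :: rat where q: "A - \<epsilon> / 2 < of_rat q" "of_rat q < s" using of_rat_dense[OF s(2)] by auto
      have "\<exists>n\<ge>N. of_rat q * real n \<le> a n x" for N
      proof -
        obtain n where n: "n \<ge> N" "s * real n \<le> a n x" using s unfolding Q_def by blast
        moreover have "of_rat q * real n \<le> s * real n" using q by (intro mult_right_mono) auto
        ultimately show ?thesis by (intro exI[of _ n]) auto
      qed
      then have "fast (of_rat r') (\<lambda>n. a n x)" unfolding fast_def using q r' by (intro exI[of _ q]) auto
      then obtain D where D: "\<And>N. \<exists>n\<ge>N. \<forall>k\<le>n. of_rat r * real k - D \<le> a n x - a (n - k) ((T ^^ k) x)"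
        using * r'(1) by blast
      \<comment> \<open>The margin between the slopes, which outweighs \<open>D\<close> for
        \<open>k \<ge> K2\<close>.\<close>
      define d where "d = of_rat r - (A - \<epsilon>)"
      have d: "d > 0" using r by (simp add: d_def)
      obtain K2 :: nat where K2: "real K2 > D / d" using reals_Archimedean2 by blast
      have "(A - \<epsilon>) * real k \<le> of_rat r * real k - D" if "k \<ge> K2" for k
      proof -
        have "D < d * real K2" using K2 d by (simp add: field_simps)
        also have "\<dots> \<le> d * real k" using that d by (intro mult_left_mono) auto
        finally show ?thesis by (simp add: d_def algebra_simps)
      qed
      then have "\<exists>n\<ge>N. \<forall>k. max K1 K2 \<le> k \<and> k \<le> n \<longrightarrow> (A - \<epsilon>) * real k \<le> a n x - a (n - k) ((T ^^ k) x)" for N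
        using D[of N] by (meson max.boundedE order_trans)
      then show ?thesis using K1 by (intro exI[of _ "max K1 K2"]) (auto intro: less_imp_le)
    qed
    then show "\<exists>A\<ge>0. \<forall>\<epsilon>>0. \<exists>K. (\<forall>k\<ge>K. a k x \<le> (A + \<epsilon>) * real k) \<and>
     (\<forall>N. \<exists>n\<ge>N. \<forall>k. K \<le> k \<and> k \<le> n \<longrightarrow> (A - \<epsilon>) * real k \<le> a n x - a (n - k) ((T ^^ k) x))"
      using A0 by blast
  qed
qed

end

section \<open>Differentiable dependence of solutions on parameters\<close>

lemma vector_mvt_bound:
  fixes u :: "real \<Rightarrow> 'a::real_normed_vector"
  assumes "\<And>s. s \<in> closed_segment a b \<Longrightarrow> (u has_vector_derivative u' s) (at s)"
    and "\<And>s. s \<in> closed_segment a b \<Longrightarrow> norm (u' s) \<le> B"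
  shows "norm (u b - u a) \<le> B * \<bar>b - a\<bar>"
proof -
  have "norm (u b - u a) \<le> B * norm (b - a)"
  proof (rule differentiable_bound[where S = "closed_segment a b" and f' = "\<lambda>s h. h *\<^sub>R u' s"])
    fix s assume s: "s \<in> closed_segment a b"
    show "(u has_derivative (\<lambda>h. h *\<^sub>R u' s)) (at s within closed_segment a b)"
      using assms(1)[OF s] unfolding has_vector_derivative_def by (rule has_derivative_at_withinI)
    show "onorm (\<lambda>h. h *\<^sub>R u' s) \<le> B"
    proof (rule onorm_le)
      fix h show "norm (h *\<^sub>R u' s) \<le> B * norm h"
        using mult_left_mono[OF assms(2)[OF s] abs_ge_zero[of h]] by (simp add: mult.commute)
    qed
  qed auto
  then show ?thesis by simp
qed

text \<open>Gronwall's estimate without an exponential: at the point \<open>m\<close> of maximal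
  norm on the segment, the mean value inequality bounds \<open>norm (u m)\<close> by
  \<open>norm (u t0) + norm (u m) / 2 + \<eta>\<close>, because
  \<open>D * L \<le> 1 / 2\<close>.\<close>

lemma gronwall_short:
  fixes u :: "real \<Rightarrow> 'a::real_normed_vector"
  assumes T: "convex T" "t0 \<in> T" "t \<in> T"
    and u: "\<And>s. s \<in> T \<Longrightarrow> (u has_vector_derivative u' s) (at s)"
    and bnd: "\<And>s. s \<in> T \<Longrightarrow> norm (u' s) \<le> L * norm (u s) + \<eta>"
    and short: "\<And>s s'. s \<in> T \<Longrightarrow> s' \<in> T \<Longrightarrow> \<bar>s - s'\<bar> \<le> D" "D * L \<le> 1 / 2" "D \<le> 1"
    and nn: "0 \<le> L" "0 \<le> \<eta>"
  shows "norm (u t) \<le> 2 * norm (u t0) + 2 * \<eta>"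
proof -
  define S where "S = closed_segment t0 t"
  have S: "S \<subseteq> T" unfolding S_def using T by (simp add: closed_segment_subset)
  have "continuous_on S u"
    using u S by (intro continuous_at_imp_continuous_on ballI) (blast intro: has_vector_derivative_continuous)
  then obtain m where m: "m \<in> S" "\<And>s. s \<in> S \<Longrightarrow> norm (u s) \<le> norm (u m)"
    using continuous_attains_sup[of S "\<lambda>s. norm (u s)"] by (auto simp: S_def intro: continuous_on_norm)
  have sub: "closed_segment t0 m \<subseteq> S"
    using m(1) unfolding S_def by (intro closed_segment_subset) auto
  have "norm (u m - u t0) \<le> (L * norm (u m) + \<eta>) * \<bar>m - t0\<bar>"
  proof (rule vector_mvt_bound[where u' = u'])
    fix s assume "s \<in> closed_segment t0 m"
    then have s: "s \<in> S" "s \<in> T" using sub S by auto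
    show "(u has_vector_derivative u' s) (at s)" by (rule u[OF s(2)])
    have "L * norm (u s) \<le> L * norm (u m)" using m(2)[OF s(1)] nn by (intro mult_left_mono)
    then show "norm (u' s) \<le> L * norm (u m) + \<eta>" using bnd[OF s(2)] by linarith
  qed
  also have "\<dots> \<le> (L * norm (u m) + \<eta>) * D"
    using short(1)[of m t0] m S T nn by (intro mult_left_mono) auto
  also have "\<dots> \<le> norm (u m) / 2 + \<eta>"
  proof -
    have "D * L * norm (u m) \<le> 1 / 2 * norm (u m)" using short by (intro mult_right_mono) auto
    moreover have "\<eta> * D \<le> \<eta>" using short nn by (simp add: mult_left_le)
    ultimately show ?thesis by (simp add: algebra_simps)
  qed
  finally have "norm (u m - u t0) \<le> norm (u m) / 2 + \<eta>" .
  moreover have "norm (u m) \<le> norm (u m - u t0) + norm (u t0)"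
    using norm_triangle_ineq[of "u m - u t0" "u t0"] by simp
  ultimately have "norm (u m) \<le> 2 * norm (u t0) + 2 * \<eta>" by linarith
  then show ?thesis using m(2)[of t] by (simp add: S_def)
qed

text \<open>Compactness and convexity of \<open>K\<close> make \<open>f\<close> Lipschitz and its
  derivative uniformly continuous, with constants that do not depend on the solution.\<close>

locale C1_field =
  fixes K :: "'a::euclidean_space set" and f :: "'a \<Rightarrow> 'a" and f' :: "'a \<Rightarrow> 'a \<Rightarrow>\<^sub>L 'a"
  assumes K: "compact K" "convex K"
    and f': "\<And>z. z \<in> K \<Longrightarrow> (f has_derivative f' z) (at z within K)" "continuous_on K f'"
begin

lemma f'_bounded: obtains L where "0 \<le> L" "\<And>z. z \<in> K \<Longrightarrow> norm (f' z) \<le> L"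
proof -
  have "bounded (f' ` K)" using K f' by (intro compact_imp_bounded compact_continuous_image)
  then obtain L where "L > 0" "\<forall>x\<in>f' ` K. norm x \<le> L" by (auto simp: bounded_pos)
  then show thesis using that[of L] by auto
qed

lemma f_lipschitz:
  assumes "\<And>z. z \<in> K \<Longrightarrow> norm (f' z) \<le> L" "z \<in> K" "z' \<in> K"
  shows "norm (f z' - f z) \<le> L * norm (z' - z)"
  using f'(1) assms by (intro differentiable_bound[OF K(2), where f' = "\<lambda>z. blinfun_apply (f' z)"])
    (auto simp: norm_blinfun.rep_eq[symmetric])

lemma f'_uniform:
  assumes "0 < \<eta>"
  obtains \<delta> where "0 < \<delta>" "\<And>z z'. z \<in> K \<Longrightarrow> z' \<in> K \<Longrightarrow> norm (z' - z) < \<delta> \<Longrightarrow> norm (f' z' - f' z) \<le> \<eta>"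
proof -
  have "uniformly_continuous_on K f'" using f' K by (intro compact_uniformly_continuous)
  then obtain \<delta> where "\<delta> > 0" "\<And>z z'. z \<in> K \<Longrightarrow> z' \<in> K \<Longrightarrow> dist z' z < \<delta> \<Longrightarrow> dist (f' z') (f' z) < \<eta>"
    using assms unfolding uniformly_continuous_on_def by metis
  then show thesis using that[of \<delta>] by (force simp: dist_norm)
qed

lemma f_linearization:
  assumes z: "z \<in> K" "z' \<in> K" and \<eta>: "\<And>w. w \<in> K \<Longrightarrow> norm (w - z) < \<delta> \<Longrightarrow> norm (f' w - f' z) \<le> \<eta>"
    and "norm (z' - z) < \<delta>"
  shows "norm (f z' - f z - f' z (z' - z)) \<le> \<eta> * norm (z' - z)"
proof -
  have sub: "closed_segment z z' \<subseteq> K" using z K by (simp add: closed_segment_subset)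
  have "norm ((f z' - f' z z') - (f z - f' z z)) \<le> \<eta> * norm (z' - z)"
  proof (rule differentiable_bound[of "closed_segment z z'" "\<lambda>w. f w - f' z w" "\<lambda>w. blinfun_apply (f' w - f' z)"])
    fix w assume w: "w \<in> closed_segment z z'"
    have "(f has_derivative f' w) (at w within closed_segment z z')"
      using f'(1)[of w] sub w by (blast intro: has_derivative_subset)
    then show "((\<lambda>w. f w - f' z w) has_derivative blinfun_apply (f' w - f' z)) (at w within closed_segment z z')"
      by (auto intro!: derivative_eq_intros simp: blinfun.diff_left fun_eq_iff)
    have "norm (w - z) \<le> norm (z' - z)" using w segment_bound1[of w z z'] by (simp add: norm_minus_commute)
    then have "norm (f' w - f' z) \<le> \<eta>" using \<eta>[of w] w sub assms(4) by auto
    then show "onorm (blinfun_apply (f' w - f' z)) \<le> \<eta>" by (simp add: norm_blinfun.rep_eq)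
  qed auto
  then show ?thesis by (simp add: blinfun.diff_right algebra_simps)
qed

end

text \<open>The solutions \<open>Z a\<close> are given, in the application by completeness; at stake
  is their dependence on \<open>a\<close>. The initial values at \<open>t0\<close> are themselves a
  C1 family, so that smoothness can be handed on from one short time interval to the next.\<close>

locale C1_family = C1_field K f f' for K :: "'a::euclidean_space set" and f f' +
  fixes L D :: real and T :: "real set" and t0 :: real
    and W :: "'b::euclidean_space set" and Z :: "'b \<Rightarrow> real \<Rightarrow> 'a" and X0 :: "'b \<Rightarrow> 'b \<Rightarrow>\<^sub>L 'a"
  assumes L: "0 \<le> L" "\<And>z. z \<in> K \<Longrightarrow> norm (f' z) \<le> L"
    and T: "open T" "convex T" "t0 \<in> T"
    and short: "\<And>s s'. s \<in> T \<Longrightarrow> s' \<in> T \<Longrightarrow> \<bar>s - s'\<bar> \<le> D" "D * L \<le> 1 / 2" "D \<le> 1"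
    and W: "open W"
    and Z_K: "\<And>a t. a \<in> W \<Longrightarrow> t \<in> T \<Longrightarrow> Z a t \<in> K"
    and Z_deriv: "\<And>a t. a \<in> W \<Longrightarrow> t \<in> T \<Longrightarrow> (Z a has_vector_derivative f (Z a t)) (at t)"
    and X0: "\<And>a. a \<in> W \<Longrightarrow> ((\<lambda>a. Z a t0) has_derivative X0 a) (at a)" "continuous_on W X0"
begin

lemmas gron = gronwall_short[OF T(2,3) _ _ _ short L(1)]

lemma f'_apply_le: "z \<in> K \<Longrightarrow> norm (f' z v) \<le> L * norm v"
  using norm_blinfun[of "f' z" v] mult_right_mono[OF L(2)[of z] norm_ge_zero[of v]] by linarith

lemma Z_diff_le:
  assumes "a \<in> W" "a' \<in> W" "t \<in> T"
  shows "norm (Z a' t - Z a t) \<le> 2 * norm (Z a' t0 - Z a t0)"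
  using gron[of t "\<lambda>t. Z a' t - Z a t" "\<lambda>t. f (Z a' t) - f (Z a t)" 0] assms
    has_vector_derivative_diff[OF Z_deriv Z_deriv, of a' _ a]
  by (simp add: Z_K f_lipschitz L)

lemma linearized_unique:
  assumes "a \<in> W" "t \<in> T" and "\<And>t. t \<in> T \<Longrightarrow> (\<xi> has_vector_derivative f' (Z a t) (\<xi> t)) (at t)"
  shows "norm (\<xi> t) \<le> 2 * norm (\<xi> t0)"
  using gron[of t \<xi> "\<lambda>t. f' (Z a t) (\<xi> t)" 0] assms Z_K by (simp add: f'_apply_le)

text \<open>The solution of the linearized equation arises as the limit of the difference quotients
  \<open>q n\<close> of the given solutions in direction \<open>b\<close>. They satisfy that
  equation up to an error that tends to 0 uniformly, so \<open>gronwall_short\<close> makes them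
  uniformly Cauchy.\<close>

lemma linearized_exists:
  assumes a: "a \<in> W"
  shows "\<exists>\<xi>. \<xi> t0 = X0 a b \<and> (\<forall>t\<in>T. (\<xi> has_vector_derivative f' (Z a t) (\<xi> t)) (at t))"
proof -
  obtain \<rho> where \<rho>: "\<rho> > 0" "ball a \<rho> \<subseteq> W" using W a by (meson open_contains_ball)
  \<comment> \<open>The factor \<open>\<rho> / (norm b + 1)\<close> keeps all points
    \<open>p n\<close> in the ball of radius \<open>\<rho>\<close>, also when \<open>b\<close> is
    0.\<close>
  define s where "s n = \<rho> / (norm b + 1) / (real n + 1)" for n :: nat
  have nb: "norm b + 1 > 0" by (simp add: add_nonneg_pos)
  have s0: "s n > 0" for n using \<rho> nb by (simp add: s_def)
  have s_lim: "s \<longlonglongrightarrow> 0" unfolding s_def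
    using tendsto_mult[OF tendsto_const[of "\<rho> / (norm b + 1)"] LIMSEQ_inverse_real_of_nat]
    by (simp add: divide_inverse add.commute)
  define p where "p n = a + s n *\<^sub>R b" for n
  have pW: "p n \<in> W" for n
  proof -
    have "s n * norm b < s n * (norm b + 1)" using s0 by simp
    also have "\<dots> = \<rho> / (real n + 1)" using nb by (simp add: s_def)
    also have "\<dots> \<le> \<rho>" using \<rho> by (simp add: field_simps)
    finally have "norm (s n *\<^sub>R b) < \<rho>" using s0[of n] by simp
    then show ?thesis using \<rho> by (auto simp: p_def dist_norm subset_iff)
  qed
  define q where "q n t = (Z (p n) t - Z a t) /\<^sub>R s n" for n t
  define q' where "q' n t = (f (Z (p n) t) - f (Z a t)) /\<^sub>R s n" for n t
  have q_deriv: "(q n has_vector_derivative q' n t) (at t)" if "t \<in> T" for n t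
    unfolding q_def q'_def using Z_deriv[OF pW that] Z_deriv[OF a that]
    by (auto intro!: derivative_eq_intros)
  have q0: "(\<lambda>n. q n t0) \<longlonglongrightarrow> X0 a b"
  proof (rule LIMSEQ_I)
    fix r :: real assume r: "r > 0"
    define e where "e = r / (norm b + 1) / 2"
    have e: "e > 0" using r nb by (simp add: e_def)
    obtain d where d: "d > 0" "\<And>y. norm (y - a) < d \<Longrightarrow> norm (Z y t0 - Z a t0 - X0 a (y - a)) \<le> e * norm (y - a)"
      using X0(1)[OF a] e unfolding has_derivative_at_alt by meson
    have "(\<lambda>n. s n * norm b) \<longlonglongrightarrow> 0" using tendsto_mult_left_zero[OF s_lim] .
    from order_tendstoD(2)[OF this d(1)] obtain n0 where n0: "\<And>n. n \<ge> n0 \<Longrightarrow> s n * norm b < d"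
      unfolding eventually_sequentially by blast
    have "norm (q n t0 - X0 a b) < r" if n: "n \<ge> n0" for n
    proof -
      have "norm (Z (p n) t0 - Z a t0 - X0 a (p n - a)) \<le> e * norm (p n - a)"
        using d(2)[of "p n"] n0[OF n] s0[of n] by (simp add: p_def)
      then have "norm (s n *\<^sub>R (q n t0 - X0 a b)) \<le> e * (s n * norm b)"
        using s0[of n] by (simp add: q_def p_def blinfun.scaleR_right scaleR_right_diff_distrib)
      then have "norm (q n t0 - X0 a b) \<le> e * norm b" using s0[of n] by (simp add: mult.assoc mult.left_commute)
      also have "\<dots> \<le> r / 2" using r nb by (simp add: e_def field_simps)
      finally show ?thesis using r by simp
    qed
    then show "\<exists>no. \<forall>n\<ge>no. norm (q n t0 - X0 a b) < r" by blast
  qed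
  have "Bseq (\<lambda>n. q n t0)" using q0 by (rule convergent_imp_Bseq[OF convergentI])
  then obtain Q where Q: "Q > 0" "\<And>n. norm (q n t0) \<le> Q" by (auto simp: Bseq_def)
  have q_le: "norm (q n t) \<le> 2 * Q" if "t \<in> T" for n t
  proof -
    have "norm (q n t) \<le> 2 * norm (q n t0)"
      using Z_diff_le[OF a pW that, of n] s0[of n] by (simp add: q_def divide_simps)
    then show ?thesis using Q(2)[of n] by linarith
  qed
  \<comment> \<open>Linearization at \<open>Z a t\<close> with a displacement of at most
    \<open>s n * (2 * Q)\<close>, divided by \<open>s n\<close>.\<close>
  have err: "\<exists>n0. \<forall>n\<ge>n0. \<forall>t\<in>T. norm (q' n t - f' (Z a t) (q n t)) \<le> \<eta>" if \<eta>: "\<eta> > 0" for \<eta>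
  proof -
    define e where "e = \<eta> / (2 * Q)"
    have e: "e > 0" using \<eta> Q by (simp add: e_def)
    obtain \<delta> where \<delta>: "\<delta> > 0" "\<And>z z'. z \<in> K \<Longrightarrow> z' \<in> K \<Longrightarrow> norm (z' - z) < \<delta> \<Longrightarrow> norm (f' z' - f' z) \<le> e"
      using f'_uniform[OF e] by blast
    have "(\<lambda>n. s n * (2 * Q)) \<longlonglongrightarrow> 0" using tendsto_mult_left_zero[OF s_lim] .
    from order_tendstoD(2)[OF this \<delta>(1)] obtain n0 where n0: "\<And>n. n \<ge> n0 \<Longrightarrow> s n * (2 * Q) < \<delta>"
      unfolding eventually_sequentially by blast
    have "norm (q' n t - f' (Z a t) (q n t)) \<le> \<eta>" if n: "n \<ge> n0" and t: "t \<in> T" for n t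
    proof -
      have Zq: "Z (p n) t - Z a t = s n *\<^sub>R q n t" using s0[of n] by (simp add: q_def)
      have le: "norm (s n *\<^sub>R q n t) \<le> s n * (2 * Q)" using q_le[OF t, of n] s0[of n] by simp
      have "norm (f (Z (p n) t) - f (Z a t) - f' (Z a t) (Z (p n) t - Z a t)) \<le> e * norm (Z (p n) t - Z a t)"
        using \<delta>(2)[OF Z_K[OF a t]] le n0[OF n] by (intro f_linearization[where \<delta> = \<delta>] Z_K a pW t) (auto simp: Zq)
      then have "norm (s n *\<^sub>R (q' n t - f' (Z a t) (q n t))) \<le> e * norm (s n *\<^sub>R q n t)"
        unfolding Zq using s0[of n] by (simp add: q'_def blinfun.scaleR_right scaleR_right_diff_distrib)
      then have "norm (q' n t - f' (Z a t) (q n t)) \<le> e * norm (q n t)"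
        using s0[of n] by (simp add: mult.left_commute)
      also have "\<dots> \<le> e * (2 * Q)" using q_le[OF t, of n] e by (intro mult_left_mono) auto
      also have "\<dots> = \<eta>" using Q by (simp add: e_def)
      finally show ?thesis .
    qed
    then show ?thesis by blast
  qed
  have "uniformly_Cauchy_on T q"
    unfolding uniformly_Cauchy_on_def
  proof (intro allI impI)
    fix e :: real assume e: "e > 0"
    obtain n1 where n1: "\<And>n t. n \<ge> n1 \<Longrightarrow> t \<in> T \<Longrightarrow> norm (q' n t - f' (Z a t) (q n t)) \<le> e / 16"
      using err[of "e / 16"] e by auto
    obtain n2 where n2: "\<And>m n. m \<ge> n2 \<Longrightarrow> n \<ge> n2 \<Longrightarrow> norm (q m t0 - q n t0) < e / 8"
      using LIMSEQ_imp_Cauchy[OF q0] e unfolding Cauchy_iff by (meson divide_pos_pos zero_less_numeral)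
    have "dist (q m t) (q n t) < e" if t: "t \<in> T" and mn: "m \<ge> max n1 n2" "n \<ge> max n1 n2" for t m n
    proof -
      have "norm (q m t - q n t) \<le> 2 * norm (q m t0 - q n t0) + 2 * (e / 8)"
      proof (rule gron[OF t, where u' = "\<lambda>t. q' m t - q' n t"])
        fix t assume t: "t \<in> T"
        show "((\<lambda>t. q m t - q n t) has_vector_derivative q' m t - q' n t) (at t)"
          by (intro has_vector_derivative_diff q_deriv t)
        have "q' m t - q' n t = f' (Z a t) (q m t - q n t) +
            ((q' m t - f' (Z a t) (q m t)) - (q' n t - f' (Z a t) (q n t)))"
          by (simp add: blinfun.diff_right)
        then have "norm (q' m t - q' n t) \<le> norm (f' (Z a t) (q m t - q n t)) +
            (norm (q' m t - f' (Z a t) (q m t)) + norm (q' n t - f' (Z a t) (q n t)))"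
          by (metis norm_triangle_le norm_triangle_ineq4 order_refl add_left_mono)
        also have "\<dots> \<le> L * norm (q m t - q n t) + (e / 16 + e / 16)"
          using n1[of m t] n1[of n t] mn t by (intro add_mono f'_apply_le Z_K a) auto
        finally show "norm (q' m t - q' n t) \<le> L * norm (q m t - q n t) + e / 8" by simp
      qed (use e in auto)
      then show ?thesis using n2[of m n] mn e by (simp add: dist_norm)
    qed
    then show "\<exists>M. \<forall>x\<in>T. \<forall>m\<ge>M. \<forall>n\<ge>M. dist (q m x) (q n x) < e" by blast
  qed
  then obtain \<xi> where \<xi>: "uniform_limit T q \<xi> sequentially"
    using Cauchy_uniformly_convergent unfolding uniformly_convergent_on_def by blast
  have lim: "(\<lambda>n. q n t) \<longlonglongrightarrow> \<xi> t" if "t \<in> T" for t using tendsto_uniform_limitI[OF \<xi> that] .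
  have "\<exists>g. \<forall>x\<in>T. (\<lambda>n. q n x) \<longlonglongrightarrow> g x \<and> (g has_derivative (\<lambda>h. h *\<^sub>R f' (Z a x) (\<xi> x))) (at x within T)"
  proof (rule has_derivative_sequence[OF T(2), where f' = "\<lambda>n x h. h *\<^sub>R q' n x"])
    show "(q n has_derivative (\<lambda>h. h *\<^sub>R q' n x)) (at x within T)" if "x \<in> T" for n x
      using q_deriv[OF that, of n] unfolding has_vector_derivative_def by (rule has_derivative_at_withinI)
    fix e :: real assume e: "e > 0"
    obtain n1 where n1: "\<And>n t. n \<ge> n1 \<Longrightarrow> t \<in> T \<Longrightarrow> norm (q' n t - f' (Z a t) (q n t)) \<le> e / 2"
      using err[of "e / 2"] e by auto
    have "\<forall>\<^sub>F n in sequentially. \<forall>t\<in>T. dist (q n t) (\<xi> t) < e / 2 / (L + 1)"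
      using uniform_limitD[OF \<xi>, of "e / 2 / (L + 1)"] e L by simp
    then show "\<forall>\<^sub>F n in sequentially. \<forall>x\<in>T. \<forall>h. norm (h *\<^sub>R q' n x - h *\<^sub>R f' (Z a x) (\<xi> x)) \<le> e * norm h"
      using eventually_ge_at_top[of n1]
    proof eventually_elim
      case (elim n)
      have "norm (q' n t - f' (Z a t) (\<xi> t)) \<le> e" if t: "t \<in> T" for t
      proof -
        have d: "norm (q n t - \<xi> t) < e / 2 / (L + 1)" using elim t by (simp add: dist_norm)
        have "norm (f' (Z a t) (q n t - \<xi> t)) \<le> L * norm (q n t - \<xi> t)" by (intro f'_apply_le Z_K a t)
        also have "\<dots> \<le> L * (e / 2 / (L + 1))" using d L by (intro mult_left_mono) auto
        also have "\<dots> \<le> e / 2" using L e by (simp add: field_simps)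
        finally have "norm (f' (Z a t) (q n t - \<xi> t)) \<le> e / 2" .
        moreover have "norm (q' n t - f' (Z a t) (q n t)) \<le> e / 2" using n1 elim t by auto
        moreover have eq: "q' n t - f' (Z a t) (\<xi> t) = (q' n t - f' (Z a t) (q n t)) + f' (Z a t) (q n t - \<xi> t)"
          by (simp add: blinfun.diff_right)
        ultimately show ?thesis unfolding eq
          using norm_triangle_ineq[of "q' n t - f' (Z a t) (q n t)" "f' (Z a t) (q n t - \<xi> t)"] by linarith
      qed
      then show ?case by (auto simp flip: scaleR_right_diff_distrib simp: mult.commute[of e] intro!: mult_left_mono)
    qed
  qed (use T lim in auto)
  then obtain g where g: "\<And>x. x \<in> T \<Longrightarrow> (\<lambda>n. q n x) \<longlonglongrightarrow> g x"
    "\<And>x. x \<in> T \<Longrightarrow> (g has_derivative (\<lambda>h. h *\<^sub>R f' (Z a x) (\<xi> x))) (at x within T)" by blast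
  have g\<xi>: "g t = \<xi> t" if "t \<in> T" for t using LIMSEQ_unique[OF g(1)[OF that] lim[OF that]] .
  show ?thesis
  proof (intro exI[of _ g] conjI ballI)
    show "g t0 = X0 a b" using LIMSEQ_unique[OF g(1)[OF T(3)] q0] .
    show "(g has_vector_derivative f' (Z a t) (g t)) (at t)" if "t \<in> T" for t
      using g(2)[OF that] unfolding has_vector_derivative_def at_within_open[OF that T(1)] g\<xi>[OF that] .
  qed
qed

text \<open>Solutions of the linearized equation depend linearly on \<open>b\<close> by uniqueness.
  The remainder \<open>Z y - Z a - \<Xi> a (y - a)\<close> solves the linearized equation with a
  forcing term that is small relative to \<open>norm (y - a)\<close>, and
  \<open>\<Xi> y b - \<Xi> a b\<close> solves it with one that is small relative to
  \<open>norm b\<close>; Gronwall then yields differentiability and continuity of the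
  derivative.\<close>

theorem differentiable_dependence:
  "\<exists>X. \<forall>t\<in>T. (\<forall>a\<in>W. ((\<lambda>a. Z a t) has_derivative blinfun_apply (X t a)) (at a)) \<and> continuous_on W (X t) \<and>
     (\<forall>a\<in>W. \<forall>b. ((\<lambda>t. blinfun_apply (X t a) b) has_vector_derivative f' (Z a t) (X t a b)) (at t))"
proof -
  obtain \<Xi> where \<Xi>0: "\<And>a b. a \<in> W \<Longrightarrow> \<Xi> a b t0 = X0 a b"
    and \<Xi>: "\<And>a b t. a \<in> W \<Longrightarrow> t \<in> T \<Longrightarrow> (\<Xi> a b has_vector_derivative f' (Z a t) (\<Xi> a b t)) (at t)"
    using linearized_exists by metis
  have \<Xi>_le: "norm (\<Xi> a b t) \<le> 2 * norm (X0 a) * norm b" if "a \<in> W" "t \<in> T" for a b t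
    using linearized_unique[OF that \<Xi>[OF that(1)], of b] norm_blinfun[of "X0 a" b] \<Xi>0[OF that(1), of b] by simp
  have lin: "bounded_linear (\<lambda>b. \<Xi> a b t)" if a: "a \<in> W" and t: "t \<in> T" for a t
  proof (rule bounded_linear_intro)
    show "\<Xi> a (b + c) t = \<Xi> a b t + \<Xi> a c t" for b c
      using linearized_unique[OF a t, of "\<lambda>t. \<Xi> a (b + c) t - (\<Xi> a b t + \<Xi> a c t)"]
        has_vector_derivative_diff[OF \<Xi>[OF a] has_vector_derivative_add[OF \<Xi>[OF a] \<Xi>[OF a]], of _ "b + c" b c]
      by (simp add: \<Xi>0[OF a] blinfun.diff_right blinfun.add_right)
    show "\<Xi> a (r *\<^sub>R b) t = r *\<^sub>R \<Xi> a b t" for r b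
      using linearized_unique[OF a t, of "\<lambda>t. \<Xi> a (r *\<^sub>R b) t - r *\<^sub>R \<Xi> a b t"]
        has_vector_derivative_diff[OF \<Xi>[OF a] bounded_linear.has_vector_derivative[OF bounded_linear_scaleR_right \<Xi>[OF a]], of _ "r *\<^sub>R b" r b]
      by (simp add: \<Xi>0[OF a] blinfun.diff_right blinfun.scaleR_right)
    show "norm (\<Xi> a b t) \<le> norm b * (2 * norm (X0 a))" for b
      using \<Xi>_le[OF a t, of b] by (simp add: mult_ac)
  qed
  define X where "X t a = Blinfun (\<lambda>b. \<Xi> a b t)" for t a
  have X: "blinfun_apply (X t a) b = \<Xi> a b t" if "a \<in> W" "t \<in> T" for a b t
    using lin[OF that] by (simp add: X_def bounded_linear_Blinfun_apply)
  have frechet: "((\<lambda>a. Z a t) has_derivative blinfun_apply (X t a)) (at a)" if a: "a \<in> W" and t: "t \<in> T" for a t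
    unfolding has_derivative_at_alt
  proof (intro conjI allI impI)
    show "bounded_linear (blinfun_apply (X t a))" by (rule blinfun.bounded_linear_right)
    fix e :: real assume e: "e > 0"
    define B where "B = norm (X0 a) + 1"
    \<comment> \<open>Gronwall doubles both errors: \<open>2 * e'\<close> and
      \<open>2 * (\<eta> * (2 * B))\<close> are at most \<open>e / 2\<close> each.\<close>
    define \<eta> where "\<eta> = e / (8 * B)"
    have B: "B \<ge> 1" by (simp add: B_def)
    have \<eta>: "\<eta> > 0" using e B by (simp add: \<eta>_def)
    obtain \<delta> where \<delta>: "\<delta> > 0" "\<And>z z'. z \<in> K \<Longrightarrow> z' \<in> K \<Longrightarrow> norm (z' - z) < \<delta> \<Longrightarrow> norm (f' z' - f' z) \<le> \<eta>"
      using f'_uniform[OF \<eta>] by blast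
    define e' where "e' = min 1 (e / 4)"
    have e': "e' > 0" "e' \<le> 1" "e' \<le> e / 4" using e by (auto simp: e'_def)
    obtain d where d: "d > 0" "\<And>y. norm (y - a) < d \<Longrightarrow> norm (Z y t0 - Z a t0 - X0 a (y - a)) \<le> e' * norm (y - a)"
      using X0(1)[OF a] e' unfolding has_derivative_at_alt by meson
    obtain \<rho> where \<rho>: "\<rho> > 0" "ball a \<rho> \<subseteq> W" using W a by (meson open_contains_ball)
    define d' where "d' = min (min d \<rho>) (\<delta> / (2 * B))"
    have "d' > 0" using d \<rho> \<delta> B by (simp add: d'_def)
    moreover have "norm (Z y t - Z a t - X t a (y - a)) \<le> e * norm (y - a)" if y: "norm (y - a) < d'" for y
    proof -
      have yW: "y \<in> W" using y \<rho> by (auto simp: d'_def dist_norm norm_minus_commute subset_iff)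
      have 1: "norm (Z y t0 - Z a t0 - X0 a (y - a)) \<le> e' * norm (y - a)" using d(2) y by (simp add: d'_def)
      have 2: "norm (Z y t0 - Z a t0) \<le> B * norm (y - a)"
      proof -
        have "norm (Z y t0 - Z a t0) \<le> norm (Z y t0 - Z a t0 - X0 a (y - a)) + norm (X0 a (y - a))"
          by (metis diff_add_cancel norm_triangle_ineq)
        also have "\<dots> \<le> e' * norm (y - a) + norm (X0 a) * norm (y - a)" by (intro add_mono 1 norm_blinfun)
        also have "\<dots> \<le> 1 * norm (y - a) + norm (X0 a) * norm (y - a)" using e' by (intro add_mono mult_right_mono) auto
        finally show ?thesis by (simp add: B_def algebra_simps)
      qed
      have 3: "norm (Z y s - Z a s) \<le> 2 * (B * norm (y - a))" if "s \<in> T" for s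
        using Z_diff_le[OF a yW that] 2 by linarith
      have 4: "2 * (B * norm (y - a)) < \<delta>"
      proof -
        have "norm (y - a) < \<delta> / (2 * B)" using y by (simp add: d'_def)
        then show ?thesis using B by (simp add: field_simps)
      qed
      have "norm (Z y t - Z a t - \<Xi> a (y - a) t) \<le> 2 * norm (Z y t0 - Z a t0 - \<Xi> a (y - a) t0) + 2 * (\<eta> * (2 * (B * norm (y - a))))"
      proof (rule gron[OF t, where u' = "\<lambda>t. f (Z y t) - f (Z a t) - f' (Z a t) (\<Xi> a (y - a) t)"])
        fix s assume s: "s \<in> T"
        show "((\<lambda>t. Z y t - Z a t - \<Xi> a (y - a) t) has_vector_derivative f (Z y s) - f (Z a s) - f' (Z a s) (\<Xi> a (y - a) s)) (at s)"
          by (intro has_vector_derivative_diff Z_deriv \<Xi> a yW s)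
        have "norm (f (Z y s) - f (Z a s) - f' (Z a s) (Z y s - Z a s)) \<le> \<eta> * norm (Z y s - Z a s)"
          using \<delta>(2)[OF Z_K[OF a s]] 3[OF s] 4 by (intro f_linearization[where \<delta> = \<delta>] Z_K a yW s) auto
        also have "\<dots> \<le> \<eta> * (2 * (B * norm (y - a)))" using 3[OF s] \<eta> by (intro mult_left_mono) auto
        finally have 5: "norm (f (Z y s) - f (Z a s) - f' (Z a s) (Z y s - Z a s)) \<le> \<eta> * (2 * (B * norm (y - a)))" .
        have "f (Z y s) - f (Z a s) - f' (Z a s) (\<Xi> a (y - a) s) =
            f' (Z a s) (Z y s - Z a s - \<Xi> a (y - a) s) + (f (Z y s) - f (Z a s) - f' (Z a s) (Z y s - Z a s))"
          by (simp add: blinfun.diff_right)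
        then have "norm (f (Z y s) - f (Z a s) - f' (Z a s) (\<Xi> a (y - a) s)) \<le>
            norm (f' (Z a s) (Z y s - Z a s - \<Xi> a (y - a) s)) + norm (f (Z y s) - f (Z a s) - f' (Z a s) (Z y s - Z a s))"
          by (metis norm_triangle_ineq)
        then show "norm (f (Z y s) - f (Z a s) - f' (Z a s) (\<Xi> a (y - a) s)) \<le>
            L * norm (Z y s - Z a s - \<Xi> a (y - a) s) + \<eta> * (2 * (B * norm (y - a)))"
          using f'_apply_le[OF Z_K[OF a s], of "Z y s - Z a s - \<Xi> a (y - a) s"] 5 by linarith
      qed (use \<eta> B in auto)
      also have "\<dots> \<le> 2 * (e' * norm (y - a)) + e / 2 * norm (y - a)"
        using 1 B by (simp add: \<Xi>0[OF a] \<eta>_def)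
      also have "\<dots> \<le> e * norm (y - a)"
        using mult_right_mono[OF e'(3) norm_ge_zero[of "y - a"]] by (simp add: algebra_simps)
      finally show ?thesis by (simp add: X[OF a t])
    qed
    ultimately show "\<exists>d>0. \<forall>y. norm (y - a) < d \<longrightarrow> norm (Z y t - Z a t - X t a (y - a)) \<le> e * norm (y - a)" by blast
  qed
  have cont: "continuous_on W (X t)" if t: "t \<in> T" for t
    unfolding continuous_on_iff
  proof (intro ballI allI impI)
    fix a and e :: real assume a: "a \<in> W" and e: "e > 0"
    define B where "B = norm (X0 a) + 1"
    have B: "B \<ge> 1" by (simp add: B_def)
    \<comment> \<open>Here Gronwall gives
      \<open>2 * (e / 8) + 2 * (\<eta> * (2 * B)) = e / 2\<close>, which is strictly below
      \<open>e\<close>.\<close>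
    define \<eta> where "\<eta> = e / (16 * B)"
    have \<eta>: "\<eta> > 0" using e B by (simp add: \<eta>_def)
    obtain \<delta> where \<delta>: "\<delta> > 0" "\<And>z z'. z \<in> K \<Longrightarrow> z' \<in> K \<Longrightarrow> norm (z' - z) < \<delta> \<Longrightarrow> norm (f' z' - f' z) \<le> \<eta>"
      using f'_uniform[OF \<eta>] by blast
    have "continuous (at a) (\<lambda>a. Z a t0)" using X0(1)[OF a] by (rule has_derivative_continuous)
    then obtain d1 where d1: "d1 > 0" "\<And>y. dist y a < d1 \<Longrightarrow> dist (Z y t0) (Z a t0) < \<delta> / 2"
      unfolding continuous_at_eps_delta using \<delta>(1) by (meson half_gt_zero)
    obtain d2 where d2: "d2 > 0" "\<And>y. y \<in> W \<Longrightarrow> dist y a < d2 \<Longrightarrow> dist (X0 y) (X0 a) < e / 8"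
      using X0(2)[unfolded continuous_on_iff, rule_format, OF a, of "e / 8"] e by auto
    have "dist (X t y) (X t a) < e" if y: "y \<in> W" "dist y a < min d1 d2" for y
    proof -
      have "norm (X t y - X t a) \<le> e / 2"
      proof (rule norm_blinfun_bound)
        fix b
        have "norm (\<Xi> y b t - \<Xi> a b t) \<le> 2 * norm (\<Xi> y b t0 - \<Xi> a b t0) + 2 * (\<eta> * (2 * B * norm b))"
        proof (rule gron[OF t, where u' = "\<lambda>t. f' (Z y t) (\<Xi> y b t) - f' (Z a t) (\<Xi> a b t)"])
          fix s assume s: "s \<in> T"
          show "((\<lambda>t. \<Xi> y b t - \<Xi> a b t) has_vector_derivative f' (Z y s) (\<Xi> y b s) - f' (Z a s) (\<Xi> a b s)) (at s)"
            by (intro has_vector_derivative_diff \<Xi> a y s)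
          have "norm (Z y s - Z a s) < \<delta>"
            using Z_diff_le[OF a y(1) s] d1(2)[of y] y by (simp add: dist_norm)
          then have "norm (f' (Z y s) - f' (Z a s)) \<le> \<eta>" by (intro \<delta>(2) Z_K a y s)
          then have "norm ((f' (Z y s) - f' (Z a s)) (\<Xi> a b s)) \<le> \<eta> * (2 * B * norm b)"
          proof -
            have "norm (\<Xi> a b s) \<le> 2 * B * norm b"
              using \<Xi>_le[OF a s, of b] mult_right_mono[of "2 * norm (X0 a)" "2 * B" "norm b"] by (simp add: B_def)
            then show ?thesis
              using norm_blinfun[of "f' (Z y s) - f' (Z a s)" "\<Xi> a b s"] \<open>norm (f' (Z y s) - f' (Z a s)) \<le> \<eta>\<close> \<eta>
              by (meson mult_mono norm_ge_zero order_trans less_imp_le)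
          qed
          moreover have "f' (Z y s) (\<Xi> y b s) - f' (Z a s) (\<Xi> a b s) =
              f' (Z y s) (\<Xi> y b s - \<Xi> a b s) + (f' (Z y s) - f' (Z a s)) (\<Xi> a b s)"
            by (simp add: blinfun.diff_right blinfun.diff_left)
          moreover have "norm (f' (Z y s) (\<Xi> y b s - \<Xi> a b s)) \<le> L * norm (\<Xi> y b s - \<Xi> a b s)"
            by (intro f'_apply_le Z_K y s)
          ultimately show "norm (f' (Z y s) (\<Xi> y b s) - f' (Z a s) (\<Xi> a b s)) \<le> L * norm (\<Xi> y b s - \<Xi> a b s) + \<eta> * (2 * B * norm b)"
            using norm_triangle_ineq[of "f' (Z y s) (\<Xi> y b s - \<Xi> a b s)" "(f' (Z y s) - f' (Z a s)) (\<Xi> a b s)"] by simp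
        qed (use \<eta> B in auto)
        also have "2 * (\<eta> * (2 * B * norm b)) = e / 4 * norm b" using B by (simp add: \<eta>_def)
        also have "norm (\<Xi> y b t0 - \<Xi> a b t0) \<le> e / 8 * norm b"
        proof -
          have "norm ((X0 y - X0 a) b) \<le> norm (X0 y - X0 a) * norm b" by (rule norm_blinfun)
          also have "\<dots> \<le> e / 8 * norm b" using d2(2)[OF y(1)] y(2) by (intro mult_right_mono) (auto simp: dist_norm)
          finally show ?thesis by (simp add: \<Xi>0 a y blinfun.diff_left)
        qed
        finally show "norm ((X t y - X t a) b) \<le> e / 2 * norm b"
          by (simp add: X a y t blinfun.diff_left)
      qed (use e in auto)
      then show ?thesis using e by (simp add: dist_norm)
    qed
    then show "\<exists>d>0. \<forall>y\<in>W. dist y a < d \<longrightarrow> dist (X t y) (X t a) < e"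
      using d1(1) d2(1) by (intro exI[of _ "min d1 d2"]) auto
  qed
  have "((\<lambda>t. X t a b) has_vector_derivative f' (Z a t) (X t a b)) (at t)" if a: "a \<in> W" and t: "t \<in> T" for a b t
    using has_vector_derivative_transform_within_open[OF \<Xi>[OF a t] T(1) t, of b "\<lambda>t. X t a b"] X[OF a]
    by (simp add: t)
  then show ?thesis using frechet cont by (intro exI[of _ X]) auto
qed

end

section \<open>Smooth families of bilinear maps\<close>

text \<open>Reduces continuity and differentiability of a family of bilinear maps to that of its
  coefficients \<open>f i j\<close>.\<close>

lemma bilinear_expand:
  fixes f :: "'a::euclidean_space \<Rightarrow> 'b::euclidean_space \<Rightarrow> 'c::real_normed_vector"
  assumes "bilinear f"
  shows "f u v = (\<Sum>i\<in>Basis. \<Sum>j\<in>Basis. ((u \<bullet> i) * (v \<bullet> j)) *\<^sub>R f i j)"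
proof -
  have lin: "linear (\<lambda>u. f u v)" for v using assms by (simp add: bilinear_def)
  have lin': "linear (\<lambda>v. f u v)" for u using assms by (simp add: bilinear_def)
  have "f u v = f (\<Sum>i\<in>Basis. (u \<bullet> i) *\<^sub>R i) v" by (simp add: euclidean_representation)
  also have "\<dots> = (\<Sum>i\<in>Basis. (u \<bullet> i) *\<^sub>R f i v)"
    using linear_sum[OF lin, of "\<lambda>i. (u \<bullet> i) *\<^sub>R i" Basis] linear_cmul[OF lin] by simp
  also have "\<dots> = (\<Sum>i\<in>Basis. \<Sum>j\<in>Basis. ((u \<bullet> i) * (v \<bullet> j)) *\<^sub>R f i j)"
  proof (rule sum.cong[OF refl])
    fix i :: 'a
    have "f i v = f i (\<Sum>j\<in>Basis. (v \<bullet> j) *\<^sub>R j)" by (simp add: euclidean_representation)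
    also have "\<dots> = (\<Sum>j\<in>Basis. (v \<bullet> j) *\<^sub>R f i j)"
      using linear_sum[OF lin', of i "\<lambda>j. (v \<bullet> j) *\<^sub>R j" Basis] linear_cmul[OF lin'] by simp
    finally show "(u \<bullet> i) *\<^sub>R f i v = (\<Sum>j\<in>Basis. ((u \<bullet> i) * (v \<bullet> j)) *\<^sub>R f i j)"
      by (simp add: scaleR_sum_right)
  qed
  finally show ?thesis .
qed

lemma bilinear_family_continuous:
  fixes B :: "'v \<Rightarrow> 'a::euclidean_space \<Rightarrow> 'b::euclidean_space \<Rightarrow> 'c::real_normed_vector"
  assumes bil: "\<And>p. p \<in> S \<Longrightarrow> bilinear (B (x p))"
    and cont: "\<And>i j. continuous_on S (\<lambda>p. B (x p) i j)"
    and uv: "continuous_on S u" "continuous_on S v"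
  shows "continuous_on S (\<lambda>p. B (x p) (u p) (v p))"
proof -
  have "continuous_on S (\<lambda>p. \<Sum>i\<in>Basis. \<Sum>j\<in>Basis. ((u p \<bullet> i) * (v p \<bullet> j)) *\<^sub>R B (x p) i j)"
    by (intro continuous_intros uv cont)
  then show ?thesis by (rule continuous_on_eq) (simp add: bil bilinear_expand[symmetric])
qed

lemma linear_derivative:
  fixes B :: "'v::real_normed_vector \<Rightarrow> 'a::real_vector \<Rightarrow> 'c::real_normed_vector"
  assumes V: "open V" "y0 \<in> V" and bil: "\<And>y. y \<in> V \<Longrightarrow> linear (B y)"
    and der: "\<And>u. ((\<lambda>y. B y u) has_derivative B' u) (at y0)"
  shows "linear (\<lambda>u. B' u h)"
proof (rule linearI)
  fix a b :: 'a and r :: real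
  have "((\<lambda>y. B y (a + b)) has_derivative (\<lambda>h. B' a h + B' b h)) (at y0)"
    by (rule has_derivative_transform_within_open[OF has_derivative_add[OF der der] V])
      (use bil in \<open>simp add: linear_add\<close>)
  from has_derivative_unique[OF this der] show "B' (a + b) h = B' a h + B' b h" by metis
  have "((\<lambda>y. B y (r *\<^sub>R a)) has_derivative (\<lambda>h. r *\<^sub>R B' a h)) (at y0)"
    by (rule has_derivative_transform_within_open[OF has_derivative_scaleR_right[OF der] V])
      (use bil in \<open>simp add: linear_cmul\<close>)
  from has_derivative_unique[OF this der] show "B' (r *\<^sub>R a) h = r *\<^sub>R B' a h" by metis
qed

lemma bilinear_derivative:
  fixes B :: "'v::real_normed_vector \<Rightarrow> 'a::real_vector \<Rightarrow> 'b::real_vector \<Rightarrow> 'c::real_normed_vector"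
  assumes V: "open V" "y0 \<in> V" and bil: "\<And>y. y \<in> V \<Longrightarrow> bilinear (B y)"
    and der: "\<And>u v. ((\<lambda>y. B y u v) has_derivative B' u v) (at y0)"
  shows "bilinear (\<lambda>u v. B' u v h)"
  unfolding bilinear_def
proof (intro conjI allI)
  show "linear (\<lambda>v. B' u v h)" for u
    by (rule linear_derivative[OF V _ der]) (use bil in \<open>auto simp: bilinear_def\<close>)
  show "linear (\<lambda>u. B' u v h)" for v
    by (rule linear_derivative[OF V _ der]) (use bil in \<open>auto simp: bilinear_def\<close>)
qed

lemma bilinear_family_derivative:
  fixes B :: "'v::real_normed_vector \<Rightarrow> 'a::euclidean_space \<Rightarrow> 'b::euclidean_space \<Rightarrow> 'c::real_normed_vector"
    and x :: "'p::real_normed_vector \<Rightarrow> 'v"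
  assumes V: "open V" "x p \<in> V" and bil: "\<And>y. y \<in> V \<Longrightarrow> bilinear (B y)"
    and der: "\<And>u v. ((\<lambda>y. B y u v) has_derivative B' u v) (at (x p))"
    and x: "(x has_derivative x') (at p)" and u: "(u has_derivative u') (at p)" and v: "(v has_derivative v') (at p)"
  shows "((\<lambda>p. B (x p) (u p) (v p)) has_derivative
    (\<lambda>h. B' (u p) (v p) (x' h) + B (x p) (u' h) (v p) + B (x p) (u p) (v' h))) (at p)"
proof -
  have bilB: "bilinear (B (x p))" using bil V by auto
  have bilB': "bilinear (\<lambda>u v. B' u v h)" for h by (rule bilinear_derivative[OF V bil der])
  obtain O' where O': "open O'" "p \<in> O'" "\<And>q. q \<in> O' \<Longrightarrow> x q \<in> V"
  proof -
    have "isCont x p" using x by (rule has_derivative_continuous)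
    then have "eventually (\<lambda>q. x q \<in> V) (nhds p)"
      using V by (auto simp: continuous_at_open eventually_nhds)
    then show thesis using that by (auto simp: eventually_nhds)
  qed
  have "((\<lambda>p. \<Sum>i\<in>Basis. \<Sum>j\<in>Basis. ((u p \<bullet> i) * (v p \<bullet> j)) *\<^sub>R B (x p) i j) has_derivative
    (\<lambda>h. \<Sum>i\<in>Basis. \<Sum>j\<in>Basis. ((u p \<bullet> i) * (v p \<bullet> j)) *\<^sub>R B' i j (x' h) +
       ((u p \<bullet> i) * (v' h \<bullet> j) + (u' h \<bullet> i) * (v p \<bullet> j)) *\<^sub>R B (x p) i j)) (at p)"
    by (intro has_derivative_sum has_derivative_scaleR has_derivative_mult has_derivative_inner_left
        u v has_derivative_compose[OF x der, unfolded comp_def])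
  also have "(\<lambda>h. \<Sum>i\<in>Basis. \<Sum>j\<in>Basis. ((u p \<bullet> i) * (v p \<bullet> j)) *\<^sub>R B' i j (x' h) +
       ((u p \<bullet> i) * (v' h \<bullet> j) + (u' h \<bullet> i) * (v p \<bullet> j)) *\<^sub>R B (x p) i j) =
    (\<lambda>h. B' (u p) (v p) (x' h) + B (x p) (u' h) (v p) + B (x p) (u p) (v' h))"
    by (simp add: bilinear_expand[OF bilB', of "u p"] bilinear_expand[OF bilB, of _ "v p"]
        bilinear_expand[OF bilB, of "u p"] sum.distrib scaleR_add_left fun_eq_iff)
  finally show ?thesis
    by (rule has_derivative_transform_within_open[OF _ O'(1,2)])
      (use O'(3) bil in \<open>simp add: bilinear_expand[symmetric]\<close>)
qed

section \<open>Riemannian metrics on open subsets of Euclidean space\<close>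

locale metric_chart =
  fixes V :: "'e::euclidean_space set" and g :: "'e \<Rightarrow> 'e \<Rightarrow> 'e \<Rightarrow> real"
  assumes V: "open V"
    and g_sym: "\<And>y a b. y \<in> V \<Longrightarrow> g y a b = g y b a"
    and g_lin: "\<And>y a b c r. y \<in> V \<Longrightarrow> g y (r *\<^sub>R a + b) c = r * g y a c + g y b c"
    and g_pos: "\<And>y a. y \<in> V \<Longrightarrow> a \<noteq> 0 \<Longrightarrow> 0 < g y a a"
    and g_smooth: "\<And>a b. C_on \<infinity> V (\<lambda>y. g y a b)"
begin

definition dg :: "'e \<Rightarrow> 'e \<Rightarrow> 'e \<Rightarrow> 'e \<Rightarrow> real" where
  "dg y u a b = frechet_derivative (\<lambda>z. g z a b) (at y) u"

lemma g_bilinear: "y \<in> V \<Longrightarrow> bilinear (g y)"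
proof -
  assume y: "y \<in> V"
  have 1: "linear (\<lambda>a. g y a b)" for b
  proof (rule linearI)
    have 0: "g y 0 b = 0" using g_lin[OF y, of "-1" 0 0 b] by simp
    show "g y (a + c) b = g y a b + g y c b" for a c using g_lin[OF y, of 1 a c b] by simp
    show "g y (r *\<^sub>R a) b = r *\<^sub>R g y a b" for r a using g_lin[OF y, of r a 0 b] 0 by simp
  qed
  then show ?thesis using g_sym[OF y] by (simp add: bilinear_def)
qed

lemma Ck_g: "Ck_on n V (\<lambda>y. g y a b)"
  using g_smooth[of a b] by (simp add: C_on_def)

lemma g_deriv: "y \<in> V \<Longrightarrow> ((\<lambda>z. g z a b) has_derivative (\<lambda>u. dg y u a b)) (at y)"
  using Ck_g[of 1 a b] by (simp add: dg_def frechet_derivative_works)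

lemma dg_deriv: "y \<in> V \<Longrightarrow> ((\<lambda>z. dg z u a b) has_derivative frechet_derivative (\<lambda>z. dg z u a b) (at y)) (at y)"
  using Ck_g[of 2 a b] unfolding numeral_2_eq_2 by (simp add: dg_def frechet_derivative_works)

lemma ddg_cont: "continuous_on V (\<lambda>y. frechet_derivative (\<lambda>z. dg z u a b) (at y) v)"
  using Ck_g[of 2 a b] unfolding numeral_2_eq_2 by (simp add: dg_def)

lemma dg_cont: "continuous_on V (\<lambda>y. dg y u a b)"
  using dg_deriv[of _ u a b]
  by (intro continuous_at_imp_continuous_on ballI) (blast intro: has_derivative_continuous)

lemma g_cont: "continuous_on V (\<lambda>y. g y a b)"
  using g_deriv[of _ a b]
  by (intro continuous_at_imp_continuous_on ballI) (blast intro: has_derivative_continuous)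

lemma dg_bilinear: "y \<in> V \<Longrightarrow> bilinear (dg y u)"
  using bilinear_derivative[OF V _ g_bilinear g_deriv, of y u] by simp

lemma dg_linear: "y \<in> V \<Longrightarrow> linear (\<lambda>u. dg y u a b)"
  using g_deriv[of y a b] by (simp add: has_derivative_linear)

lemma dg_sym: "y \<in> V \<Longrightarrow> dg y u a b = dg y u b a"
proof -
  assume y: "y \<in> V"
  have "((\<lambda>z. g z b a) has_derivative (\<lambda>u. dg y u a b)) (at y)"
    by (rule has_derivative_transform_within_open[OF g_deriv[OF y] V y]) (rule g_sym)
  from has_derivative_unique[OF this g_deriv[OF y]] show ?thesis by metis
qed

lemma g_cauchy_schwarz: "y \<in> V \<Longrightarrow> (g y a b)\<^sup>2 \<le> g y a a * g y b b"
  and g_cauchy_schwarz_strict: "y \<in> V \<Longrightarrow> a \<noteq> 0 \<Longrightarrow> (\<And>c. b \<noteq> c *\<^sub>R a) \<Longrightarrow> (g y a b)\<^sup>2 < g y a a * g y b b"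
proof -
  assume y: "y \<in> V"
  note bl = g_bilinear[OF y]
  \<comment> \<open>The Gram determinant is \<open>g y a a\<close> times the squared length of the
    component of \<open>b\<close> orthogonal to \<open>a\<close>.\<close>
  have *: "g y (b - c *\<^sub>R a) (b - c *\<^sub>R a) * g y a a = g y a a * g y b b - (g y a b)\<^sup>2"
    if a: "a \<noteq> 0" and c: "c = g y a b / g y a a" for a b c
  proof -
    have "g y a a > 0" using g_pos y a by auto
    then have "c * g y a a = g y a b" using c by simp
    moreover have "g y (b - c *\<^sub>R a) (b - c *\<^sub>R a) = g y b b - 2 * c * g y a b + c * (c * g y a a)"
      using bl by (simp add: bilinear_lsub bilinear_rsub bilinear_lmul bilinear_rmul g_sym[OF y, of b a])
    ultimately have "g y (b - c *\<^sub>R a) (b - c *\<^sub>R a) * g y a a = (g y b b - c * g y a b) * g y a a" by simp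
    also have "\<dots> = g y b b * g y a a - (c * g y a a) * g y a b" by (simp add: algebra_simps)
    finally show ?thesis using \<open>c * g y a a = g y a b\<close> by (simp add: power2_eq_square mult.commute)
  qed
  have nn: "0 \<le> g y a a" for a using g_pos[OF y, of a] bilinear_lzero[OF bl, of 0] by (cases "a = 0") auto
  show "(g y a b)\<^sup>2 \<le> g y a a * g y b b"
  proof (cases "a = 0")
    case True then show ?thesis using bilinear_lzero[OF bl] by simp
  next
    case False
    have "0 \<le> g y a a * g y b b - (g y a b)\<^sup>2" unfolding *[OF False refl, symmetric] by (intro mult_nonneg_nonneg nn)
    then show ?thesis by simp
  qed
  assume a: "a \<noteq> 0" and b: "\<And>c. b \<noteq> c *\<^sub>R a"
  have "0 < g y a a * g y b b - (g y a b)\<^sup>2"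
    unfolding *[OF a refl, symmetric] using b by (intro mult_pos_pos g_pos y a) simp
  then show "(g y a b)\<^sup>2 < g y a a * g y b b" by simp
qed

lemma g_nonneg: "y \<in> V \<Longrightarrow> 0 \<le> g y a a"
  using g_pos[of y a] bilinear_lzero[OF g_bilinear, of y 0] by (cases "a = 0") auto

text \<open>The operator that represents \<open>g y\<close> with respect to the Euclidean inner
  product. Its inverse \<open>sol\<close> raises an index, which solves the Koszul formula.\<close>

definition gram :: "'e \<Rightarrow> 'e \<Rightarrow> 'e" where
  "gram y w = (\<Sum>i\<in>Basis. g y w i *\<^sub>R i)"

definition sol :: "'e \<Rightarrow> 'e \<Rightarrow> 'e" where
  "sol y l = inv (gram y) l"

lemma linear_functional_inner:
  fixes l :: "'a::euclidean_space \<Rightarrow> real"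
  assumes "linear l"
  shows "(\<Sum>i\<in>Basis. l i *\<^sub>R i) \<bullet> z = l z"
proof -
  have "(\<Sum>i\<in>Basis. l i *\<^sub>R i) \<bullet> z = (\<Sum>i\<in>Basis. (z \<bullet> i) * l i)"
    by (simp add: inner_commute[of _ z] inner_sum_right mult.commute)
  also have "\<dots> = l (\<Sum>i\<in>Basis. (z \<bullet> i) *\<^sub>R i)"
    using linear_sum[OF assms, of "\<lambda>i. (z \<bullet> i) *\<^sub>R i" Basis] linear_cmul[OF assms] by simp
  finally show ?thesis by (simp add: euclidean_representation)
qed

lemma gram_inner: "y \<in> V \<Longrightarrow> gram y w \<bullet> z = g y w z"
  unfolding gram_def using g_bilinear[of y] by (intro linear_functional_inner) (simp add: bilinear_def)

lemma gram_linear: "y \<in> V \<Longrightarrow> linear (gram y)"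
  by (intro linearI) (simp_all add: gram_def bilinear_ladd[OF g_bilinear] bilinear_lmul[OF g_bilinear]
      scaleR_add_left sum.distrib scaleR_sum_right)

lemma gram_bij: "y \<in> V \<Longrightarrow> bij (gram y)"
proof -
  assume y: "y \<in> V"
  have "inj (gram y)" unfolding linear_injective_0[OF gram_linear[OF y]]
    using g_pos[OF y] gram_inner[OF y] by (metis inner_zero_left less_irrefl)
  then show ?thesis using linear_injective_imp_surjective[OF gram_linear[OF y]] by (simp add: bij_def)
qed

lemma gram_sol: "y \<in> V \<Longrightarrow> gram y (sol y l) = l"
  by (simp add: sol_def bij_inv_eq_iff[OF gram_bij, symmetric] surj_f_inv_f[OF bij_is_surj[OF gram_bij]])

lemma sol_gram: "y \<in> V \<Longrightarrow> sol y (gram y w) = w"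
  by (simp add: sol_def inv_f_f[OF bij_is_inj[OF gram_bij]])

lemma g_sol: "y \<in> V \<Longrightarrow> g y (sol y l) z = l \<bullet> z"
  by (metis gram_inner gram_sol)

lemma sol_eqI: "y \<in> V \<Longrightarrow> (\<And>z. g y w z = l \<bullet> z) \<Longrightarrow> sol y l = w"
  by (metis gram_inner sol_gram vector_eq_rdot)

lemma sol_linear: "y \<in> V \<Longrightarrow> linear (sol y)"
  by (intro linearI) (auto intro!: sol_eqI simp: bilinear_ladd[OF g_bilinear] bilinear_lmul[OF g_bilinear] g_sol inner_add_left)

text \<open>Carrying the base point along turns the inversion of all the operators
  \<open>gram y\<close> at once into the inversion of a single injective map between open subsets of
  \<open>'e \<times> 'e\<close>.\<close>

definition gF :: "'e \<times> 'e \<Rightarrow> 'e \<times> 'e" where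
  "gF p = (fst p, gram (fst p) (snd p))"

definition gF_inv :: "'e \<times> 'e \<Rightarrow> 'e \<times> 'e" where
  "gF_inv p = (fst p, sol (fst p) (snd p))"

definition dgram :: "'e \<Rightarrow> 'e \<Rightarrow> 'e \<Rightarrow> 'e" where
  "dgram y h w = (\<Sum>i\<in>Basis. dg y h w i *\<^sub>R i)"

lemma dgram_linear: "y \<in> V \<Longrightarrow> linear (\<lambda>h. dgram y h w)"
  by (intro linearI) (simp_all add: dgram_def linear_add[OF dg_linear] linear_cmul[OF dg_linear]
      scaleR_add_left sum.distrib scaleR_sum_right)

lemma g_family_deriv:
  assumes "x p \<in> V" "(x has_derivative x') (at p)" "(u has_derivative u') (at p)" "(v has_derivative v') (at p)"
  shows "((\<lambda>p. g (x p) (u p) (v p)) has_derivative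
    (\<lambda>h. dg (x p) (x' h) (u p) (v p) + g (x p) (u' h) (v p) + g (x p) (u p) (v' h))) (at p)"
  by (rule bilinear_family_derivative[where B = g and V = V and B' = "\<lambda>u v h. dg (x p) h u v"])
    (use V assms g_bilinear g_deriv in auto)

lemma gram_deriv:
  assumes "fst p \<in> V"
  shows "((\<lambda>p. gram (fst p) (snd p)) has_derivative (\<lambda>h. dgram (fst p) (fst h) (snd p) + gram (fst p) (snd h))) (at p)"
proof -
  have "((\<lambda>p. g (fst p) (snd p) i) has_derivative
      (\<lambda>h. dg (fst p) (fst h) (snd p) i + g (fst p) (snd h) i + g (fst p) (snd p) 0)) (at p)" for i
    using assms by (intro g_family_deriv has_derivative_fst has_derivative_snd has_derivative_ident has_derivative_const)
  moreover have "g (fst p) (snd p) 0 = 0" using bilinear_rzero[OF g_bilinear[OF assms]] .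
  ultimately have *: "((\<lambda>p. g (fst p) (snd p) i) has_derivative
      (\<lambda>h. dg (fst p) (fst h) (snd p) i + g (fst p) (snd h) i)) (at p)" for i by simp
  have "((\<lambda>p. \<Sum>i\<in>Basis. g (fst p) (snd p) i *\<^sub>R i) has_derivative
      (\<lambda>h. \<Sum>i\<in>Basis. (dg (fst p) (fst h) (snd p) i + g (fst p) (snd h) i) *\<^sub>R i)) (at p)"
    by (intro has_derivative_sum has_derivative_scaleR_left *)
  then show ?thesis by (simp add: gram_def dgram_def scaleR_add_left sum.distrib)
qed

lemma gF_image: "gF ` (V \<times> UNIV) = V \<times> UNIV"
proof (intro equalityI subsetI)
  fix p :: "'e \<times> 'e" assume "p \<in> V \<times> UNIV"
  then show "p \<in> gF ` (V \<times> UNIV)"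
    by (intro image_eqI[of _ _ "gF_inv p"]) (auto simp: gF_def gF_inv_def gram_sol)
qed (auto simp: gF_def)

text \<open>Invariance of domain makes the solution of the linear system continuous in its coefficients.\<close>

lemma gF_inv_cont: "continuous_on (V \<times> UNIV) gF_inv"
proof -
  have cont: "continuous_on (V \<times> UNIV) gF" unfolding gF_def
    by (intro continuous_intros continuous_at_imp_continuous_on ballI)
      (auto intro!: has_derivative_continuous[OF gram_deriv])
  have "inj_on gF (V \<times> UNIV)"
    by (rule inj_on_inverseI[of _ gF_inv]) (auto simp: gF_def gF_inv_def sol_gram)
  then obtain k where k: "homeomorphism (V \<times> UNIV) (gF ` (V \<times> UNIV)) gF k"
    using invariance_of_domain_homeomorphism[OF open_Times[OF V open_UNIV] cont] by auto
  have "k p = gF_inv p" if "p \<in> V \<times> UNIV" for p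
  proof -
    have "gF (gF_inv p) = p" "gF_inv p \<in> V \<times> UNIV" using that by (auto simp: gF_def gF_inv_def gram_sol)
    then show ?thesis using k by (metis homeomorphism_apply1)
  qed
  moreover have "continuous_on (V \<times> UNIV) k" using k gF_image by (simp add: homeomorphism_def)
  ultimately show ?thesis by (metis continuous_on_eq)
qed

lemma sol_cont:
  assumes "continuous_on S x" "x ` S \<subseteq> V" "continuous_on S l"
  shows "continuous_on S (\<lambda>p. sol (x p) (l p))"
proof -
  have "continuous_on S (\<lambda>p. snd (gF_inv (x p, l p)))"
    using assms by (intro continuous_on_snd continuous_on_compose2[OF gF_inv_cont] continuous_on_Pair) auto
  then show ?thesis by (simp add: gF_inv_def)
qed

text \<open>The formula results from differentiating \<open>gram y (sol y (k y)) = k y\<close>. That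
  there is a derivative at all follows from the inverse rule for \<open>gF\<close>, whose inverse is
  already known to be continuous.\<close>

lemma sol_deriv:
  assumes y: "y \<in> V" and k: "(k has_derivative k') (at y)"
  shows "((\<lambda>y. sol y (k y)) has_derivative (\<lambda>h. sol y (k' h - dgram y h (sol y (k y))))) (at y)"
proof -
  define p where "p = (y, k y)"
  define F' where "F' h = (fst h, dgram y (fst h) (sol y (k y)) + gram y (snd h))" for h :: "'e \<times> 'e"
  define G' where "G' h = (fst h, sol y (snd h - dgram y (fst h) (sol y (k y))))" for h :: "'e \<times> 'e"
  have "(gF_inv has_derivative G') (at p)"
  proof (rule has_derivative_inverse_basic[where f = gF and f' = F' and T = "V \<times> UNIV"])
    show "(gF has_derivative F') (at (gF_inv p))"
      unfolding gF_def F'_def using gram_deriv[of "gF_inv p"] y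
      by (intro has_derivative_Pair) (auto simp: gF_inv_def p_def intro!: derivative_eq_intros)
    have 1: "bounded_linear (sol y)" using sol_linear[OF y] by (simp add: linear_conv_bounded_linear)
    have 2: "bounded_linear (\<lambda>h. dgram y h (sol y (k y)))"
      using dgram_linear[OF y] by (simp add: linear_conv_bounded_linear)
    show "bounded_linear G'" unfolding G'_def
      by (rule bounded_linear_Pair[OF bounded_linear_fst bounded_linear_compose[OF 1
            bounded_linear_sub[OF bounded_linear_snd bounded_linear_compose[OF 2 bounded_linear_fst]]]])
    show "G' \<circ> F' = id" using y by (auto simp: fun_eq_iff F'_def G'_def sol_gram)
    show "continuous (at p) gF_inv"
      using gF_inv_cont y V by (simp add: continuous_on_eq_continuous_at open_Times p_def)
    show "gF (gF_inv z) = z" if "z \<in> V \<times> UNIV" for z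
      using that by (auto simp: gF_def gF_inv_def gram_sol)
  qed (use V y in \<open>auto simp: open_Times p_def\<close>)
  then have "((\<lambda>y. snd (gF_inv (y, k y))) has_derivative (\<lambda>h. snd (G' (h, k' h)))) (at y)"
    using has_derivative_compose[OF has_derivative_Pair[OF has_derivative_ident k], of gF_inv G']
    by (intro has_derivative_snd) (simp add: p_def)
  then show ?thesis by (simp add: gF_inv_def G'_def)
qed

subsection \<open>The Levi-Civita connection\<close>

definition koszul :: "'e \<Rightarrow> 'e \<Rightarrow> 'e \<Rightarrow> 'e" where
  "koszul u v y = (\<Sum>i\<in>Basis. ((dg y u v i + dg y v u i - dg y i u v) / 2) *\<^sub>R i)"

definition Gam :: "'e \<Rightarrow> 'e \<Rightarrow> 'e \<Rightarrow> 'e" where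
  "Gam y u v = sol y (koszul u v y)"

definition dGam :: "'e \<Rightarrow> 'e \<Rightarrow> 'e \<Rightarrow> 'e \<Rightarrow> 'e" where
  "dGam y h u v = frechet_derivative (\<lambda>z. Gam z u v) (at y) h"

lemma koszul_inner: "y \<in> V \<Longrightarrow> koszul u v y \<bullet> z = (dg y u v z + dg y v u z - dg y z u v) / 2"
  unfolding koszul_def
  by (intro linear_functional_inner linearI) (simp_all add: bilinear_radd[OF dg_bilinear] bilinear_rmul[OF dg_bilinear]
      linear_add[OF dg_linear] linear_cmul[OF dg_linear] algebra_simps add_divide_distrib diff_divide_distrib)

lemma Gam_koszul: "y \<in> V \<Longrightarrow> 2 * g y (Gam y u v) z = dg y u v z + dg y v u z - dg y z u v"
  by (simp add: Gam_def g_sol koszul_inner)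

lemma Gam_unique:
  "y \<in> V \<Longrightarrow> (\<And>z. 2 * g y w z = dg y u v z + dg y v u z - dg y z u v) \<Longrightarrow> w = Gam y u v"
proof -
  assume y: "y \<in> V" and w: "\<And>z. 2 * g y w z = dg y u v z + dg y v u z - dg y z u v"
  show ?thesis unfolding Gam_def
  proof (rule sol_eqI[OF y, symmetric])
    show "g y w z = koszul u v y \<bullet> z" for z using w[of z] koszul_inner[OF y, of u v z] by simp
  qed
qed

lemma Gam_THE:
  "y \<in> V \<Longrightarrow> (THE w. \<forall>z. 2 * g y w z = dg y u v z + dg y v u z - dg y z u v) = Gam y u v"
  by (rule the_equality) (auto simp: Gam_koszul intro: Gam_unique)

lemma Gam_sym: "y \<in> V \<Longrightarrow> Gam y u v = Gam y v u"
  by (rule Gam_unique) (auto simp: Gam_koszul dg_sym)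

lemma Gam_bilinear: "y \<in> V \<Longrightarrow> bilinear (Gam y)"
proof -
  assume y: "y \<in> V"
  have "linear (\<lambda>u. Gam y u v)" for v
  proof (rule linearI)
    show "Gam y (a + b) v = Gam y a v + Gam y b v" for a b
      using Gam_koszul[OF y]
      by (intro Gam_unique[symmetric] y) (simp add: bilinear_ladd[OF g_bilinear[OF y]] bilinear_ladd[OF dg_bilinear[OF y]]
          bilinear_radd[OF dg_bilinear[OF y]] linear_add[OF dg_linear[OF y]] algebra_simps)
    show "Gam y (r *\<^sub>R a) v = r *\<^sub>R Gam y a v" for r a
    proof (intro Gam_unique[symmetric] y)
      fix z
      have "2 * g y (r *\<^sub>R Gam y a v) z = r * (2 * g y (Gam y a v) z)"
        by (simp add: bilinear_lmul[OF g_bilinear[OF y]])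
      then show "2 * g y (r *\<^sub>R Gam y a v) z = dg y (r *\<^sub>R a) v z + dg y v (r *\<^sub>R a) z - dg y z (r *\<^sub>R a) v"
        using Gam_koszul[OF y, of a v z]
        by (simp add: bilinear_lmul[OF dg_bilinear[OF y]] bilinear_rmul[OF dg_bilinear[OF y]] linear_cmul[OF dg_linear[OF y]] algebra_simps)
    qed
  qed
  then show ?thesis using Gam_sym[OF y] by (simp add: bilinear_def)
qed

text \<open>The explicit form is what makes \<open>dGam\<close> continuous in \<open>y\<close>: it
  is composed of \<open>sol\<close>, \<open>Gam\<close> and first and second derivatives of the
  metric.\<close>

lemma Gam_deriv': "y \<in> V \<Longrightarrow> ((\<lambda>z. Gam z u v) has_derivative (\<lambda>h. sol y
    ((\<Sum>i\<in>Basis. ((frechet_derivative (\<lambda>z. dg z u v i) (at y) h + frechet_derivative (\<lambda>z. dg z v u i) (at y) h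
       - frechet_derivative (\<lambda>z. dg z i u v) (at y) h) / 2) *\<^sub>R i) - dgram y h (Gam y u v)))) (at y)"
  unfolding Gam_def
proof (rule sol_deriv)
  assume y: "y \<in> V"
  show "(koszul u v has_derivative (\<lambda>h. \<Sum>i\<in>Basis. ((frechet_derivative (\<lambda>z. dg z u v i) (at y) h + frechet_derivative (\<lambda>z. dg z v u i) (at y) h
       - frechet_derivative (\<lambda>z. dg z i u v) (at y) h) / 2) *\<^sub>R i)) (at y)"
    unfolding koszul_def divide_inverse
    by (intro has_derivative_sum has_derivative_scaleR_left has_derivative_mult_left has_derivative_add has_derivative_diff dg_deriv y)
qed

lemma Gam_deriv: "y \<in> V \<Longrightarrow> ((\<lambda>z. Gam z u v) has_derivative (\<lambda>h. dGam y h u v)) (at y)"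
  unfolding dGam_def by (rule frechet_derivative_works[THEN iffD1, OF differentiableI[OF Gam_deriv']])

lemma Gam_cont: "continuous_on V (\<lambda>y. Gam y u v)"
  using Gam_deriv[of _ u v]
  by (intro continuous_at_imp_continuous_on ballI) (blast intro: has_derivative_continuous)

lemma dGam_cont: "continuous_on V (\<lambda>y. dGam y h u v)"
proof -
  have "continuous_on V (\<lambda>y. sol y
    ((\<Sum>i\<in>Basis. ((frechet_derivative (\<lambda>z. dg z u v i) (at y) h + frechet_derivative (\<lambda>z. dg z v u i) (at y) h
       - frechet_derivative (\<lambda>z. dg z i u v) (at y) h) / 2) *\<^sub>R i) - dgram y h (Gam y u v)))"
  proof (rule sol_cont)
    have "continuous_on V (\<lambda>y. dg y h (Gam y u v) i)" for i
      by (rule bilinear_family_continuous[where x = "\<lambda>y. y" and B = "\<lambda>y. dg y h"])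
        (auto intro: dg_bilinear dg_cont Gam_cont continuous_on_const)
    then have "continuous_on V (\<lambda>y. dgram y h (Gam y u v))" unfolding dgram_def
      by (intro continuous_on_sum continuous_on_scaleR continuous_on_const)
    then show "continuous_on V (\<lambda>y. (\<Sum>i\<in>Basis. ((frechet_derivative (\<lambda>z. dg z u v i) (at y) h + frechet_derivative (\<lambda>z. dg z v u i) (at y) h
       - frechet_derivative (\<lambda>z. dg z i u v) (at y) h) / 2) *\<^sub>R i) - dgram y h (Gam y u v))"
      unfolding divide_inverse
      by (intro continuous_on_diff continuous_on_sum continuous_on_scaleR continuous_on_const continuous_on_mult
          continuous_on_add ddg_cont)
  qed (auto intro: continuous_on_id)
  then show ?thesis
  proof (rule continuous_on_eq)
    fix y assume "y \<in> V"
    then show "sol y ((\<Sum>i\<in>Basis. ((frechet_derivative (\<lambda>z. dg z u v i) (at y) h + frechet_derivative (\<lambda>z. dg z v u i) (at y) h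
       - frechet_derivative (\<lambda>z. dg z i u v) (at y) h) / 2) *\<^sub>R i) - dgram y h (Gam y u v)) = dGam y h u v"
      using fun_cong[OF has_derivative_unique[OF Gam_deriv' Gam_deriv], of y u v h] by simp
  qed
qed

lemma dGam_bilinear: "y \<in> V \<Longrightarrow> bilinear (dGam y h)"
  using bilinear_derivative[OF V _ Gam_bilinear Gam_deriv, of y h] by simp

lemma dGam_linear: "y \<in> V \<Longrightarrow> linear (\<lambda>h. dGam y h u v)"
  using Gam_deriv[of y u v] by (simp add: has_derivative_linear)

lemma dGam_sym: "y \<in> V \<Longrightarrow> dGam y h u v = dGam y h v u"
proof -
  assume y: "y \<in> V"
  have "((\<lambda>z. Gam z v u) has_derivative (\<lambda>h. dGam y h u v)) (at y)"
    by (rule has_derivative_transform_within_open[OF Gam_deriv[OF y] V y]) (rule Gam_sym)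
  from has_derivative_unique[OF this Gam_deriv[OF y]] show ?thesis by metis
qed

lemma Gam_family_deriv:
  assumes "x p \<in> V" "(x has_derivative x') (at p)" "(u has_derivative u') (at p)" "(v has_derivative v') (at p)"
  shows "((\<lambda>p. Gam (x p) (u p) (v p)) has_derivative
    (\<lambda>h. dGam (x p) (x' h) (u p) (v p) + Gam (x p) (u' h) (v p) + Gam (x p) (u p) (v' h))) (at p)"
  by (rule bilinear_family_derivative[where B = Gam and V = V and B' = "\<lambda>u v h. dGam (x p) h u v"])
    (use V assms Gam_bilinear Gam_deriv in auto)

lemma metric_compatible: "y \<in> V \<Longrightarrow> dg y u a b = g y (Gam y u a) b + g y a (Gam y u b)"
proof -
  assume y: "y \<in> V"
  have "2 * dg y u a b = 2 * g y (Gam y u a) b + 2 * g y (Gam y u b) a"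
    unfolding Gam_koszul[OF y] using dg_sym[OF y] by simp
  then show ?thesis using g_sym[OF y, of a] by simp
qed

text \<open>The covariant derivative along a curve with velocity \<open>x'\<close> is \<open>A' + Gam x x' A\<close>.\<close>

lemma metric_curve_deriv:
  assumes "x t \<in> V" "(x has_vector_derivative x') (at t)"
    "(A has_vector_derivative A') (at t)" "(B has_vector_derivative B') (at t)"
  shows "((\<lambda>t. g (x t) (A t) (B t)) has_real_derivative
    g (x t) (A' + Gam (x t) x' (A t)) (B t) + g (x t) (A t) (B' + Gam (x t) x' (B t))) (at t)"
proof -
  note bl = g_bilinear[OF assms(1)]
  have "((\<lambda>t. g (x t) (A t) (B t)) has_derivative (\<lambda>h. dg (x t) (h *\<^sub>R x') (A t) (B t) +
      g (x t) (h *\<^sub>R A') (B t) + g (x t) (A t) (h *\<^sub>R B'))) (at t)"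
    using assms unfolding has_vector_derivative_def
    by (intro g_family_deriv)
  moreover have "(\<lambda>h. dg (x t) (h *\<^sub>R x') (A t) (B t) + g (x t) (h *\<^sub>R A') (B t) + g (x t) (A t) (h *\<^sub>R B')) =
     (*) (g (x t) (A' + Gam (x t) x' (A t)) (B t) + g (x t) (A t) (B' + Gam (x t) x' (B t)))"
    using linear_cmul[OF dg_linear[OF assms(1)]]
    by (simp add: fun_eq_iff bilinear_lmul[OF bl] bilinear_rmul[OF bl] bilinear_ladd[OF bl] bilinear_radd[OF bl]
        metric_compatible[OF assms(1)] algebra_simps)
  ultimately show ?thesis unfolding has_field_derivative_def by simp
qed

subsection \<open>The geodesic spray\<close>

definition spray :: "'e \<times> 'e \<Rightarrow> 'e \<times> 'e" where
  "spray z = (snd z, - Gam (fst z) (snd z) (snd z))"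

definition dspray :: "'e \<times> 'e \<Rightarrow> ('e \<times> 'e) \<Rightarrow>\<^sub>L ('e \<times> 'e)" where
  "dspray z = Blinfun (\<lambda>h. (snd h, - dGam (fst z) (fst h) (snd z) (snd z) - 2 *\<^sub>R Gam (fst z) (snd z) (snd h)))"

lemma spray_deriv': 
  assumes "fst z \<in> V"
  shows "(spray has_derivative (\<lambda>h. (snd h, - dGam (fst z) (fst h) (snd z) (snd z) - 2 *\<^sub>R Gam (fst z) (snd z) (snd h)))) (at z)"
proof -
  have "((\<lambda>z. Gam (fst z) (snd z) (snd z)) has_derivative
    (\<lambda>h. dGam (fst z) (fst h) (snd z) (snd z) + Gam (fst z) (snd h) (snd z) + Gam (fst z) (snd z) (snd h))) (at z)"
    using assms by (intro Gam_family_deriv has_derivative_fst has_derivative_snd has_derivative_ident)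
  then have "((\<lambda>z. (snd z, - Gam (fst z) (snd z) (snd z))) has_derivative
    (\<lambda>h. (snd h, - (dGam (fst z) (fst h) (snd z) (snd z) + Gam (fst z) (snd h) (snd z) + Gam (fst z) (snd z) (snd h))))) (at z)"
    by (intro has_derivative_Pair has_derivative_minus) (auto intro!: derivative_eq_intros)
  moreover have "(\<lambda>h. (snd h, - (dGam (fst z) (fst h) (snd z) (snd z) + Gam (fst z) (snd h) (snd z) + Gam (fst z) (snd z) (snd h)))) =
      (\<lambda>h. (snd h, - dGam (fst z) (fst h) (snd z) (snd z) - 2 *\<^sub>R Gam (fst z) (snd z) (snd h)))"
    using Gam_sym[OF assms, of _ "snd z"] by (simp add: fun_eq_iff scaleR_2)
  ultimately show ?thesis by (simp only: spray_def[abs_def])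
qed

lemma dspray_apply:
  "fst z \<in> V \<Longrightarrow> blinfun_apply (dspray z) h = (snd h, - dGam (fst z) (fst h) (snd z) (snd z) - 2 *\<^sub>R Gam (fst z) (snd z) (snd h))"
  unfolding dspray_def using spray_deriv'[of z] by (subst bounded_linear_Blinfun_apply) (auto intro: has_derivative_bounded_linear)

lemma spray_deriv: "fst z \<in> V \<Longrightarrow> (spray has_derivative blinfun_apply (dspray z)) (at z)"
proof -
  assume z: "fst z \<in> V"
  have "blinfun_apply (dspray z) = (\<lambda>h. (snd h, - dGam (fst z) (fst h) (snd z) (snd z) - 2 *\<^sub>R Gam (fst z) (snd z) (snd h)))"
    by (rule ext) (rule dspray_apply[OF z])
  then show ?thesis using spray_deriv'[OF z] by (simp only:)
qed

lemma dspray_cont: "continuous_on (V \<times> UNIV) dspray"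
proof (rule continuous_on_blinfun_componentwise)
  fix i :: "'e \<times> 'e"
  have c: "continuous_on (V \<times> UNIV) (\<lambda>z :: 'e \<times> 'e. F (fst z))" if "continuous_on V F" for F :: "'e \<Rightarrow> 'e"
    by (rule continuous_on_compose2[OF that]) (auto intro: continuous_intros)
  have "continuous_on (V \<times> UNIV) (\<lambda>z. dGam (fst z) (fst i) (snd z) (snd z))"
    by (rule bilinear_family_continuous[where x = fst and B = "\<lambda>y. dGam y (fst i)"])
      (auto intro: c dGam_cont dGam_bilinear continuous_intros)
  moreover have "continuous_on (V \<times> UNIV) (\<lambda>z. Gam (fst z) (snd z) (snd i))"
    by (rule bilinear_family_continuous[where x = fst and B = Gam])
      (auto intro: c Gam_cont Gam_bilinear continuous_intros)
  ultimately have "continuous_on (V \<times> UNIV) (\<lambda>z. (snd i, - dGam (fst z) (fst i) (snd z) (snd z) - 2 *\<^sub>R Gam (fst z) (snd z) (snd i)))"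
    by (intro continuous_on_Pair continuous_on_const continuous_on_diff continuous_on_minus continuous_on_scaleR)
  then show "continuous_on (V \<times> UNIV) (\<lambda>z. blinfun_apply (dspray z) i)"
    by (rule continuous_on_eq) (auto simp: dspray_apply)
qed

subsection \<open>Curvature and Jacobi fields\<close>

definition curv :: "'e \<Rightarrow> 'e \<Rightarrow> 'e \<Rightarrow> 'e \<Rightarrow> 'e" where
  "curv y u v w = dGam y u v w - dGam y v u w + Gam y u (Gam y v w) - Gam y v (Gam y u w)"

text \<open>For dependent \<open>u\<close> and \<open>v\<close> the numerator vanishes; for
  independent ones the denominator is positive by the strict Cauchy-Schwarz inequality.\<close>

lemma curv_nonpos:
  assumes y: "y \<in> V" and sec: "\<And>u v. u \<noteq> v \<Longrightarrow> independent {u, v} \<Longrightarrow>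
      g y (curv y u v v) u / (g y u u * g y v v - (g y u v)\<^sup>2) \<le> 0"
  shows "g y (curv y u v v) u \<le> 0"
proof (cases "u = 0 \<or> (\<exists>c. v = c *\<^sub>R u)")
  case True
  then show ?thesis
  proof
    assume "\<exists>c. v = c *\<^sub>R u"
    then obtain c where "v = c *\<^sub>R u" by blast
    then have "curv y u v v = 0"
      unfolding curv_def
      by (simp add: linear_cmul[OF dGam_linear[OF y]] bilinear_lmul[OF dGam_bilinear[OF y]] bilinear_rmul[OF dGam_bilinear[OF y]]
          bilinear_lmul[OF Gam_bilinear[OF y]] bilinear_rmul[OF Gam_bilinear[OF y]])
    then show ?thesis by (simp add: bilinear_lzero[OF g_bilinear[OF y]])
  qed (simp add: bilinear_rzero[OF g_bilinear[OF y]])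
next
  case False
  then have "u \<noteq> 0" and v: "v \<noteq> c *\<^sub>R u" for c by auto
  moreover have "u \<noteq> v" using v[of 1] by auto
  moreover have "independent {u, v}"
    using \<open>u \<noteq> 0\<close> \<open>u \<noteq> v\<close> v by (subst insert_commute, subst independent_insert) (auto simp: span_singleton)
  ultimately have "g y (curv y u v v) u / (g y u u * g y v v - (g y u v)\<^sup>2) \<le> 0" "(g y u v)\<^sup>2 < g y u u * g y v v"
    using sec g_cauchy_schwarz_strict[OF y, of u v] by auto
  then show ?thesis by (simp add: divide_le_0_iff)
qed

text \<open>\<open>J\<close> and \<open>K\<close> solve the linearized geodesic equation, and
  \<open>U\<close> is the covariant derivative of \<open>J\<close>. In these terms the equation is
  Jacobi's: the covariant derivative of \<open>U\<close> is
  \<open>- curv (x t) (J t) (y t) (y t)\<close>.\<close>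

lemma jacobi_norm:
  assumes x: "x t \<in> V" "(x has_vector_derivative y t) (at t)"
    and y: "(y has_vector_derivative - Gam (x t) (y t) (y t)) (at t)"
    and J: "(J has_vector_derivative K t) (at t)"
    and K: "(K has_vector_derivative - dGam (x t) (J t) (y t) (y t) - 2 *\<^sub>R Gam (x t) (y t) (K t)) (at t)"
  defines "U \<equiv> \<lambda>t. K t + Gam (x t) (y t) (J t)"
  shows "((\<lambda>t. g (x t) (J t) (J t)) has_real_derivative 2 * g (x t) (U t) (J t)) (at t)"
    and "((\<lambda>t. 2 * g (x t) (U t) (J t)) has_real_derivative
      2 * g (x t) (U t) (U t) - 2 * g (x t) (curv (x t) (J t) (y t) (y t)) (J t)) (at t)"
proof -
  note bl = g_bilinear[OF x(1)]
  have "((\<lambda>t. g (x t) (J t) (J t)) has_real_derivative g (x t) (U t) (J t) + g (x t) (J t) (U t)) (at t)"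
    using metric_curve_deriv[OF x J J] by (simp add: U_def)
  then show "((\<lambda>t. g (x t) (J t) (J t)) has_real_derivative 2 * g (x t) (U t) (J t)) (at t)"
    by (simp add: g_sym[OF x(1), of "J t"])
  define U' where "U' = (- dGam (x t) (J t) (y t) (y t) - 2 *\<^sub>R Gam (x t) (y t) (K t)) +
    (dGam (x t) (y t) (y t) (J t) + Gam (x t) (- Gam (x t) (y t) (y t)) (J t) + Gam (x t) (y t) (K t))"
  have "((\<lambda>t. Gam (x t) (y t) (J t)) has_derivative
      (\<lambda>h. dGam (x t) (h *\<^sub>R y t) (y t) (J t) + Gam (x t) (h *\<^sub>R - Gam (x t) (y t) (y t)) (J t) + Gam (x t) (y t) (h *\<^sub>R K t))) (at t)"
    using x y J unfolding has_vector_derivative_def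
    by (intro Gam_family_deriv)
  then have "((\<lambda>t. Gam (x t) (y t) (J t)) has_vector_derivative
      dGam (x t) (y t) (y t) (J t) + Gam (x t) (- Gam (x t) (y t) (y t)) (J t) + Gam (x t) (y t) (K t)) (at t)"
    unfolding has_vector_derivative_def using linear_cmul[OF dGam_linear[OF x(1)]]
    by (simp add: bilinear_lmul[OF Gam_bilinear[OF x(1)]] bilinear_rmul[OF Gam_bilinear[OF x(1)]] scaleR_add_right
        del: scaleR_minus_right)
  then have U: "(U has_vector_derivative U') (at t)"
    unfolding U_def U'_def by (intro has_vector_derivative_add K)
  have "U' + Gam (x t) (y t) (U t) = - curv (x t) (J t) (y t) (y t)"
  proof -
    have "Gam (x t) (Gam (x t) (y t) (y t)) (J t) = Gam (x t) (J t) (Gam (x t) (y t) (y t))"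
      "Gam (x t) (J t) (y t) = Gam (x t) (y t) (J t)" "dGam (x t) (y t) (y t) (J t) = dGam (x t) (y t) (J t) (y t)"
      by (rule Gam_sym[OF x(1)] dGam_sym[OF x(1)])+
    then show ?thesis unfolding U'_def U_def curv_def
      by (simp add: bilinear_radd[OF Gam_bilinear[OF x(1)]] bilinear_lneg[OF Gam_bilinear[OF x(1)]] scaleR_2)
  qed
  then have "((\<lambda>t. g (x t) (U t) (J t)) has_real_derivative
      - g (x t) (curv (x t) (J t) (y t) (y t)) (J t) + g (x t) (U t) (U t)) (at t)"
    using metric_curve_deriv[OF x U J] by (simp add: U_def bilinear_lneg[OF bl])
  from DERIV_cmult[OF this, of 2] show "((\<lambda>t. 2 * g (x t) (U t) (J t)) has_real_derivative
      2 * g (x t) (U t) (U t) - 2 * g (x t) (curv (x t) (J t) (y t) (y t)) (J t)) (at t)"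
    by (simp add: algebra_simps)
qed

end

section \<open>Charts and tangent vectors\<close>

text \<open>The tangent map of a transition carries position and velocity together from chart to
  chart. Its second component already contains a derivative of \<open>\<tau>\<close>, hence C2 for a
  C1 result.\<close>

lemma tangent_map_C1:
  fixes \<tau> :: "'a::euclidean_space \<Rightarrow> 'b::euclidean_space"
  assumes S: "open S" and C2: "Ck_on 2 S \<tau>"
  obtains T' :: "'a \<times> 'a \<Rightarrow> ('a \<times> 'a) \<Rightarrow>\<^sub>L ('b \<times> 'b)" where
    "\<And>z. fst z \<in> S \<Longrightarrow> ((\<lambda>z. (\<tau> (fst z), frechet_derivative \<tau> (at (fst z)) (snd z))) has_derivative blinfun_apply (T' z)) (at z)"
    "continuous_on (S \<times> UNIV) T'"
proof -
  define d where "d x v = frechet_derivative \<tau> (at x) v" for x v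
  define dd where "dd x h v = frechet_derivative (\<lambda>x. d x v) (at x) h" for x h v
  have \<tau>: "(\<tau> has_derivative d x) (at x)" if "x \<in> S" for x
    using C2 that unfolding numeral_2_eq_2 by (simp add: d_def[abs_def] frechet_derivative_works)
  have d: "((\<lambda>x. d x v) has_derivative (\<lambda>h. dd x h v)) (at x)" if "x \<in> S" for x v
    using C2 that unfolding numeral_2_eq_2 by (simp add: d_def dd_def frechet_derivative_works)
  have dd_cont: "continuous_on S (\<lambda>x. dd x h v)" for h v
    using C2 unfolding numeral_2_eq_2 by (simp add: d_def dd_def)
  have d_cont: "continuous_on S (\<lambda>x. d x v)" for v
    using d[of _ v] by (intro continuous_at_imp_continuous_on ballI) (blast intro: has_derivative_continuous)
  have d_lin: "linear (d x)" if "x \<in> S" for x using \<tau>[OF that] by (rule has_derivative_linear)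
  have dd_lin: "linear (\<lambda>v. dd x h v)" if "x \<in> S" for x h
    by (rule linear_derivative[OF S that d_lin d[OF that]])
  \<comment> \<open>A scalar factor, later set to 1, presents a family of linear maps as a family of
    bilinear ones, so that the lemmas on the latter apply.\<close>
  have bil: "bilinear (\<lambda>(r::real) v. r *\<^sub>R L v)" if "linear L" for L :: "'a \<Rightarrow> 'b"
    using that unfolding bilinear_def by (auto intro!: linearI simp: linear_add linear_cmul scaleR_add_left scaleR_add_right)
  define F where "F z h = (d (fst z) (fst h), dd (fst z) (fst h) (snd z) + d (fst z) (snd h))" for z h :: "'a \<times> 'a"
  have deriv: "((\<lambda>z. (\<tau> (fst z), d (fst z) (snd z))) has_derivative F z) (at z)" if z: "fst z \<in> S" for z
    unfolding F_def
  proof (intro has_derivative_Pair)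
    show "((\<lambda>z. \<tau> (fst z)) has_derivative (\<lambda>h. d (fst z) (fst h))) (at z)"
      using has_derivative_compose[OF has_derivative_fst[OF has_derivative_ident] \<tau>[OF z]] .
    have "((\<lambda>z. 1 *\<^sub>R d (fst z) (snd z)) has_derivative
        (\<lambda>h. 1 *\<^sub>R dd (fst z) (fst h) (snd z) + 0 *\<^sub>R d (fst z) (snd z) + 1 *\<^sub>R d (fst z) (snd h))) (at z)"
      by (rule bilinear_family_derivative[where V = S and B = "\<lambda>x r v. r *\<^sub>R d x v" and B' = "\<lambda>r v h. r *\<^sub>R dd (fst z) h v"
            and x = fst and u = "\<lambda>_. 1" and v = snd])
        (use S z bil d_lin d in \<open>auto intro!: has_derivative_scaleR_right has_derivative_fst has_derivative_snd has_derivative_ident\<close>)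
    then show "((\<lambda>z. d (fst z) (snd z)) has_derivative (\<lambda>h. dd (fst z) (fst h) (snd z) + d (fst z) (snd h))) (at z)" by simp
  qed
  define T' where "T' z = Blinfun (F z)" for z
  have T': "blinfun_apply (T' z) = F z" if "fst z \<in> S" for z
    unfolding T'_def using deriv[OF that] by (intro bounded_linear_Blinfun_apply) (rule has_derivative_bounded_linear)
  have "continuous_on (S \<times> UNIV) T'"
  proof (rule continuous_on_blinfun_componentwise)
    fix i :: "'a \<times> 'a"
    have c: "continuous_on (S \<times> UNIV) (\<lambda>z :: 'a \<times> 'a. G (fst z))" if "continuous_on S G" for G :: "'a \<Rightarrow> 'b"
      by (rule continuous_on_compose2[OF that]) (auto intro: continuous_intros)
    have "continuous_on (S \<times> UNIV) (\<lambda>z. 1 *\<^sub>R dd (fst z) (fst i) (snd z))"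
      by (rule bilinear_family_continuous[where x = fst and B = "\<lambda>x r v. r *\<^sub>R dd x (fst i) v" and u = "\<lambda>_. 1"])
        (use bil dd_lin c[OF dd_cont] in \<open>auto intro!: continuous_intros\<close>)
    then have "continuous_on (S \<times> UNIV) (\<lambda>z. F z i)" unfolding F_def
      by (intro continuous_on_Pair continuous_on_add c d_cont) simp
    then show "continuous_on (S \<times> UNIV) (\<lambda>z. blinfun_apply (T' z) i)"
      by (rule continuous_on_eq) (auto simp: T')
  qed
  then show thesis using that[of T'] deriv T' by (simp add: d_def[abs_def])
qed

locale smooth_manifold =
  fixes M :: "('m::{t2_space,second_countable_topology}, 'e::euclidean_space, 'x) mfd_scheme"
  assumes manifold: "manifold \<infinity> M"
begin

abbreviation "img c \<equiv> snd c ` fst c"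

lemma chart_dom:
  assumes "c \<in> charts M"
  shows "openin (top_of_set (points M)) (fst c)" "open (img c)"
    "homeomorphism (fst c) (img c) (snd c) (chart_inv c)" "fst c \<subseteq> points M"
  using assms manifold openin_imp_subset unfolding manifold_def by blast+

lemma chart_inv_apply: "c \<in> charts M \<Longrightarrow> p \<in> fst c \<Longrightarrow> chart_inv c (snd c p) = p"
  using chart_dom(3) homeomorphism_apply1 by metis

lemma apply_chart_inv: "c \<in> charts M \<Longrightarrow> y \<in> img c \<Longrightarrow> snd c (chart_inv c y) = y"
  using chart_dom(3) homeomorphism_apply2 by metis

lemma chart_inv_in: "c \<in> charts M \<Longrightarrow> y \<in> img c \<Longrightarrow> chart_inv c y \<in> fst c"
  by (metis chart_inv_apply imageE)

lemma chart_cont: "c \<in> charts M \<Longrightarrow> continuous_on (fst c) (snd c)"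
  using chart_dom(3) homeomorphism_cont1 by metis

lemma chart_inv_cont: "c \<in> charts M \<Longrightarrow> continuous_on (img c) (chart_inv c)"
  using chart_dom(3) homeomorphism_cont2 by metis

lemma chart_inj: "c \<in> charts M \<Longrightarrow> p \<in> fst c \<Longrightarrow> q \<in> fst c \<Longrightarrow> snd c p = snd c q \<Longrightarrow> p = q"
  by (metis chart_inv_apply)

lemma chart_exists: "p \<in> points M \<Longrightarrow> \<exists>c\<in>charts M. p \<in> fst c"
  using manifold unfolding manifold_def by (metis UN_iff imageE UnionE)

lemma chart_openin:
  assumes "c \<in> charts M" "openin (top_of_set (points M)) U" "U \<subseteq> fst c"
  shows "open (snd c ` U)"
proof -
  have "openin (top_of_set (fst c)) U"
    using assms(2,3) chart_dom(4)[OF assms(1)] by (rule openin_subset_trans)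
  then have "openin (top_of_set (img c)) (snd c ` U)"
    using homeomorphism_imp_open_map[OF chart_dom(3)[OF assms(1)]] by blast
  then show ?thesis using chart_dom(2)[OF assms(1)] openin_open_eq by blast
qed

lemma overlap_open:
  assumes "c \<in> charts M" "c' \<in> charts M"
  shows "open (snd c ` (fst c \<inter> fst c'))"
  using chart_dom(1)[OF assms(1)] chart_dom(1)[OF assms(2)] by (intro chart_openin[OF assms(1)]) auto

lemma transition_Ck:
  assumes "c \<in> charts M" "c' \<in> charts M"
  shows "Ck_on n (snd c ` (fst c \<inter> fst c')) (transition c c')"
  using assms manifold unfolding manifold_def C_on_def by simp

definition dtr :: "('m, 'e) chart \<Rightarrow> ('m, 'e) chart \<Rightarrow> 'm \<Rightarrow> 'e \<Rightarrow> 'e" where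
  "dtr c c' p = frechet_derivative (transition c c') (at (snd c p))"

lemma transition_deriv:
  assumes "c \<in> charts M" "c' \<in> charts M" "p \<in> fst c" "p \<in> fst c'"
  shows "(transition c c' has_derivative dtr c c' p) (at (snd c p))"
  using transition_Ck[OF assms(1,2), of 1] assms(3,4) by (simp add: dtr_def[abs_def] frechet_derivative_works)

lemma transition_apply: "c \<in> charts M \<Longrightarrow> p \<in> fst c \<Longrightarrow> transition c c' (snd c p) = snd c' p"
  by (simp add: transition_def chart_inv_apply)

lemma dtr_linear: "c \<in> charts M \<Longrightarrow> c' \<in> charts M \<Longrightarrow> p \<in> fst c \<Longrightarrow> p \<in> fst c' \<Longrightarrow> linear (dtr c c' p)"
  using transition_deriv has_derivative_linear by blast

lemma change_chart_deriv:
  fixes F :: "'v::real_normed_vector \<Rightarrow> 'm"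
  assumes c: "c \<in> charts M" "c' \<in> charts M" "F p \<in> fst c" "F p \<in> fst c'"
    and F: "((\<lambda>v. snd c (F v)) has_derivative F') (at p)"
    and ev: "open W" "p \<in> W" "\<And>v. v \<in> W \<Longrightarrow> F v \<in> fst c"
  shows "((\<lambda>v. snd c' (F v)) has_derivative (\<lambda>h. dtr c c' (F p) (F' h))) (at p)"
proof -
  have "((\<lambda>v. transition c c' (snd c (F v))) has_derivative (\<lambda>h. dtr c c' (F p) (F' h))) (at p)"
    by (rule has_derivative_compose[OF F transition_deriv[OF c]])
  then show ?thesis
    by (rule has_derivative_transform_within_open[OF _ ev(1,2)]) (use c ev transition_apply in auto)
qed

lemma dtr_compose:
  assumes "c \<in> charts M" "c' \<in> charts M" "c'' \<in> charts M" "p \<in> fst c" "p \<in> fst c'" "p \<in> fst c''"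
  shows "dtr c' c'' p (dtr c c' p a) = dtr c c'' p a"
proof -
  define O' where "O' = snd c ` (fst c \<inter> fst c')"
  have O': "open O'" "snd c p \<in> O'" unfolding O'_def using assms overlap_open by auto
  have "(transition c c' has_derivative dtr c c' p) (at (snd c p))" by (rule transition_deriv) fact+
  moreover have "(transition c' c'' has_derivative dtr c' c'' p) (at (transition c c' (snd c p)))"
    using transition_deriv[of c' c'' p] assms by (simp add: transition_apply)
  ultimately have "((\<lambda>y. transition c' c'' (transition c c' y)) has_derivative (\<lambda>a. dtr c' c'' p (dtr c c' p a))) (at (snd c p))"
    by (rule has_derivative_compose)
  then have "(transition c c'' has_derivative (\<lambda>a. dtr c' c'' p (dtr c c' p a))) (at (snd c p))"
  proof (rule has_derivative_transform_within_open[OF _ O'])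
    fix y assume "y \<in> O'"
    then obtain q where "q \<in> fst c" "q \<in> fst c'" "y = snd c q" by (auto simp: O'_def)
    then show "transition c' c'' (transition c c' y) = transition c c'' y"
      using assms by (simp add: transition_apply)
  qed
  from has_derivative_unique[OF this transition_deriv[of c c'' p]] assms show ?thesis by metis
qed

lemma dtr_self:
  assumes "c \<in> charts M" "p \<in> fst c"
  shows "dtr c c p a = a"
proof -
  have "((\<lambda>y. y) has_derivative dtr c c p) (at (snd c p))"
  proof (rule has_derivative_transform_within_open[OF transition_deriv[OF assms(1,1,2,2)] chart_dom(2)[OF assms(1)]])
    show "transition c c y = y" if "y \<in> img c" for y
      using that transition_apply[OF assms(1)] by (metis imageE)
  qed (use assms in auto)
  from has_derivative_unique[OF this has_derivative_ident] show ?thesis by metis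
qed

lemma coord_vec_apply: "c' \<in> charts_at M p \<Longrightarrow> coord_vec M c p a c' = dtr c c' p a"
  by (simp add: coord_vec_def dtr_def)

lemma coord_vec_self: "c \<in> charts_at M p \<Longrightarrow> coord_vec M c p a c = a"
  by (simp add: coord_vec_apply dtr_self charts_at_def)

lemma coord_vec_tangent: "c \<in> charts_at M p \<Longrightarrow> coord_vec M c p a \<in> tangent_space M p"
  unfolding tangent_space_def
  by (auto simp: coord_vec_apply dtr_def[symmetric])
    (auto simp: coord_vec_def charts_at_def dtr_compose dtr_def[symmetric])

lemma tangent_coord_vec:
  assumes "v \<in> tangent_space M p" "c \<in> charts_at M p"
  shows "coord_vec M c p (v c) = v"
proof
  fix c' show "coord_vec M c p (v c) c' = v c'"
  proof (cases "c' \<in> charts_at M p")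
    case True
    then have "v c' = frechet_derivative (transition c c') (at (snd c p)) (v c)"
      using assms unfolding tangent_space_def by blast
    then show ?thesis using True by (simp add: coord_vec_def)
  next
    case False
    then have "v c' = 0" using assms(1) unfolding tangent_space_def by blast
    then show ?thesis using False by (simp add: coord_vec_def)
  qed
qed

lemma coord_vec_change:
  assumes "c \<in> charts_at M p" "c' \<in> charts_at M p"
  shows "coord_vec M c' p (dtr c c' p a) = coord_vec M c p a"
  using tangent_coord_vec[OF coord_vec_tangent[OF assms(1)] assms(2)] assms by (simp add: coord_vec_apply)

lemma coord_vec_add: "c \<in> charts_at M p \<Longrightarrow> coord_vec M c p (a + b) = tadd (coord_vec M c p a) (coord_vec M c p b)"
  by (rule ext) (auto simp: tadd_def coord_vec_def dtr_def[symmetric] charts_at_def linear_add[OF dtr_linear])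

lemma coord_vec_scale: "c \<in> charts_at M p \<Longrightarrow> coord_vec M c p (r *\<^sub>R a) = tscale r (coord_vec M c p a)"
  by (rule ext) (auto simp: tscale_def coord_vec_def dtr_def[symmetric] charts_at_def linear_cmul[OF dtr_linear])

end

locale riemannian = smooth_manifold M
  for M :: "('m::{t2_space,second_countable_topology}, 'e::euclidean_space) riem_mfd" +
  assumes riemannian: "riemannian_manifold M"
begin

lemma local_metric_eq:
  assumes "c \<in> charts_at M p"
  shows "local_metric M c (snd c p) a b = metric M p (coord_vec M c p a) (coord_vec M c p b)"
  using assms by (simp add: local_metric_def charts_at_def chart_inv_apply)

lemma local_metric_change:
  assumes "c \<in> charts_at M p" "c' \<in> charts_at M p"
  shows "local_metric M c' (snd c' p) (dtr c c' p a) (dtr c c' p b) = local_metric M c (snd c p) a b"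
  using assms by (simp add: local_metric_eq coord_vec_change)

text \<open>Makes the calculus on open subsets of Euclidean space available in every chart.
  Positivity uses that a nonzero \<open>a\<close> gives a nonzero tangent vector, since its entry at
  \<open>c\<close> is \<open>a\<close> itself.\<close>

lemma metric_chart:
  assumes c: "c \<in> charts M"
  shows "metric_chart (img c) (local_metric M c)"
proof
  show "open (img c)" by (rule chart_dom(2)[OF c])
  fix y a b c' r assume y: "y \<in> img c"
  then obtain p where p: "p \<in> fst c" "y = snd c p" by auto
  then have pc: "c \<in> charts_at M p" and pM: "p \<in> points M" using c chart_dom(4)[OF c] by (auto simp: charts_at_def)
  note t = coord_vec_tangent[OF pc]
  show "local_metric M c y a b = local_metric M c y b a"
    using riemannian t pM unfolding riemannian_manifold_def by (simp add: p local_metric_eq[OF pc])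
  show "local_metric M c y (r *\<^sub>R a + b) c' = r * local_metric M c y a c' + local_metric M c y b c'"
    using riemannian t pM unfolding riemannian_manifold_def
    by (simp add: p local_metric_eq[OF pc] coord_vec_add[OF pc] coord_vec_scale[OF pc])
  assume "a \<noteq> 0"
  then have "coord_vec M c p a \<noteq> (\<lambda>_. 0)" using coord_vec_self[OF pc, of a] by metis
  then show "0 < local_metric M c y a a"
    using riemannian t pM unfolding riemannian_manifold_def by (simp add: p local_metric_eq[OF pc])
next
  fix a b show "C_on \<infinity> (img c) (\<lambda>y. local_metric M c y a b)"
    using riemannian c unfolding riemannian_manifold_def by blast
qed

abbreviation "\<Gamma> c \<equiv> metric_chart.Gam (local_metric M c)"
abbreviation "d\<Gamma> c \<equiv> metric_chart.dGam (local_metric M c)"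
abbreviation "Spray c \<equiv> metric_chart.spray (local_metric M c)"
abbreviation "dSpray c \<equiv> metric_chart.dspray (local_metric M c)"

lemma christoffel_eq: "c \<in> charts M \<Longrightarrow> y \<in> img c \<Longrightarrow> christoffel M c y u v = \<Gamma> c y u v"
  using metric_chart.Gam_THE[OF metric_chart]
  by (simp add: christoffel_def metric_deriv_def metric_chart.dg_def[OF metric_chart])

text \<open>\<open>christoffel\<close> and \<open>Gam\<close> are known to agree on
  \<open>img c\<close>; as this set is open, their derivatives agree there too.\<close>

lemma curvature_eq:
  assumes c: "c \<in> charts M" and y: "y \<in> img c"
  shows "curvature M c y u v w = metric_chart.curv (local_metric M c) y u v w"
proof -
  interpret metric_chart "img c" "local_metric M c" by (rule metric_chart[OF c])
  have "frechet_derivative (\<lambda>z. christoffel M c z v w) (at y) = (\<lambda>h. dGam y h v w)" for v w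
  proof (rule frechet_derivative_at[symmetric])
    show "((\<lambda>z. christoffel M c z v w) has_derivative (\<lambda>h. dGam y h v w)) (at y)"
      by (rule has_derivative_transform_within_open[OF Gam_deriv[OF y] V y]) (simp add: christoffel_eq c)
  qed
  then show ?thesis using y by (simp add: curvature_def curv_def christoffel_eq c)
qed

lemma nonpositive:
  assumes "nonpositive_curvature M" and c: "c \<in> charts M" and y: "y \<in> img c"
  shows "local_metric M c y (metric_chart.curv (local_metric M c) y u v v) u \<le> 0"
proof -
  interpret metric_chart "img c" "local_metric M c" by (rule metric_chart[OF c])
  show ?thesis
    by (rule curv_nonpos[OF y]) (use assms in \<open>auto simp: nonpositive_curvature_def sectional_curvature_def curvature_eq\<close>)
qed

lemma metric_coords:
  assumes "u \<in> tangent_space M p" "v \<in> tangent_space M p" "c \<in> charts_at M p"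
  shows "metric M p u v = local_metric M c (snd c p) (u c) (v c)"
  using assms by (simp add: local_metric_eq tangent_coord_vec)

section \<open>Geodesics\<close>

definition state :: "('m, 'e) chart \<Rightarrow> (real \<Rightarrow> 'm) \<Rightarrow> real \<Rightarrow> 'e \<times> 'e" where
  "state c \<gamma> t = (snd c (\<gamma> t), velocity M \<gamma> t c)"

lemma geodesic_chart_open:
  assumes "geodesic_on M I \<gamma>" "open I" "c \<in> charts M"
  shows "open {t \<in> I. \<gamma> t \<in> fst c}"
proof -
  have "openin (top_of_set I) (I \<inter> \<gamma> -` fst c)"
    using assms chart_dom(1) unfolding geodesic_on_def
    by (intro continuous_openin_preimage[where T = "points M"]) auto
  then have "open (I \<inter> \<gamma> -` fst c)" using assms(2) openin_open_eq by blast
  moreover have "I \<inter> \<gamma> -` fst c = {t \<in> I. \<gamma> t \<in> fst c}" by auto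
  ultimately show ?thesis by simp
qed

lemma geodesic_state:
  assumes \<gamma>: "geodesic_on M I \<gamma>" and I: "open I" "t \<in> I" and c: "c \<in> charts M" "\<gamma> t \<in> fst c"
  shows "((\<lambda>t. snd c (\<gamma> t)) has_vector_derivative velocity M \<gamma> t c) (at t)"
    and "((\<lambda>t. velocity M \<gamma> t c) has_vector_derivative - \<Gamma> c (snd c (\<gamma> t)) (velocity M \<gamma> t c) (velocity M \<gamma> t c)) (at t)"
    and "(state c \<gamma> has_vector_derivative Spray c (state c \<gamma> t)) (at t)"
proof -
  obtain D where D: "\<And>t. t \<in> I \<Longrightarrow> \<gamma> t \<in> fst c \<Longrightarrow> ((snd c \<circ> \<gamma>) has_vector_derivative D t) (at t) \<and>
      (D has_vector_derivative - christoffel M c (snd c (\<gamma> t)) (D t) (D t)) (at t)"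
    using \<gamma> c unfolding geodesic_on_def by meson
  have vel: "velocity M \<gamma> s c = D s" if "s \<in> {t \<in> I. \<gamma> t \<in> fst c}" for s
    using D[of s] that c vector_derivative_at by (auto simp: velocity_def charts_at_def)
  have t: "t \<in> {t \<in> I. \<gamma> t \<in> fst c}" using I c by simp
  show 1: "((\<lambda>t. snd c (\<gamma> t)) has_vector_derivative velocity M \<gamma> t c) (at t)"
    using D[of t] I c vel[OF t] by (simp add: comp_def)
  have "(D has_vector_derivative - \<Gamma> c (snd c (\<gamma> t)) (velocity M \<gamma> t c) (velocity M \<gamma> t c)) (at t)"
    using D[of t] I c vel[OF t] by (simp add: christoffel_eq)
  then show 2: "((\<lambda>t. velocity M \<gamma> t c) has_vector_derivative - \<Gamma> c (snd c (\<gamma> t)) (velocity M \<gamma> t c) (velocity M \<gamma> t c)) (at t)"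
    by (rule has_vector_derivative_transform_within_open[OF _ geodesic_chart_open[OF \<gamma> I(1) c(1)] t]) (simp add: vel)
  show "(state c \<gamma> has_vector_derivative Spray c (state c \<gamma> t)) (at t)"
    using has_vector_derivative_Pair[OF 1 2] metric_chart.spray_def[OF metric_chart[OF c(1)]]
    by (simp add: state_def[abs_def])
qed

lemma geodesic_state_cont:
  assumes "geodesic_on M I \<gamma>" "open I" "t \<in> I" "c \<in> charts M" "\<gamma> t \<in> fst c"
  shows "isCont (state c \<gamma>) t"
  using geodesic_state(3)[OF assms] by (rule has_vector_derivative_continuous)

text \<open>\<open>W\<close> keeps the curve in the chart near \<open>t\<close>, so that transition
  maps can be applied to it and its velocity in every other chart follows from
  \<open>a\<close>.\<close>

lemma velocity_tangent:
  assumes c: "c \<in> charts M" and W: "open W" "t \<in> W" "\<And>s. s \<in> W \<Longrightarrow> \<gamma> s \<in> fst c"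
    and d: "((\<lambda>t. snd c (\<gamma> t)) has_vector_derivative a) (at t)"
  shows "velocity M \<gamma> t = coord_vec M c (\<gamma> t) a"
proof
  fix c'
  show "velocity M \<gamma> t c' = coord_vec M c (\<gamma> t) a c'"
  proof (cases "c' \<in> charts_at M (\<gamma> t)")
    case True
    then have c': "c' \<in> charts M" "\<gamma> t \<in> fst c'" by (auto simp: charts_at_def)
    have "((\<lambda>t. snd c' (\<gamma> t)) has_derivative (\<lambda>h. dtr c c' (\<gamma> t) (h *\<^sub>R a))) (at t)"
      by (rule change_chart_deriv[OF c c'(1) W(3)[OF W(2)] c'(2) d[unfolded has_vector_derivative_def] W])
    then have "((\<lambda>t. snd c' (\<gamma> t)) has_vector_derivative dtr c c' (\<gamma> t) a) (at t)"
      unfolding has_vector_derivative_def using linear_cmul[OF dtr_linear[OF c c'(1) W(3)[OF W(2)] c'(2)]] by simp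
    then show ?thesis using True vector_derivative_at by (auto simp: velocity_def coord_vec_apply comp_def)
  qed (simp add: velocity_def coord_vec_def)
qed

lemma geodesic_velocity:
  assumes \<gamma>: "geodesic_on M I \<gamma>" and I: "open I" "t \<in> I"
  shows "velocity M \<gamma> t \<in> tangent_space M (\<gamma> t)"
    and "c \<in> charts_at M (\<gamma> t) \<Longrightarrow> velocity M \<gamma> t = coord_vec M c (\<gamma> t) (velocity M \<gamma> t c)"
proof -
  have *: "velocity M \<gamma> t = coord_vec M c (\<gamma> t) (velocity M \<gamma> t c)" if "c \<in> charts_at M (\<gamma> t)" for c
    using that geodesic_state(1)[OF \<gamma> I] I
    by (intro velocity_tangent[OF _ geodesic_chart_open[OF \<gamma> I(1)]]) (auto simp: charts_at_def)
  then show "c \<in> charts_at M (\<gamma> t) \<Longrightarrow> velocity M \<gamma> t = coord_vec M c (\<gamma> t) (velocity M \<gamma> t c)" .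
  have "\<gamma> t \<in> points M" using \<gamma> I unfolding geodesic_on_def by auto
  then obtain c where "c \<in> charts_at M (\<gamma> t)" using chart_exists[of "\<gamma> t"] by (auto simp: charts_at_def)
  then show "velocity M \<gamma> t \<in> tangent_space M (\<gamma> t)" using * coord_vec_tangent by metis
qed

lemma geodesic_subset: "geodesic_on M I \<gamma> \<Longrightarrow> J \<subseteq> I \<Longrightarrow> geodesic_on M J \<gamma>"
  unfolding geodesic_on_def by (meson continuous_on_subset image_mono order_trans subsetD)

lemma geodesic_affine:
  assumes \<gamma>: "geodesic_on M UNIV \<gamma>"
  shows "geodesic_on M UNIV (\<lambda>t. \<gamma> (r * t + s))"
    and "velocity M (\<lambda>t. \<gamma> (r * t + s)) t = tscale r (velocity M \<gamma> (r * t + s))"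
proof -
  have aff: "((\<lambda>t. r * t + s) has_vector_derivative r) (at t)" for t
    by (auto intro!: derivative_eq_intros simp flip: has_real_derivative_iff_has_vector_derivative)
  have 1: "((\<lambda>t. snd c (\<gamma> (r * t + s))) has_vector_derivative r *\<^sub>R velocity M \<gamma> (r * t + s) c) (at t)"
    and 2: "((\<lambda>t. r *\<^sub>R velocity M \<gamma> (r * t + s) c) has_vector_derivative
       - christoffel M c (snd c (\<gamma> (r * t + s))) (r *\<^sub>R velocity M \<gamma> (r * t + s) c) (r *\<^sub>R velocity M \<gamma> (r * t + s) c)) (at t)"
    if c: "c \<in> charts M" "\<gamma> (r * t + s) \<in> fst c" for c t
  proof -
    show "((\<lambda>t. snd c (\<gamma> (r * t + s))) has_vector_derivative r *\<^sub>R velocity M \<gamma> (r * t + s) c) (at t)"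
      using vector_diff_chain_at[OF aff geodesic_state(1)[OF \<gamma> _ _ c]] by (simp add: comp_def)
    have "bilinear (\<Gamma> c (snd c (\<gamma> (r * t + s))))"
      using metric_chart.Gam_bilinear[OF metric_chart[OF c(1)]] c by auto
    then show "((\<lambda>t. r *\<^sub>R velocity M \<gamma> (r * t + s) c) has_vector_derivative
       - christoffel M c (snd c (\<gamma> (r * t + s))) (r *\<^sub>R velocity M \<gamma> (r * t + s) c) (r *\<^sub>R velocity M \<gamma> (r * t + s) c)) (at t)"
      using bounded_linear.has_vector_derivative[OF bounded_linear_scaleR_right[of r]
          vector_diff_chain_at[OF aff geodesic_state(2)[OF \<gamma> _ _ c]]] c
      by (simp add: comp_def christoffel_eq bilinear_lmul bilinear_rmul)
  qed
  have "continuous_on UNIV \<gamma>" "range \<gamma> \<subseteq> points M" using \<gamma> by (auto simp: geodesic_on_def)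
  moreover have "continuous_on UNIV (\<lambda>t. \<gamma> (r * t + s))"
    by (rule continuous_on_compose2[OF \<open>continuous_on UNIV \<gamma>\<close>]) (auto intro!: continuous_intros)
  moreover have "\<exists>D. \<forall>t\<in>UNIV. \<gamma> (r * t + s) \<in> fst c \<longrightarrow>
        ((snd c \<circ> (\<lambda>t. \<gamma> (r * t + s))) has_vector_derivative D t) (at t) \<and>
        (D has_vector_derivative - christoffel M c (snd c (\<gamma> (r * t + s))) (D t) (D t)) (at t)" if "c \<in> charts M" for c
    using 1[OF that] 2[OF that] by (intro exI[of _ "\<lambda>t. r *\<^sub>R velocity M \<gamma> (r * t + s) c"]) (auto simp: comp_def)
  ultimately show "geodesic_on M UNIV (\<lambda>t. \<gamma> (r * t + s))" unfolding geodesic_on_def by auto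
  show "velocity M (\<lambda>t. \<gamma> (r * t + s)) t = tscale r (velocity M \<gamma> (r * t + s))"
    using 1[THEN vector_derivative_at] by (auto simp: velocity_def tscale_def charts_at_def comp_def fun_eq_iff)
qed

end

section \<open>Induction on the unit interval and a convexity estimate\<close>

text \<open>Induction along a continuum, with the infimum of the failures as the critical point.
  Passing to a limit and going beyond a point are separate hypotheses, since in
  \<open>geodesic_stay\<close> and \<open>section_exists\<close> they hold for different reasons:
  compactness for the one, openness for the other.\<close>

lemma unit_interval_induct:
  fixes P :: "real \<Rightarrow> bool"
  assumes P0: "P 0"
    and lim: "\<And>u. 0 < u \<Longrightarrow> u \<le> 1 \<Longrightarrow> (\<And>v. 0 \<le> v \<Longrightarrow> v < u \<Longrightarrow> P v) \<Longrightarrow> P u"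
    and step: "\<And>u. 0 \<le> u \<Longrightarrow> u < 1 \<Longrightarrow> (\<And>v. 0 \<le> v \<Longrightarrow> v \<le> u \<Longrightarrow> P v) \<Longrightarrow> \<exists>e>0. \<forall>v. u \<le> v \<and> v < u + e \<and> v \<le> 1 \<longrightarrow> P v"
    and u: "0 \<le> u" "u \<le> 1"
  shows "P u"
proof (rule ccontr)
  assume "\<not> P u"
  define N where "N = {v. 0 \<le> v \<and> v \<le> 1 \<and> \<not> P v}"
  have N: "u \<in> N" "bdd_below N" using u \<open>\<not> P u\<close> by (auto simp: N_def intro: bdd_belowI[of _ 0])
  define s where "s = Inf N"
  have "s \<le> u" unfolding s_def by (rule cInf_lower[OF N])
  moreover have "0 \<le> s" unfolding s_def by (rule cInf_greatest) (use N in \<open>auto simp: N_def\<close>)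
  ultimately have s: "0 \<le> s" "s \<le> 1" using u by auto
  have below: "P v" if "0 \<le> v" "v < s" for v
    using that s cInf_lower[OF _ N(2), of v] by (force simp: N_def s_def)
  have Ps: "P s" using below lim s P0 by (cases "s = 0") auto
  have le_s: "P v" if "0 \<le> v" "v \<le> s" for v using below Ps that by (cases "v = s") auto
  show False
  proof (cases "s = 1")
    case True
    then show False using le_s u \<open>\<not> P u\<close> by auto
  next
    case False
    then obtain e where e: "e > 0" "\<And>v. s \<le> v \<Longrightarrow> v < s + e \<Longrightarrow> v \<le> 1 \<Longrightarrow> P v"
      using step[of s] s le_s by (metis less_le)
    have "s + e \<le> Inf N"
    proof (rule cInf_greatest)
      fix v assume v: "v \<in> N"
      then have "s \<le> v" unfolding s_def using N by (intro cInf_lower)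
      then show "s + e \<le> v" using e(2)[of v] v by (force simp: N_def)
    qed (use N in auto)
    then show False using e by (simp add: s_def)
  qed
qed

lemma isCont_open_ball:
  fixes f :: "real \<Rightarrow> 'a::topological_space"
  assumes "isCont f u" "open S" "f u \<in> S"
  obtains \<delta> where "\<delta> > 0" "\<And>v. \<bar>v - u\<bar> < \<delta> \<Longrightarrow> f v \<in> S"
proof -
  obtain T where "open T" "u \<in> T" "\<And>v. v \<in> T \<Longrightarrow> f v \<in> S"
    using assms unfolding continuous_at_open by metis
  then obtain \<delta> where "\<delta> > 0" "\<And>v. dist v u < \<delta> \<Longrightarrow> v \<in> T" unfolding open_dist by metis
  then show thesis using that[of \<delta>] \<open>\<And>v. v \<in> T \<Longrightarrow> f v \<in> S\<close> by (auto simp: dist_real_def)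
qed

text \<open>
  The hypotheses say that \<open>sqrt \<circ> \<phi>\<close> is convex; they are phrased so that \<open>\<psi>\<close> may depend on the point.
\<close>

lemma sqrt_convex_bound:
  fixes \<phi> :: "real \<Rightarrow> real"
  assumes loc: "\<And>t1. \<exists>e>0. \<exists>\<psi> \<kappa>. (\<forall>t. \<bar>t - t1\<bar> < e \<longrightarrow> (\<phi> has_real_derivative \<psi> t) (at t)) \<and>
      (\<psi> has_real_derivative \<kappa>) (at t1) \<and> (\<psi> t1)\<^sup>2 \<le> 2 * \<phi> t1 * \<kappa> \<and> 0 \<le> \<kappa>"
    and init: "\<exists>e>0. \<exists>\<psi>. (\<forall>t. \<bar>t\<bar> < e \<longrightarrow> (\<phi> has_real_derivative \<psi> t) (at t)) \<and> (\<psi> has_real_derivative 2 * \<beta>) (at 0)"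
    and \<phi>0: "\<phi> 0 = 0" and \<beta>: "0 < \<beta>"
  shows "\<beta> \<le> \<phi> 1"
proof -
  define \<psi> where "\<psi> t = deriv \<phi> t" for t
  have \<phi>: "(\<phi> has_real_derivative \<psi> t) (at t)" for t
  proof -
    obtain e \<psi>' where "e > 0" "\<forall>s. \<bar>s - t\<bar> < e \<longrightarrow> (\<phi> has_real_derivative \<psi>' s) (at s)" using loc[of t] by blast
    then have "(\<phi> has_real_derivative \<psi>' t) (at t)" by simp
    then show ?thesis using DERIV_imp_deriv[of \<phi> "\<psi>' t" t] by (simp add: \<psi>_def)
  qed
  \<comment> \<open>Each local \<open>\<psi>'\<close> is a derivative of \<open>\<phi>\<close> near
    \<open>t1\<close>, so it coincides there with \<open>deriv \<phi>\<close> and hands its own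
    derivative on to the global \<open>\<psi>\<close>.\<close>
  have transfer: "(\<psi> has_real_derivative \<kappa>) (at t1) \<and> \<psi>' t1 = \<psi> t1"
    if "e > 0" "\<And>t. \<bar>t - t1\<bar> < e \<Longrightarrow> (\<phi> has_real_derivative \<psi>' t) (at t)" "(\<psi>' has_real_derivative \<kappa>) (at t1)" for e \<psi>' \<kappa> t1
  proof -
    have eq: "\<psi>' t = \<psi> t" if "t \<in> ball t1 e" for t
      using that DERIV_unique[OF \<open>\<And>t. \<bar>t - t1\<bar> < e \<Longrightarrow> (\<phi> has_real_derivative \<psi>' t) (at t)\<close> \<phi>, of t]
      by (auto simp: dist_real_def)
    then show ?thesis
      using has_field_derivative_transform_within_open[OF that(3), of "ball t1 e" \<psi>] that(1) by auto
  qed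
  have "\<exists>\<kappa>. (\<psi> has_real_derivative \<kappa>) (at t) \<and> (\<psi> t)\<^sup>2 \<le> 2 * \<phi> t * \<kappa> \<and> 0 \<le> \<kappa>" for t
    using loc[of t] transfer[of _ t] by metis
  then obtain \<kappa> where \<kappa>: "\<And>t. (\<psi> has_real_derivative \<kappa> t) (at t)" "\<And>t. (\<psi> t)\<^sup>2 \<le> 2 * \<phi> t * \<kappa> t" "\<And>t. 0 \<le> \<kappa> t" by metis
  have \<psi>_0: "\<psi> 0 = 0" using \<kappa>(2)[of 0] \<phi>0 by simp
  have \<psi>'0: "(\<psi> has_real_derivative 2 * \<beta>) (at 0)"
    using init transfer[of _ 0 _ "2 * \<beta>"] by auto
  have \<psi>_mono: "\<psi> s \<le> \<psi> t" if "s \<le> t" for s t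
    using DERIV_nonneg_imp_nondecreasing[OF that] \<kappa> by blast
  have near: "eventually (\<lambda>t. \<beta>1 < \<psi> t / t \<and> \<psi> t / t < \<beta>2) (at_right 0)" if "\<beta>1 < 2 * \<beta>" "2 * \<beta> < \<beta>2" for \<beta>1 \<beta>2
  proof -
    have "((\<lambda>t. \<psi> t / t) \<longlongrightarrow> 2 * \<beta>) (at 0)"
      using \<psi>'0 \<psi>_0 by (simp add: has_field_derivative_iff)
    then have "((\<lambda>t. \<psi> t / t) \<longlongrightarrow> 2 * \<beta>) (at_right 0)" by (rule filterlim_mono) (auto simp: at_le)
    then show ?thesis using that by (intro eventually_conj order_tendstoD)
  qed
  have \<psi>_pos: "0 < \<psi> t" if "0 < t" for t
  proof -
    obtain b where b: "b > 0" "\<And>s. 0 < s \<Longrightarrow> s < b \<Longrightarrow> 0 < \<psi> s / s"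
      using near[of 0 "3 * \<beta>"] \<beta> by (auto simp: eventually_at_right)
    have m: "0 < min t (b / 2)" "min t (b / 2) < b" using b(1) that by auto
    have "0 < \<psi> (min t (b / 2))" using b(2)[OF m] m(1) by (simp only: zero_less_divide_iff) auto
    also have "\<dots> \<le> \<psi> t" by (rule \<psi>_mono) simp
    finally show ?thesis .
  qed
  have \<phi>_pos: "0 < \<phi> t" if t: "0 < t" for t
  proof -
    obtain z where "0 < z" "z < t" "\<phi> t - \<phi> 0 = (t - 0) * \<psi> z"
      using MVT2[OF t, of \<phi> \<psi>] \<phi> by blast
    then show ?thesis using \<psi>_pos[of z] t \<phi>0 by simp
  qed
  \<comment> \<open>Four times the squared derivative of \<open>sqrt \<circ> \<phi>\<close>.
    Convexity makes it nondecreasing, and it tends to \<open>4 * \<beta>\<close> at 0, since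
    \<open>\<phi> t\<close> behaves like \<open>\<beta> * t\<^sup>2\<close> there.\<close>
  define \<rho> where "\<rho> t = (\<psi> t)\<^sup>2 / \<phi> t" for t
  have \<rho>_mono: "\<rho> s \<le> \<rho> t" if "0 < s" "s \<le> t" for s t
  proof (rule DERIV_nonneg_imp_nondecreasing[OF that(2)])
    fix x assume "s \<le> x" "x \<le> t"
    then have x: "0 < x" using that by simp
    note p = \<phi>_pos[OF x] \<psi>_pos[OF x]
    have "(\<rho> has_real_derivative (2 * \<psi> x * \<kappa> x * \<phi> x - (\<psi> x)\<^sup>2 * \<psi> x) / (\<phi> x * \<phi> x)) (at x)"
      unfolding \<rho>_def using p by (auto intro!: derivative_eq_intros \<phi> \<kappa>(1) simp: power2_eq_square)
    moreover have "0 \<le> (2 * \<psi> x * \<kappa> x * \<phi> x - (\<psi> x)\<^sup>2 * \<psi> x) / (\<phi> x * \<phi> x)"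
    proof -
      have "(\<psi> x)\<^sup>2 * \<psi> x \<le> (2 * \<phi> x * \<kappa> x) * \<psi> x" using \<kappa>(2)[of x] p by (intro mult_right_mono) auto
      then show ?thesis using p by (intro divide_nonneg_pos) (auto simp: mult_ac)
    qed
    ultimately show "\<exists>y. (\<rho> has_real_derivative y) (at x) \<and> 0 \<le> y" by blast
  qed
  have \<rho>_ge: "4 * (\<beta> * c) \<le> \<rho> t" if t: "0 < t" and c: "0 < c" "c < 1" for t c
  proof -
    \<comment> \<open>\<open>b1\<close> and \<open>b2\<close> enclose \<open>2 * \<beta>\<close>
      with relative error \<open>(1 - c) / 4\<close>. Near 0 they bound \<open>\<psi> s / s\<close>,
      whence \<open>\<rho> s \<ge> 2 * b1\<^sup>2 / b2\<close>, and this error is small enough to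
      keep the bound above \<open>4 * (\<beta> * c)\<close>.\<close>
    define b1 where "b1 = 2 * \<beta> * (1 - (1 - c) / 4)"
    define b2 where "b2 = 2 * \<beta> * (1 + (1 - c) / 4)"
    have b: "b1 < 2 * \<beta>" "2 * \<beta> < b2" "0 < b1" using \<beta> c by (auto simp: b1_def b2_def)
    obtain d where d: "d > 0" "\<And>s. 0 < s \<Longrightarrow> s < d \<Longrightarrow> b1 < \<psi> s / s \<and> \<psi> s / s < b2"
      using near[OF b(1,2)] unfolding eventually_at_right_field by blast
    define s where "s = min t (d / 2)"
    have s: "0 < s" "s \<le> t" "s < d" using t d(1) by (auto simp: s_def)
    have up: "\<phi> s - b2 / 2 * s\<^sup>2 \<le> \<phi> 0 - b2 / 2 * 0\<^sup>2"
    proof (rule DERIV_nonpos_imp_nonincreasing[of 0 s "\<lambda>s. \<phi> s - b2 / 2 * s\<^sup>2"])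
      fix x assume x: "0 \<le> x" "x \<le> s"
      have "((\<lambda>s. \<phi> s - b2 / 2 * s\<^sup>2) has_real_derivative \<psi> x - b2 * x) (at x)"
        by (auto intro!: derivative_eq_intros \<phi>)
      moreover have "\<psi> x - b2 * x \<le> 0"
        using d(2)[of x] x s \<psi>_0 by (cases "x = 0") (auto simp: divide_less_eq)
      ultimately show "\<exists>y. ((\<lambda>s. \<phi> s - b2 / 2 * s\<^sup>2) has_real_derivative y) (at x) \<and> y \<le> 0" by blast
    qed (use s in auto)
    have "b1 * s < \<psi> s" using d(2)[of s] s by (auto simp: less_divide_eq)
    then have "(b1 * s)\<^sup>2 \<le> (\<psi> s)\<^sup>2" using b s by (intro power_mono) auto
    then have "(b1 * s)\<^sup>2 / (b2 / 2 * s\<^sup>2) \<le> \<rho> s"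
      unfolding \<rho>_def using up \<phi>0 \<phi>_pos[OF s(1)] by (intro frac_le) auto
    then have "2 * b1\<^sup>2 / b2 \<le> \<rho> s" using s b by (simp add: power_mult_distrib field_simps)
    moreover have "4 * (\<beta> * c) \<le> 2 * b1\<^sup>2 / b2"
    proof -
      define e where "e = (1 - c) / 4"
      have e: "0 < e" "e < 1 / 4" "c = 1 - 4 * e" using c by (auto simp: e_def field_simps)
      have "(1 - 4 * e) * (1 + e) \<le> (1 - e)\<^sup>2" using e by (simp add: power2_eq_square algebra_simps)
      then have "8 * \<beta>\<^sup>2 * ((1 - 4 * e) * (1 + e)) \<le> 8 * \<beta>\<^sup>2 * (1 - e)\<^sup>2" using \<beta> by (intro mult_left_mono) auto
      then have "4 * (\<beta> * (1 - 4 * e)) * b2 \<le> 2 * b1\<^sup>2"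
        unfolding b1_def b2_def e_def[symmetric] by (simp add: power2_eq_square algebra_simps)
      then show ?thesis using b e by (simp add: pos_le_divide_eq)
    qed
    ultimately show ?thesis using \<rho>_mono[OF s(1,2)] by linarith
  qed
  have \<rho>_ge': "4 * \<beta> \<le> \<rho> t" if t: "0 < t" for t
  proof (rule field_le_mult_one_interval)
    fix z :: real assume "0 < z" "z < 1"
    then show "z * (4 * \<beta>) \<le> \<rho> t" using \<rho>_ge[OF t, of z] by (simp add: mult_ac)
  qed
  \<comment> \<open>The square root is not differentiable where \<open>\<phi>\<close> vanishes, so
    the mean value theorem is applied on \<open>{s..1}\<close> and \<open>s\<close> is sent to 0
    afterwards.\<close>
  have sq: "sqrt \<beta> * (1 - s) \<le> sqrt (\<phi> 1) - sqrt (\<phi> s)" if s: "0 < s" "s < 1" for s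
  proof -
    obtain z where z: "s < z" "z < 1" "sqrt (\<phi> 1) - sqrt (\<phi> s) = (1 - s) * (\<psi> z / (2 * sqrt (\<phi> z)))"
    proof -
      have "((\<lambda>x. sqrt (\<phi> x)) has_real_derivative \<psi> x / (2 * sqrt (\<phi> x))) (at x)" if "s \<le> x" for x
        using \<phi>_pos[of x] that s \<phi>[of x] by (auto intro!: derivative_eq_intros simp: field_simps)
      then show thesis using MVT2[OF s(2), of "\<lambda>x. sqrt (\<phi> x)" "\<lambda>x. \<psi> x / (2 * sqrt (\<phi> x))"] that by blast
    qed
    have zp: "0 < z" using z s by simp
    note p = \<phi>_pos[OF zp] \<psi>_pos[OF zp]
    have "4 * \<beta> * \<phi> z \<le> (\<psi> z)\<^sup>2" using \<rho>_ge'[OF zp] p by (simp add: \<rho>_def pos_le_divide_eq)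
    then have "sqrt (4 * \<beta> * \<phi> z) \<le> \<psi> z" using p by (intro real_le_lsqrt) auto
    then have "sqrt \<beta> \<le> \<psi> z / (2 * sqrt (\<phi> z))" using p by (simp add: real_sqrt_mult pos_le_divide_eq mult_ac)
    then have "sqrt \<beta> * (1 - s) \<le> (\<psi> z / (2 * sqrt (\<phi> z))) * (1 - s)" using s by (intro mult_right_mono) auto
    then show ?thesis using z by (simp add: mult.commute)
  qed
  have "z * sqrt \<beta> \<le> sqrt (\<phi> 1)" if "0 < z" "z < 1" for z
  proof -
    have "0 \<le> sqrt (\<phi> (1 - z))" using \<phi>_pos[of "1 - z"] that by simp
    moreover have "z * sqrt \<beta> \<le> sqrt (\<phi> 1) - sqrt (\<phi> (1 - z))" using sq[of "1 - z"] that by (simp add: mult.commute)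
    ultimately show ?thesis by linarith
  qed
  then have "sqrt \<beta> \<le> sqrt (\<phi> 1)" by (rule field_le_mult_one_interval)
  then show ?thesis by simp
qed

context riemannian
begin

lemma geodesic_in: "geodesic_on M I \<gamma> \<Longrightarrow> t \<in> I \<Longrightarrow> \<gamma> t \<in> points M"
  by (auto simp: geodesic_on_def)

lemma spray_field:
  assumes c: "c \<in> charts M" and sub: "cball x0 r \<subseteq> img c"
  shows "C1_field (cball x0 r \<times> cball 0 R) (Spray c) (dSpray c)"
proof -
  interpret metric_chart "img c" "local_metric M c" by (rule metric_chart[OF c])
  show ?thesis
  proof
    show "(spray has_derivative dspray z) (at z within cball x0 r \<times> cball 0 R)" if "z \<in> cball x0 r \<times> cball 0 R" for z
    proof (rule has_derivative_at_withinI[OF spray_deriv])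
      show "fst z \<in> img c" using that sub by (auto simp: mem_Times_iff)
    qed
    show "continuous_on (cball x0 r \<times> cball 0 R) dspray"
      by (rule continuous_on_subset[OF dspray_cont]) (use sub in auto)
  qed (auto intro: compact_Times convex_Times)
qed

text \<open>While the state is in the large box it moves at speed at most \<open>B\<close>, hence in
  the given time by less than half of either radius. Membership in the chart domain has to be
  carried along, because \<open>state c\<close> describes the curve only there.\<close>

lemma geodesic_stay:
  assumes \<gamma>: "geodesic_on M UNIV \<gamma>" and c: "c \<in> charts M" and sub: "cball x0 r \<subseteq> img c" and rR: "0 < r" "0 < R"
    and bnd: "\<And>z. z \<in> cball x0 r \<times> cball 0 R \<Longrightarrow> norm (Spray c z) \<le> B"
    and start: "\<gamma> t0 \<in> fst c" "state c \<gamma> t0 \<in> cball x0 (r / 2) \<times> cball 0 (R / 2)"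
    and short: "B * \<bar>t - t0\<bar> < min (r / 2) (R / 2)"
  shows "\<gamma> t \<in> fst c \<and> state c \<gamma> t \<in> cball x0 r \<times> cball 0 R"
proof -
  \<comment> \<open>An affine parametrization from \<open>t0\<close> to \<open>t\<close>, which
    covers both directions of time.\<close>
  define q where "q u = t0 + u * (t - t0)" for u
  define P where "P u \<longleftrightarrow> \<gamma> (q u) \<in> fst c \<and> state c \<gamma> (q u) \<in> cball x0 r \<times> cball 0 R" for u
  have \<gamma>c: "continuous_on UNIV \<gamma>" using \<gamma> by (simp add: geodesic_on_def)
  have qc: "isCont q u" for u unfolding q_def by (intro continuous_intros)
  have sc: "isCont (\<lambda>u. state c \<gamma> (q u)) u" if "\<gamma> (q u) \<in> fst c" for u
    using isCont_o2[OF qc geodesic_state_cont[OF \<gamma> open_UNIV UNIV_I c that]] .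
  have "norm (Spray c (x0, 0)) \<le> B" using rR by (intro bnd) auto
  then have B0: "0 \<le> B" by (rule order_trans[OF norm_ge_zero])
  have "P 1"
  proof (rule unit_interval_induct)
    show "P 0" using start rR by (auto simp: P_def q_def mem_Times_iff)
  next
    fix u :: real assume u: "0 < u" "u \<le> 1" and P: "\<And>v. 0 \<le> v \<Longrightarrow> v < u \<Longrightarrow> P v"
    \<comment> \<open>The chart domain need not be closed. The compact set of points with
      coordinates in the closed ball is, so the limit of the curve still belongs to the
      chart.\<close>
    define C where "C = chart_inv c ` cball x0 r"
    have "compact C" unfolding C_def
      using chart_inv_cont[OF c] sub by (intro compact_continuous_image) (auto intro: continuous_on_subset)
    then have "closed C" by (rule compact_imp_closed)
    then have "closed ((\<lambda>u. \<gamma> (q u)) -` C)"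
      using \<gamma>c qc by (intro continuous_closed_vimage) (auto intro!: isCont_o2[OF qc] simp: continuous_on_eq_continuous_at)
    moreover have "{0..<u} \<subseteq> (\<lambda>u. \<gamma> (q u)) -` C"
    proof
      fix v assume "v \<in> {0..<u}"
      then have "P v" using P by auto
      then have "chart_inv c (snd c (\<gamma> (q v))) = \<gamma> (q v)" "snd c (\<gamma> (q v)) \<in> cball x0 r"
        using chart_inv_apply[OF c] by (auto simp: P_def state_def)
      then show "v \<in> (\<lambda>u. \<gamma> (q u)) -` C" unfolding C_def by (metis image_eqI vimageI)
    qed
    ultimately have "closure {0..<u} \<subseteq> (\<lambda>u. \<gamma> (q u)) -` C" by (rule closure_minimal[rotated])
    moreover have "u \<in> closure {0..<u}" using u by (simp add: closure_atLeastLessThan)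
    ultimately have "\<gamma> (q u) \<in> C" by blast
    then have uc: "\<gamma> (q u) \<in> fst c" unfolding C_def using sub chart_inv_in[OF c] by auto
    have "state c \<gamma> (q u) \<in> cball x0 r \<times> cball 0 R"
    proof (rule ccontr)
      assume "state c \<gamma> (q u) \<notin> cball x0 r \<times> cball 0 R"
      then have "state c \<gamma> (q u) \<in> - (cball x0 r \<times> cball 0 R)" by simp
      moreover have "open (- (cball x0 r \<times> cball (0::'e) R))" by (simp add: open_Compl closed_Times)
      ultimately obtain \<delta> where \<delta>: "\<delta> > 0" "\<And>v. \<bar>v - u\<bar> < \<delta> \<Longrightarrow> state c \<gamma> (q v) \<in> - (cball x0 r \<times> cball 0 R)"
        using isCont_open_ball[OF sc[OF uc]] by metis
      define v where "v = max 0 (u - \<delta> / 2)"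
      have "0 \<le> v" "v < u" "\<bar>v - u\<bar> < \<delta>" using \<delta>(1) u by (auto simp: v_def)
      then show False using P \<delta>(2) unfolding P_def by blast
    qed
    then show "P u" using uc by (simp add: P_def)
  next
    fix u :: real assume u: "0 \<le> u" "u < 1" and P: "\<And>v. 0 \<le> v \<Longrightarrow> v \<le> u \<Longrightarrow> P v"
    have "norm (state c \<gamma> (q u) - state c \<gamma> t0) \<le> B * \<bar>q u - t0\<bar>"
    proof (rule vector_mvt_bound[where u' = "\<lambda>s. Spray c (state c \<gamma> s)"])
      fix s assume "s \<in> closed_segment t0 (q u)"
      then obtain w where w: "0 \<le> w" "w \<le> 1" "s = (1 - w) * t0 + w * q u" by (auto simp: closed_segment_def)
      then have "s = q (w * u)" by (simp add: q_def algebra_simps)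
      moreover have "P (w * u)" using u w by (intro P) (auto simp: mult_left_le_one_le)
      ultimately have "\<gamma> s \<in> fst c" "state c \<gamma> s \<in> cball x0 r \<times> cball 0 R" by (auto simp: P_def)
      then show "(state c \<gamma> has_vector_derivative Spray c (state c \<gamma> s)) (at s)" "norm (Spray c (state c \<gamma> s)) \<le> B"
        using geodesic_state(3)[OF \<gamma> open_UNIV UNIV_I c] bnd by auto
    qed
    also have "\<dots> \<le> B * \<bar>t - t0\<bar>"
    proof -
      have "\<bar>q u - t0\<bar> = u * \<bar>t - t0\<bar>" using u by (simp add: q_def abs_mult)
      also have "\<dots> \<le> 1 * \<bar>t - t0\<bar>" using u by (intro mult_right_mono) auto
      finally show ?thesis using B0 by (simp add: mult_left_mono)
    qed
    finally have n: "norm (state c \<gamma> (q u) - state c \<gamma> t0) < min (r / 2) (R / 2)" using short by linarith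
    have n1: "norm (fst (state c \<gamma> (q u)) - fst (state c \<gamma> t0)) < r / 2"
      and n2: "norm (snd (state c \<gamma> (q u)) - snd (state c \<gamma> t0)) < R / 2"
      using n norm_fst_le[of "fst (state c \<gamma> (q u) - state c \<gamma> t0)" "snd (state c \<gamma> (q u) - state c \<gamma> t0)"]
        norm_snd_le[of "snd (state c \<gamma> (q u) - state c \<gamma> t0)" "fst (state c \<gamma> (q u) - state c \<gamma> t0)"]
      by (auto simp flip: minus_prod_def)
    have m1: "norm (fst (state c \<gamma> t0) - x0) \<le> r / 2" and m2: "norm (snd (state c \<gamma> t0)) \<le> R / 2"
      using start(2) by (auto simp: mem_Times_iff dist_norm norm_minus_commute)
    have "norm (fst (state c \<gamma> (q u)) - x0) < r"
      using norm_triangle_ineq[of "fst (state c \<gamma> (q u)) - fst (state c \<gamma> t0)" "fst (state c \<gamma> t0) - x0"] n1 m1 by simp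
    moreover have "norm (snd (state c \<gamma> (q u))) < R"
      using norm_triangle_ineq[of "snd (state c \<gamma> (q u)) - snd (state c \<gamma> t0)" "snd (state c \<gamma> t0)"] n2 m2 by simp
    ultimately have int: "state c \<gamma> (q u) \<in> ball x0 r \<times> ball 0 R"
      by (simp add: mem_Times_iff dist_norm norm_minus_commute)
    have uc: "\<gamma> (q u) \<in> fst c" using P[of u] u by (simp add: P_def)
    obtain \<delta>1 where \<delta>1: "\<delta>1 > 0" "\<And>v. \<bar>v - u\<bar> < \<delta>1 \<Longrightarrow> state c \<gamma> (q v) \<in> ball x0 r \<times> ball 0 R"
      by (rule isCont_open_ball[OF sc[OF uc] _ int]) (auto simp: open_Times)
    obtain \<delta>2 where \<delta>2: "\<delta>2 > 0" "\<And>v. \<bar>v - u\<bar> < \<delta>2 \<Longrightarrow> q v \<in> {t \<in> UNIV. \<gamma> t \<in> fst c}"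
      by (rule isCont_open_ball[OF qc geodesic_chart_open[OF \<gamma> open_UNIV c]]) (use uc in auto)
    have "P v" if "u \<le> v" "v < u + min \<delta>1 \<delta>2" for v
    proof -
      have "\<bar>v - u\<bar> < \<delta>1" "\<bar>v - u\<bar> < \<delta>2" using that by auto
      then show ?thesis using \<delta>1(2) \<delta>2(2) by (force simp: P_def mem_Times_iff)
    qed
    then show "\<exists>e>0. \<forall>v. u \<le> v \<and> v < u + e \<and> v \<le> 1 \<longrightarrow> P v" using \<delta>1(1) \<delta>2(1) by (intro exI[of _ "min \<delta>1 \<delta>2"]) auto
  qed auto
  then show ?thesis by (simp add: P_def q_def)
qed

text \<open>Agreement of position and velocity is locally constant in time. Near a time at which the
  points differ, Hausdorff separation excludes agreement; near a time at which they coincide, both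
  states solve the same Lipschitz equation in one chart.\<close>

theorem geodesic_unique:
  assumes \<gamma>: "geodesic_on M I \<gamma>" and \<eta>: "geodesic_on M I \<eta>" and I: "open I" "connected I" "t0 \<in> I"
    and eq: "\<gamma> t0 = \<eta> t0" "velocity M \<gamma> t0 = velocity M \<eta> t0" and t: "t \<in> I"
  shows "\<gamma> t = \<eta> t \<and> velocity M \<gamma> t = velocity M \<eta> t"
proof (rule connected_induction_simple[OF I(2,3) t, where P = "\<lambda>t. \<gamma> t = \<eta> t \<and> velocity M \<gamma> t = velocity M \<eta> t"])
  fix t1 assume t1: "t1 \<in> I"
  have ct: "isCont \<gamma> t1" "isCont \<eta> t1"
    using \<gamma> \<eta> I t1 unfolding geodesic_on_def by (auto simp: continuous_on_eq_continuous_at)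
  obtain e0 where e0: "e0 > 0" "ball t1 e0 \<subseteq> I" using I(1) t1 by (meson open_contains_ball)
  have op: "openin (top_of_set I) (ball t1 e)" if "e \<le> e0" for e
    using that e0 by (auto simp: openin_open intro!: exI[of _ "ball t1 e"])
  show "\<exists>T. openin (top_of_set I) T \<and> t1 \<in> T \<and>
      (\<forall>x\<in>T. \<forall>y\<in>T. \<gamma> x = \<eta> x \<and> velocity M \<gamma> x = velocity M \<eta> x \<longrightarrow> \<gamma> y = \<eta> y \<and> velocity M \<gamma> y = velocity M \<eta> y)"
  proof (cases "\<gamma> t1 = \<eta> t1")
    case False
    then obtain U V where UV: "open U" "open V" "\<gamma> t1 \<in> U" "\<eta> t1 \<in> V" "U \<inter> V = {}" using hausdorff by metis
    obtain d1 where d1: "d1 > 0" "\<And>v. \<bar>v - t1\<bar> < d1 \<Longrightarrow> \<gamma> v \<in> U" by (rule isCont_open_ball[OF ct(1) UV(1,3)]) blast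
    obtain d2 where d2: "d2 > 0" "\<And>v. \<bar>v - t1\<bar> < d2 \<Longrightarrow> \<eta> v \<in> V" by (rule isCont_open_ball[OF ct(2) UV(2,4)]) blast
    define e where "e = min e0 (min d1 d2)"
    have "\<gamma> x \<noteq> \<eta> x" if "x \<in> ball t1 e" for x
    proof -
      have "\<bar>x - t1\<bar> < e" using that by (simp add: dist_real_def abs_minus_commute)
      then show ?thesis using d1(2)[of x] d2(2)[of x] UV(5) by (auto simp: e_def)
    qed
    then show ?thesis using op[of e] e0 d1 d2 by (intro exI[of _ "ball t1 e"]) (auto simp: e_def)
  next
    case True
    have "\<gamma> t1 \<in> points M" using \<gamma> t1 by (auto simp: geodesic_on_def)
    then obtain c where c: "c \<in> charts M" "\<gamma> t1 \<in> fst c" using chart_exists by blast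
    then have c\<eta>: "\<eta> t1 \<in> fst c" using True by simp
    define x0 where "x0 = snd c (\<gamma> t1)"
    obtain r where r: "r > 0" "cball x0 r \<subseteq> img c"
      using chart_dom(2)[OF c(1)] c(2) unfolding x0_def by (meson open_contains_cball imageI)
    \<comment> \<open>At \<open>t1\<close> only the points are known to coincide, so the box has to
      contain both velocities.\<close>
    define R where "R = norm (velocity M \<gamma> t1 c) + norm (velocity M \<eta> t1 c) + 1"
    interpret C1_field "cball x0 r \<times> cball 0 R" "Spray c" "dSpray c" by (rule spray_field[OF c(1) r(2)])
    obtain L where L: "0 \<le> L" "\<And>z. z \<in> cball x0 r \<times> cball 0 R \<Longrightarrow> norm (dSpray c z) \<le> L" using f'_bounded by blast
    obtain d1 where d1: "d1 > 0" "\<And>v. \<bar>v - t1\<bar> < d1 \<Longrightarrow> state c \<gamma> v \<in> ball x0 r \<times> ball 0 R"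
    proof (rule isCont_open_ball[OF geodesic_state_cont[OF \<gamma> I(1) t1 c], of "ball x0 r \<times> ball 0 R"])
      show "state c \<gamma> t1 \<in> ball x0 r \<times> ball 0 R" using r by (simp add: state_def x0_def R_def add_nonneg_pos)
    qed (auto simp: open_Times)
    obtain d2 where d2: "d2 > 0" "\<And>v. \<bar>v - t1\<bar> < d2 \<Longrightarrow> state c \<eta> v \<in> ball x0 r \<times> ball 0 R"
    proof (rule isCont_open_ball[OF geodesic_state_cont[OF \<eta> I(1) t1 c(1) c\<eta>], of "ball x0 r \<times> ball 0 R"])
      have "norm (velocity M \<eta> t1 c) < R" unfolding R_def by (simp add: add_nonneg_pos)
      then show "state c \<eta> t1 \<in> ball x0 r \<times> ball 0 R" using r True by (simp add: state_def x0_def)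
    qed (auto simp: open_Times)
    obtain d3 where d3: "d3 > 0" "ball t1 d3 \<subseteq> {t \<in> I. \<gamma> t \<in> fst c}"
      by (rule openE[OF geodesic_chart_open[OF \<gamma> I(1) c(1)], of t1]) (use t1 c in auto)
    obtain d4 where d4: "d4 > 0" "ball t1 d4 \<subseteq> {t \<in> I. \<eta> t \<in> fst c}"
      by (rule openE[OF geodesic_chart_open[OF \<eta> I(1) c(1)], of t1]) (use t1 c\<eta> in auto)
    \<comment> \<open>The last entry makes the ball, of diameter \<open>2 * e\<close>, short enough
      for \<open>gronwall_short\<close> with Lipschitz constant \<open>L\<close>.\<close>
    define S where "S = {e0, d1, d2, d3, d4, 1 / (4 * (L + 1))}"
    define e where "e = Min S"
    have "e \<in> S" unfolding e_def by (rule Min_in) (auto simp: S_def)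
    then have e_pos: "e > 0" unfolding S_def using e0(1) d1(1) d2(1) d3(1) d4(1) L(1) by (elim insertE) simp_all
    have "e \<le> x" if "x \<in> S" for x unfolding e_def using that by (intro Min_le) (auto simp: S_def)
    then have e: "e > 0" "e \<le> e0" "e \<le> d1" "e \<le> d2" "e \<le> d3" "e \<le> d4" "e \<le> 1 / (4 * (L + 1))"
      using e_pos unfolding S_def by blast+
    have eL: "2 * e * L \<le> 1 / 2" "2 * e \<le> 1"
    proof -
      have "e * (4 * (L + 1)) \<le> 1" using e(7) L by (simp add: pos_le_divide_eq)
      moreover have "0 \<le> e * L" using e L by simp
      ultimately show "2 * e * L \<le> 1 / 2" "2 * e \<le> 1" using e by (auto simp: algebra_simps)
    qed
    have inK: "\<gamma> s \<in> fst c" "\<eta> s \<in> fst c" "state c \<gamma> s \<in> cball x0 r \<times> cball 0 R" "state c \<eta> s \<in> cball x0 r \<times> cball 0 R" "s \<in> I"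
      if s: "s \<in> ball t1 e" for s
    proof -
      have s': "\<bar>s - t1\<bar> < e" using s by (simp add: dist_real_def)
      have "s \<in> ball t1 d3" "s \<in> ball t1 d4" using s e by auto
      then show "\<gamma> s \<in> fst c" "\<eta> s \<in> fst c" "s \<in> I" using d3(2) d4(2) by auto
      show "state c \<gamma> s \<in> cball x0 r \<times> cball 0 R" "state c \<eta> s \<in> cball x0 r \<times> cball 0 R"
        using d1(2)[of s] d2(2)[of s] s' e by (auto simp: mem_Times_iff)
    qed
    have "\<gamma> y = \<eta> y \<and> velocity M \<gamma> y = velocity M \<eta> y"
      if x: "x \<in> ball t1 e" and y: "y \<in> ball t1 e" and xeq: "\<gamma> x = \<eta> x \<and> velocity M \<gamma> x = velocity M \<eta> x" for x y
    proof -
      have "norm (state c \<gamma> y - state c \<eta> y) \<le> 2 * norm (state c \<gamma> x - state c \<eta> x) + 2 * 0"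
      proof (rule gronwall_short[OF convex_ball x y, where D = "2 * e" and L = L and u' = "\<lambda>s. Spray c (state c \<gamma> s) - Spray c (state c \<eta> s)"])
        fix s assume s: "s \<in> ball t1 e"
        show "((\<lambda>t. state c \<gamma> t - state c \<eta> t) has_vector_derivative Spray c (state c \<gamma> s) - Spray c (state c \<eta> s)) (at s)"
          using inK[OF s] by (intro has_vector_derivative_diff geodesic_state(3)[OF \<gamma> I(1) _ c(1)] geodesic_state(3)[OF \<eta> I(1) _ c(1)])
        show "norm (Spray c (state c \<gamma> s) - Spray c (state c \<eta> s)) \<le> L * norm (state c \<gamma> s - state c \<eta> s) + 0"
          using f_lipschitz[OF L(2) inK(4)[OF s] inK(3)[OF s]] by simp
      qed (use e L eL in \<open>auto simp: dist_real_def\<close>)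
      moreover have "state c \<gamma> x = state c \<eta> x" using xeq by (simp add: state_def)
      ultimately have st: "state c \<gamma> y = state c \<eta> y" by simp
      then have "snd c (\<gamma> y) = snd c (\<eta> y)" "velocity M \<gamma> y c = velocity M \<eta> y c" by (auto simp: state_def)
      then have "\<gamma> y = \<eta> y" using chart_inj[OF c(1) inK(1,2)[OF y]] by simp
      moreover have "velocity M \<gamma> y = velocity M \<eta> y"
      proof -
        have "c \<in> charts_at M (\<gamma> y)" "c \<in> charts_at M (\<eta> y)" using inK[OF y] c(1) by (auto simp: charts_at_def)
        then have "velocity M \<gamma> y = coord_vec M c (\<gamma> y) (velocity M \<gamma> y c)"
          "velocity M \<eta> y = coord_vec M c (\<eta> y) (velocity M \<eta> y c)"
          using geodesic_velocity(2)[OF \<gamma> I(1) inK(5)[OF y], of c] geodesic_velocity(2)[OF \<eta> I(1) inK(5)[OF y], of c] by blast+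
        then show ?thesis using \<open>velocity M \<gamma> y c = velocity M \<eta> y c\<close> \<open>\<gamma> y = \<eta> y\<close> by metis
      qed
      ultimately show ?thesis by simp
    qed
    then have "\<forall>x\<in>ball t1 e. \<forall>y\<in>ball t1 e. \<gamma> x = \<eta> x \<and> velocity M \<gamma> x = velocity M \<eta> x \<longrightarrow>
        \<gamma> y = \<eta> y \<and> velocity M \<gamma> y = velocity M \<eta> y" by blast
    moreover have "openin (top_of_set I) (ball t1 e)" "t1 \<in> ball t1 e" using op[OF e(2)] e(1) by auto
    ultimately show ?thesis by blast
  qed
qed (use eq in auto)

section \<open>Families of geodesics\<close>

definition smooth_at :: "('b::euclidean_space \<Rightarrow> real \<Rightarrow> 'm) \<Rightarrow> ('m, 'e) chart \<Rightarrow> 'b \<Rightarrow> real \<Rightarrow> bool" where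
  "smooth_at G c a0 t \<longleftrightarrow> (\<exists>W X. open W \<and> a0 \<in> W \<and> continuous_on W X \<and>
     (\<forall>a\<in>W. G a t \<in> fst c \<and> ((\<lambda>a. state c (G a) t) has_derivative blinfun_apply (X a)) (at a)))"

text \<open>The parameter set \<open>W\<close> is meant to be common to a range of times: this is
  what allows the derivative \<open>X t a\<close> to be followed in \<open>t\<close> and to satisfy
  the linearized equation.\<close>

definition smooth_flow :: "('b::euclidean_space \<Rightarrow> real \<Rightarrow> 'm) \<Rightarrow> ('m, 'e) chart \<Rightarrow> 'b set \<Rightarrow>
    (real \<Rightarrow> 'b \<Rightarrow> 'b \<Rightarrow>\<^sub>L ('e \<times> 'e)) \<Rightarrow> real \<Rightarrow> bool" where
  "smooth_flow G c W X t \<longleftrightarrow> continuous_on W (X t) \<and>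
     (\<forall>a\<in>W. G a t \<in> fst c \<and> ((\<lambda>a. state c (G a) t) has_derivative blinfun_apply (X t a)) (at a) \<and>
       (\<forall>b. ((\<lambda>t. blinfun_apply (X t a) b) has_vector_derivative dSpray c (state c (G a) t) (X t a b)) (at t)))"

text \<open>Position and velocity change by the tangent map of the transition, which
  \<open>tangent_map_C1\<close> shows to be C1.\<close>

lemma smooth_at_change:
  assumes G: "\<And>a. geodesic_on M UNIV (G a)" and c: "c \<in> charts M" "c' \<in> charts M" "G a0 t \<in> fst c'"
    and sm: "smooth_at G c a0 t"
  shows "smooth_at G c' a0 t"
proof -
  obtain W X where W: "open W" "a0 \<in> W" "continuous_on W X"
    "\<And>a. a \<in> W \<Longrightarrow> G a t \<in> fst c" "\<And>a. a \<in> W \<Longrightarrow> ((\<lambda>a. state c (G a) t) has_derivative blinfun_apply (X a)) (at a)"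
    using sm unfolding smooth_at_def by blast
  define S where "S = snd c ` (fst c \<inter> fst c')"
  have S: "open S" unfolding S_def by (rule overlap_open[OF c(1,2)])
  obtain T' where T': "\<And>z. fst z \<in> S \<Longrightarrow> ((\<lambda>z. (transition c c' (fst z), frechet_derivative (transition c c') (at (fst z)) (snd z)))
      has_derivative blinfun_apply (T' z)) (at z)" "continuous_on (S \<times> UNIV) T'"
    using tangent_map_C1[OF S transition_Ck[OF c(1,2), of 2, folded S_def]] by blast
  have cont: "continuous_on W (\<lambda>a. state c (G a) t)"
    using W(5) by (intro continuous_at_imp_continuous_on ballI) (blast intro: has_derivative_continuous)
  define W' where "W' = W \<inter> (\<lambda>a. state c (G a) t) -` (S \<times> UNIV)"
  have W'o: "open W'" unfolding W'_def
    using cont W(1) S by (intro continuous_open_preimage open_Times) auto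
  have fc': "G a t \<in> fst c'" if a: "a \<in> W'" for a
  proof -
    have "G a t \<in> fst c" "snd c (G a t) \<in> S" using a W(4) by (auto simp: W'_def state_def)
    then obtain w where "w \<in> fst c" "w \<in> fst c'" "snd c (G a t) = snd c w" unfolding S_def by blast
    then show ?thesis using chart_inj[OF c(1) \<open>G a t \<in> fst c\<close>] by simp
  qed
  have a0: "a0 \<in> W'" using W c(3) by (auto simp: W'_def state_def S_def)
  define X' where "X' a = T' (state c (G a) t) o\<^sub>L X a" for a
  have "continuous_on W' X'" unfolding X'_def
    by (intro bounded_bilinear.continuous_on[OF bounded_bilinear_blinfun_compose] continuous_on_compose2[OF T'(2)] continuous_on_subset[OF cont] continuous_on_subset[OF W(3)])
      (auto simp: W'_def)
  moreover have "((\<lambda>a. state c' (G a) t) has_derivative blinfun_apply (X' a)) (at a)" if a: "a \<in> W'" for a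
  proof -
    have aW: "a \<in> W" "fst (state c (G a) t) \<in> S" using a by (auto simp: W'_def mem_Times_iff)
    have "((\<lambda>a. (transition c c' (fst (state c (G a) t)), frechet_derivative (transition c c') (at (fst (state c (G a) t))) (snd (state c (G a) t))))
      has_derivative blinfun_apply (X' a)) (at a)"
      using has_derivative_compose[OF W(5)[OF aW(1)] T'(1)[OF aW(2)]] by (simp add: X'_def blinfun_compose.rep_eq comp_def)
    then show ?thesis
    proof (rule has_derivative_transform_within_open[OF _ W'o a])
      fix b assume b: "b \<in> W'"
      then have bc: "G b t \<in> fst c" "G b t \<in> fst c'" using W(4) fc' by (auto simp: W'_def)
      then have "velocity M (G b) t c' = dtr c c' (G b t) (velocity M (G b) t c)"
        using geodesic_velocity(2)[OF G open_UNIV UNIV_I, of c b t] coord_vec_apply[of c' "G b t" c] c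
        by (metis (no_types, lifting) charts_at_def mem_Collect_eq)
      then show "(transition c c' (fst (state c (G b) t)), frechet_derivative (transition c c') (at (fst (state c (G b) t))) (snd (state c (G b) t)))
        = state c' (G b) t"
        using transition_apply[OF c(1) bc(1)] by (simp add: state_def dtr_def)
    qed
  qed
  ultimately show ?thesis unfolding smooth_at_def using W'o a0 fc' by blast
qed

text \<open>For a short time around \<open>t1\<close>, all geodesics with parameter close to
  \<open>a0\<close> remain in one compact box of the chart. There
  \<open>differentiable_dependence\<close> applies, starting from whichever time \<open>t\<close> of
  the interval smoothness is given at.\<close>

lemma smooth_at_local:
  fixes G :: "'b::euclidean_space \<Rightarrow> real \<Rightarrow> 'm"
  assumes G: "\<And>a. geodesic_on M UNIV (G a)" and c: "c \<in> charts M" "G a0 t1 \<in> fst c"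
  shows "\<exists>\<epsilon>>0. (\<forall>t\<in>ball t1 \<epsilon>. G a0 t \<in> fst c) \<and> (\<forall>t\<in>ball t1 \<epsilon>. smooth_at G c a0 t \<longrightarrow>
    (\<exists>W X. open W \<and> a0 \<in> W \<and> (\<forall>t'\<in>ball t1 \<epsilon>. smooth_flow G c W X t')))"
proof -
  define x0 where "x0 = snd c (G a0 t1)"
  obtain r where r: "r > 0" "cball x0 r \<subseteq> img c"
    using chart_dom(2)[OF c(1)] c(2) unfolding x0_def by (meson open_contains_cball imageI)
  \<comment> \<open>Half of \<open>R\<close> exceeds the coordinate speed at \<open>t1\<close>, so
    the state there lies in the half-size box \<open>?H\<close>; states that start in
    \<open>?H\<close> remain in \<open>?K\<close> for a while.\<close>
  define R where "R = 2 * norm (velocity M (G a0) t1 c) + 2"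
  have R: "R > 0" unfolding R_def by (smt (verit) norm_ge_zero)
  let ?K = "cball x0 r \<times> cball 0 R"
  let ?H = "ball x0 (r / 2) \<times> ball (0::'e) (R / 2)"
  interpret C1_field ?K "Spray c" "dSpray c" by (rule spray_field[OF c(1) r(2)])
  obtain L where L: "0 \<le> L" "\<And>z. z \<in> ?K \<Longrightarrow> norm (dSpray c z) \<le> L" using f'_bounded by blast
  have "continuous_on ?K (Spray c)"
    using f'(1) by (meson continuous_on_eq_continuous_within has_derivative_continuous)
  then have "bounded (Spray c ` ?K)" using K(1) by (intro compact_imp_bounded compact_continuous_image)
  then obtain B where B: "B > 0" "\<And>z. z \<in> ?K \<Longrightarrow> norm (Spray c z) \<le> B" by (auto simp: bounded_pos)
  obtain d1 where d1: "d1 > 0" "\<And>v. \<bar>v - t1\<bar> < d1 \<Longrightarrow> state c (G a0) v \<in> ?H"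
  proof (rule isCont_open_ball[OF geodesic_state_cont[OF G open_UNIV UNIV_I c], of ?H])
    show "state c (G a0) t1 \<in> ?H" using r by (simp add: state_def x0_def R_def)
  qed (auto simp: open_Times)
  obtain d2 where d2: "d2 > 0" "ball t1 d2 \<subseteq> {t \<in> UNIV. G a0 t \<in> fst c}"
    by (rule openE[OF geodesic_chart_open[OF G[of a0] open_UNIV c(1)], of t1]) (use c(2) in auto)
  define m where "m = min (r / 2) (R / 2)"
  have m: "m > 0" using r R by (simp add: m_def)
  \<comment> \<open>Two times in \<open>ball t1 e\<close> differ by at most \<open>2 * e\<close>.
    The third bound yields \<open>2 * e * L \<le> 1 / 2\<close>, and the fourth limits the motion of
    states to \<open>m / 2\<close>.\<close>
  define e where "e = Min {d1, d2, 1 / (4 * (L + 1)), m / (4 * B)}"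
  have e: "e > 0" "e \<le> d1" "e \<le> d2" "e \<le> 1 / (4 * (L + 1))" "e \<le> m / (4 * B)"
    using d1(1) d2(1) L(1) m B(1) by (simp_all add: e_def)
  have eL: "2 * e * L \<le> 1 / 2" "2 * e \<le> 1"
  proof -
    have "e * (4 * (L + 1)) \<le> 1" using e(4) L by (simp add: pos_le_divide_eq)
    moreover have "0 \<le> e * L" using e L by simp
    ultimately show "2 * e * L \<le> 1 / 2" "2 * e \<le> 1" using e by (auto simp: algebra_simps)
  qed
  have dist_T: "\<bar>s - s'\<bar> \<le> 2 * e" if "s \<in> ball t1 e" "s' \<in> ball t1 e" for s s'
    using that by (auto simp: dist_real_def)
  have eB: "B * \<bar>s - s'\<bar> < m" if "s \<in> ball t1 e" "s' \<in> ball t1 e" for s s'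
  proof -
    have "B * \<bar>s - s'\<bar> \<le> B * (2 * e)" using dist_T[OF that] B by (intro mult_left_mono) auto
    also have "\<dots> \<le> m / 2" using e(5) B by (simp add: pos_le_divide_eq field_simps)
    finally show ?thesis using m by simp
  qed
  have inc: "G a0 t \<in> fst c" if "t \<in> ball t1 e" for t
  proof -
    have "t \<in> ball t1 d2" using that e(3) by simp
    then show ?thesis using d2(2) by blast
  qed
  show ?thesis
  proof (intro exI[of _ e] conjI ballI impI)
    fix t assume t: "t \<in> ball t1 e" and sm: "smooth_at G c a0 t"
    obtain W0 X0 where W0: "open W0" "a0 \<in> W0" "continuous_on W0 X0"
      "\<And>a. a \<in> W0 \<Longrightarrow> G a t \<in> fst c" "\<And>a. a \<in> W0 \<Longrightarrow> ((\<lambda>a. state c (G a) t) has_derivative blinfun_apply (X0 a)) (at a)"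
      using sm unfolding smooth_at_def by blast
    have cont: "continuous_on W0 (\<lambda>a. state c (G a) t)"
      using W0(5) by (intro continuous_at_imp_continuous_on ballI) (blast intro: has_derivative_continuous)
    define W where "W = W0 \<inter> (\<lambda>a. state c (G a) t) -` ?H"
    have Wo: "open W" unfolding W_def using cont W0(1) by (intro continuous_open_preimage open_Times) auto
    have a0: "a0 \<in> W" using W0(2) d1(2)[of t] t e(2) by (auto simp: W_def dist_real_def)
    have stay: "G a s \<in> fst c \<and> state c (G a) s \<in> ?K" if a: "a \<in> W" and s: "s \<in> ball t1 e" for a s
    proof (rule geodesic_stay[OF G c(1) r(2,1) R B(2)])
      show "G a t \<in> fst c" "state c (G a) t \<in> cball x0 (r / 2) \<times> cball 0 (R / 2)"
        using a W0(4) by (auto simp: W_def mem_Times_iff)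
      show "B * \<bar>s - t\<bar> < min (r / 2) (R / 2)" using eB[OF s t] by (simp add: m_def)
    qed
    interpret C1_family ?K "Spray c" "dSpray c" L "2 * e" "ball t1 e" t W "\<lambda>a t. state c (G a) t" X0
    proof
      show "(state c (G a) has_vector_derivative Spray c (state c (G a) s)) (at s)" if "a \<in> W" "s \<in> ball t1 e" for a s
        using stay[OF that] geodesic_state(3)[OF G open_UNIV UNIV_I c(1)] by blast
      show "continuous_on W X0" using W0(3) by (rule continuous_on_subset) (auto simp: W_def)
    qed (use L t dist_T eL Wo stay W0(5) in \<open>auto simp: W_def\<close>)
    from differentiable_dependence obtain X where X: "\<forall>s\<in>ball t1 e. (\<forall>a\<in>W. ((\<lambda>a. state c (G a) s) has_derivative blinfun_apply (X s a)) (at a)) \<and>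
      continuous_on W (X s) \<and> (\<forall>a\<in>W. \<forall>b. ((\<lambda>s. blinfun_apply (X s a) b) has_vector_derivative dSpray c (state c (G a) s) (X s a b)) (at s))"
      by blast
    then have "\<forall>s\<in>ball t1 e. smooth_flow G c W X s" using stay by (simp add: smooth_flow_def)
    then show "\<exists>W X. open W \<and> a0 \<in> W \<and> (\<forall>t'\<in>ball t1 e. smooth_flow G c W X t')" using Wo a0 by blast
  qed (use e inc in auto)
qed

text \<open>Stating the property for all charts at \<open>G a0 t\<close> makes the passage between
  charts along the geodesic free of charge; it is then locally constant in \<open>t\<close>.\<close>

lemma smooth_at_all:
  fixes G :: "'b::euclidean_space \<Rightarrow> real \<Rightarrow> 'm"
  assumes G: "\<And>a. geodesic_on M UNIV (G a)" and c0: "c0 \<in> charts M" "smooth_at G c0 a0 0"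
    and c: "c \<in> charts M" "G a0 t \<in> fst c"
  shows "smooth_at G c a0 t"
proof -
  define P where "P t \<longleftrightarrow> (\<forall>c\<in>charts M. G a0 t \<in> fst c \<longrightarrow> smooth_at G c a0 t)" for t
  have "P t"
  proof (rule connected_induction_simple[of UNIV "0::real" t P])
    show "P 0" unfolding P_def using smooth_at_change[where G = G and c = c0] G c0 by blast
    fix t1 :: real
    have "G a0 t1 \<in> points M" using G[of a0] by (auto simp: geodesic_on_def)
    then obtain c1 where c1: "c1 \<in> charts M" "G a0 t1 \<in> fst c1" using chart_exists by blast
    obtain e where e: "e > 0" "\<And>t. t\<in>ball t1 e \<Longrightarrow> G a0 t \<in> fst c1"
      and sm: "\<And>t. t\<in>ball t1 e \<Longrightarrow> smooth_at G c1 a0 t \<Longrightarrow>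
      (\<exists>W X. open W \<and> a0 \<in> W \<and> (\<forall>t'\<in>ball t1 e. smooth_flow G c1 W X t'))"
      using smooth_at_local[where G = G, OF G c1] by blast
    have "P y" if x: "x \<in> ball t1 e" and y: "y \<in> ball t1 e" and Px: "P x" for x y
    proof -
      have "smooth_at G c1 a0 x" using Px e(2)[OF x] c1(1) by (simp add: P_def)
      from sm[OF x this] obtain W X where W: "open W" "a0 \<in> W" "\<forall>t'\<in>ball t1 e. smooth_flow G c1 W X t'" by blast
      have "smooth_flow G c1 W X y" using W(3) y by blast
      then have "smooth_at G c1 a0 y" unfolding smooth_at_def smooth_flow_def using W(1,2) by blast
      then show ?thesis unfolding P_def using smooth_at_change[where G = G and c = c1] G c1(1) by blast
    qed
    then have "\<forall>x\<in>ball t1 e. \<forall>y\<in>ball t1 e. P x \<longrightarrow> P y" by blast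
    moreover have "openin (top_of_set UNIV) (ball t1 e)" "t1 \<in> ball t1 e" using e(1) by auto
    ultimately show "\<exists>T. openin (top_of_set UNIV) T \<and> t1 \<in> T \<and> (\<forall>x\<in>T. \<forall>y\<in>T. P x \<longrightarrow> P y)" by blast
  qed auto
  then show ?thesis using c by (simp add: P_def)
qed

section \<open>Jacobi fields\<close>

definition jacobi :: "('b::euclidean_space \<Rightarrow> real \<Rightarrow> 'm) \<Rightarrow> ('m, 'e) chart \<Rightarrow> 'b \<Rightarrow> 'b \<Rightarrow> real \<Rightarrow> 'e" where
  "jacobi G c a b t = frechet_derivative (\<lambda>a. snd c (G a t)) (at a) b"

text \<open>A function of \<open>t\<close> along the whole geodesic, across charts: a chart is
  picked afresh at every time, and by \<open>jacobi_sq_eq\<close> every other chart gives the same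
  value.\<close>

definition jacobi_sq :: "('b::euclidean_space \<Rightarrow> real \<Rightarrow> 'm) \<Rightarrow> 'b \<Rightarrow> 'b \<Rightarrow> real \<Rightarrow> real" where
  "jacobi_sq G a b t = (let c = (SOME c. c \<in> charts_at M (G a t)) in
     local_metric M c (snd c (G a t)) (jacobi G c a b t) (jacobi G c a b t))"

lemma jacobi_sq_eq:
  fixes G :: "'b::euclidean_space \<Rightarrow> real \<Rightarrow> 'm"
  assumes c: "c \<in> charts M" and W: "open W" "a \<in> W" "\<And>a. a \<in> W \<Longrightarrow> G a t \<in> fst c"
    and d: "((\<lambda>a. snd c (G a t)) has_derivative J) (at a)"
  shows "jacobi G c a b t = J b" "jacobi_sq G a b t = local_metric M c (snd c (G a t)) (J b) (J b)"
proof -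
  have J: "jacobi G c a b t = J b" for b
    using frechet_derivative_at[OF d] by (simp add: jacobi_def)
  then show "jacobi G c a b t = J b" .
  define c' where "c' = (SOME c. c \<in> charts_at M (G a t))"
  have cat: "c \<in> charts_at M (G a t)" using c W by (simp add: charts_at_def)
  then have c': "c' \<in> charts_at M (G a t)" unfolding c'_def by (rule someI)
  have "((\<lambda>a. snd c' (G a t)) has_derivative (\<lambda>h. dtr c c' (G a t) (J h))) (at a)"
    by (rule change_chart_deriv[OF c _ _ _ d W(1,2)]) (use W c' in \<open>auto simp: charts_at_def\<close>)
  then have "jacobi G c' a b t = dtr c c' (G a t) (J b)"
    unfolding jacobi_def using frechet_derivative_at by metis
  then show "jacobi_sq G a b t = local_metric M c (snd c (G a t)) (J b) (J b)"
    unfolding jacobi_sq_def c'_def[symmetric] by (simp add: local_metric_change[OF cat c'])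
qed

text \<open>Supplies the hypotheses of \<open>sqrt_convex_bound\<close>. With \<open>U\<close> the
  covariant derivative of the Jacobi field \<open>J\<close>, one has
  \<open>\<psi> = 2 g(U, J)\<close> and, by the sign of the curvature,
  \<open>\<kappa> \<ge> 2 g(U, U)\<close>; the quadratic inequality is then Cauchy-Schwarz.\<close>

lemma jacobi_sq_local:
  fixes G :: "'b::euclidean_space \<Rightarrow> real \<Rightarrow> 'm"
  assumes npc: "nonpositive_curvature M" and G: "\<And>a. geodesic_on M UNIV (G a)"
    and c: "c \<in> charts M" "G a0 t1 \<in> fst c" and sm: "smooth_at G c a0 t1"
    and Y: "((\<lambda>a. state c (G a) t1) has_derivative Y) (at a0)"
  shows "\<exists>e>0. \<exists>\<psi> \<kappa>. (\<forall>t. \<bar>t - t1\<bar> < e \<longrightarrow> (jacobi_sq G a0 b has_real_derivative \<psi> t) (at t)) \<and>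
    (\<psi> has_real_derivative \<kappa>) (at t1) \<and> (\<psi> t1)\<^sup>2 \<le> 2 * jacobi_sq G a0 b t1 * \<kappa> \<and> 0 \<le> \<kappa> \<and>
    (fst (Y b) = 0 \<longrightarrow> \<kappa> = 2 * local_metric M c (snd c (G a0 t1)) (snd (Y b)) (snd (Y b)))"
proof -
  interpret mc: metric_chart "img c" "local_metric M c" by (rule metric_chart[OF c(1)])
  obtain e W X where e: "e > 0" and W: "open W" "a0 \<in> W" and fl: "\<And>t. t \<in> ball t1 e \<Longrightarrow> smooth_flow G c W X t"
  proof -
    obtain e where e: "e > 0" and *: "\<forall>t\<in>ball t1 e. smooth_at G c a0 t \<longrightarrow>
      (\<exists>W X. open W \<and> a0 \<in> W \<and> (\<forall>t'\<in>ball t1 e. smooth_flow G c W X t'))"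
      using smooth_at_local[where G = G, OF G c] by blast
    have "t1 \<in> ball t1 e" using e by simp
    with * sm obtain W X where "open W" "a0 \<in> W" "\<forall>t'\<in>ball t1 e. smooth_flow G c W X t'" by blast
    with e show thesis by (intro that[of e W X]) auto
  qed
  let ?g = "local_metric M c"
  define x where "x t = snd c (G a0 t)" for t
  define y where "y t = velocity M (G a0) t c" for t
  define J where "J t = fst (blinfun_apply (X t a0) b)" for t
  define K where "K t = snd (blinfun_apply (X t a0) b)" for t
  define U where "U t = K t + mc.Gam (x t) (y t) (J t)" for t
  have inc: "G a0 t \<in> fst c" if "t \<in> ball t1 e" for t using fl[OF that] W by (simp add: smooth_flow_def)
  have x: "x t \<in> img c" "(x has_vector_derivative y t) (at t)"
    and y: "(y has_vector_derivative - mc.Gam (x t) (y t) (y t)) (at t)" if t: "t \<in> ball t1 e" for t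
    using geodesic_state(1,2)[OF G open_UNIV UNIV_I c(1) inc[OF t]] inc[OF t] by (auto simp: x_def[abs_def] y_def[abs_def])
  have JK: "(J has_vector_derivative K t) (at t)"
    "(K has_vector_derivative - mc.dGam (x t) (J t) (y t) (y t) - 2 *\<^sub>R mc.Gam (x t) (y t) (K t)) (at t)"
    if t: "t \<in> ball t1 e" for t
  proof -
    have "((\<lambda>t. blinfun_apply (X t a0) b) has_vector_derivative dSpray c (state c (G a0) t) (X t a0 b)) (at t)"
      using fl[OF t] W unfolding smooth_flow_def by blast
    moreover have "dSpray c (state c (G a0) t) (X t a0 b) =
        (K t, - mc.dGam (x t) (J t) (y t) (y t) - 2 *\<^sub>R mc.Gam (x t) (y t) (K t))"
      using x(1)[OF t] by (subst mc.dspray_apply) (simp_all add: state_def x_def y_def J_def K_def)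
    ultimately have "((\<lambda>t. blinfun_apply (X t a0) b) has_vector_derivative
        (K t, - mc.dGam (x t) (J t) (y t) (y t) - 2 *\<^sub>R mc.Gam (x t) (y t) (K t))) (at t)" by simp
    from bounded_linear.has_vector_derivative[OF bounded_linear_fst this]
      bounded_linear.has_vector_derivative[OF bounded_linear_snd this]
    show "(J has_vector_derivative K t) (at t)"
      "(K has_vector_derivative - mc.dGam (x t) (J t) (y t) (y t) - 2 *\<^sub>R mc.Gam (x t) (y t) (K t)) (at t)"
      by (simp_all add: J_def[abs_def] K_def[abs_def])
  qed
  have sq: "jacobi_sq G a0 b t = ?g (x t) (J t) (J t)" if t: "t \<in> ball t1 e" for t
  proof -
    have "((\<lambda>a. state c (G a) t) has_derivative blinfun_apply (X t a0)) (at a0)"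
      using fl[OF t] W unfolding smooth_flow_def by blast
    from has_derivative_fst[OF this] have "((\<lambda>a. snd c (G a t)) has_derivative (\<lambda>b. fst (X t a0 b))) (at a0)"
      by (simp add: state_def)
    from jacobi_sq_eq(2)[where G = G and t = t and b = b and c = c and W = W and a = a0 and J = "\<lambda>b. fst (X t a0 b)", OF c(1) W _ this] fl[OF t] show ?thesis
      by (simp add: smooth_flow_def x_def J_def)
  qed
  define \<psi> where "\<psi> t = 2 * ?g (x t) (U t) (J t)" for t
  define \<kappa> where "\<kappa> = 2 * ?g (x t1) (U t1) (U t1) - 2 * ?g (x t1) (mc.curv (x t1) (J t1) (y t1) (y t1)) (J t1)"
  have t1: "t1 \<in> ball t1 e" using e by simp
  have 1: "(jacobi_sq G a0 b has_real_derivative \<psi> t) (at t)" if t: "\<bar>t - t1\<bar> < e" for t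
  proof -
    have tb: "t \<in> ball t1 e" using t by (simp add: dist_real_def abs_minus_commute)
    have "((\<lambda>t. ?g (x t) (J t) (J t)) has_real_derivative \<psi> t) (at t)"
      unfolding \<psi>_def U_def by (rule mc.jacobi_norm(1)[OF x[OF tb] y[OF tb] JK[OF tb]])
    then show ?thesis
      by (rule has_field_derivative_transform_within_open[OF _ open_ball tb]) (simp add: sq)
  qed
  have 2: "(\<psi> has_real_derivative \<kappa>) (at t1)"
    unfolding \<psi>_def U_def \<kappa>_def by (rule mc.jacobi_norm(2)[OF x[OF t1] y[OF t1] JK[OF t1]])
  have "?g (x t1) (mc.curv (x t1) (J t1) (y t1) (y t1)) (J t1) \<le> 0"
    by (rule nonpositive[OF npc c(1) x(1)[OF t1]])
  then have \<kappa>: "2 * ?g (x t1) (U t1) (U t1) \<le> \<kappa>" by (simp add: \<kappa>_def)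
  have nn: "0 \<le> ?g (x t1) v v" for v by (rule mc.g_nonneg[OF x(1)[OF t1]])
  have 3: "(\<psi> t1)\<^sup>2 \<le> 2 * jacobi_sq G a0 b t1 * \<kappa>"
  proof -
    have "(\<psi> t1)\<^sup>2 = 4 * (?g (x t1) (U t1) (J t1))\<^sup>2" by (simp add: \<psi>_def power_mult_distrib)
    also have "\<dots> \<le> 4 * (?g (x t1) (U t1) (U t1) * ?g (x t1) (J t1) (J t1))"
      using mc.g_cauchy_schwarz[OF x(1)[OF t1]] by simp
    also have "\<dots> = 2 * jacobi_sq G a0 b t1 * (2 * ?g (x t1) (U t1) (U t1))" by (simp add: sq[OF t1])
    also have "\<dots> \<le> 2 * jacobi_sq G a0 b t1 * \<kappa>" using \<kappa> nn by (intro mult_left_mono) (auto simp: sq[OF t1])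
    finally show ?thesis .
  qed
  \<comment> \<open>Where the field vanishes, the Christoffel term of \<open>U\<close> and the
    curvature term of \<open>\<kappa>\<close> vanish as well.\<close>
  have 4: "\<kappa> = 2 * ?g (snd c (G a0 t1)) (snd (Y b)) (snd (Y b))" if Y0: "fst (Y b) = 0"
  proof -
    have "((\<lambda>a. state c (G a) t1) has_derivative blinfun_apply (X t1 a0)) (at a0)"
      using fl[OF t1] W unfolding smooth_flow_def by blast
    from has_derivative_unique[OF this Y] have "J t1 = 0" "K t1 = snd (Y b)" using Y0 by (auto simp: J_def K_def)
    moreover from this have "U t1 = snd (Y b)" by (simp add: U_def bilinear_rzero[OF mc.Gam_bilinear[OF x(1)[OF t1]]])
    ultimately have "\<kappa> = 2 * ?g (x t1) (snd (Y b)) (snd (Y b))"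
      by (simp add: \<kappa>_def bilinear_rzero[OF mc.g_bilinear[OF x(1)[OF t1]]])
    then show ?thesis by (simp add: x_def)
  qed
  have 5: "0 \<le> \<kappa>" using \<kappa> nn[of "U t1"] by linarith
  show ?thesis using e 1 2 3 4 5 by (intro exI[of _ e] conjI exI[of _ \<psi>] exI[of _ \<kappa>]) auto
qed

end

section \<open>The exponential map and its expansion\<close>

locale hadamard_base = riemannian M
  for M :: "('m::{t2_space,second_countable_topology}, 'e::euclidean_space) riem_mfd" +
  assumes complete: "complete_riemannian M" and npc: "nonpositive_curvature M"
begin

definition geo :: "('m, 'e) chart \<Rightarrow> 'm \<Rightarrow> 'e \<Rightarrow> real \<Rightarrow> 'm" where
  "geo c p a = (SOME \<gamma>. geodesic_on M UNIV \<gamma> \<and> \<gamma> 0 = p \<and> velocity M \<gamma> 0 = coord_vec M c p a)"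

lemma geo:
  assumes "c \<in> charts_at M p"
  shows "geodesic_on M UNIV (geo c p a)" "geo c p a 0 = p" "velocity M (geo c p a) 0 = coord_vec M c p a"
proof -
  have "p \<in> points M" using assms chart_dom(4)[of c] by (auto simp: charts_at_def)
  then have "\<exists>\<gamma>. geodesic_on M UNIV \<gamma> \<and> \<gamma> 0 = p \<and> velocity M \<gamma> 0 = coord_vec M c p a"
    using complete coord_vec_tangent[OF assms, of a] unfolding complete_riemannian_def by blast
  from someI_ex[OF this] show "geodesic_on M UNIV (geo c p a)" "geo c p a 0 = p" "velocity M (geo c p a) 0 = coord_vec M c p a"
    unfolding geo_def by auto
qed

lemma geo_unique:
  assumes "c \<in> charts_at M p" "geodesic_on M I \<gamma>" "open I" "connected I" "0 \<in> I" "t \<in> I"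
    "\<gamma> 0 = p" "velocity M \<gamma> 0 = coord_vec M c p a"
  shows "\<gamma> t = geo c p a t"
  using geodesic_unique[OF assms(2) geodesic_subset[OF geo(1)[OF assms(1)]] assms(3-5) _ _ assms(6), of a]
    geo(2,3)[OF assms(1), of a] assms by simp

text \<open>The exponential map in the linear coordinates that \<open>c\<close> induces on the
  tangent space at \<open>p\<close>, so that its domain is the Euclidean space
  \<open>'e\<close>.\<close>

definition Exp :: "('m, 'e) chart \<Rightarrow> 'm \<Rightarrow> 'e \<Rightarrow> 'm" where
  "Exp c p a = geo c p a 1"

lemma geo_scale:
  assumes "c \<in> charts_at M p"
  shows "geo c p (r *\<^sub>R a) t = geo c p a (r * t)"
  using geo_unique[OF assms geodesic_affine(1)[OF geo(1)[OF assms, of a], of r 0] open_UNIV connected_UNIV, of t "r *\<^sub>R a"]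
    geo(2,3)[OF assms, of a] geodesic_affine(2)[OF geo(1)[OF assms, of a], of r 0 0] coord_vec_scale[OF assms]
  by simp

lemma Exp_scale: "c \<in> charts_at M p \<Longrightarrow> Exp c p (t *\<^sub>R a) = geo c p a t"
  by (simp add: Exp_def geo_scale)

lemma Exp_0: "c \<in> charts_at M p \<Longrightarrow> Exp c p 0 = p"
  using Exp_scale[of c p 0 0] geo(2) by simp

lemma Exp_in: "c \<in> charts_at M p \<Longrightarrow> Exp c p a \<in> points M"
  using geo(1)[of c p a] by (auto simp: Exp_def geodesic_on_def)

text \<open>Comparison with flat space: the Jacobi field that vanishes at time 0 with derivative
  \<open>b\<close> has convex length with initial slope the length of \<open>b\<close>, so at time 1
  it is at least as long as \<open>b\<close>. Its value at time 1 is the derivative of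
  \<open>Exp\<close> applied to \<open>b\<close>.\<close>

lemma Exp_expanding:
  assumes c0: "c0 \<in> charts_at M p" and c: "c \<in> charts M" "Exp c0 p a0 \<in> fst c"
  obtains W X where "open W" "a0 \<in> W" "continuous_on W X"
    "\<And>a. a \<in> W \<Longrightarrow> Exp c0 p a \<in> fst c"
    "\<And>a. a \<in> W \<Longrightarrow> ((\<lambda>a. snd c (Exp c0 p a)) has_derivative blinfun_apply (X a)) (at a)"
    "\<And>a b. a \<in> W \<Longrightarrow> local_metric M c0 (snd c0 p) b b \<le> local_metric M c (snd c (Exp c0 p a)) (X a b) (X a b)"
proof -
  define G where "G = geo c0 p"
  have G: "geodesic_on M UNIV (G a)" for a unfolding G_def by (rule geo(1)[OF c0])
  have c0': "c0 \<in> charts M" "p \<in> fst c0" using c0 by (auto simp: charts_at_def)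
  have st0: "state c0 (G a) 0 = (snd c0 p, a)" for a
    unfolding G_def state_def using geo(2,3)[OF c0] coord_vec_self[OF c0] by simp
  \<comment> \<open>All geodesics of the family start at \<open>p\<close>: the position is constant
    and the velocity coordinate is the parameter.\<close>
  have Y0: "((\<lambda>a. state c0 (G a) 0) has_derivative (\<lambda>b. (0, b))) (at a)" for a
    unfolding st0 by (intro has_derivative_Pair has_derivative_const has_derivative_ident)
  have sm0: "smooth_at G c0 a 0" for a
    unfolding smooth_at_def
  proof (intro exI[of _ UNIV] exI[of _ "\<lambda>_. Blinfun (\<lambda>b. (0, b))"] conjI ballI)
    have "bounded_linear (\<lambda>b::'e. (0::'e, b))" by (intro bounded_linear_Pair bounded_linear_zero bounded_linear_ident)
    then show "((\<lambda>a. state c0 (G a) 0) has_derivative blinfun_apply (Blinfun (\<lambda>b. (0, b)))) (at a)" for a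
      using Y0 by (simp add: bounded_linear_Blinfun_apply)
    show "G a 0 \<in> fst c0" for a unfolding G_def using geo(2)[OF c0] c0' by simp
  qed auto
  have sm: "smooth_at G c a t" if "c \<in> charts M" "G a t \<in> fst c" for c a t
    by (rule smooth_at_all[where G = G, OF G c0'(1) sm0 that])
  have bound: "local_metric M c0 (snd c0 p) b b \<le> jacobi_sq G a b 1" for a b
  proof (cases "b = 0")
    interpret mc: metric_chart "img c0" "local_metric M c0" by (rule metric_chart[OF c0'(1)])
    case True
    \<comment> \<open>\<open>sqrt_convex_bound\<close> requires a positive slope. For
      \<open>b = 0\<close> the claim is that a squared length is nonnegative.\<close>
    obtain c where c: "c \<in> charts M" "G a 1 \<in> fst c" using chart_exists[OF geodesic_in[OF G UNIV_I]] by blast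
    obtain W X where "open W" "a \<in> W" "\<And>a. a \<in> W \<Longrightarrow> G a 1 \<in> fst c"
      "\<And>a. a \<in> W \<Longrightarrow> ((\<lambda>a. state c (G a) 1) has_derivative blinfun_apply (X a)) (at a)"
      using sm[OF c] unfolding smooth_at_def by blast
    from jacobi_sq_eq(2)[where G = G and t = 1 and b = b and c = c and W = W and a = a and J = "\<lambda>b. fst (X a b)",
        OF c(1) this(1,2,3) has_derivative_fst[OF this(4)[OF this(2)], unfolded state_def fst_conv]]
    have "0 \<le> jacobi_sq G a b 1"
      using metric_chart.g_nonneg[OF metric_chart[OF c(1)]] c \<open>a \<in> W\<close> by simp
    then show ?thesis using True bilinear_lzero[OF mc.g_bilinear] c0' by simp
  next
    case False
    interpret mc: metric_chart "img c0" "local_metric M c0" by (rule metric_chart[OF c0'(1)])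
    show ?thesis
    proof (rule sqrt_convex_bound[of "jacobi_sq G a b"])
      show "\<exists>e>0. \<exists>\<psi> \<kappa>. (\<forall>t. \<bar>t - t1\<bar> < e \<longrightarrow> (jacobi_sq G a b has_real_derivative \<psi> t) (at t)) \<and>
        (\<psi> has_real_derivative \<kappa>) (at t1) \<and> (\<psi> t1)\<^sup>2 \<le> 2 * jacobi_sq G a b t1 * \<kappa> \<and> 0 \<le> \<kappa>" for t1
      proof -
        obtain c where c: "c \<in> charts M" "G a t1 \<in> fst c" using chart_exists[OF geodesic_in[OF G UNIV_I]] by blast
        obtain W X where "open W" "a \<in> W" "((\<lambda>a. state c (G a) t1) has_derivative blinfun_apply (X a)) (at a)"
          using sm[OF c] unfolding smooth_at_def by blast
        from jacobi_sq_local[where G = G, OF npc G c sm[OF c] this(3), of b] show ?thesis by blast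
      qed
      have 0: "G a 0 \<in> fst c0" unfolding G_def using geo(2)[OF c0] c0' by simp
      have "snd c0 (G a 0) = snd c0 p" unfolding G_def using geo(2)[OF c0] by simp
      with jacobi_sq_local[where G = G, OF npc G c0'(1) 0 sm0 Y0, of b]
      show "\<exists>e>0. \<exists>\<psi>. (\<forall>t. \<bar>t\<bar> < e \<longrightarrow> (jacobi_sq G a b has_real_derivative \<psi> t) (at t)) \<and>
         (\<psi> has_real_derivative 2 * local_metric M c0 (snd c0 p) b b) (at 0)"
        by auto
      have "((\<lambda>a. snd c0 (G a 0)) has_derivative (\<lambda>b. 0)) (at a)"
        using has_derivative_fst[OF Y0[of a]] by (simp add: state_def)
      from jacobi_sq_eq(2)[where G = G and t = 0 and b = b and c = c0 and W = UNIV and a = a and J = "\<lambda>b. 0",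
          OF c0'(1) open_UNIV UNIV_I _ this] show "jacobi_sq G a b 0 = 0"
        using geo(2)[OF c0] c0' by (simp add: G_def bilinear_lzero[OF mc.g_bilinear])
      show "0 < local_metric M c0 (snd c0 p) b b" using mc.g_pos c0' False by auto
    qed
  qed
  obtain W X where W: "open W" "a0 \<in> W" "continuous_on W X" "\<And>a. a \<in> W \<Longrightarrow> G a 1 \<in> fst c"
    "\<And>a. a \<in> W \<Longrightarrow> ((\<lambda>a. state c (G a) 1) has_derivative blinfun_apply (X a)) (at a)"
    using sm[of c a0 1] c unfolding smooth_at_def Exp_def G_def by blast
  define X' where "X' a = Blinfun fst o\<^sub>L X a" for a
  have X': "blinfun_apply (X' a) b = fst (X a b)" for a b
    by (simp add: X'_def blinfun_compose.rep_eq bounded_linear_Blinfun_apply[OF bounded_linear_fst])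
  have d: "((\<lambda>a. snd c (G a 1)) has_derivative blinfun_apply (X' a)) (at a)" if "a \<in> W" for a
    using has_derivative_fst[OF W(5)[OF that]] by (simp add: state_def X'[abs_def])
  show thesis
  proof (rule that[OF W(1,2)])
    show "continuous_on W X'" unfolding X'_def
      by (intro bounded_bilinear.continuous_on[OF bounded_bilinear_blinfun_compose] continuous_on_const W(3))
    show "Exp c0 p a \<in> fst c" "((\<lambda>a. snd c (Exp c0 p a)) has_derivative blinfun_apply (X' a)) (at a)" if "a \<in> W" for a
      using W(4) d that by (auto simp: Exp_def G_def)
    show "local_metric M c0 (snd c0 p) b b \<le> local_metric M c (snd c (Exp c0 p a)) (X' a b) (X' a b)" if "a \<in> W" for a b
      using bound[of b a] jacobi_sq_eq(2)[where G = G and t = 1 and b = b and c = c and W = W and a = a and J = "blinfun_apply (X' a)",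
          OF c(1) W(1) that W(4) d[OF that]] by (simp add: Exp_def G_def)
  qed
qed

end

section \<open>The exponential map is a covering\<close>

text \<open>The chain rule backwards. The error of \<open>F\<close> is relative to
  \<open>norm (k s - k t)\<close>, which is not yet under control, but the lower bound
  \<open>B\<close> of the injective derivative lets half of the left side absorb it.\<close>

lemma lift_has_vector_derivative:
  fixes F :: "'a::euclidean_space \<Rightarrow> 'b::euclidean_space" and k :: "real \<Rightarrow> 'a"
  assumes F: "(F has_derivative X) (at (k t))" "inj X" and k: "continuous (at t within S) k"
    and Fk: "((\<lambda>s. F (k s)) has_vector_derivative X w) (at t within S)"
  shows "(k has_vector_derivative w) (at t within S)"
proof -
  have linX: "linear X" using F(1) by (rule has_derivative_linear)
  obtain B where B: "B > 0" "\<And>h. B * norm h \<le> norm (X h)"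
    using linear_inj_bounded_below_pos[OF linX F(2)] by blast
  show ?thesis
    unfolding has_vector_derivative_def has_derivative_within_alt
  proof (intro conjI allI impI)
    show "bounded_linear (\<lambda>x. x *\<^sub>R w)" by (rule bounded_linear_scaleR_left)
    fix e :: real assume e: "e > 0"
    \<comment> \<open>The first bound absorbs the multiple of \<open>norm D\<close>; the second
      turns the remaining factor \<open>\<epsilon> * (1 + norm w)\<close> into at most
      \<open>e * B / 2\<close>.\<close>
    define \<epsilon> where "\<epsilon> = min (B / 2) (e * B / (2 * (1 + norm w)))"
    have w1: "1 + norm w > 0" by (smt (verit) norm_ge_zero)
    have \<epsilon>: "\<epsilon> \<le> B / 2" "\<epsilon> \<le> e * B / (2 * (1 + norm w))"
      unfolding \<epsilon>_def by (rule min.cobounded1 min.cobounded2)+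
    have \<epsilon>0: "\<epsilon> > 0" using e B(1) w1 by (simp add: \<epsilon>_def)
    obtain d1 where d1: "d1 > 0" "\<And>y. norm (y - k t) < d1 \<Longrightarrow> norm (F y - F (k t) - X (y - k t)) \<le> \<epsilon> * norm (y - k t)"
      using F(1) \<epsilon>0 unfolding has_derivative_at_alt by meson
    obtain d2 where d2: "d2 > 0" "\<And>s. s \<in> S \<Longrightarrow> dist s t < d2 \<Longrightarrow> dist (k s) (k t) < d1"
      using k d1(1) unfolding continuous_within_eps_delta by blast
    obtain d3 where d3: "d3 > 0" "\<And>s. s \<in> S \<Longrightarrow> norm (s - t) < d3 \<Longrightarrow>
        norm (F (k s) - F (k t) - (s - t) *\<^sub>R X w) \<le> \<epsilon> * norm (s - t)"
      using Fk \<epsilon>0 unfolding has_vector_derivative_def has_derivative_within_alt by meson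
    have "norm (k s - k t - (s - t) *\<^sub>R w) \<le> e * norm (s - t)" if s: "s \<in> S" "norm (s - t) < min d2 d3" for s
    proof -
      define D where "D = k s - k t - (s - t) *\<^sub>R w"
      have 1: "norm (F (k s) - F (k t) - X (k s - k t)) \<le> \<epsilon> * norm (k s - k t)"
        using d1(2)[of "k s"] d2(2)[OF s(1)] s(2) by (simp add: dist_norm)
      have 2: "norm (F (k s) - F (k t) - (s - t) *\<^sub>R X w) \<le> \<epsilon> * norm (s - t)" using d3(2)[OF s(1)] s(2) by simp
      have "X D = (F (k s) - F (k t) - (s - t) *\<^sub>R X w) - (F (k s) - F (k t) - X (k s - k t))"
        by (simp add: D_def linear_diff[OF linX] linear_cmul[OF linX])
      then have "norm (X D) \<le> \<epsilon> * norm (s - t) + \<epsilon> * norm (k s - k t)"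
        using norm_triangle_ineq4[of "F (k s) - F (k t) - (s - t) *\<^sub>R X w" "F (k s) - F (k t) - X (k s - k t)"] 1 2 by simp
      also have "norm (k s - k t) \<le> norm D + norm (s - t) * norm w"
        using norm_triangle_ineq[of D "(s - t) *\<^sub>R w"] by (simp add: D_def)
      finally have "norm (X D) \<le> \<epsilon> * norm (s - t) + \<epsilon> * (norm D + norm (s - t) * norm w)" using \<epsilon>0 by simp
      moreover have "\<epsilon> * norm D \<le> B / 2 * norm D" using \<epsilon> by (intro mult_right_mono) auto
      ultimately have "B / 2 * norm D \<le> \<epsilon> * (1 + norm w) * norm (s - t)"
        using B(2)[of D] by (simp add: algebra_simps)
      also have "\<dots> \<le> e * B / 2 * norm (s - t)"
      proof (intro mult_right_mono)
        have "\<epsilon> * (1 + norm w) \<le> e * B / (2 * (1 + norm w)) * (1 + norm w)" using \<epsilon>(2) w1 by (intro mult_right_mono) auto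
        also have "\<dots> = e * B / 2" using w1 by (metis divide_divide_eq_left less_irrefl nonzero_eq_divide_eq times_divide_eq_left)
        finally show "\<epsilon> * (1 + norm w) \<le> e * B / 2" .
      qed simp
      finally have "B / 2 * norm D \<le> B / 2 * (e * norm (s - t))" by (simp add: mult_ac)
      then show ?thesis using B(1) by (simp add: D_def)
    qed
    then show "\<exists>d>0. \<forall>y\<in>S. norm (y - t) < d \<longrightarrow> norm (k y - k t - (y - t) *\<^sub>R w) \<le> e * norm (y - t)"
      using d2(1) d3(1) by (intro exI[of _ "min d2 d3"]) auto
  qed
qed

text \<open>\<open>\<Omega>\<close> is the union of the open boxes on which equal values force equal
  arguments. It covers the compact \<open>K \<times> K\<close>: on the diagonal by local
  injectivity, off it by separating the values. A uniform neighbourhood of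
  \<open>K \<times> K\<close> therefore lies in it.\<close>

lemma locally_injective_near_compact:
  fixes F :: "'a::euclidean_space \<Rightarrow> 'b::t2_space"
  assumes A: "open A" "continuous_on A F" and loc: "\<And>a. a \<in> A \<Longrightarrow> \<exists>W. open W \<and> a \<in> W \<and> inj_on F W"
    and K: "compact K" "K \<subseteq> A" "inj_on F K" "K \<noteq> {}"
  obtains O' where "open O'" "K \<subseteq> O'" "O' \<subseteq> A" "inj_on F O'"
proof -
  define \<Omega> where "\<Omega> = \<Union>{U \<times> V |U V. open U \<and> open V \<and> U \<subseteq> A \<and> V \<subseteq> A \<and> (\<forall>a\<in>U. \<forall>b\<in>V. F a = F b \<longrightarrow> a = b)}"
  have "open \<Omega>" unfolding \<Omega>_def by (rule open_Union) (auto intro: open_Times)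
  moreover have "K \<times> K \<subseteq> \<Omega>"
  proof clarify
    fix a b assume ab: "a \<in> K" "b \<in> K"
    show "(a, b) \<in> \<Omega>"
    proof (cases "a = b")
      case True
      obtain W where W: "open W" "a \<in> W" "inj_on F W" using loc ab K by blast
      have "open (W \<inter> A)" using W A by blast
      then have "(W \<inter> A) \<times> (W \<inter> A) \<subseteq> \<Omega>"
        unfolding \<Omega>_def using W(3)
        by (intro Union_upper CollectI exI[of _ "W \<inter> A"]) (auto dest: inj_onD)
      then show ?thesis using True W ab K by blast
    next
      case False
      then have "F a \<noteq> F b" using ab K by (auto dest: inj_onD)
      then obtain P Q where PQ: "open P" "open Q" "F a \<in> P" "F b \<in> Q" "P \<inter> Q = {}" using hausdorff by metis
      have o: "open (A \<inter> F -` P)" "open (A \<inter> F -` Q)" using A PQ by (auto intro: continuous_open_preimage)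
      have "(A \<inter> F -` P) \<times> (A \<inter> F -` Q) \<subseteq> \<Omega>"
        unfolding \<Omega>_def using o PQ(5) by (intro Union_upper CollectI exI[of _ "A \<inter> F -` P"] exI[of _ "A \<inter> F -` Q"]) auto
      then show ?thesis using ab K PQ by auto
    qed
  qed
  ultimately obtain e where e: "e > 0" "{x. infdist x (K \<times> K) \<le> e} \<subseteq> \<Omega>"
    using compact_in_open_separated[of "K \<times> K" \<Omega>] K by (auto simp: compact_Times)
  define O' where "O' = (\<Union>k\<in>K. ball k (e / 2))"
  have sub: "(a, b) \<in> \<Omega>" if ab: "a \<in> O'" "b \<in> O'" for a b
  proof -
    obtain k l where kl: "k \<in> K" "dist k a < e / 2" "l \<in> K" "dist l b < e / 2" using ab by (auto simp: O'_def)
    have "infdist (a, b) (K \<times> K) \<le> dist (a, b) (k, l)" using kl by (intro infdist_le) auto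
    also have "\<dots> \<le> dist a k + dist b l" unfolding dist_Pair_Pair by (rule sqrt_sum_squares_le_sum) auto
    also have "\<dots> \<le> e" using kl by (simp add: dist_commute)
    finally show ?thesis using e by auto
  qed
  show thesis
  proof
    show "open O'" by (auto simp: O'_def)
    show "K \<subseteq> O'" using e by (force simp: O'_def)
    show "O' \<subseteq> A" using sub[of a a for a] unfolding \<Omega>_def by blast
    show "inj_on F O'"
    proof (rule inj_onI)
      fix a b assume "a \<in> O'" "b \<in> O'" "F a = F b"
      then show "a = b" using sub[of a b] unfolding \<Omega>_def by blast
    qed
  qed
qed

lemma positive_definite_bound:
  fixes B :: "'a::euclidean_space \<Rightarrow> 'a \<Rightarrow> real"
  assumes B: "bilinear B" "\<And>a. a \<noteq> 0 \<Longrightarrow> 0 < B a a"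
  obtains m where "m > 0" "\<And>a. m * (norm a)\<^sup>2 \<le> B a a"
proof -
  have "continuous_on (sphere 0 1) (\<lambda>a::'a. B a a)"
    by (rule bilinear_family_continuous[where B = "\<lambda>_. B"]) (use B in \<open>auto intro: continuous_intros\<close>)
  moreover have "sphere (0::'a) 1 \<noteq> {}" by simp
  ultimately obtain u where u: "norm u = 1" "\<And>v. norm v = 1 \<Longrightarrow> B u u \<le> B v v"
    using continuous_attains_inf[of "sphere (0::'a) 1" "\<lambda>a. B a a"] by auto
  have "B u u * (norm a)\<^sup>2 \<le> B a a" for a
  proof (cases "a = 0")
    case True then show ?thesis using bilinear_lzero[OF B(1)] by simp
  next
    case False
    have "B u u \<le> B (a /\<^sub>R norm a) (a /\<^sub>R norm a)" using u(2)[of "a /\<^sub>R norm a"] False by simp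
    also have "\<dots> = B a a / (norm a)\<^sup>2"
      by (simp add: bilinear_lmul[OF B(1)] bilinear_rmul[OF B(1)] power2_eq_square divide_inverse)
    finally show ?thesis using False by (simp add: pos_le_divide_eq)
  qed
  moreover have "B u u > 0" using u(1) by (intro B(2)) auto
  ultimately show thesis using that by blast
qed

lemma (in metric_chart) g_upper:
  assumes "cball y0 r \<subseteq> V"
  obtains C where "C > 0" "\<And>y u. y \<in> cball y0 r \<Longrightarrow> g y u u \<le> C * (norm u)\<^sup>2"
proof -
  define S where "S = cball y0 r \<times> sphere (0::'e) 1"
  have cont: "continuous_on S (\<lambda>z. g (fst z) (snd z) (snd z))"
  proof (rule bilinear_family_continuous[where x = fst and B = g])
    show "continuous_on S (\<lambda>z. g (fst z) i j)" for i j
      by (rule continuous_on_compose2[OF g_cont]) (use assms in \<open>auto simp: S_def intro: continuous_intros\<close>)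
  qed (use assms g_bilinear in \<open>auto simp: S_def intro: continuous_intros\<close>)
  have "compact S" unfolding S_def by (intro compact_Times) auto
  from compact_imp_bounded[OF compact_continuous_image[OF cont this]]
  obtain C where C: "C > 0" "\<And>z. z \<in> S \<Longrightarrow> \<bar>g (fst z) (snd z) (snd z)\<bar> \<le> C" by (auto simp: bounded_pos)
  have "g y u u \<le> C * (norm u)\<^sup>2" if y: "y \<in> cball y0 r" for y u
  proof (cases "u = 0")
    case True then show ?thesis using bilinear_lzero[OF g_bilinear, of y] y assms by auto
  next
    case False
    have yV: "y \<in> V" using y assms by auto
    have "g y (u /\<^sub>R norm u) (u /\<^sub>R norm u) \<le> C" using C(2)[of "(y, u /\<^sub>R norm u)"] y False by (simp add: S_def)
    moreover have "g y (u /\<^sub>R norm u) (u /\<^sub>R norm u) = g y u u / (norm u)\<^sup>2"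
      by (simp add: bilinear_lmul[OF g_bilinear[OF yV]] bilinear_rmul[OF g_bilinear[OF yV]] power2_eq_square divide_inverse)
    ultimately show ?thesis using False by (simp add: pos_divide_le_eq)
  qed
  with C(1) show thesis by (rule that)
qed

section \<open>Local sections of the exponential map\<close>

locale hadamard_point = hadamard_base M
  for M :: "('m::{t2_space,second_countable_topology}, 'e::euclidean_space) riem_mfd" +
  fixes c0 :: "('m, 'e) chart" and p0 :: 'm
  assumes c0: "c0 \<in> charts_at M p0"
begin

abbreviation "ex \<equiv> Exp c0 p0"
abbreviation "B0 \<equiv> local_metric M c0 (snd c0 p0)"

lemma B0: "bilinear B0" "a \<noteq> 0 \<Longrightarrow> 0 < B0 a a" "B0 a b = B0 b a"
proof -
  have c: "c0 \<in> charts M" "snd c0 p0 \<in> img c0" using c0 by (auto simp: charts_at_def)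
  interpret mc: metric_chart "img c0" "local_metric M c0" by (rule metric_chart[OF c(1)])
  show "bilinear B0" "a \<noteq> 0 \<Longrightarrow> 0 < B0 a a" "B0 a b = B0 b a"
    using mc.g_bilinear[OF c(2)] mc.g_pos[OF c(2)] mc.g_sym[OF c(2)] by auto
qed

lemma ex_in: "ex a \<in> points M" by (rule Exp_in[OF c0])

lemma ex_cont: "continuous_on UNIV ex"
proof -
  have "isCont ex a" for a
  proof -
    obtain c where c: "c \<in> charts M" "ex a \<in> fst c" using chart_exists[OF ex_in] by blast
    obtain W X where W: "open W" "a \<in> W" "\<And>a. a \<in> W \<Longrightarrow> ex a \<in> fst c"
      "((\<lambda>a. snd c (ex a)) has_derivative blinfun_apply (X a)) (at a)"
      using Exp_expanding[OF c0 c] by metis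
    have "isCont (\<lambda>a. snd c (ex a)) a" using W(4) by (rule has_derivative_continuous)
    moreover have "isCont (chart_inv c) (snd c (ex a))"
      using chart_inv_cont[OF c(1)] chart_dom(2)[OF c(1)] c(2) by (auto simp: continuous_on_eq_continuous_at)
    ultimately have "isCont (\<lambda>a. chart_inv c (snd c (ex a))) a" by (rule isCont_o2)
    moreover have "eventually (\<lambda>a. chart_inv c (snd c (ex a)) = ex a) (nhds a)"
      using W chart_inv_apply[OF c(1)] by (auto simp: eventually_nhds)
    ultimately show ?thesis by (rule isCont_cong[THEN iffD1, rotated])
  qed
  then show ?thesis by (simp add: continuous_on_eq_continuous_at)
qed

lemma chart_preimage_open: "c \<in> charts M \<Longrightarrow> open (ex -` fst c)"
proof -
  assume c: "c \<in> charts M"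
  have "openin (top_of_set UNIV) (UNIV \<inter> ex -` fst c)"
    using ex_in by (intro continuous_openin_preimage[OF ex_cont _ chart_dom(1)[OF c]]) auto
  then show ?thesis by simp
qed

lemma ex_deriv_inj:
  assumes c: "c \<in> charts M" "ex a \<in> fst c" and X: "((\<lambda>a. snd c (ex a)) has_derivative X) (at a)"
  shows "linear X" "inj X" "B0 b b \<le> local_metric M c (snd c (ex a)) (X b) (X b)"
proof -
  obtain W X' where "a \<in> W" "((\<lambda>a. snd c (ex a)) has_derivative blinfun_apply (X' a)) (at a)"
    "\<And>b. B0 b b \<le> local_metric M c (snd c (ex a)) (X' a b) (X' a b)"
    using Exp_expanding[OF c0 c] by metis
  with has_derivative_unique[OF X] show le: "B0 b b \<le> local_metric M c (snd c (ex a)) (X b) (X b)" for b by metis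
  show lin: "linear X" using X by (rule has_derivative_linear)
  interpret mc: metric_chart "img c" "local_metric M c" by (rule metric_chart[OF c(1)])
  have "b = 0" if "X b = 0" for b
    using le[of b] B0(2)[of b] bilinear_lzero[OF mc.g_bilinear, of "snd c (ex a)" 0] c that by force
  then show "inj X" using linear_injective_0[OF lin] by blast
qed

lemma chart_map_inj:
  assumes c: "c \<in> charts M" "ex a \<in> fst c"
  obtains W where "open W" "a \<in> W" "W \<subseteq> ex -` fst c" "inj_on (\<lambda>a. snd c (ex a)) W"
proof -
  obtain W X where W: "open W" "a \<in> W" "continuous_on W X" "\<And>a. a \<in> W \<Longrightarrow> ex a \<in> fst c"
      "\<And>a. a \<in> W \<Longrightarrow> ((\<lambda>a. snd c (ex a)) has_derivative blinfun_apply (X a)) (at a)"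
    using Exp_expanding[OF c0 c] by metis
  note inj = ex_deriv_inj[OF c W(5)[OF W(2)]]
  obtain g' where g': "linear g'" "g' \<circ> blinfun_apply (X a) = id"
    using linear_injective_left_inverse[OF inj(1,2)] by blast
  obtain r where r: "r > 0" "ball a r \<subseteq> W" "inj_on (\<lambda>a. snd c (ex a)) (ball a r)"
  proof (rule has_derivative_locally_injective[of a W g' "\<lambda>a. blinfun_apply (X a)" "\<lambda>a. snd c (ex a)"])
    fix e :: real assume e: "e > 0"
    obtain d where d: "d > 0" "\<And>x. x \<in> W \<Longrightarrow> dist x a < d \<Longrightarrow> dist (X x) (X a) < e"
      using W(2,3) e unfolding continuous_on_iff by metis
    obtain d' where d': "d' > 0" "ball a d' \<subseteq> W" using W(1,2) by (meson open_contains_ball)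
    have "onorm (\<lambda>v. X x v - X a v) < e" if "dist a x < min d d'" for x
    proof -
      have "dist (X x) (X a) < e" using that d' by (intro d(2)) (auto simp: dist_commute)
      then show ?thesis by (simp add: dist_norm norm_blinfun.rep_eq minus_blinfun.rep_eq)
    qed
    then show "\<exists>d>0. \<forall>x. dist a x < d \<longrightarrow> onorm (\<lambda>v. X x v - X a v) < e"
      using d(1) d'(1) by (intro exI[of _ "min d d'"]) auto
  qed (use W g' in \<open>auto simp: linear_conv_bounded_linear\<close>)
  show thesis by (rule that[of "ball a r"]) (use r W in auto)
qed

lemma chart_map_cont: "c \<in> charts M \<Longrightarrow> continuous_on (ex -` fst c) (\<lambda>a. snd c (ex a))"
  by (rule continuous_on_compose2[OF chart_cont]) (auto intro: continuous_on_subset[OF ex_cont])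

text \<open>Expansion of \<open>ex\<close> read backwards: a continuous lift of a differentiable
  curve is differentiable and does not move faster than the curve.\<close>

lemma ex_lift_deriv:
  assumes c: "c \<in> charts M" "\<gamma> t \<in> fst c" and k: "isCont k t"
    and lift: "open S" "t \<in> S" "\<And>s. s \<in> S \<Longrightarrow> ex (k s) = \<gamma> s"
    and \<gamma>: "((\<lambda>s. snd c (\<gamma> s)) has_vector_derivative w) (at t)"
  obtains w' where "(k has_vector_derivative w') (at t)" "B0 w' w' \<le> local_metric M c (snd c (\<gamma> t)) w w"
proof -
  have kt: "ex (k t) = \<gamma> t" using lift by blast
  then have ec: "ex (k t) \<in> fst c" using c by simp
  obtain X where X: "((\<lambda>a. snd c (ex a)) has_derivative X) (at (k t))"
    using Exp_expanding[OF c0 c(1) ec] by metis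
  note inj = ex_deriv_inj[OF c(1) ec X]
  obtain w' where w': "w = X w'" using linear_injective_isomorphism[OF inj(1,2)] by metis
  have "((\<lambda>s. snd c (ex (k s))) has_vector_derivative X w') (at t)"
    by (rule has_vector_derivative_transform_within_open[OF \<gamma>[unfolded w'] lift(1,2)]) (simp add: lift)
  from lift_has_vector_derivative[OF X inj(2) k this] have "(k has_vector_derivative w') (at t)" .
  then show thesis using inj(3)[of w'] kt w' by (intro that) auto
qed

definition section_on :: "('m, 'e) chart \<Rightarrow> 'e set \<Rightarrow> ('e \<Rightarrow> 'e) \<Rightarrow> bool" where
  "section_on c S \<sigma> \<longleftrightarrow> continuous_on S \<sigma> \<and> (\<forall>y\<in>S. ex (\<sigma> y) = chart_inv c y)"

lemma section_unique:
  assumes c: "c \<in> charts M" and S: "connected S" "S \<subseteq> img c" and \<sigma>: "section_on c S \<sigma>" "section_on c S \<tau>"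
    and x: "x \<in> S" "\<sigma> x = \<tau> x" and y: "y \<in> S"
  shows "\<sigma> y = \<tau> y"
proof (rule lift_unique[where C = "ex -` fst c" and p = "\<lambda>a. snd c (ex a)" and T = S and ?g1.0 = \<sigma> and ?g2.0 = \<tau> and a = x, OF _ S(1)])
  fix a assume "a \<in> ex -` fst c"
  then obtain W where W: "open W" "a \<in> W" "W \<subseteq> ex -` fst c" "inj_on (\<lambda>a. snd c (ex a)) W"
    using chart_map_inj[OF c, of a] by auto
  then show "\<exists>W. openin (top_of_set (ex -` fst c)) W \<and> a \<in> W \<and> inj_on (\<lambda>a. snd c (ex a)) W"
    by (intro exI[of _ W]) (auto simp: openin_open)
qed (use assms chart_inv_in[OF c] in \<open>auto simp: section_on_def subset_iff\<close>)

text \<open>Since \<open>ex\<close> expands, derivatives of its sections are bounded by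
  \<open>sqrt (C / m)\<close>, where \<open>C\<close> bounds the metric of the chart from above and
  \<open>m\<close> bounds \<open>B0\<close> from below.\<close>

lemma section_lipschitz:
  assumes c: "c \<in> charts M" and S: "open S" "convex S" "S \<subseteq> img c" and \<sigma>: "section_on c S \<sigma>"
    and C: "\<And>y u. y \<in> S \<Longrightarrow> local_metric M c y u u \<le> C * (norm u)\<^sup>2" "0 \<le> C"
  obtains L where "\<And>y z. y \<in> S \<Longrightarrow> z \<in> S \<Longrightarrow> norm (\<sigma> y - \<sigma> z) \<le> L * norm (y - z)"
proof -
  obtain m where m: "m > 0" "\<And>a. m * (norm a)\<^sup>2 \<le> B0 a a" using positive_definite_bound[OF B0(1,2)] by blast
  define L where "L = sqrt (C / m)"
  have "\<exists>G'. (\<sigma> has_derivative G') (at y) \<and> onorm G' \<le> L" if y: "y \<in> S" for y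
  proof -
    have e: "ex (\<sigma> y) = chart_inv c y" using \<sigma> y by (simp add: section_on_def)
    then have ec: "ex (\<sigma> y) \<in> fst c" using chart_inv_in[OF c] S y by auto
    obtain X where X: "((\<lambda>a. snd c (ex a)) has_derivative X) (at (\<sigma> y))"
      using Exp_expanding[OF c0 c ec] by metis
    note inj = ex_deriv_inj[OF c ec X]
    obtain g' where g': "linear g'" "\<And>x. g' (X x) = x" "\<And>x. X (g' x) = x"
      using linear_injective_isomorphism[OF inj(1,2)] by blast
    have "(\<sigma> has_derivative g') (at y)"
    proof (rule has_derivative_inverse_basic[where f = "\<lambda>a. snd c (ex a)" and g = \<sigma> and T = S, OF X _ _ _ S(1) y])
      show "g' \<circ> X = id" using g' by auto
      show "continuous (at y) \<sigma>" using \<sigma> S y by (simp add: section_on_def continuous_on_eq_continuous_at)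
      show "snd c (ex (\<sigma> z)) = z" if "z \<in> S" for z
        using \<sigma> that S apply_chart_inv[OF c] by (auto simp: section_on_def)
    qed (use g' in \<open>simp add: linear_conv_bounded_linear\<close>)
    moreover have "onorm g' \<le> L"
    proof (rule onorm_le)
      fix u
      have "m * (norm (g' u))\<^sup>2 \<le> B0 (g' u) (g' u)" by (rule m)
      also have "\<dots> \<le> local_metric M c (snd c (ex (\<sigma> y))) u u" using inj(3)[of "g' u"] g' by simp
      also have "snd c (ex (\<sigma> y)) = y" using e apply_chart_inv[OF c] S y by auto
      also have "local_metric M c y u u \<le> C * (norm u)\<^sup>2" by (rule C(1)[OF y])
      finally have "(norm (g' u))\<^sup>2 \<le> C / m * (norm u)\<^sup>2" using m(1) by (simp add: field_simps)
      then have "sqrt ((norm (g' u))\<^sup>2) \<le> sqrt (C / m * (norm u)\<^sup>2)" by (rule real_sqrt_le_mono)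
      moreover have "sqrt (C / m * (norm u)\<^sup>2) = L * norm u"
        unfolding L_def real_sqrt_mult by (simp only: real_sqrt_abs abs_norm_cancel)
      ultimately show "norm (g' u) \<le> L * norm u" by (simp only: real_sqrt_abs abs_norm_cancel)
    qed
    ultimately show ?thesis by blast
  qed
  then obtain G' where G': "\<And>y. y \<in> S \<Longrightarrow> (\<sigma> has_derivative G' y) (at y)" "\<And>y. y \<in> S \<Longrightarrow> onorm (G' y) \<le> L" by metis
  have "norm (\<sigma> y - \<sigma> z) \<le> L * norm (y - z)" if "y \<in> S" "z \<in> S" for y z
    by (rule differentiable_bound[OF S(2) _ G'(2) that(1) that(2)]) (auto intro: has_derivative_at_withinI G'(1))
  then show thesis by (rule that)
qed

text \<open>The radius is enlarged by \<open>unit_interval_induct\<close>. Sections on smaller balls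
  are glued by uniqueness. To go beyond a radius, the Lipschitz bound is decisive: it prevents the
  section from escaping to infinity at the boundary of the ball.\<close>

lemma section_exists:
  assumes c: "c \<in> charts M" and R: "cball x R \<subseteq> img c" "0 < R" and v: "ex v = chart_inv c x"
  obtains \<sigma> where "section_on c (ball x R) \<sigma>" "\<sigma> x = v"
proof -
  interpret mc: metric_chart "img c" "local_metric M c" by (rule metric_chart[OF c])
  obtain C where C: "C > 0" "\<And>y u. y \<in> cball x R \<Longrightarrow> local_metric M c y u u \<le> C * (norm u)\<^sup>2"
    using mc.g_upper[OF R(1)] by blast
  let ?F = "\<lambda>a. snd c (ex a)"
  define P where "P u \<longleftrightarrow> (\<exists>\<sigma>. section_on c (ball x (u * R)) \<sigma> \<and> \<sigma> x = v)" for u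
  have sub: "ball x (u * R) \<subseteq> img c" if "u \<le> 1" for u
  proof -
    have "u * R \<le> 1 * R" using that R by (intro mult_right_mono) auto
    then show ?thesis using R(1) by (auto simp: subset_iff)
  qed
  have "P 1"
  proof (rule unit_interval_induct)
    show "P 0" unfolding P_def by (intro exI[of _ "\<lambda>_. v"]) (simp add: section_on_def)
  next
    fix u :: real assume u: "0 < u" "u \<le> 1" and P: "\<And>w. 0 \<le> w \<Longrightarrow> w < u \<Longrightarrow> P w"
    obtain \<sigma> where \<sigma>: "\<And>w. 0 \<le> w \<Longrightarrow> w < u \<Longrightarrow> section_on c (ball x (w * R)) (\<sigma> w)" "\<And>w. 0 \<le> w \<Longrightarrow> w < u \<Longrightarrow> \<sigma> w x = v"
      using P unfolding P_def by metis
    have agree: "\<sigma> w1 y = \<sigma> w2 y" if w: "0 < w1" "w1 \<le> w2" "w2 < u" and y: "y \<in> ball x (w1 * R)" for w1 w2 y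
    proof (rule section_unique[OF c _ _ _ _ _ _ y])
      have "w1 * R \<le> w2 * R" using w R by (intro mult_right_mono) auto
      then show "section_on c (ball x (w1 * R)) (\<sigma> w2)" using \<sigma>(1)[of w2] w
        unfolding section_on_def by (auto intro: continuous_on_subset)
      show "\<sigma> w1 x = \<sigma> w2 x" using \<sigma>(2) w by simp
    qed (use w u R \<sigma> sub[of w1] in auto)
    \<comment> \<open>The index lies strictly between the relative radius of \<open>y\<close> and
      \<open>u\<close>, so the chosen section is defined in a whole neighbourhood of
      \<open>y\<close>.\<close>
    define \<tau> where "\<tau> y = \<sigma> ((dist x y / R + u) / 2) y" for y
    have mid: "0 < (dist x y / R + u) / 2 \<and> (dist x y / R + u) / 2 < u \<and> dist x y < (dist x y / R + u) / 2 * R"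
      if "y \<in> ball x (u * R)" for y
    proof -
      define q where "q = dist x y / R"
      have q: "0 \<le> q" "q < u" "dist x y = q * R" using that R by (auto simp: q_def pos_divide_less_eq)
      moreover have "q * R < (q + u) / 2 * R" using q R by (intro mult_strict_right_mono) auto
      ultimately show ?thesis using u unfolding q_def[symmetric] by auto
    qed
    have \<tau>_eq: "\<tau> y = \<sigma> w y" if w: "0 < w" "w < u" and y: "y \<in> ball x (w * R)" for w y
    proof -
      have "w * R \<le> u * R" using w R by (intro mult_right_mono) auto
      then have yu: "y \<in> ball x (u * R)" using y by auto
      let ?w = "(dist x y / R + u) / 2"
      show ?thesis
      proof (cases "w \<le> ?w")
        case True
        then show ?thesis using agree[OF w(1) True _ y] mid[OF yu] by (simp add: \<tau>_def)
      next
        case False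
        then show ?thesis using agree[of ?w w y] mid[OF yu] w by (simp add: \<tau>_def)
      qed
    qed
    have "section_on c (ball x (u * R)) \<tau>" unfolding section_on_def
    proof (intro conjI ballI)
      have "isCont \<tau> y" if y: "y \<in> ball x (u * R)" for y
      proof -
        define w where "w = (dist x y / R + u) / 2"
        have w: "0 < w" "w < u" "y \<in> ball x (w * R)" using mid[OF y] by (auto simp: w_def)
        have "continuous_on (ball x (w * R)) (\<sigma> w)" using \<sigma>(1)[of w] w by (simp add: section_on_def)
        then have "continuous_on (ball x (w * R)) \<tau>" by (rule continuous_on_eq) (rule \<tau>_eq[OF w(1,2), symmetric])
        then show ?thesis using w(3) by (simp add: continuous_on_eq_continuous_at)
      qed
      then show "continuous_on (ball x (u * R)) \<tau>" by (simp add: continuous_on_eq_continuous_at)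
      fix y assume y: "y \<in> ball x (u * R)"
      define w where "w = (dist x y / R + u) / 2"
      have w: "0 < w" "w < u" "y \<in> ball x (w * R)" using mid[OF y] by (auto simp: w_def)
      then show "ex (\<tau> y) = chart_inv c y" using \<tau>_eq[OF w] \<sigma>(1)[of w] unfolding section_on_def by (metis less_imp_le)
    qed
    moreover have "\<tau> x = v" using \<sigma>(2)[of "u / 2"] u by (simp add: \<tau>_def)
    ultimately show "P u" unfolding P_def by blast
  next
    fix u :: real assume u: "0 \<le> u" "u < 1" and P: "\<And>w. 0 \<le> w \<Longrightarrow> w \<le> u \<Longrightarrow> P w"
    define K where "K = cball x (u * R)"
    have Ksub: "K \<subseteq> img c"
    proof -
      have "u * R \<le> 1 * R" using u R by (intro mult_right_mono) auto
      then show ?thesis using R(1) by (auto simp: K_def subset_iff)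
    qed
    \<comment> \<open>Being Lipschitz, the section extends to the closed ball \<open>K\<close>. For
      \<open>u = 0\<close> the open ball is empty while \<open>K\<close> is a point, which is why
      this case is separate.\<close>
    obtain \<sigma> where \<sigma>: "section_on c K \<sigma>" "\<sigma> x = v"
    proof (cases "u = 0")
      case True
      then have "section_on c K (\<lambda>_. v)" using v by (auto simp: section_on_def K_def)
      then show thesis by (rule that) simp
    next
      case False
      then have uR: "u * R > 0" using u R by simp
      obtain \<tau> where \<tau>: "section_on c (ball x (u * R)) \<tau>" "\<tau> x = v" using P[OF u(1) order_refl] unfolding P_def by blast
      have "u * R \<le> R" using u R mult_left_le_one_le[of R u] by simp
      then have bs: "ball x (u * R) \<subseteq> cball x R" by (auto simp: subset_iff)
      obtain L where L: "\<And>y z. y \<in> ball x (u * R) \<Longrightarrow> z \<in> ball x (u * R) \<Longrightarrow> norm (\<tau> y - \<tau> z) \<le> L * norm (y - z)"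
        using section_lipschitz[OF c open_ball convex_ball sub[of u] \<tau>(1), of C] C bs u by (auto simp: subset_iff)
      have "uniformly_continuous_on (ball x (u * R)) \<tau>"
      proof (rule lipschitz_on_uniformly_continuous)
        show "\<bar>L\<bar>-lipschitz_on (ball x (u * R)) \<tau>"
        proof (rule lipschitz_onI)
          fix y z assume yz: "y \<in> ball x (u * R)" "z \<in> ball x (u * R)"
          have "L * norm (y - z) \<le> \<bar>L\<bar> * norm (y - z)" by (intro mult_right_mono) auto
          then show "dist (\<tau> y) (\<tau> z) \<le> \<bar>L\<bar> * dist y z" using L[OF yz] by (simp add: dist_norm)
        qed simp
      qed
      then obtain \<rho> where \<rho>: "uniformly_continuous_on (closure (ball x (u * R))) \<rho>" "\<And>y. y \<in> ball x (u * R) \<Longrightarrow> \<tau> y = \<rho> y"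
        using uniformly_continuous_on_extension_on_closure by metis
      have clK: "closure (ball x (u * R)) = K" using uR by (simp add: K_def)
      have \<rho>c: "continuous_on K \<rho>" using \<rho>(1) clK by (simp add: uniformly_continuous_imp_continuous)
      have "ex (\<rho> y) = chart_inv c y" if y: "y \<in> K" for y
      proof -
        obtain s where s: "\<And>n. s n \<in> ball x (u * R)" "s \<longlonglongrightarrow> y"
          using y unfolding clK[symmetric] closure_sequential by blast
        have sK: "\<And>n. s n \<in> K" using s(1) by (auto simp: K_def less_imp_le)
        have "(\<lambda>n. ex (\<rho> (s n))) \<longlonglongrightarrow> ex (\<rho> y)"
        proof (rule isCont_tendsto_compose[of _ ex])
          show "isCont ex (\<rho> y)" using ex_cont by (simp add: continuous_on_eq_continuous_at)
          show "(\<lambda>n. \<rho> (s n)) \<longlonglongrightarrow> \<rho> y" using continuous_on_tendsto_compose[OF \<rho>c s(2) y] sK by simp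
        qed
        moreover have "(\<lambda>n. chart_inv c (s n)) \<longlonglongrightarrow> chart_inv c y"
          by (rule continuous_on_tendsto_compose[OF chart_inv_cont[OF c] s(2)]) (use y sK Ksub in \<open>auto intro: always_eventually\<close>)
        moreover have "ex (\<rho> (s n)) = chart_inv c (s n)" for n
          using \<tau>(1) s(1)[of n] \<rho>(2)[of "s n"] unfolding section_on_def by metis
        ultimately show ?thesis using LIMSEQ_unique by auto
      qed
      then have "section_on c K \<rho>" using \<rho>c by (simp add: section_on_def)
      moreover have "\<rho> x = v" using \<rho>(2)[of x] \<tau>(2) uR by simp
      ultimately show thesis by (rule that)
    qed
    have F\<sigma>: "?F (\<sigma> y) = y" if "y \<in> K" for y
      using \<sigma>(1) that Ksub apply_chart_inv[OF c] by (auto simp: section_on_def)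
    have "compact (\<sigma> ` K)" using \<sigma>(1) by (intro compact_continuous_image) (auto simp: section_on_def K_def)
    moreover have "\<sigma> ` K \<subseteq> ex -` fst c" using \<sigma>(1) Ksub chart_inv_in[OF c] by (auto simp: section_on_def subset_iff)
    moreover have "inj_on ?F (\<sigma> ` K)" using F\<sigma> by (auto intro!: inj_onI)
    moreover have "x \<in> K" using u R by (simp add: K_def)
    ultimately obtain O' where O': "open O'" "\<sigma> ` K \<subseteq> O'" "O' \<subseteq> ex -` fst c" "inj_on ?F O'"
      using locally_injective_near_compact[OF chart_preimage_open[OF c] chart_map_cont[OF c], of "\<sigma> ` K"] chart_map_inj[OF c]
      by (metis empty_iff image_is_empty vimageE)
    have contO: "continuous_on O' ?F" using chart_map_cont[OF c] O'(3) by (rule continuous_on_subset)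
    \<comment> \<open>\<open>h\<close> inverts the chart map near the compact image of
      \<open>\<sigma>\<close>. It is a section over an open set that contains \<open>K\<close>, and
      hence over a larger ball.\<close>
    obtain h where h: "homeomorphism O' (?F ` O') ?F h"
      using invariance_of_domain_homeomorphism[OF O'(1) contO _ O'(4)] by auto
    have "open (?F ` O')" by (rule invariance_of_domain[OF contO O'(1,4)])
    moreover have "K \<subseteq> ?F ` O'" using F\<sigma> O'(2) by (force simp: image_iff)
    ultimately obtain d where d: "d > 0" "{y. infdist y K \<le> d} \<subseteq> ?F ` O'"
      using compact_in_open_separated[of K "?F ` O'"] \<open>x \<in> K\<close> by (auto simp: K_def)
    have big: "ball x (w * R) \<subseteq> ?F ` O'" if w: "w < u + d / R" for w
    proof
      fix y assume y: "y \<in> ball x (w * R)"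
      have "w * R < u * R + d" using w R by (simp add: field_simps)
      then have dy: "dist x y < u * R + d" using y by simp
      have "infdist y K \<le> d"
      proof (cases "dist x y \<le> u * R")
        case True
        then show ?thesis using d(1) by (simp add: K_def infdist_zero)
      next
        case False
        define z where "z = x + (u * R / dist x y) *\<^sub>R (y - x)"
        have pos: "dist x y > 0" using False u R by (smt (verit) mult_nonneg_nonneg)
        have "z \<in> K" using pos u R by (simp add: z_def K_def dist_norm norm_minus_commute)
        moreover have "y - z = (1 - u * R / dist x y) *\<^sub>R (y - x)" by (simp add: z_def algebra_simps)
        then have "dist y z = \<bar>1 - u * R / dist x y\<bar> * dist x y" by (simp add: dist_norm norm_minus_commute)
        then have "dist y z = \<bar>dist x y - u * R\<bar>" using pos
          by (metis abs_mult abs_of_pos left_diff_distrib mult_1 nonzero_eq_divide_eq order_less_irrefl)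
        then have "dist y z = dist x y - u * R" using False by simp
        ultimately show ?thesis using infdist_le[of z K y] dy by simp
      qed
      then show "y \<in> ?F ` O'" using d(2) by auto
    qed
    have "P w" if w: "u \<le> w" "w < u + d / R" "w \<le> 1" for w
    proof -
      have "section_on c (ball x (w * R)) h" unfolding section_on_def
      proof (intro conjI ballI)
        show "continuous_on (ball x (w * R)) h"
          using h big[OF w(2)] by (auto simp: homeomorphism_def intro: continuous_on_subset)
        fix y assume y: "y \<in> ball x (w * R)"
        then have yO: "y \<in> ?F ` O'" using big[OF w(2)] by blast
        then have "?F (h y) = y" "h y \<in> O'" using h by (auto simp: homeomorphism_def)
        then show "ex (h y) = chart_inv c y" using chart_inv_apply[OF c, of "ex (h y)"] O'(3) by auto
      qed
      moreover have "h x = v"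
      proof -
        have "?F v = x" using F\<sigma>[of x] \<sigma>(2) \<open>x \<in> K\<close> by simp
        moreover have "v \<in> O'" using O'(2) \<sigma>(2) \<open>x \<in> K\<close> by auto
        ultimately show ?thesis using h by (metis homeomorphism_apply1)
      qed
      ultimately show ?thesis unfolding P_def by blast
    qed
    then show "\<exists>e>0. \<forall>w. u \<le> w \<and> w < u + e \<and> w \<le> 1 \<longrightarrow> P w" using d(1) R by (intro exI[of _ "d / R"]) auto
  qed auto
  then show thesis using that unfolding P_def by auto
qed

text \<open>Take a ball of radius \<open>r\<close> whose triple lies in the chart. For any preimage
  \<open>w\<close> of a point of it with coordinates \<open>x\<close>, \<open>section_exists\<close>
  gives a section through \<open>w\<close> on the ball of radius \<open>2 * r\<close> around
  \<open>x\<close>, which contains the whole original ball.\<close>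

theorem ex_covering:
  assumes conn: "connected (points M)"
  shows "covering_space UNIV ex (points M)"
proof -
  have nbhd: "\<exists>c y0 r. c \<in> charts M \<and> q \<in> fst c \<and> y0 = snd c q \<and> r > 0 \<and> cball y0 (3 * r) \<subseteq> img c" if q: "q \<in> points M" for q
  proof -
    obtain c where c: "c \<in> charts M" "q \<in> fst c" using chart_exists[OF q] by blast
    obtain r where r: "r > 0" "cball (snd c q) r \<subseteq> img c"
      using chart_dom(2)[OF c(1)] c(2) by (meson open_contains_cball imageI)
    then show ?thesis using c by (intro exI[of _ c] exI[of _ "snd c q"] exI[of _ "r / 3"]) auto
  qed
  have U_open: "openin (top_of_set (points M)) (chart_inv c ` ball y0 r)" if c: "c \<in> charts M" and r: "ball y0 r \<subseteq> img c" for c y0 r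
  proof -
    have "openin (top_of_set (fst c)) (chart_inv c ` ball y0 r)"
      using chart_dom(3)[OF c, THEN homeomorphism_symD] r
      by (intro homeomorphism_imp_open_map[of "img c"]) (auto simp: openin_open_eq[OF chart_dom(2)[OF c]])
    then show ?thesis using chart_dom(1)[OF c] openin_trans by blast
  qed
  have sec: "\<exists>\<sigma>. section_on c (ball y0 r) \<sigma> \<and> \<sigma> (snd c (ex w)) = w"
    if c: "c \<in> charts M" and r: "cball y0 (3 * r) \<subseteq> img c" "r > 0" and w: "ex w \<in> chart_inv c ` ball y0 r" for c y0 r w
  proof -
    obtain x where x: "x \<in> ball y0 r" "ex w = chart_inv c x" using w by auto
    have s: "cball x (2 * r) \<subseteq> img c"
    proof
      fix z assume "z \<in> cball x (2 * r)"
      then have "dist y0 z \<le> 3 * r" using x(1) dist_triangle[of y0 z x] by simp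
      then show "z \<in> img c" using r(1) by auto
    qed
    obtain \<sigma> where \<sigma>: "section_on c (ball x (2 * r)) \<sigma>" "\<sigma> x = w" using section_exists[OF c s _ x(2)] r(2) by auto
    have "ball y0 r \<subseteq> ball x (2 * r)"
    proof
      fix z assume "z \<in> ball y0 r"
      then show "z \<in> ball x (2 * r)" using x(1) dist_triangle[of x z y0] by (simp add: dist_commute)
    qed
    then have "section_on c (ball y0 r) \<sigma>" using \<sigma>(1) by (auto simp: section_on_def intro: continuous_on_subset)
    moreover have "snd c (ex w) = x" using x apply_chart_inv[OF c] s r by (metis centre_in_cball less_imp_le mult_pos_pos subsetD zero_less_numeral)
    ultimately show ?thesis using \<sigma>(2) by blast
  qed
  \<comment> \<open>The range is open and closed: a section through one preimage reaches every point
    over the ball.\<close>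
  have surj: "points M \<subseteq> range ex"
  proof
    fix q assume q: "q \<in> points M"
    show "q \<in> range ex"
    proof (rule connected_induction_simple[OF conn ex_in q, of "\<lambda>q. q \<in> range ex" 0])
      fix q assume q: "q \<in> points M"
      obtain c y0 r where c: "c \<in> charts M" "q \<in> fst c" "y0 = snd c q" "r > 0" "cball y0 (3 * r) \<subseteq> img c" using nbhd[OF q] by blast
      define U where "U = chart_inv c ` ball y0 r"
      have Uo: "openin (top_of_set (points M)) U" unfolding U_def using c by (intro U_open) (auto simp: subset_iff)
      have qU: "q \<in> U" unfolding U_def using c chart_inv_apply[OF c(1,2)] by (metis centre_in_ball imageI)
      have "z \<in> range ex" if yz: "y \<in> U" "z \<in> U" "y \<in> range ex" for y z
      proof -
        obtain w where "y = ex w" using yz by auto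
        then obtain \<sigma> where "section_on c (ball y0 r) \<sigma>" using sec[OF c(1,5,4), of w] yz by (auto simp: U_def)
        moreover obtain z' where "z' \<in> ball y0 r" "z = chart_inv c z'" using yz by (auto simp: U_def)
        ultimately show ?thesis by (metis rangeI section_on_def)
      qed
      then show "\<exists>T. openin (top_of_set (points M)) T \<and> q \<in> T \<and> (\<forall>x\<in>T. \<forall>y\<in>T. x \<in> range ex \<longrightarrow> y \<in> range ex)"
        using Uo qU by blast
    qed simp
  qed
  show ?thesis
  proof
    show "continuous_on UNIV ex" by (rule ex_cont)
    show "range ex = points M" using surj ex_in by auto
    fix q assume q: "q \<in> points M"
    obtain c y0 r where c: "c \<in> charts M" "q \<in> fst c" "y0 = snd c q" "r > 0" "cball y0 (3 * r) \<subseteq> img c" using nbhd[OF q] by blast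
    define B where "B = ball y0 r"
    have Bs: "B \<subseteq> img c" using c by (auto simp: B_def subset_iff)
    define U where "U = chart_inv c ` B"
    \<comment> \<open>The sheets are the images of all sections over \<open>B\<close>: open by
      invariance of domain, and equal or disjoint by uniqueness of sections.\<close>
    define \<V> where "\<V> = {\<sigma> ` B |\<sigma>. section_on c B \<sigma>}"
    have sece: "snd c (ex (\<sigma> y)) = y" "ex (\<sigma> y) \<in> U" if "section_on c B \<sigma>" "y \<in> B" for \<sigma> y
      using that Bs apply_chart_inv[OF c(1)] by (auto simp: section_on_def U_def)
    have Uo: "openin (top_of_set (points M)) U" unfolding U_def using Bs c by (auto simp: B_def intro: U_open)
    moreover have "q \<in> U" unfolding U_def B_def using c chart_inv_apply[OF c(1,2)] by (metis centre_in_ball imageI)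
    moreover have "\<Union>\<V> = UNIV \<inter> ex -` U"
    proof (intro equalityI subsetI)
      fix w assume "w \<in> \<Union>\<V>"
      then show "w \<in> UNIV \<inter> ex -` U" using sece by (auto simp: \<V>_def)
    next
      fix w assume "w \<in> UNIV \<inter> ex -` U"
      then obtain \<sigma> where \<sigma>: "section_on c B \<sigma>" "\<sigma> (snd c (ex w)) = w" using sec[OF c(1,5,4), of w] by (auto simp: U_def B_def)
      moreover have "snd c (ex w) \<in> B" using \<open>w \<in> _\<close> Bs apply_chart_inv[OF c(1)] by (auto simp: U_def)
      ultimately show "w \<in> \<Union>\<V>" unfolding \<V>_def by (metis (mono_tags, lifting) UnionI image_eqI mem_Collect_eq)
    qed
    moreover have "open (\<sigma> ` B)" if "section_on c B \<sigma>" for \<sigma>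
    proof (rule invariance_of_domain)
      show "inj_on \<sigma> B" by (rule inj_on_inverseI[of _ "\<lambda>a. snd c (ex a)"]) (use sece that in auto)
    qed (use that in \<open>auto simp: section_on_def B_def\<close>)
    then have "\<forall>u\<in>\<V>. openin (top_of_set UNIV) u" by (auto simp: \<V>_def)
    moreover have "pairwise disjnt \<V>"
    proof (rule pairwiseI)
      fix S1 S2 assume S: "S1 \<in> \<V>" "S2 \<in> \<V>" "S1 \<noteq> S2"
      then obtain \<sigma>1 \<sigma>2 where \<sigma>: "S1 = \<sigma>1 ` B" "S2 = \<sigma>2 ` B" "section_on c B \<sigma>1" "section_on c B \<sigma>2" by (auto simp: \<V>_def)
      show "disjnt S1 S2"
      proof (rule ccontr)
        assume "\<not> disjnt S1 S2"
        then obtain y1 y2 where y: "y1 \<in> B" "y2 \<in> B" "\<sigma>1 y1 = \<sigma>2 y2" by (auto simp: \<sigma> disjnt_def)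
        then have "y1 = y2" using sece(1)[OF \<sigma>(3) y(1)] sece(1)[OF \<sigma>(4) y(2)] by simp
        then have "\<sigma>1 z = \<sigma>2 z" if "z \<in> B" for z
          using section_unique[OF c(1) _ Bs \<sigma>(3,4) y(1) _ that] y by (simp add: B_def)
        then show False using S(3) \<sigma> by auto
      qed
    qed
    moreover have "\<forall>u\<in>\<V>. \<exists>q. homeomorphism u U ex q"
    proof
      fix u assume "u \<in> \<V>"
      then obtain \<sigma> where \<sigma>: "u = \<sigma> ` B" "section_on c B \<sigma>" by (auto simp: \<V>_def)
      have e: "ex (\<sigma> y) = chart_inv c y" if "y \<in> B" for y using \<sigma>(2) that by (simp add: section_on_def)
      have "homeomorphism u U ex (\<lambda>z. \<sigma> (snd c z))" unfolding homeomorphism_def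
      proof (intro conjI ballI)
        show "continuous_on U (\<lambda>z. \<sigma> (snd c z))"
        proof (rule continuous_on_compose2[of B \<sigma>])
          show "continuous_on B \<sigma>" using \<sigma>(2) by (simp add: section_on_def)
          show "continuous_on U (snd c)" by (rule continuous_on_subset[OF chart_cont[OF c(1)]]) (use Bs chart_inv_in[OF c(1)] in \<open>auto simp: U_def\<close>)
          show "snd c ` U \<subseteq> B" using Bs apply_chart_inv[OF c(1)] by (auto simp: U_def)
        qed
        show "ex ` u = U" by (force simp: \<sigma>(1) U_def e image_iff)
        show "(\<lambda>z. \<sigma> (snd c z)) ` U = u" using Bs apply_chart_inv[OF c(1)] by (force simp: U_def \<sigma>(1) image_iff subset_iff)
        show "continuous_on u ex" by (rule continuous_on_subset[OF ex_cont]) simp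
        show "\<sigma> (snd c (ex a)) = a" if "a \<in> u" for a using that sece(1)[OF \<sigma>(2)] by (auto simp: \<sigma>(1))
        show "ex (\<sigma> (snd c z)) = z" if "z \<in> U" for z using that Bs apply_chart_inv[OF c(1)] e by (auto simp: U_def subset_iff)
      qed
      then show "\<exists>q. homeomorphism u U ex q" by blast
    qed
    ultimately show "\<exists>T. q \<in> T \<and> openin (top_of_set (points M)) T \<and> (\<exists>v. \<Union>v = UNIV \<inter> ex -` T \<and>
        (\<forall>u\<in>v. openin (top_of_set UNIV) u) \<and> pairwise disjnt v \<and> (\<forall>u\<in>v. \<exists>q. homeomorphism u T ex q))"
      by blast
  qed
qed

end

section \<open>The universal covering through the exponential map\<close>

lemma covering_open_map:
  assumes cov: "covering_space C p S" and T: "openin (top_of_set C) T"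
  shows "openin (top_of_set S) (p ` T)"
proof (subst openin_subopen, clarify)
  fix x assume x: "x \<in> T"
  then have "x \<in> C" using openin_imp_subset[OF T] by blast
  then obtain T0 u q where T0: "x \<in> T0" "openin (top_of_set C) T0" "openin (top_of_set S) u" "homeomorphism T0 u p q"
    by (rule covering_space_local_homeomorphism[OF cov])
  have "openin (top_of_set T0) (T \<inter> T0)"
    using T T0(2) by (meson Int_lower2 openin_Int openin_imp_subset openin_subset_trans)
  then have "openin (top_of_set u) (p ` (T \<inter> T0))" by (rule homeomorphism_imp_open_map[OF T0(4)])
  then have "openin (top_of_set S) (p ` (T \<inter> T0))" using T0(3) by (rule openin_trans)
  then show "\<exists>V. openin (top_of_set S) V \<and> p x \<in> V \<and> V \<subseteq> p ` T" using x T0(1) by blast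
qed

text \<open>Where \<open>p\<close> is injective, a point belongs to the image of \<open>g\<close> as
  soon as its projection belongs to the corresponding image of \<open>ex\<close>, and
  \<open>ex\<close> is an open map.\<close>

lemma lift_of_covering_open_map:
  assumes cov: "covering_space E ex S" "covering_space C p S"
    and g: "continuous_on E g" "g ` E \<subseteq> C" "\<And>a. a \<in> E \<Longrightarrow> p (g a) = ex a" and V: "openin (top_of_set E) V"
  shows "openin (top_of_set C) (g ` V)"
proof (subst openin_subopen, clarify)
  fix a assume a: "a \<in> V"
  have VE: "V \<subseteq> E" using V openin_imp_subset by blast
  then have "g a \<in> C" using a g by blast
  then obtain W where W: "openin (top_of_set C) W" "g a \<in> W" "inj_on p W"
    by (rule covering_space_locally_injective[OF cov(2)])
  have "openin (top_of_set E) (V \<inter> (E \<inter> g -` W))"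
    using V continuous_openin_preimage[OF g(1) _ W(1)] g(2) by (auto simp: image_subset_iff_funcset openin_Int)
  then have "openin (top_of_set S) (ex ` (V \<inter> (E \<inter> g -` W)))" by (rule covering_open_map[OF cov(1)])
  then have "openin (top_of_set C) (C \<inter> p -` (ex ` (V \<inter> (E \<inter> g -` W))))"
    using covering_space_imp_surjective[OF cov(2)]
    by (intro continuous_openin_preimage[OF covering_space_imp_continuous[OF cov(2)]]) auto
  then have "openin (top_of_set C) (W \<inter> (C \<inter> p -` (ex ` (V \<inter> (E \<inter> g -` W)))))" using W(1) by (rule openin_Int[rotated])
  moreover have "W \<inter> (C \<inter> p -` (ex ` (V \<inter> (E \<inter> g -` W)))) \<subseteq> g ` V"
  proof
    fix z assume z: "z \<in> W \<inter> (C \<inter> p -` (ex ` (V \<inter> (E \<inter> g -` W))))"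
    then obtain b where b: "b \<in> V" "b \<in> E" "g b \<in> W" "p z = ex b" by auto
    then have "p z = p (g b)" using g(3) by simp
    then have "z = g b" using W(3) b z by (auto dest: inj_onD)
    then show "z \<in> g ` V" using b by blast
  qed
  moreover have "g a \<in> W \<inter> (C \<inter> p -` (ex ` (V \<inter> (E \<inter> g -` W))))" using a VE W(2) g(3) \<open>g a \<in> C\<close> by auto
  ultimately show "\<exists>T. openin (top_of_set C) T \<and> g a \<in> T \<and> T \<subseteq> g ` V" by blast
qed

lemma loops_homotopic:
  assumes "simply_connected S" "path p" "pathfinish p = pathstart p" "path_image p \<subseteq> S"
    "path q" "pathfinish q = pathstart q" "path_image q \<subseteq> S"
  obtains h where "continuous_on ({0..1::real} \<times> {0..1::real}) h" "h ` ({0..1} \<times> {0..1}) \<subseteq> S"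
    "\<And>x. x \<in> {0..1} \<Longrightarrow> h (0, x) = p x" "\<And>x. x \<in> {0..1} \<Longrightarrow> h (1, x) = q x"
    "\<And>t. t \<in> {0..1} \<Longrightarrow> h (t, 0) = h (t, 1)"
proof -
  have "homotopic_loops S p q" using assms unfolding simply_connected_def by blast
  then obtain h where h: "continuous_on ({0..1::real} \<times> {0..1::real}) h" "h \<in> ({0..1} \<times> {0..1}) \<rightarrow> S"
    "\<forall>x\<in>{0..1}. h (0, x) = p x" "\<forall>x\<in>{0..1}. h (1, x) = q x"
    "\<forall>t\<in>{0..1}. pathfinish (h \<circ> Pair t) = pathstart (h \<circ> Pair t)"
    unfolding homotopic_loops by blast
  show thesis
    by (rule that[OF h(1)]) (use h in \<open>auto simp: pathfinish_def pathstart_def\<close>)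
qed

text \<open>The homotopy between the constant loops at \<open>a\<close> and \<open>b\<close> traces
  a path.\<close>

lemma simply_connected_path_between:
  assumes S: "simply_connected S" "a \<in> S" "b \<in> S"
  obtains k where "continuous_on {0..1::real} k" "k ` {0..1} \<subseteq> S" "k 0 = a" "k 1 = b"
proof -
  have const: "path (\<lambda>_::real. x)" "pathfinish (\<lambda>_::real. x) = pathstart (\<lambda>_. x)" "path_image (\<lambda>_::real. x) = {x}" for x :: 'a
    by (auto simp: path_def pathfinish_def pathstart_def path_image_def)
  obtain h where h: "continuous_on ({0..1::real} \<times> {0..1::real}) h" "h ` ({0..1} \<times> {0..1}) \<subseteq> S"
    "\<And>x. x \<in> {0..1} \<Longrightarrow> h (0, x) = a" "\<And>x. x \<in> {0..1} \<Longrightarrow> h (1, x) = b"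
    by (rule loops_homotopic[OF S(1) const(1)[of a] const(2)[of a] _ const(1)[of b] const(2)[of b]])
      (use S const(3) in auto)
  show thesis
  proof (rule that[of "\<lambda>t. h (t, 0)"])
    show "continuous_on {0..1} (\<lambda>t. h (t, 0))"
      by (rule continuous_on_compose2[OF h(1)]) (auto intro!: continuous_intros)
  qed (use h in auto)
qed

text \<open>Surjectivity: a path in \<open>C\<close> from \<open>g 0\<close> is projected and lifted
  through \<open>ex\<close>, and \<open>g\<close> takes the result back to the path. Injectivity: if
  \<open>g v = g w\<close>, then \<open>g\<close> maps the segment to a loop, which is contracted in
  \<open>C\<close>; the lift of this contraction through \<open>ex\<close> forces the ends of the
  segment together.\<close>

theorem lift_of_covering_homeomorphism:
  fixes ex :: "'a::real_normed_vector \<Rightarrow> 'b::topological_space" and p :: "'c::t2_space \<Rightarrow> 'b"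
  assumes cov: "covering_space UNIV ex S" "covering_space C p S" and sc: "simply_connected C"
    and g: "continuous_on UNIV g" "range g \<subseteq> C" "\<And>a. p (g a) = ex a"
  shows "homeomorphism UNIV C g (inv g)"
proof -
  have pcont: "continuous_on C p" and pim: "p ` C = S"
    using cov(2) covering_space_imp_continuous covering_space_imp_surjective by blast+
  have "C \<subseteq> range g"
  proof
    fix q assume q: "q \<in> C"
    obtain k where k: "continuous_on {0..1::real} k" "k ` {0..1} \<subseteq> C" "k 0 = g 0" "k 1 = q"
      using simply_connected_path_between[OF sc, of "g 0" q] g q by blast
    have "continuous_on {0..1} (\<lambda>t. p (k t))" by (rule continuous_on_compose2[OF pcont k(1,2)])
    moreover have "(\<lambda>t. p (k t)) ` {0..1} \<subseteq> S" using k pim by auto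
    moreover have "ex 0 = p (k 0)" using k g by metis
    ultimately obtain \<sigma> where \<sigma>: "continuous_on {0..1} \<sigma>" "\<sigma> 0 = 0" "\<And>t. t \<in> {0..1} \<Longrightarrow> ex (\<sigma> t) = p (k t)"
      using covering_path_lift[OF cov(1), where g = "\<lambda>t. p (k t)" and a = 0] by auto
    have "k 1 = g (\<sigma> 1)"
    proof (rule covering_lift_unique[where T = "{0..1}" and ?g1.0 = k and ?g2.0 = "\<lambda>t. g (\<sigma> t)" and a = 0, OF cov(2)])
      show "continuous_on {0..1} (\<lambda>t. g (\<sigma> t))" by (rule continuous_on_compose2[OF g(1) \<sigma>(1)]) auto
    qed (use k \<sigma> g in auto)
    then show "q \<in> range g" using k(4) by blast
  qed
  then have im: "range g = C" using g(2) by blast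
  have inj: "inj g"
  proof (rule injI)
    fix v w assume vw: "g v = g w"
    have l: "continuous_on {0..1::real} (\<lambda>x. v + x *\<^sub>R (w - v))" by (intro continuous_intros)
    have loop: "path (\<lambda>x. g (v + x *\<^sub>R (w - v)))" unfolding path_def by (rule continuous_on_compose2[OF g(1) l]) auto
    have const: "path (\<lambda>_::real. g v)" by (auto simp: path_def)
    obtain h where h: "continuous_on ({0..1::real} \<times> {0..1::real}) h" "h ` ({0..1} \<times> {0..1}) \<subseteq> C"
      "\<And>x. x \<in> {0..1} \<Longrightarrow> h (0, x) = g (v + x *\<^sub>R (w - v))" "\<And>x. x \<in> {0..1} \<Longrightarrow> h (1, x) = g v"
      "\<And>t. t \<in> {0..1} \<Longrightarrow> h (t, 0) = h (t, 1)"
      by (rule loops_homotopic[OF sc loop _ _ const])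
        (use vw g(2) in \<open>auto simp: pathfinish_def pathstart_def path_image_def\<close>)
    have ph: "continuous_on ({0..1} \<times> {0..1}) (\<lambda>z. p (h z))" "(\<lambda>z. p (h z)) ` ({0..1} \<times> {0..1}) \<subseteq> S"
      using continuous_on_compose2[OF pcont h(1,2)] h(2) pim by auto
    obtain k where k: "continuous_on ({0..1} \<times> {0..1}) k"
      "\<And>y. y \<in> {0..1} \<Longrightarrow> k (0, y) = v + y *\<^sub>R (w - v)" "\<And>z. z \<in> {0..1} \<times> {0..1} \<Longrightarrow> ex (k z) = p (h z)"
      by (rule covering_homotopy_lift[OF cov(1) ph l]) (use h(3) g(3) in auto)
    have kc: "continuous_on {0..1} (\<lambda>t. k (\<alpha> t))" if "continuous_on {0..1} \<alpha>" "\<alpha> ` {0..1} \<subseteq> {0..1} \<times> {0..1}" for \<alpha> :: "real \<Rightarrow> real \<times> real"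
      by (rule continuous_on_compose2[OF k(1) that])
    \<comment> \<open>The contraction ends in a constant loop, so its lift is constant along that
      edge.\<close>
    have end1: "k (1, 0) = k (1, 1)"
      by (rule covering_lift_unique[where T = "{0..1::real}" and ?g1.0 = "\<lambda>x. k (1, 0)" and ?g2.0 = "\<lambda>x. k (1, x)" and a = 0, OF cov(1)])
        (use k h in \<open>auto intro!: kc continuous_intros\<close>)
    \<comment> \<open>The two other edges lift the same path, since the contraction runs through
      loops; they meet at time 1, hence also at time 0.\<close>
    have "k (0, 0) = k (0, 1)"
      by (rule covering_lift_unique[where T = "{0..1::real}" and ?g1.0 = "\<lambda>t. k (t, 0)" and ?g2.0 = "\<lambda>t. k (t, 1)" and a = 1, OF cov(1)])
        (use k h end1 in \<open>auto intro!: kc continuous_intros\<close>)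
    then show "v = w" using k(2)[of 0] k(2)[of 1] by simp
  qed
  have op: "openin (top_of_set C) (g ` V)" if "openin (top_of_set UNIV) V" for V
    by (rule lift_of_covering_open_map[OF cov g(1,2) _ that]) (use g in auto)
  have "continuous_on C (inv g)"
    by (rule continuous_on_inverse_open_map[OF g(1) im _ op]) (use inj in auto)
  then show ?thesis using im inj g(1) by (auto simp: homeomorphism_def surj_f_inv_f f_inv_into_f)
qed

locale universal_cover = hadamard_base M
  for M :: "('m::{t2_space,second_countable_topology}, 'e::euclidean_space) riem_mfd" +
  fixes Mt :: "('c::{t2_space,second_countable_topology}, 'e) riem_mfd" and \<pi> :: "'c \<Rightarrow> 'm"
  assumes conn: "connected (points M)" and cov: "universal_riemannian_covering Mt \<pi> M"

sublocale universal_cover \<subseteq> mt: riemannian Mt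
  using cov by unfold_locales (auto simp: universal_riemannian_covering_def riemannian_manifold_def)

context universal_cover
begin

lemma covering: "covering_space (points Mt) \<pi> (points M)" "simply_connected (points Mt)"
  using cov by (auto simp: universal_riemannian_covering_def)

lemma proj_cont: "continuous_on (points Mt) \<pi>" and proj_in: "q \<in> points Mt \<Longrightarrow> \<pi> q \<in> points M"
  and proj_surj: "p \<in> points M \<Longrightarrow> \<exists>q\<in>points Mt. \<pi> q = p"
  using covering_space_imp_continuous[OF covering(1)] covering_space_imp_surjective[OF covering(1)] by (auto, metis imageE)

abbreviation based :: "('m, 'e) chart \<Rightarrow> 'c \<Rightarrow> bool" where
  "based c q \<equiv> q \<in> points Mt \<and> c \<in> charts_at M (\<pi> q)"

lemma based_exists: "q \<in> points Mt \<Longrightarrow> \<exists>c. based c q"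
  using chart_exists[OF proj_in] unfolding charts_at_def by blast

text \<open>The choice is harmless, as a lift is determined by its value at 0. The coordinates are
  those of the tangent space at \<open>\<pi> q\<close>, so all points of one fibre share
  them.\<close>

definition Ext :: "('m, 'e) chart \<Rightarrow> 'c \<Rightarrow> 'e \<Rightarrow> 'c" where
  "Ext c q = (SOME g. continuous_on UNIV g \<and> range g \<subseteq> points Mt \<and> g 0 = q \<and> (\<forall>a. \<pi> (g a) = Exp c (\<pi> q) a))"

definition Log :: "('m, 'e) chart \<Rightarrow> 'c \<Rightarrow> 'c \<Rightarrow> 'e" where
  "Log c q = inv (Ext c q)"

lemma Exp_cov: assumes "based c q" shows "covering_space UNIV (Exp c (\<pi> q)) (points M)"
proof -
  interpret hadamard_point M c "\<pi> q" using assms by unfold_locales auto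
  show ?thesis using conn by (rule ex_covering)
qed

text \<open>The contraction \<open>Exp c (\<pi> q) (t *\<^sub>R a)\<close> of the exponential map to
  a constant is lifted, beginning with the constant \<open>q\<close>; its final stage is the desired
  lift.\<close>

lemma Ext_spec:
  assumes b: "based c q"
  shows "continuous_on UNIV (Ext c q) \<and> range (Ext c q) \<subseteq> points Mt \<and> Ext c q 0 = q \<and> (\<forall>a. \<pi> (Ext c q a) = Exp c (\<pi> q) a)"
proof -
  have ex: "continuous_on UNIV (Exp c (\<pi> q))" "range (Exp c (\<pi> q)) \<subseteq> points M"
    using Exp_cov[OF b] covering_space_imp_continuous covering_space_imp_surjective by blast+
  have h: "continuous_on ({0..1::real} \<times> UNIV) (\<lambda>z. Exp c (\<pi> q) (fst z *\<^sub>R snd z))"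
    by (rule continuous_on_compose2[OF ex(1)]) (auto intro!: continuous_intros)
  obtain k where k: "continuous_on ({0..1} \<times> UNIV) k" "k ` ({0..1} \<times> UNIV) \<subseteq> points Mt"
    "\<And>y. k (0, y) = q" "\<And>z. z \<in> {0..1} \<times> UNIV \<Longrightarrow> \<pi> (k z) = Exp c (\<pi> q) (fst z *\<^sub>R snd z)"
    by (rule covering_homotopy_lift[OF covering(1) h, where f = "\<lambda>_. q"]) (use ex(2) b Exp_0 in auto)
  have kc: "continuous_on UNIV (\<lambda>x. k (\<alpha> x))" if "continuous_on UNIV \<alpha>" "range \<alpha> \<subseteq> {0..1} \<times> UNIV" for \<alpha> :: "'e \<Rightarrow> real \<times> 'e"
    by (rule continuous_on_compose2[OF k(1) that])
  have "continuous_on UNIV (\<lambda>a. k (1, a))" by (rule kc) (auto intro!: continuous_intros)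
  moreover have "k (1, 0) = q"
  proof -
    have "k (0, 0) = k (1, 0)"
    proof (rule covering_lift_unique[where T = "{0..1::real}" and ?g1.0 = "\<lambda>t. k (0, 0)" and ?g2.0 = "\<lambda>t. k (t, 0)" and a = 0, OF covering(1)])
      show "continuous_on {0..1} (\<lambda>t. k (t, 0))" by (rule continuous_on_compose2[OF k(1)]) (auto intro!: continuous_intros)
    qed (use k b Exp_0[of c "\<pi> q"] in \<open>auto simp del: k(3) simp: image_subset_iff\<close>)
    then show ?thesis using k(3) by simp
  qed
  moreover have "range (\<lambda>a. k (1, a)) \<subseteq> points Mt" using k(2) by auto
  moreover have "\<forall>a. \<pi> (k (1, a)) = Exp c (\<pi> q) a" using k(4) by auto
  ultimately have "\<exists>g. continuous_on UNIV g \<and> range g \<subseteq> points Mt \<and> g 0 = q \<and> (\<forall>a. \<pi> (g a) = Exp c (\<pi> q) a)" by blast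
  then show ?thesis unfolding Ext_def by (rule someI_ex)
qed

lemma Ext:
  assumes "based c q"
  shows "continuous_on UNIV (Ext c q)" "Ext c q a \<in> points Mt" "Ext c q 0 = q" "\<pi> (Ext c q a) = Exp c (\<pi> q) a"
  using Ext_spec[OF assms] by auto

lemma Ext_homeomorphism: "based c q \<Longrightarrow> homeomorphism UNIV (points Mt) (Ext c q) (Log c q)"
  unfolding Log_def by (rule lift_of_covering_homeomorphism[OF Exp_cov covering]) (use Ext[of q c] in \<open>simp_all add: image_subset_iff\<close>)

lemma Log:
  assumes "based c q"
  shows "continuous_on (points Mt) (Log c q)" "Log c q (Ext c q a) = a" "z \<in> points Mt \<Longrightarrow> Ext c q (Log c q z) = z"
    "Log c q q = 0"
  using Ext_homeomorphism[OF assms] Ext(3)[OF assms] by (auto simp: homeomorphism_def) metis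

end

section \<open>Lengths of curves in the universal covering\<close>

lemma C1_curve_on_subset:
  assumes "C1_curve_on M a b \<gamma>" "{u..v} \<subseteq> {a..b}"
  shows "C1_curve_on M u v \<gamma>"
  unfolding C1_curve_on_def
proof (intro conjI ballI)
  have "continuous_on {a..b} \<gamma>" "\<gamma> ` {a..b} \<subseteq> points M" using assms(1) by (auto simp: C1_curve_on_def)
  then show "continuous_on {u..v} \<gamma>" "\<gamma> ` {u..v} \<subseteq> points M"
    using assms(2) continuous_on_subset by (blast, blast)
  fix c assume "c \<in> charts M"
  then obtain D where D: "continuous_on {t \<in> {a..b}. \<gamma> t \<in> fst c} D"
    "\<And>t. t \<in> {a..b} \<Longrightarrow> \<gamma> t \<in> fst c \<Longrightarrow> ((snd c \<circ> \<gamma>) has_vector_derivative D t) (at t within {a..b})"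
    using assms(1) unfolding C1_curve_on_def by blast
  have "continuous_on {t \<in> {u..v}. \<gamma> t \<in> fst c} D"
    by (rule continuous_on_subset[OF D(1)]) (use assms(2) in blast)
  moreover have "((snd c \<circ> \<gamma>) has_vector_derivative D t) (at t within {u..v})" if "t \<in> {u..v}" "\<gamma> t \<in> fst c" for t
    by (rule has_vector_derivative_within_subset[OF D(2) assms(2)]) (use that assms(2) in blast)+
  ultimately show "\<exists>D. continuous_on {t \<in> {u..v}. \<gamma> t \<in> fst c} D \<and>
      (\<forall>t\<in>{u..v}. \<gamma> t \<in> fst c \<longrightarrow> ((snd c \<circ> \<gamma>) has_vector_derivative D t) (at t within {u..v}))" by blast
qed

lemma piecewise_C1_pieces:
  assumes "piecewise_C1_curve M \<gamma>"
  obtains S where "finite S" "\<And>u v. 0 \<le> u \<Longrightarrow> u < v \<Longrightarrow> v \<le> 1 \<Longrightarrow> {u<..<v} \<inter> S = {} \<Longrightarrow> C1_curve_on M u v \<gamma>"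
proof -
  obtain S where S: "finite S" "0 \<in> S" "1 \<in> S"
    "\<And>a b. a \<in> S \<Longrightarrow> b \<in> S \<Longrightarrow> a < b \<Longrightarrow> {a<..<b} \<inter> S = {} \<Longrightarrow> C1_curve_on M a b \<gamma>"
    using assms unfolding piecewise_C1_curve_def by (metis insert_subset)
  have "C1_curve_on M u v \<gamma>" if uv: "0 \<le> u" "u < v" "v \<le> 1" "{u<..<v} \<inter> S = {}" for u v
  proof -
    define a b where "a = Max {s \<in> S. s \<le> u}" and "b = Min {s \<in> S. v \<le> s}"
    have A: "finite {s \<in> S. s \<le> u}" "{s \<in> S. s \<le> u} \<noteq> {}" and B: "finite {s \<in> S. v \<le> s}" "{s \<in> S. v \<le> s} \<noteq> {}"
      using S uv by auto
    have a: "a \<in> S" "a \<le> u" "\<And>s. s \<in> S \<Longrightarrow> s \<le> u \<Longrightarrow> s \<le> a" using Max_in[OF A] A by (auto simp: a_def)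
    have b: "b \<in> S" "v \<le> b" "\<And>s. s \<in> S \<Longrightarrow> v \<le> s \<Longrightarrow> b \<le> s" using Min_in[OF B] B by (auto simp: b_def)
    have "{a<..<b} \<inter> S = {}"
    proof (rule ccontr)
      assume "{a<..<b} \<inter> S \<noteq> {}"
      then obtain s where s: "a < s" "s < b" "s \<in> S" by auto
      then have "\<not> s \<le> u" "\<not> v \<le> s" using a(3) b(3) by force+
      then have "s \<in> {u<..<v}" by simp
      then show False using s(3) uv(4) by blast
    qed
    then have "C1_curve_on M a b \<gamma>" using a b uv by (intro S(4)) auto
    then show ?thesis by (rule C1_curve_on_subset) (use a b in auto)
  qed
  with S(1) show thesis by (rule that)
qed

context riemannian
begin

lemma geodesic_speed:
  assumes \<gamma>: "geodesic_on M UNIV \<gamma>"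
  shows "metric M (\<gamma> t) (velocity M \<gamma> t) (velocity M \<gamma> t) = metric M (\<gamma> s) (velocity M \<gamma> s) (velocity M \<gamma> s)"
proof (rule DERIV_isconst_all[where f = "\<lambda>t. metric M (\<gamma> t) (velocity M \<gamma> t) (velocity M \<gamma> t)"])
  show "\<forall>t. ((\<lambda>t. metric M (\<gamma> t) (velocity M \<gamma> t) (velocity M \<gamma> t)) has_real_derivative 0) (at t)"
  proof
    fix t
    obtain c where c: "c \<in> charts M" "\<gamma> t \<in> fst c" using chart_exists[OF geodesic_in[OF \<gamma>]] by blast
    interpret mc: metric_chart "img c" "local_metric M c" by (rule metric_chart[OF c(1)])
    let ?x = "\<lambda>t. snd c (\<gamma> t)" and ?w = "\<lambda>t. velocity M \<gamma> t c"
    note st = geodesic_state[OF \<gamma> open_UNIV UNIV_I c]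
    have y: "?x t \<in> img c" using c(2) by blast
    have d: "((\<lambda>t. local_metric M c (?x t) (?w t) (?w t)) has_real_derivative 0) (at t)"
      using mc.metric_curve_deriv[OF y st(1,2,2)] bilinear_lzero[OF mc.g_bilinear[OF y]] bilinear_rzero[OF mc.g_bilinear[OF y]] by simp
    have o: "open {s. \<gamma> s \<in> fst c}" using geodesic_chart_open[OF \<gamma> open_UNIV c(1)] by simp
    have e: "local_metric M c (?x s) (?w s) (?w s) = metric M (\<gamma> s) (velocity M \<gamma> s) (velocity M \<gamma> s)" if "s \<in> {s. \<gamma> s \<in> fst c}" for s
      using metric_coords[OF geodesic_velocity(1)[OF \<gamma> open_UNIV UNIV_I] geodesic_velocity(1)[OF \<gamma> open_UNIV UNIV_I], of c s] c that
      by (simp add: charts_at_def)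
    show "((\<lambda>t. metric M (\<gamma> t) (velocity M \<gamma> t) (velocity M \<gamma> t)) has_real_derivative 0) (at t)"
      by (rule has_field_derivative_transform_within_open[OF d o _ e]) (use c(2) in simp)
  qed
qed

abbreviation speed :: "(real \<Rightarrow> 'm) \<Rightarrow> real \<Rightarrow> real" where
  "speed \<gamma> t \<equiv> sqrt (metric M (\<gamma> t) (velocity M \<gamma> t) (velocity M \<gamma> t))"

lemma velocity_metric:
  assumes c: "c \<in> charts M" and W: "open W" "t \<in> W" "\<And>s. s \<in> W \<Longrightarrow> \<gamma> s \<in> fst c"
    and d: "((\<lambda>t. snd c (\<gamma> t)) has_vector_derivative a) (at t)"
  shows "metric M (\<gamma> t) (velocity M \<gamma> t) (velocity M \<gamma> t) = local_metric M c (snd c (\<gamma> t)) a a"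
proof -
  have "c \<in> charts_at M (\<gamma> t)" using c W by (auto simp: charts_at_def)
  moreover have "velocity M \<gamma> t = coord_vec M c (\<gamma> t) a" using c W d by (rule velocity_tangent)
  ultimately show ?thesis using local_metric_eq by simp
qed

lemma C1_speed_integrable:
  assumes \<gamma>: "C1_curve_on M u v \<gamma>" and c: "c \<in> charts M" "\<gamma> ` {u..v} \<subseteq> fst c"
  shows "speed \<gamma> integrable_on {u..v}"
proof -
  interpret mc: metric_chart "img c" "local_metric M c" by (rule metric_chart[OF c(1)])
  have eq: "{t \<in> {u..v}. \<gamma> t \<in> fst c} = {u..v}" using c(2) by auto
  obtain D where D: "continuous_on {u..v} D"
    "\<And>t. t \<in> {u..v} \<Longrightarrow> ((snd c \<circ> \<gamma>) has_vector_derivative D t) (at t within {u..v})"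
    using \<gamma> c unfolding C1_curve_on_def by (metis (no_types, lifting) eq image_subset_iff)
  have \<gamma>c: "continuous_on {u..v} \<gamma>" using \<gamma> by (simp add: C1_curve_on_def)
  have x: "continuous_on {u..v} (\<lambda>t. snd c (\<gamma> t))" by (rule continuous_on_compose2[OF chart_cont[OF c(1)] \<gamma>c c(2)])
  have xim: "snd c (\<gamma> t) \<in> img c" if "t \<in> {u..v}" for t using c(2) that by blast
  have "continuous_on {u..v} (\<lambda>t. local_metric M c (snd c (\<gamma> t)) (D t) (D t))"
  proof (rule bilinear_family_continuous[where x = "\<lambda>t. snd c (\<gamma> t)" and B = "local_metric M c"])
    show "continuous_on {u..v} (\<lambda>t. local_metric M c (snd c (\<gamma> t)) i j)" for i j
      by (rule continuous_on_compose2[OF mc.g_cont x]) (use xim in blast)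
  qed (use mc.g_bilinear xim D in auto)
  then have "continuous_on {u..v} (\<lambda>t. sqrt (local_metric M c (snd c (\<gamma> t)) (D t) (D t)))" by (intro continuous_intros)
  then have "(\<lambda>t. sqrt (local_metric M c (snd c (\<gamma> t)) (D t) (D t))) integrable_on {u..v}" by (rule integrable_continuous_interval)
  then show ?thesis
  \<comment> \<open>\<open>velocity\<close> is a two-sided derivative, so at the ends of the
    interval it may differ from \<open>D\<close>.\<close>
  proof (rule integrable_spike_finite[of "{u, v}", rotated 2])
    fix t assume t: "t \<in> {u..v} - {u, v}"
    then have "at t within {u..v} = at t" by (intro at_within_Icc_at) auto
    then have "((\<lambda>t. snd c (\<gamma> t)) has_vector_derivative D t) (at t)" using D(2)[of t] t by (auto simp: o_def)
    then show "speed \<gamma> t = sqrt (local_metric M c (snd c (\<gamma> t)) (D t) (D t))"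
      using velocity_metric[of c "{u<..<v}" t \<gamma> "D t"] c t by (auto simp: image_subset_iff)
  qed simp
qed

lemma curve_chart_openin:
  assumes "C1_curve_on M u v \<gamma>" "c \<in> charts M"
  shows "openin (top_of_set {u..v}) {t \<in> {u..v}. \<gamma> t \<in> fst c}"
proof -
  have "openin (top_of_set {u..v}) ({u..v} \<inter> \<gamma> -` fst c)"
    by (rule continuous_openin_preimage[OF _ _ chart_dom(1)[OF assms(2)]]) (use assms(1) in \<open>auto simp: C1_curve_on_def\<close>)
  then show ?thesis by (simp add: vimage_def Int_def)
qed

text \<open>Every piece is continuous up to its closed ends, so left and right continuity are glued
  at each point.\<close>

lemma piecewise_C1_continuous: 
  assumes "piecewise_C1_curve M \<gamma>"
  shows "continuous_on {0..1} \<gamma>" "\<gamma> ` {0..1} \<subseteq> points M"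
proof -
  obtain S where S: "finite S" "\<And>u v. 0 \<le> u \<Longrightarrow> u < v \<Longrightarrow> v \<le> 1 \<Longrightarrow> {u<..<v} \<inter> S = {} \<Longrightarrow> C1_curve_on M u v \<gamma>"
    using piecewise_C1_pieces[OF assms] by blast
  have ex: "\<exists>e>0. e < 1 \<and> (\<forall>u v. 0 \<le> u \<and> u < v \<and> v \<le> 1 \<and> x - e \<le> u \<and> v \<le> x + e \<and> x \<notin> {u<..<v} \<longrightarrow> C1_curve_on M u v \<gamma>)" for x
  proof -
    obtain d where d: "d > 0" "\<And>s. s \<in> S \<Longrightarrow> s \<noteq> x \<Longrightarrow> d \<le> dist x s" using finite_set_avoid[OF S(1), of x] by blast
    define e where "e = min (d / 2) (1 / 2)"
    have e: "e > 0" "e < 1" "e < d" using d(1) by (auto simp: e_def)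
    have "C1_curve_on M u v \<gamma>" if h: "0 \<le> u" "u < v" "v \<le> 1" "x - e \<le> u" "v \<le> x + e" "x \<notin> {u<..<v}" for u v
    proof (rule S(2)[OF h(1-3)], rule ccontr)
      assume "{u<..<v} \<inter> S \<noteq> {}"
      then obtain s where s: "s \<in> S" "u < s" "s < v" by auto
      then have "s \<noteq> x" using h by auto
      then show False using d(2)[OF s(1)] s h e by (auto simp: dist_real_def split: if_splits)
    qed
    then show ?thesis using e by blast
  qed
  have cont: "continuous (at x within {0..1}) \<gamma> \<and> \<gamma> x \<in> points M" if x: "x \<in> {0..1}" for x
  proof -
    obtain e where e: "e > 0" "e < 1" "\<And>u v. 0 \<le> u \<Longrightarrow> u < v \<Longrightarrow> v \<le> 1 \<Longrightarrow> x - e \<le> u \<Longrightarrow> v \<le> x + e \<Longrightarrow> x \<notin> {u<..<v} \<Longrightarrow> C1_curve_on M u v \<gamma>"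
      using ex[of x] by blast
    define l r where "l = max 0 (x - e)" and "r = min 1 (x + e)"
    have lr: "0 \<le> l" "l \<le> x" "x \<le> r" "r \<le> 1" "x - e \<le> l" "r \<le> x + e" using x e by (auto simp: l_def r_def)
    have L: "continuous_on {l..x} \<gamma> \<and> (l < x \<longrightarrow> \<gamma> x \<in> points M)"
    proof (cases "l = x")
      case False
      then have "C1_curve_on M l x \<gamma>" using lr e x by (intro e(3)) auto
      then show ?thesis using lr by (auto simp: C1_curve_on_def image_subset_iff)
    qed auto
    have R: "continuous_on {x..r} \<gamma> \<and> (x < r \<longrightarrow> \<gamma> x \<in> points M)"
    proof (cases "x = r")
      case False
      then have "C1_curve_on M x r \<gamma>" using lr e x by (intro e(3)) auto
      then show ?thesis using lr by (auto simp: C1_curve_on_def image_subset_iff)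
    qed auto
    have "continuous_on ({l..x} \<union> {x..r}) \<gamma>" using L R by (intro continuous_on_closed_Un) auto
    moreover have "{l..x} \<union> {x..r} = {l..r}" using lr by auto
    ultimately have "continuous_on {l..r} \<gamma>" by simp
    then have "continuous (at x within {l..r}) \<gamma>" using lr by (auto simp: continuous_on_eq_continuous_within)
    moreover have "at x within {l..r} = at x within {0..1}"
      by (rule at_within_nhd[where S = "{x-e<..<x+e}"]) (use e lr in \<open>auto simp: l_def r_def\<close>)
    moreover have "l < x \<or> x < r" using e x by (auto simp: l_def r_def)
    ultimately show ?thesis using L R by auto
  qed
  then show "continuous_on {0..1} \<gamma>" "\<gamma> ` {0..1} \<subseteq> points M" by (auto simp: continuous_on_eq_continuous_within)
qed

lemma piecewise_C1_interior:
  assumes pw: "piecewise_C1_curve M \<gamma>"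
  obtains S where "finite S" "\<And>t c. t \<in> {0<..<1} - S \<Longrightarrow> c \<in> charts M \<Longrightarrow> \<gamma> t \<in> fst c \<Longrightarrow>
    \<exists>W a. open W \<and> t \<in> W \<and> W \<subseteq> {0..1} \<and> (\<forall>s\<in>W. \<gamma> s \<in> fst c) \<and> ((\<lambda>t. snd c (\<gamma> t)) has_vector_derivative a) (at t)"
proof -
  obtain S where S: "finite S" "\<And>u v. 0 \<le> u \<Longrightarrow> u < v \<Longrightarrow> v \<le> 1 \<Longrightarrow> {u<..<v} \<inter> S = {} \<Longrightarrow> C1_curve_on M u v \<gamma>"
    using piecewise_C1_pieces[OF pw] by blast
  have "\<exists>W a. open W \<and> t \<in> W \<and> W \<subseteq> {0..1} \<and> (\<forall>s\<in>W. \<gamma> s \<in> fst c) \<and> ((\<lambda>t. snd c (\<gamma> t)) has_vector_derivative a) (at t)"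
    if t: "t \<in> {0<..<1} - S" and c: "c \<in> charts M" "\<gamma> t \<in> fst c" for t c
  proof -
    have "open ({0<..<1} - S)" using S(1) by (intro open_Diff finite_imp_closed) auto
    then obtain e where e: "e > 0" "cball t e \<subseteq> {0<..<1} - S" using t by (meson open_contains_cball)
    have "t - e \<in> cball t e" "t + e \<in> cball t e" using e by (auto simp: dist_real_def)
    then have ab: "t - e \<in> {0<..<1}" "t + e \<in> {0<..<1}" using e by blast+
    have "{t-e<..<t+e} \<inter> S = {}"
    proof (rule ccontr)
      assume "{t-e<..<t+e} \<inter> S \<noteq> {}"
      then obtain s where "s \<in> S" "t - e < s" "s < t + e" by auto
      moreover from this have "s \<in> cball t e" by (auto simp: dist_real_def)
      ultimately show False using e by blast
    qed
    then have C: "C1_curve_on M (t - e) (t + e) \<gamma>" using ab e by (intro S(2)) auto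
    define W where "W = {t-e<..<t+e} \<inter> {s \<in> {t-e..t+e}. \<gamma> s \<in> fst c}"
    obtain O' where O': "open O'" "{s \<in> {t-e..t+e}. \<gamma> s \<in> fst c} = O' \<inter> {t-e..t+e}"
      using curve_chart_openin[OF C c(1)] unfolding openin_open by (metis Int_commute)
    have "W = {t-e<..<t+e} \<inter> O'" unfolding W_def O'(2) by auto
    then have "open W" using O'(1) by auto
    moreover obtain D where "\<forall>s\<in>{t-e..t+e}. \<gamma> s \<in> fst c \<longrightarrow> ((snd c \<circ> \<gamma>) has_vector_derivative D s) (at s within {t-e..t+e})"
      using C c(1) unfolding C1_curve_on_def by blast
    then have "((snd c \<circ> \<gamma>) has_vector_derivative D t) (at t within {t-e..t+e})" using e(1) c(2) by simp
    then have "((\<lambda>t. snd c (\<gamma> t)) has_vector_derivative D t) (at t)" using e by (simp add: o_def at_within_Icc_at)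
    moreover have "t \<in> W" using e c by (auto simp: W_def)
    moreover have "W \<subseteq> {0..1}" using ab by (auto simp: W_def)
    moreover have "\<forall>s\<in>W. \<gamma> s \<in> fst c" by (simp add: W_def)
    ultimately show ?thesis by (intro exI[of _ W] exI[of _ "D t"]) simp
  qed
  with S(1) show thesis by (rule that)
qed

text \<open>Integrability is local. Near \<open>x\<close> the curve lies in one chart and has no
  break point except possibly \<open>x\<close>, so it is C1 on either side.\<close>

lemma speed_integrable:
  assumes pw: "piecewise_C1_curve M \<gamma>"
  shows "speed \<gamma> integrable_on {0..1}"
proof (rule integrable_on_little_subintervals[of "0::real" 1, unfolded cbox_interval], intro ballI)
  obtain S where S: "finite S" "\<And>u v. 0 \<le> u \<Longrightarrow> u < v \<Longrightarrow> v \<le> 1 \<Longrightarrow> {u<..<v} \<inter> S = {} \<Longrightarrow> C1_curve_on M u v \<gamma>"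
    using piecewise_C1_pieces[OF pw] by blast
  fix x :: real assume x: "x \<in> {0..1}"
  obtain d where d: "d > 0" "\<And>s. s \<in> S \<Longrightarrow> s \<noteq> x \<Longrightarrow> d \<le> dist x s" using finite_set_avoid[OF S(1), of x] by blast
  have "\<gamma> x \<in> points M" using piecewise_C1_continuous(2)[OF pw] x by blast
  then obtain c where c: "c \<in> charts M" "\<gamma> x \<in> fst c" using chart_exists by blast
  have "openin (top_of_set {0..1}) ({0..1} \<inter> \<gamma> -` fst c)"
    using piecewise_C1_continuous[OF pw] by (intro continuous_openin_preimage[OF _ _ chart_dom(1)[OF c(1)]]) auto
  then obtain e where e: "e > 0" "\<And>s. s \<in> {0..1} \<Longrightarrow> dist s x < e \<Longrightarrow> \<gamma> s \<in> fst c"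
    using x c unfolding openin_euclidean_subtopology_iff by (metis IntD2 IntI vimageE vimageI)
  have part: "speed \<gamma> integrable_on {u..v}" if h: "0 \<le> u" "u \<le> v" "v \<le> 1" "x = u \<or> x = v" "{u..v} \<subseteq> ball x (min d e)" for u v
  proof (cases "u = v")
    case False
    have "{u<..<v} \<inter> S = {}"
    proof (rule ccontr)
      assume "{u<..<v} \<inter> S \<noteq> {}"
      then obtain s where s: "s \<in> S" "u < s" "s < v" by auto
      moreover have "s \<in> ball x (min d e)" using s h(5) by (meson atLeastAtMost_iff less_imp_le subsetD)
      ultimately show False using d(2)[of s] h(4) by auto
    qed
    then have "C1_curve_on M u v \<gamma>" using h False by (intro S(2)) auto
    then show ?thesis
    proof (rule C1_speed_integrable[OF _ c(1)])
      show "\<gamma> ` {u..v} \<subseteq> fst c" using e(2) h by (force simp: dist_commute)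
    qed
  qed (use integrable_on_refl[of "speed \<gamma>" v] in simp)
  have "speed \<gamma> integrable_on {u..v}" if "x \<in> {u..v}" "{u..v} \<subseteq> ball x (min d e)" "{u..v} \<subseteq> {0..1}" for u v
  proof (rule Henstock_Kurzweil_Integration.integrable_combine[of u x v])
    show "speed \<gamma> integrable_on {u..x}" by (rule part) (use that in auto)
    show "speed \<gamma> integrable_on {x..v}" by (rule part) (use that in auto)
  qed (use that in auto)
  then show "\<exists>d>0. \<forall>u v. x \<in> {u..v} \<and> {u..v} \<subseteq> ball x d \<and> {u..v} \<subseteq> {0..1} \<longrightarrow> speed \<gamma> integrable_on {u..v}"
    using d(1) e(1) by (intro exI[of _ "min d e"]) auto
qed

end

context universal_cover
begin

subsection \<open>The covering map in charts\<close>

definition pdom :: "('c, 'e) chart \<Rightarrow> ('m, 'e) chart \<Rightarrow> 'e set" where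
  "pdom ct c = snd ct ` (fst ct \<inter> \<pi> -` fst c)"

definition pmap :: "('c, 'e) chart \<Rightarrow> ('m, 'e) chart \<Rightarrow> 'e \<Rightarrow> 'e" where
  "pmap ct c y = snd c (\<pi> (chart_inv ct y))"

definition pder :: "('c, 'e) chart \<Rightarrow> ('m, 'e) chart \<Rightarrow> 'e \<Rightarrow> 'e \<Rightarrow> 'e" where
  "pder ct c y = frechet_derivative (pmap ct c) (at y)"

context
  fixes ct :: "('c, 'e) chart" and c :: "('m, 'e) chart"
  assumes ct: "ct \<in> charts Mt" and c: "c \<in> charts M"
begin

lemma pdom_iff: "q \<in> fst ct \<Longrightarrow> snd ct q \<in> pdom ct c \<longleftrightarrow> \<pi> q \<in> fst c"
  unfolding pdom_def using mt.chart_inj[OF ct] by blast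

lemma pdom_open: "open (pdom ct c)"
  unfolding pdom_def
proof (rule mt.chart_openin[OF ct])
  have "openin (top_of_set (points Mt)) (points Mt \<inter> \<pi> -` fst c)"
    using proj_in by (intro continuous_openin_preimage[OF proj_cont _ chart_dom(1)[OF c]]) auto
  then have "openin (top_of_set (points Mt)) (fst ct \<inter> (points Mt \<inter> \<pi> -` fst c))" using mt.chart_dom(1)[OF ct] by (rule openin_Int[rotated])
  moreover have "fst ct \<inter> (points Mt \<inter> \<pi> -` fst c) = fst ct \<inter> \<pi> -` fst c" using mt.chart_dom(4)[OF ct] by blast
  ultimately show "openin (top_of_set (points Mt)) (fst ct \<inter> \<pi> -` fst c)" by simp
qed blast

lemma pmap_C1: "Ck_on 1 (pdom ct c) (pmap ct c)"
proof -
  have "C_on \<infinity> (pdom ct c) (snd c \<circ> \<pi> \<circ> chart_inv ct)"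
    using cov ct c unfolding universal_riemannian_covering_def C_map_def pdom_def by blast
  moreover have "snd c \<circ> \<pi> \<circ> chart_inv ct = pmap ct c" by (auto simp: pmap_def)
  ultimately show ?thesis by (simp add: C_on_def)
qed

lemma pmap_deriv: "y \<in> pdom ct c \<Longrightarrow> (pmap ct c has_derivative pder ct c y) (at y)"
  using pmap_C1 by (auto simp: pder_def frechet_derivative_works numeral_2_eq_2)

lemma pder_cont: "continuous_on (pdom ct c) (\<lambda>y. pder ct c y a)"
  using pmap_C1 by (auto simp: pder_def)

end

lemma pmap_transition:
  assumes ct: "ct \<in> charts Mt" "ct' \<in> charts Mt" and c: "c \<in> charts M" and q: "q \<in> fst ct" "q \<in> fst ct'" "\<pi> q \<in> fst c"
  shows "pder ct c (snd ct q) a = pder ct' c (snd ct' q) (mt.dtr ct ct' q a)"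
proof -
  have y: "snd ct q \<in> pdom ct c" "snd ct' q \<in> pdom ct' c" using pdom_iff ct c q by auto
  have "((\<lambda>y. pmap ct' c (transition ct ct' y)) has_derivative (\<lambda>a. pder ct' c (snd ct' q) (mt.dtr ct ct' q a))) (at (snd ct q))"
    using diff_chain_at[OF mt.transition_deriv[OF ct q(1,2)], of "pmap ct' c" "pder ct' c (snd ct' q)"]
      pmap_deriv[OF ct(2) c y(2)] mt.transition_apply[OF ct(1) q(1)] by (simp add: o_def)
  then have "(pmap ct c has_derivative (\<lambda>a. pder ct' c (snd ct' q) (mt.dtr ct ct' q a))) (at (snd ct q))"
  proof (rule has_derivative_transform_within_open[OF _ mt.overlap_open[OF ct]])
    show "pmap ct' c (transition ct ct' y) = pmap ct c y" if "y \<in> snd ct ` (fst ct \<inter> fst ct')" for y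
      using that mt.chart_inv_apply[OF ct(1)] mt.chart_inv_apply[OF ct(2)] by (auto simp: pmap_def transition_def)
  qed (use q in auto)
  then show ?thesis using has_derivative_unique[OF pmap_deriv[OF ct(1) c y(1)]] by metis
qed

text \<open>\<open>differential\<close> evaluates in an arbitrary chart at \<open>q\<close>;
  \<open>pmap_transition\<close> shows that the choice has no influence.\<close>

lemma differential_coord:
  assumes ct: "ct \<in> charts_at Mt q" and c: "c \<in> charts_at M (\<pi> q)"
  shows "differential Mt M \<pi> q (coord_vec Mt ct q a) = coord_vec M c (\<pi> q) (pder ct c (snd ct q) a)"
proof
  fix c'
  show "differential Mt M \<pi> q (coord_vec Mt ct q a) c' = coord_vec M c (\<pi> q) (pder ct c (snd ct q) a) c'"
  proof (cases "c' \<in> charts_at M (\<pi> q)")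
    case True
    define c1 where "c1 = (SOME c. c \<in> charts_at Mt q)"
    have c1: "c1 \<in> charts_at Mt q" unfolding c1_def using ct by (rule someI)
    note mem = ct[unfolded charts_at_def] c[unfolded charts_at_def] True[unfolded charts_at_def] c1[unfolded charts_at_def]
    have "differential Mt M \<pi> q (coord_vec Mt ct q a) c' = pder c1 c' (snd c1 q) (coord_vec Mt ct q a c1)"
      using True by (simp add: differential_def c1_def[symmetric] pder_def pmap_def[abs_def] o_def)
    also have "\<dots> = pder ct c' (snd ct q) a"
      unfolding mt.coord_vec_apply[OF c1] using mem by (intro pmap_transition[symmetric]) auto
    also have "\<dots> = dtr c c' (\<pi> q) (pder ct c (snd ct q) a)"
    proof -
      have q: "chart_inv ct (snd ct q) = q" using mt.chart_inv_apply mem by blast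
      have y: "snd ct q \<in> pdom ct c" "snd ct q \<in> pdom ct c'" using pdom_iff mem by auto
      have "((\<lambda>y. snd c' (\<pi> (chart_inv ct y))) has_derivative (\<lambda>h. dtr c c' (\<pi> (chart_inv ct (snd ct q))) (pder ct c (snd ct q) h))) (at (snd ct q))"
      proof (rule change_chart_deriv[where W = "pdom ct c"])
        show "((\<lambda>y. snd c (\<pi> (chart_inv ct y))) has_derivative pder ct c (snd ct q)) (at (snd ct q))"
          using pmap_deriv[OF _ _ y(1)] mem by (auto simp: pmap_def[abs_def])
        show "open (pdom ct c)" using mem by (intro pdom_open) auto
        show "\<pi> (chart_inv ct y) \<in> fst c" if "y \<in> pdom ct c" for y
          using that mem mt.chart_inv_apply[of ct] unfolding pdom_def by auto
      qed (use y mem q in auto)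
      moreover have "((\<lambda>y. snd c' (\<pi> (chart_inv ct y))) has_derivative pder ct c' (snd ct q)) (at (snd ct q))"
        using pmap_deriv[OF _ _ y(2)] mem by (auto simp: pmap_def[abs_def])
      ultimately show ?thesis using has_derivative_unique q by (metis (no_types, lifting))
    qed
    also have "\<dots> = coord_vec M c (\<pi> q) (pder ct c (snd ct q) a) c'" using coord_vec_apply[OF True] by simp
    finally show ?thesis .
  qed (auto simp: differential_def coord_vec_def)
qed

lemma pder_metric:
  assumes ct: "ct \<in> charts_at Mt q" and c: "c \<in> charts_at M (\<pi> q)"
  shows "local_metric M c (snd c (\<pi> q)) (pder ct c (snd ct q) a) (pder ct c (snd ct q) b) = local_metric Mt ct (snd ct q) a b"
proof -
  have q: "q \<in> points Mt" using ct mt.chart_dom(4)[of ct] by (auto simp: charts_at_def)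
  have "local_metric M c (snd c (\<pi> q)) (pder ct c (snd ct q) a) (pder ct c (snd ct q) b) =
    metric M (\<pi> q) (differential Mt M \<pi> q (coord_vec Mt ct q a)) (differential Mt M \<pi> q (coord_vec Mt ct q b))"
    unfolding differential_coord[OF ct c] by (rule local_metric_eq[OF c])
  also have "\<dots> = metric Mt q (coord_vec Mt ct q a) (coord_vec Mt ct q b)"
    using cov q mt.coord_vec_tangent[OF ct] unfolding universal_riemannian_covering_def by blast
  also have "\<dots> = local_metric Mt ct (snd ct q) a b" by (rule mt.local_metric_eq[OF ct, symmetric])
  finally show ?thesis .
qed

lemma pder_inj:
  assumes ct: "ct \<in> charts_at Mt q" and c: "c \<in> charts_at M (\<pi> q)"
  shows "linear (pder ct c (snd ct q))" "inj (pder ct c (snd ct q))"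
proof -
  have mem: "ct \<in> charts Mt" "q \<in> fst ct" "c \<in> charts M" "\<pi> q \<in> fst c" using ct c by (auto simp: charts_at_def)
  interpret mc: metric_chart "img c" "local_metric M c" by (rule metric_chart[OF mem(3)])
  interpret mct: metric_chart "img ct" "local_metric Mt ct" by (rule mt.metric_chart[OF mem(1)])
  show lin: "linear (pder ct c (snd ct q))" using pmap_deriv[OF mem(1,3)] pdom_iff[OF mem(1,3,2)] mem(4) has_derivative_linear by blast
  have "b = 0" if "pder ct c (snd ct q) b = 0" for b
    using pder_metric[OF ct c, of b b] mct.g_pos[of "snd ct q" b] bilinear_lzero[OF mc.g_bilinear, of "snd c (\<pi> q)" 0] mem that by force
  then show "inj (pder ct c (snd ct q))" using linear_injective_0[OF lin] by blast
qed

lemma proj_curve_deriv: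
  assumes ct: "ct \<in> charts Mt" "\<gamma> t \<in> fst ct" and c: "c \<in> charts M" "\<pi> (\<gamma> t) \<in> fst c"
    and W: "open W" "t \<in> W" "\<And>s. s \<in> W \<Longrightarrow> \<gamma> s \<in> fst ct"
    and d: "((\<lambda>t. snd ct (\<gamma> t)) has_vector_derivative a) (at t)"
  shows "((\<lambda>t. snd c (\<pi> (\<gamma> t))) has_vector_derivative pder ct c (snd ct (\<gamma> t)) a) (at t)"
proof -
  have y: "snd ct (\<gamma> t) \<in> pdom ct c" using pdom_iff[OF ct(1) c(1) ct(2)] c(2) by simp
  have "((\<lambda>t. pmap ct c (snd ct (\<gamma> t))) has_vector_derivative pder ct c (snd ct (\<gamma> t)) a) (at t)"
    using vector_derivative_diff_chain_within[of "\<lambda>t. snd ct (\<gamma> t)" a t UNIV "pmap ct c"] d pmap_deriv[OF ct(1) c(1) y]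
    by (auto simp: o_def intro: has_derivative_at_withinI)
  then show ?thesis
    by (rule has_vector_derivative_transform_within_open[OF _ W(1,2)]) (simp add: pmap_def mt.chart_inv_apply[OF ct(1) W(3)])
qed

subsection \<open>The lower bound\<close>

definition nrm :: "('m, 'e) chart \<Rightarrow> 'm \<Rightarrow> 'e \<Rightarrow> real" where
  "nrm c p a = sqrt (local_metric M c (snd c p) a a)"

text \<open>The curve is pulled back to the tangent space by \<open>Log\<close>, which does not
  increase its speed. A linear functional \<open>l\<close> of norm 1 that attains the norm of
  \<open>w - v\<close> then reduces the claim to integrating the derivative of a real
  function.\<close>

lemma length_lower:
  assumes b: "based c0 q0" and pw: "piecewise_C1_curve Mt \<gamma>" and ends: "\<gamma> 0 = Ext c0 q0 v" "\<gamma> 1 = Ext c0 q0 w"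
  shows "nrm c0 (\<pi> q0) (w - v) \<le> curve_length Mt \<gamma>"
proof -
  interpret hp: hadamard_point M c0 "\<pi> q0" using b by unfold_locales auto
  have c0: "c0 \<in> charts M" "snd c0 (\<pi> q0) \<in> img c0" using b by (auto simp: charts_at_def)
  interpret mc: metric_chart "img c0" "local_metric M c0" by (rule metric_chart[OF c0(1)])
  let ?B = "local_metric M c0 (snd c0 (\<pi> q0))"
  define \<sigma> where "\<sigma> t = Log c0 q0 (\<gamma> t)" for t
  note \<gamma> = mt.piecewise_C1_continuous[OF pw]
  have \<sigma>c: "continuous_on {0..1} \<sigma>" unfolding \<sigma>_def using \<gamma> by (rule continuous_on_compose2[OF Log(1)[OF b]])
  have \<sigma>0: "\<sigma> 0 = v" "\<sigma> 1 = w" using ends Log(2)[OF b] by (auto simp: \<sigma>_def)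
  have ex\<sigma>: "Exp c0 (\<pi> q0) (\<sigma> t) = \<pi> (\<gamma> t)" if "t \<in> {0..1}" for t
    using \<gamma>(2) that Log(3)[OF b] Ext(4)[OF b] by (metis \<sigma>_def image_subset_iff)
  \<comment> \<open>For \<open>w = v\<close> any nonzero vector will do to define the
    functional.\<close>
  obtain u where u: "u \<noteq> 0" "w \<noteq> v \<Longrightarrow> u = w - v"
    using nonzero_Basis[OF SOME_Basis] by (cases "w = v") auto
  have n: "nrm c0 (\<pi> q0) u > 0" using hp.B0(2)[of u] u(1) by (simp add: nrm_def)
  define l where "l a = ?B u a / nrm c0 (\<pi> q0) u" for a
  have l_lin: "linear l" unfolding l_def
    by (intro linearI) (simp_all add: bilinear_radd[OF hp.B0(1)] bilinear_rmul[OF hp.B0(1)] add_divide_distrib)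
  have l_le: "l a \<le> nrm c0 (\<pi> q0) a" for a
  proof -
    have "(?B u a)\<^sup>2 \<le> ?B u u * ?B a a" by (rule mc.g_cauchy_schwarz[OF c0(2)])
    then have "\<bar>?B u a\<bar> \<le> nrm c0 (\<pi> q0) u * nrm c0 (\<pi> q0) a"
      unfolding nrm_def real_sqrt_mult[symmetric] by (metis real_sqrt_abs real_sqrt_le_iff)
    then show ?thesis using n by (auto simp: l_def pos_divide_le_eq mult.commute)
  qed
  obtain S where S: "finite S" "\<And>t c. t \<in> {0<..<1} - S \<Longrightarrow> c \<in> charts Mt \<Longrightarrow> \<gamma> t \<in> fst c \<Longrightarrow>
      \<exists>W a. open W \<and> t \<in> W \<and> W \<subseteq> {0..1} \<and> (\<forall>s\<in>W. \<gamma> s \<in> fst c) \<and> ((\<lambda>t. snd c (\<gamma> t)) has_vector_derivative a) (at t)"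
    using mt.piecewise_C1_interior[OF pw] by blast
  have "\<exists>d. ((\<lambda>t. l (\<sigma> t)) has_vector_derivative d) (at t) \<and> d \<le> mt.speed \<gamma> t" if t: "t \<in> {0<..<1} - S" for t
  proof -
    have t01: "t \<in> {0..1}" using t by auto
    then have "\<gamma> t \<in> points Mt" using \<gamma>(2) by blast
    then obtain ct where ct: "ct \<in> charts Mt" "\<gamma> t \<in> fst ct" using mt.chart_exists by blast
    obtain c where c: "c \<in> charts M" "\<pi> (\<gamma> t) \<in> fst c" using chart_exists[OF proj_in[OF \<open>\<gamma> t \<in> points Mt\<close>]] by blast
    obtain W a where W: "open W" "t \<in> W" "W \<subseteq> {0..1}" "\<And>s. s \<in> W \<Longrightarrow> \<gamma> s \<in> fst ct"
      and d: "((\<lambda>t. snd ct (\<gamma> t)) has_vector_derivative a) (at t)" using S(2)[OF t ct] by blast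
    have "continuous_on W \<sigma>" using \<sigma>c W(3) by (rule continuous_on_subset)
    then have \<sigma>t: "isCont \<sigma> t" using W(1,2) by (simp add: continuous_on_eq_continuous_at)
    obtain w' where w': "(\<sigma> has_vector_derivative w') (at t)"
      "?B w' w' \<le> local_metric M c (snd c (\<pi> (\<gamma> t))) (pder ct c (snd ct (\<gamma> t)) a) (pder ct c (snd ct (\<gamma> t)) a)"
    proof (rule hp.ex_lift_deriv[of c "\<lambda>t. \<pi> (\<gamma> t)", OF c \<sigma>t W(1,2)])
      show "((\<lambda>t. snd c (\<pi> (\<gamma> t))) has_vector_derivative pder ct c (snd ct (\<gamma> t)) a) (at t)"
        by (rule proj_curve_deriv[OF ct c W(1,2,4) d])
    qed (use ex\<sigma> W(3) in auto)
    have "local_metric M c (snd c (\<pi> (\<gamma> t))) (pder ct c (snd ct (\<gamma> t)) a) (pder ct c (snd ct (\<gamma> t)) a) = local_metric Mt ct (snd ct (\<gamma> t)) a a"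
      using ct c by (intro pder_metric) (auto simp: charts_at_def)
    also have "\<dots> = metric Mt (\<gamma> t) (velocity Mt \<gamma> t) (velocity Mt \<gamma> t)"
      by (rule mt.velocity_metric[OF ct(1) W(1,2,4) d, symmetric])
    finally have "nrm c0 (\<pi> q0) w' \<le> mt.speed \<gamma> t" using w'(2) unfolding nrm_def by simp
    moreover have "((\<lambda>t. l (\<sigma> t)) has_vector_derivative l w') (at t)"
      using bounded_linear.has_vector_derivative[of l, OF _ w'(1)] l_lin by (simp add: linear_conv_bounded_linear)
    ultimately show ?thesis using l_le[of w'] by (intro exI[of _ "l w'"]) auto
  qed
  then obtain d where d: "\<And>t. t \<in> {0<..<1} - S \<Longrightarrow> ((\<lambda>t. l (\<sigma> t)) has_vector_derivative d t) (at t)"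
    "\<And>t. t \<in> {0<..<1} - S \<Longrightarrow> d t \<le> mt.speed \<gamma> t" by metis
  have "continuous_on {0..1} (\<lambda>t. l (\<sigma> t))"
    by (rule continuous_on_compose2[OF linear_continuous_on \<sigma>c, of l UNIV]) (use l_lin in \<open>auto simp: linear_conv_bounded_linear\<close>)
  then have "(d has_integral (l (\<sigma> 1) - l (\<sigma> 0))) {0..1}"
    by (intro fundamental_theorem_of_calculus_interior_strong[OF S(1) _ d(1)]) auto
  \<comment> \<open>The values of \<open>d\<close> at the finitely many exceptional times are
    arbitrary; replacing them by the speed makes the comparison hold everywhere without changing the
    integral.\<close>
  then have "((\<lambda>t. if t \<in> {0<..<1} - S then d t else mt.speed \<gamma> t) has_integral (l (\<sigma> 1) - l (\<sigma> 0))) {0..1}"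
    by (rule has_integral_spike_finite[of "S \<union> {0, 1}", rotated 2]) (use S(1) in auto)
  moreover have "(mt.speed \<gamma> has_integral curve_length Mt \<gamma>) {0..1}"
    unfolding curve_length_def using mt.speed_integrable[OF pw] by (rule integrable_integral)
  ultimately have "l (\<sigma> 1) - l (\<sigma> 0) \<le> curve_length Mt \<gamma>" by (rule has_integral_le) (use d(2) in auto)
  moreover have "l (\<sigma> 1) - l (\<sigma> 0) = l (w - v)" by (simp add: \<sigma>0 linear_diff[OF l_lin])
  moreover have "l (w - v) = nrm c0 (\<pi> q0) (w - v)"
  proof (cases "w = v")
    case True
    then show ?thesis using bilinear_lzero[OF hp.B0(1)] linear_0[OF l_lin] by (simp add: nrm_def)
  next
    case False
    have "?B u u = nrm c0 (\<pi> q0) u * nrm c0 (\<pi> q0) u" using n by (simp add: nrm_def)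
    then show ?thesis using n u(2)[OF False] by (simp add: l_def)
  qed
  ultimately show ?thesis by simp
qed

subsection \<open>Lifted geodesics\<close>

lemma lift_geodesic_deriv:
  assumes \<eta>: "geodesic_on M UNIV \<eta>" and k: "continuous_on UNIV k" "\<And>t. k t \<in> points Mt" "\<And>t. \<pi> (k t) = \<eta> t"
    and ct: "ct \<in> charts Mt" "k t \<in> fst ct" and c: "c \<in> charts M" "\<eta> t \<in> fst c"
  defines "D \<equiv> \<lambda>t. vector_derivative (\<lambda>s. snd ct (k s)) (at t)"
  shows "((\<lambda>s. snd ct (k s)) has_vector_derivative D t) (at t)"
    and "pder ct c (snd ct (k t)) (D t) = velocity M \<eta> t c"
    and "open {s. k s \<in> fst ct}"
proof -
  have "openin (top_of_set UNIV) (UNIV \<inter> k -` fst ct)"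
    using k(2) by (intro continuous_openin_preimage[OF k(1) _ mt.chart_dom(1)[OF ct(1)]]) auto
  then show T: "open {s. k s \<in> fst ct}" by (simp add: vimage_def)
  have at: "ct \<in> charts_at Mt (k t)" "c \<in> charts_at M (\<pi> (k t))" using ct c k(3) by (auto simp: charts_at_def)
  let ?X = "pder ct c (snd ct (k t))"
  note inj = pder_inj[OF at]
  obtain a where a: "?X a = velocity M \<eta> t c" using linear_injective_isomorphism[OF inj] by metis
  have y: "snd ct (k t) \<in> pdom ct c" using pdom_iff[OF ct(1) c(1) ct(2)] c k by simp
  have "((\<lambda>s. snd ct (k s)) has_vector_derivative a) (at t)"
  proof (rule lift_has_vector_derivative[where F = "pmap ct c" and X = ?X and k = "\<lambda>s. snd ct (k s)"])
    show "(pmap ct c has_derivative ?X) (at (snd ct (k t)))" by (rule pmap_deriv[OF ct(1) c(1) y])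
    show "inj ?X" by (rule inj(2))
    have "continuous_on {s. k s \<in> fst ct} (\<lambda>s. snd ct (k s))"
      by (rule continuous_on_compose2[OF mt.chart_cont[OF ct(1)]]) (auto intro: continuous_on_subset[OF k(1)])
    then show "isCont (\<lambda>s. snd ct (k s)) t" using T ct by (simp add: continuous_on_eq_continuous_at)
    have "((\<lambda>s. snd c (\<eta> s)) has_vector_derivative ?X a) (at t)"
      unfolding a by (rule geodesic_state(1)[OF \<eta> open_UNIV UNIV_I c])
    then show "((\<lambda>s. pmap ct c (snd ct (k s))) has_vector_derivative ?X a) (at t)"
      by (rule has_vector_derivative_transform_within_open[OF _ T]) (use ct k(3) mt.chart_inv_apply[OF ct(1)] in \<open>auto simp: pmap_def\<close>)
  qed
  moreover from this have "D t = a" unfolding D_def by (rule vector_derivative_at)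
  ultimately show "((\<lambda>s. snd ct (k s)) has_vector_derivative D t) (at t)" "?X (D t) = velocity M \<eta> t c" using a by auto
qed

text \<open>As for \<open>gF\<close>, invariance of domain inverts a whole family of linear maps at
  once. It recovers the velocity of a lift continuously from that of its projection.\<close>

lemma pder_inverse_cont:
  assumes ct: "ct \<in> charts Mt" and c: "c \<in> charts M"
  obtains R g where "open R" "continuous_on R g"
    "\<And>y a. y \<in> pdom ct c \<Longrightarrow> (y, pder ct c y a) \<in> R \<and> g (y, pder ct c y a) = (y, a)"
proof -
  let ?P = "pdom ct c \<times> (UNIV :: 'e set)"
  let ?G = "\<lambda>z. (fst z, pder ct c (fst z) (snd z))"
  have lin: "linear (pder ct c y)" and inj: "inj (pder ct c y)" if y: "y \<in> pdom ct c" for y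
  proof -
    obtain q where "y = snd ct q" "q \<in> fst ct" "\<pi> q \<in> fst c" using y by (auto simp: pdom_def)
    then show "linear (pder ct c y)" "inj (pder ct c y)" using pder_inj[of ct q c] ct c by (auto simp: charts_at_def)
  qed
  have "continuous_on ?P (\<lambda>z. \<Sum>i\<in>Basis. (snd z \<bullet> i) *\<^sub>R pder ct c (fst z) i)"
    by (intro continuous_intros continuous_on_compose2[OF pder_cont[OF ct c]]) auto
  moreover have "(\<Sum>i\<in>Basis. (snd z \<bullet> i) *\<^sub>R pder ct c (fst z) i) = pder ct c (fst z) (snd z)" if "z \<in> ?P" for z
  proof -
    have "pder ct c (fst z) (snd z) = pder ct c (fst z) (\<Sum>i\<in>Basis. (snd z \<bullet> i) *\<^sub>R i)" by (simp add: euclidean_representation)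
    also have "\<dots> = (\<Sum>i\<in>Basis. (snd z \<bullet> i) *\<^sub>R pder ct c (fst z) i)"
      using lin[of "fst z"] that by (auto simp: linear_sum linear_cmul)
    finally show ?thesis by simp
  qed
  ultimately have "continuous_on ?P (\<lambda>z. pder ct c (fst z) (snd z))" by (metis (no_types, lifting) continuous_on_cong)
  then have Gc: "continuous_on ?P ?G" by (intro continuous_intros)
  have oP: "open ?P" using pdom_open[OF ct c] by (intro open_Times) auto
  have Gi: "inj_on ?G ?P"
  proof (rule inj_onI)
    fix z w assume z: "z \<in> ?P" "?G z = ?G w"
    then have "inj (pder ct c (fst z))" "pder ct c (fst z) (snd z) = pder ct c (fst z) (snd w)" using inj by auto
    then have "snd z = snd w" by (rule injD)
    then show "z = w" using z(2) by (simp add: prod_eq_iff)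
  qed
  obtain g where g: "homeomorphism ?P (?G ` ?P) ?G g"
    using invariance_of_domain_homeomorphism[OF oP Gc _ Gi] by auto
  have "open (?G ` ?P)" by (rule invariance_of_domain[OF Gc oP Gi])
  moreover have "continuous_on (?G ` ?P) g" using g by (simp add: homeomorphism_def)
  moreover have "(y, pder ct c y a) \<in> ?G ` ?P \<and> g (y, pder ct c y a) = (y, a)" if "y \<in> pdom ct c" for y a
  proof -
    have z: "(y, a) \<in> ?P" using that by simp
    then have "?G (y, a) \<in> ?G ` ?P" by (rule imageI)
    then show ?thesis using homeomorphism_apply1[OF g z] by (simp only: fst_conv snd_conv)
  qed
  ultimately show thesis by (rule that)
qed

text \<open>Lifts of geodesics are at first merely continuous. To compete in the infimum that
  defines the distance they must be C1, and their speed must be that of the geodesic below.\<close>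

lemma lift_geodesic_C1:
  assumes \<eta>: "geodesic_on M UNIV \<eta>" and k: "continuous_on UNIV k" "\<And>t. k t \<in> points Mt" "\<And>t. \<pi> (k t) = \<eta> t"
  shows "C1_curve_on Mt 0 1 k"
    and "metric Mt (k t) (velocity Mt k t) (velocity Mt k t) = metric M (\<eta> t) (velocity M \<eta> t) (velocity M \<eta> t)"
proof -
  define D where "D ct t = vector_derivative (\<lambda>s. snd ct (k s)) (at t)" for ct :: "('c, 'e) chart" and t
  note der = lift_geodesic_deriv[OF \<eta> k, folded D_def]
  have c_ex: "\<exists>c. c \<in> charts M \<and> \<eta> t \<in> fst c" for t using chart_exists[OF geodesic_in[OF \<eta>]] by blast
  have "isCont (D ct) t" if ct: "ct \<in> charts Mt" "k t \<in> fst ct" for ct t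
  proof -
    obtain c where c: "c \<in> charts M" "\<eta> t \<in> fst c" using c_ex by blast
    obtain R g where R: "open R" "continuous_on R g"
      "\<And>y a. y \<in> pdom ct c \<Longrightarrow> (y, pder ct c y a) \<in> R \<and> g (y, pder ct c y a) = (y, a)"
      using pder_inverse_cont[OF ct(1) c(1)] by metis
    let ?z = "\<lambda>s. (snd ct (k s), velocity M \<eta> s c)"
    have eq: "?z s \<in> R \<and> g (?z s) = (snd ct (k s), D ct s)" if s: "k s \<in> fst ct" "\<eta> s \<in> fst c" for s
    proof -
      have "snd ct (k s) \<in> pdom ct c" using pdom_iff[OF ct(1) c(1) s(1)] s k by simp
      then show ?thesis using R(3)[of "snd ct (k s)" "D ct s"] der(2)[OF ct(1) s(1) c(1) s(2)] by simp
    qed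
    have "isCont ?z t"
      using has_vector_derivative_continuous[OF der(1)[OF ct c]]
        has_vector_derivative_continuous[OF geodesic_state(2)[OF \<eta> open_UNIV UNIV_I c]] by (rule continuous_Pair)
    moreover have "isCont g (?z t)" using R(1,2) eq[OF ct(2) c(2)] by (simp add: continuous_on_eq_continuous_at)
    ultimately have "isCont (\<lambda>s. g (?z s)) t" by (rule isCont_o2)
    then have "isCont (\<lambda>s. snd (g (?z s))) t" by (rule continuous_snd)
    moreover have "eventually (\<lambda>s. snd (g (?z s)) = D ct s) (nhds t)"
    proof -
      have "open ({s. k s \<in> fst ct} \<inter> {s \<in> UNIV. \<eta> s \<in> fst c})"
        using der(3)[OF ct c] geodesic_chart_open[OF \<eta> open_UNIV c(1)] by (rule open_Int)
      moreover have "t \<in> {s. k s \<in> fst ct} \<inter> {s \<in> UNIV. \<eta> s \<in> fst c}" using ct c by simp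
      moreover have "\<forall>s \<in> {s. k s \<in> fst ct} \<inter> {s \<in> UNIV. \<eta> s \<in> fst c}. snd (g (?z s)) = D ct s" using eq by simp
      ultimately show ?thesis unfolding eventually_nhds by blast
    qed
    ultimately show ?thesis by (rule isCont_cong[THEN iffD1, rotated])
  qed
  then have "continuous_on {t \<in> {0..1}. k t \<in> fst ct} (D ct)" if "ct \<in> charts Mt" for ct
    using that by (intro continuous_at_imp_continuous_on) auto
  moreover have "(snd ct \<circ> k has_vector_derivative D ct t) (at t within {0..1})" if "ct \<in> charts Mt" "k t \<in> fst ct" for ct t
    using der(1)[OF that] c_ex[of t] by (auto simp: o_def intro: has_vector_derivative_at_within)
  ultimately show "C1_curve_on Mt 0 1 k"
    unfolding C1_curve_on_def using k by (blast intro: continuous_on_subset)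
  obtain ct where ct: "ct \<in> charts Mt" "k t \<in> fst ct" using mt.chart_exists[OF k(2)] by blast
  obtain c where c: "c \<in> charts M" "\<eta> t \<in> fst c" using c_ex by blast
  have at: "ct \<in> charts_at Mt (k t)" "c \<in> charts_at M (\<pi> (k t))" using ct c k(3) by (auto simp: charts_at_def)
  have "metric Mt (k t) (velocity Mt k t) (velocity Mt k t) = local_metric Mt ct (snd ct (k t)) (D ct t) (D ct t)"
    by (rule mt.velocity_metric[OF ct(1) der(3)[OF ct c] _ _ der(1)[OF ct c]]) (use ct in auto)
  also have "\<dots> = local_metric M c (snd c (\<eta> t)) (velocity M \<eta> t c) (velocity M \<eta> t c)"
    using pder_metric[OF at, of "D ct t" "D ct t"] der(2)[OF ct c] k(3) by simp
  also have "\<dots> = metric M (\<eta> t) (velocity M \<eta> t) (velocity M \<eta> t)"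
    using at(2) k(3) geodesic_velocity(1)[OF \<eta> open_UNIV] by (intro metric_coords[symmetric]) auto
  finally show "metric Mt (k t) (velocity Mt k t) (velocity Mt k t) = metric M (\<eta> t) (velocity M \<eta> t) (velocity M \<eta> t)" .
qed

lemma nrm_geo:
  assumes "c \<in> charts_at M p"
  shows "metric M (geo c p v t) (velocity M (geo c p v) t) (velocity M (geo c p v) t) = (nrm c p v)\<^sup>2"
proof -
  have "metric M (geo c p v t) (velocity M (geo c p v) t) (velocity M (geo c p v) t) = local_metric M c (snd c p) v v"
    using geodesic_speed[OF geo(1)[OF assms], of v t 0] geo[OF assms, of v] local_metric_eq[OF assms] by simp
  moreover have "0 \<le> local_metric M c (snd c p) v v"
    using metric_chart.g_nonneg[OF metric_chart] assms by (auto simp: charts_at_def)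
  ultimately show ?thesis by (simp add: nrm_def)
qed

lemma Ext_ray:
  assumes b: "based c q"
  shows "piecewise_C1_curve Mt (\<lambda>t. Ext c q (t *\<^sub>R v))" "curve_length Mt (\<lambda>t. Ext c q (t *\<^sub>R v)) = nrm c (\<pi> q) v"
proof -
  let ?k = "\<lambda>t. Ext c q (t *\<^sub>R v)"
  have c: "c \<in> charts_at M (\<pi> q)" using b by simp
  have k: "continuous_on UNIV ?k" "\<And>t. ?k t \<in> points Mt" "\<And>t. \<pi> (?k t) = geo c (\<pi> q) v t"
    using Ext[OF b] Exp_scale[OF c] by (auto intro!: continuous_on_compose2[OF Ext(1)[OF b]] continuous_intros)
  note C1 = lift_geodesic_C1[OF geo(1)[OF c] k]
  show "piecewise_C1_curve Mt ?k" unfolding piecewise_C1_curve_def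
    using C1(1) by (intro exI[of _ "{0, 1}"]) auto
  have "mt.speed ?k t = nrm c (\<pi> q) v" for t
    unfolding C1(2) nrm_geo[OF c] using metric_chart.g_nonneg[OF metric_chart, of c "snd c (\<pi> q)" v] c
    by (auto simp: nrm_def charts_at_def)
  then show "curve_length Mt ?k = nrm c (\<pi> q) v" by (simp add: curve_length_def)
qed

subsection \<open>The distance of the universal covering\<close>

abbreviation dt :: "'c \<Rightarrow> 'c \<Rightarrow> real" where "dt \<equiv> riemannian_dist Mt"

lemma dist_lower:
  assumes b: "based c q"
  shows "nrm c (\<pi> q) (w - v) \<le> dt (Ext c q v) (Ext c q w)"
  unfolding riemannian_dist_def
proof (rule cInf_greatest)
  let ?q = "Ext c q v"
  have q: "?q \<in> points Mt" "Ext c q w \<in> points Mt" using Ext[OF b] by auto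
  \<comment> \<open>The set of lengths must be nonempty for its infimum to mean anything; the ray
    from \<open>?q\<close>, in a chart at its projection, provides a curve.\<close>
  obtain c' where b': "based c' ?q" using based_exists[OF q(1)] by blast
  have "Ext c' ?q (0 *\<^sub>R Log c' ?q (Ext c q w)) = ?q" "Ext c' ?q (1 *\<^sub>R Log c' ?q (Ext c q w)) = Ext c q w"
    using Ext[OF b'] Log[OF b'] q by auto
  then show "{curve_length Mt \<gamma> |\<gamma>. piecewise_C1_curve Mt \<gamma> \<and> \<gamma> 0 = ?q \<and> \<gamma> 1 = Ext c q w} \<noteq> {}"
    using Ext_ray(1)[OF b', of "Log c' ?q (Ext c q w)"] by blast
qed (use length_lower[OF b] in auto)

lemma dist_ray:
  assumes b: "based c q"
  shows "dt q (Ext c q v) = nrm c (\<pi> q) v"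
proof (rule antisym)
  show "nrm c (\<pi> q) v \<le> dt q (Ext c q v)" using dist_lower[OF b, of v 0] Ext(3)[OF b] by simp
  have "curve_length Mt (\<lambda>t. Ext c q (t *\<^sub>R v)) \<in> {curve_length Mt \<gamma> |\<gamma>. piecewise_C1_curve Mt \<gamma> \<and> \<gamma> 0 = q \<and> \<gamma> 1 = Ext c q v}"
    using Ext_ray(1)[OF b, of v] Ext(3)[OF b] by force
  moreover have "bdd_below {curve_length Mt \<gamma> |\<gamma>. piecewise_C1_curve Mt \<gamma> \<and> \<gamma> 0 = q \<and> \<gamma> 1 = Ext c q v}"
    using length_lower[OF b, of _ 0 v] Ext(3)[OF b] by (intro bdd_belowI[of _ "nrm c (\<pi> q) (v - 0)"]) auto
  ultimately show "dt q (Ext c q v) \<le> nrm c (\<pi> q) v"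
    unfolding riemannian_dist_def Ext_ray(2)[OF b, symmetric] by (rule cInf_lower)
qed

text \<open>Moves the base point along a ray: \<open>u\<close> holds the coordinates of the velocity
  at time \<open>s0\<close>. Estimates that are exact from the base point thereby become available
  at every point of the ray.\<close>

lemma Ext_reparam:
  assumes b: "based c q" and b': "based c' (Ext c q (s0 *\<^sub>R v))"
  obtains u where "nrm c' (\<pi> (Ext c q (s0 *\<^sub>R v))) u = nrm c (\<pi> q) v"
    "\<And>s. Ext c' (Ext c q (s0 *\<^sub>R v)) (s *\<^sub>R u) = Ext c q ((s0 + s) *\<^sub>R v)"
proof -
  let ?q = "Ext c q (s0 *\<^sub>R v)" and ?\<eta> = "geo c (\<pi> q) v"
  have c: "c \<in> charts_at M (\<pi> q)" "c' \<in> charts_at M (\<pi> ?q)" using b b' by auto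
  note \<eta> = geo(1)[OF c(1), of v]
  have q: "\<pi> ?q = ?\<eta> s0" using Ext(4)[OF b] Exp_scale[OF c(1)] by simp
  define u where "u = velocity M ?\<eta> s0 c'"
  have vel: "velocity M ?\<eta> s0 \<in> tangent_space M (\<pi> ?q)" unfolding q by (rule geodesic_velocity(1)[OF \<eta>]) auto
  have cu: "coord_vec M c' (\<pi> ?q) u = velocity M ?\<eta> s0" unfolding u_def by (rule tangent_coord_vec[OF vel c(2)])
  have sh: "?\<eta> (s0 + s) = geo c' (\<pi> ?q) u s" for s
  proof (rule geo_unique[OF c(2) _ open_UNIV connected_UNIV UNIV_I UNIV_I, of "\<lambda>s. ?\<eta> (s0 + s)"])
    show "geodesic_on M UNIV (\<lambda>s. ?\<eta> (s0 + s))" using geodesic_affine(1)[OF \<eta>, of 1 s0] by (simp add: add.commute)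
    show "velocity M (\<lambda>s. ?\<eta> (s0 + s)) 0 = coord_vec M c' (\<pi> ?q) u"
      using geodesic_affine(2)[OF \<eta>, of 1 s0 0] cu by (simp add: add.commute tscale_def)
  qed (simp add: q)
  have "Ext c' ?q (s *\<^sub>R u) = Ext c q ((s0 + s) *\<^sub>R v)" for s
  proof (rule covering_lift_unique[where T = UNIV and ?g1.0 = "\<lambda>s. Ext c' ?q (s *\<^sub>R u)" and ?g2.0 = "\<lambda>s. Ext c q ((s0 + s) *\<^sub>R v)" and a = 0, OF covering(1)])
    show "continuous_on UNIV (\<lambda>s. Ext c' ?q (s *\<^sub>R u))" by (rule continuous_on_compose2[OF Ext(1)[OF b']]) (auto intro!: continuous_intros)
    show "continuous_on UNIV (\<lambda>s. Ext c q ((s0 + s) *\<^sub>R v))" by (rule continuous_on_compose2[OF Ext(1)[OF b]]) (auto intro!: continuous_intros)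
    show "\<pi> (Ext c' ?q (s *\<^sub>R u)) = \<pi> (Ext c q ((s0 + s) *\<^sub>R v))" for s
      using Ext(4)[OF b'] Exp_scale[OF c(2)] sh Ext(4)[OF b] Exp_scale[OF c(1)] by metis
  qed (use Ext[OF b] Ext[OF b'] in auto)
  moreover have "nrm c' (\<pi> ?q) u = nrm c (\<pi> q) v"
  proof -
    have "local_metric M c' (snd c' (\<pi> ?q)) u u = (nrm c (\<pi> q) v)\<^sup>2"
      using local_metric_eq[OF c(2), of u u] nrm_geo[OF c(1), of v s0] cu q by simp
    then have "nrm c' (\<pi> ?q) u = \<bar>nrm c (\<pi> q) v\<bar>" by (simp add: nrm_def)
    moreover have "0 \<le> nrm c (\<pi> q) v" using metric_chart.g_nonneg[OF metric_chart, of c "snd c (\<pi> q)" v] c(1)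
      by (auto simp: nrm_def charts_at_def)
    ultimately show ?thesis by simp
  qed
  ultimately show thesis using that by blast
qed

end

section \<open>Metric properties of the distance\<close>

context universal_cover
begin

text \<open>The third from last clause, \<open>nrm_eq_0\<close>, separates points of the tangent
  space; \<open>nrm_convex\<close> is Stewart's identity for the point 0 on the segment from
  \<open>- s *\<^sub>R b\<close> to \<open>(1 - s) *\<^sub>R b\<close>, seen from
  \<open>a\<close>.\<close>

lemma
  assumes c: "c \<in> charts_at M p"
  shows nrm_nonneg: "0 \<le> nrm c p a"
    and nrm_scale: "nrm c p (r *\<^sub>R a) = \<bar>r\<bar> * nrm c p a"
    and nrm_triangle: "nrm c p (a + b) \<le> nrm c p a + nrm c p b"
    and nrm_eq_0: "nrm c p a = 0 \<longleftrightarrow> a = 0"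
    and nrm_convex: "0 \<le> s \<Longrightarrow> s \<le> 1 \<Longrightarrow> (1 - s) * (nrm c p (a + s *\<^sub>R b))\<^sup>2 + s * (nrm c p (a - (1 - s) *\<^sub>R b))\<^sup>2
      = (nrm c p a)\<^sup>2 + s * (1 - s) * (nrm c p b)\<^sup>2"
    and nrm_cont: "continuous_on UNIV (nrm c p)"
proof -
  have c': "c \<in> charts M" "snd c p \<in> img c" using c by (auto simp: charts_at_def)
  interpret mc: metric_chart "img c" "local_metric M c" by (rule metric_chart[OF c'(1)])
  let ?B = "local_metric M c (snd c p)"
  note bil = mc.g_bilinear[OF c'(2)]
  note B = bilinear_radd[OF bil] bilinear_ladd[OF bil] bilinear_rmul[OF bil] bilinear_lmul[OF bil]
    bilinear_rsub[OF bil] bilinear_lsub[OF bil] bilinear_lzero[OF bil] bilinear_rzero[OF bil] bilinear_rneg[OF bil] bilinear_lneg[OF bil]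
  have sq: "(nrm c p a)\<^sup>2 = ?B a a" for a using mc.g_nonneg[OF c'(2)] by (simp add: nrm_def)
  show nn: "0 \<le> nrm c p a" for a using mc.g_nonneg[OF c'(2)] by (simp add: nrm_def)
  show "nrm c p (r *\<^sub>R a) = \<bar>r\<bar> * nrm c p a"
    by (simp add: nrm_def B real_sqrt_mult mult.assoc[symmetric])
  show "nrm c p a = 0 \<longleftrightarrow> a = 0"
    using mc.g_pos[OF c'(2), of a] B(7)[of 0] by (cases "a = 0") (auto simp: nrm_def)
  have cs: "?B a b \<le> nrm c p a * nrm c p b" for a b
  proof -
    have "(?B a b)\<^sup>2 \<le> (nrm c p a * nrm c p b)\<^sup>2" unfolding power_mult_distrib sq by (rule mc.g_cauchy_schwarz[OF c'(2)])
    then have "\<bar>?B a b\<bar> \<le> nrm c p a * nrm c p b" using nn by (simp add: abs_le_square_iff[symmetric] abs_mult)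
    then show ?thesis by simp
  qed
  show "nrm c p (a + b) \<le> nrm c p a + nrm c p b"
  proof (rule power2_le_imp_le)
    have "?B b a = ?B a b" using mc.g_sym[OF c'(2)] by blast
    then show "(nrm c p (a + b))\<^sup>2 \<le> (nrm c p a + nrm c p b)\<^sup>2"
      using cs[of a b] unfolding power2_sum sq by (simp add: B)
  qed (use nn in \<open>simp add: add_nonneg_nonneg\<close>)
  have ba: "?B b a = ?B a b" using mc.g_sym[OF c'(2)] by blast
  show "(1 - s) * (nrm c p (a + s *\<^sub>R b))\<^sup>2 + s * (nrm c p (a - (1 - s) *\<^sub>R b))\<^sup>2
      = (nrm c p a)\<^sup>2 + s * (1 - s) * (nrm c p b)\<^sup>2" if "0 \<le> s" "s \<le> 1"
    unfolding sq by (simp add: B ba algebra_simps power2_eq_square)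
  have "continuous_on UNIV (\<lambda>a. ?B a a)"
    by (rule bilinear_family_continuous[where B = "\<lambda>_. ?B"]) (use bil in \<open>auto intro: continuous_intros\<close>)
  then show "continuous_on UNIV (nrm c p)" unfolding nrm_def[abs_def] by (intro continuous_intros)
qed

lemma point_polar:
  assumes "x \<in> points Mt" "y \<in> points Mt"
  obtains c v where "based c x" "y = Ext c x v" "dt x y = nrm c (\<pi> x) v"
proof -
  obtain c where c: "based c x" using based_exists[OF assms(1)] by blast
  show thesis by (rule that[OF c, of "Log c x y"]) (use Log(3)[OF c assms(2)] dist_ray[OF c, of "Log c x y"] in auto)
qed

lemma dist_nonneg: "x \<in> points Mt \<Longrightarrow> y \<in> points Mt \<Longrightarrow> 0 \<le> dt x y"
  by (rule point_polar[of x y]) (use nrm_nonneg in auto)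

lemma dist_self: "x \<in> points Mt \<Longrightarrow> dt x x = 0"
  using based_exists[of x] dist_ray[of x _ 0] Ext(3)[of x] nrm_eq_0 by metis

text \<open>\<open>dist_ray\<close> sees the distance from the first point; running back along the
  ray, by \<open>Ext_reparam\<close>, gives the same value from the second.\<close>

lemma dist_sym:
  assumes "x \<in> points Mt" "y \<in> points Mt"
  shows "dt x y = dt y x"
proof -
  obtain c v where c: "based c x" "y = Ext c x v" "dt x y = nrm c (\<pi> x) v" using assms by (rule point_polar)
  obtain c' where c': "based c' (Ext c x (1 *\<^sub>R v))" using based_exists Ext(2)[OF c(1)] by blast
  obtain u where u: "nrm c' (\<pi> (Ext c x (1 *\<^sub>R v))) u = nrm c (\<pi> x) v" "\<And>s. Ext c' (Ext c x (1 *\<^sub>R v)) (s *\<^sub>R u) = Ext c x ((1 + s) *\<^sub>R v)"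
    using Ext_reparam[OF c(1) c'] by blast
  have "Ext c' y ((-1) *\<^sub>R u) = x" using u(2)[of "-1"] Ext(3)[OF c(1)] c(2) by simp
  then have "dt y x = nrm c' (\<pi> y) ((-1) *\<^sub>R u)" using dist_ray[OF c', of "(-1) *\<^sub>R u"] c(2) by simp
  also have "\<dots> = nrm c' (\<pi> y) u" using nrm_scale[of c' "\<pi> y" "-1" u] c' c(2) by simp
  finally show ?thesis using u(1) c by simp
qed

text \<open>Read in the tangent space at \<open>x\<close>, where distances from \<open>x\<close> are
  norms and the norm of \<open>w - v\<close> does not exceed \<open>dt y z\<close>.\<close>

lemma dist_triangle_dt:
  assumes "x \<in> points Mt" "y \<in> points Mt" "z \<in> points Mt"
  shows "dt x z \<le> dt x y + dt y z"
proof -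
  obtain c v where c: "based c x" "y = Ext c x v" "dt x y = nrm c (\<pi> x) v" using assms(1,2) by (rule point_polar)
  define w where "w = Log c x z"
  have z: "z = Ext c x w" using Log(3)[OF c(1) assms(3)] by (simp add: w_def)
  have "nrm c (\<pi> x) w \<le> nrm c (\<pi> x) v + nrm c (\<pi> x) (w - v)" using nrm_triangle[of c "\<pi> x" v "w - v"] c(1) by simp
  also have "nrm c (\<pi> x) (w - v) \<le> dt y z" unfolding c(2) z by (rule dist_lower[OF c(1)])
  finally show ?thesis using dist_ray[OF c(1), of w] c(3) z by simp
qed

text \<open>With the base point moved to \<open>?z\<close>, the distance to \<open>y\<close> is the
  norm of \<open>w\<close>, while \<open>dist_lower\<close> underestimates the distances from
  \<open>y\<close> to both ends of the ray. Stewart's identity \<open>nrm_convex\<close> relates the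
  three norms.\<close>

lemma bruhat_tits:
  assumes b: "based c q" and s: "0 \<le> s" "s \<le> 1" and y: "y \<in> points Mt"
  shows "(dt y (Ext c q (s *\<^sub>R v)))\<^sup>2 \<le> (1 - s) * (dt y q)\<^sup>2 + s * (dt y (Ext c q v))\<^sup>2 - s * (1 - s) * (nrm c (\<pi> q) v)\<^sup>2"
proof -
  let ?z = "Ext c q (s *\<^sub>R v)"
  have z: "?z \<in> points Mt" using Ext[OF b] by blast
  obtain c' where b': "based c' ?z" using based_exists[OF z] by blast
  obtain u where u: "nrm c' (\<pi> ?z) u = nrm c (\<pi> q) v" "\<And>r. Ext c' ?z (r *\<^sub>R u) = Ext c q ((s + r) *\<^sub>R v)"
    using Ext_reparam[OF b b'] by blast
  define w where "w = Log c' ?z y"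
  have w: "y = Ext c' ?z w" using Log(3)[OF b' y] by (simp add: w_def)
  have q: "q = Ext c' ?z ((-s) *\<^sub>R u)" "Ext c q v = Ext c' ?z ((1 - s) *\<^sub>R u)" unfolding u(2) using Ext(3)[OF b] by auto
  have c': "c' \<in> charts_at M (\<pi> ?z)" using b' by simp
  let ?n = "nrm c' (\<pi> ?z)"
  have "?n (w + s *\<^sub>R u) \<le> dt q y" using dist_lower[OF b', of w "(-s) *\<^sub>R u"] q(1) w by simp
  then have 1: "(?n (w + s *\<^sub>R u))\<^sup>2 \<le> (dt y q)\<^sup>2"
    using nrm_nonneg[OF c'] dist_sym[of q y] b y by (intro power_mono) auto
  have "?n (w - (1 - s) *\<^sub>R u) \<le> dt (Ext c q v) y" using dist_lower[OF b', of w "(1 - s) *\<^sub>R u"] q(2) w by simp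
  then have 2: "(?n (w - (1 - s) *\<^sub>R u))\<^sup>2 \<le> (dt y (Ext c q v))\<^sup>2"
    using nrm_nonneg[OF c'] dist_sym[of "Ext c q v" y] Ext(2)[OF b] y by (intro power_mono) auto
  have "dt y ?z = ?n w" using dist_ray[OF b', of w] w dist_sym[OF z y] by simp
  moreover have "(?n w)\<^sup>2 + s * (1 - s) * (?n u)\<^sup>2 \<le> (1 - s) * (dt y q)\<^sup>2 + s * (dt y (Ext c q v))\<^sup>2"
    unfolding nrm_convex[OF c' s, symmetric] using 1 2 s by (intro add_mono mult_left_mono) auto
  ultimately show ?thesis using u(1) by simp
qed

lemma dist_ray_points:
  assumes b: "based c q" and st: "0 \<le> s" "s \<le> t"
  shows "dt (Ext c q (s *\<^sub>R v)) (Ext c q (t *\<^sub>R v)) = (t - s) * nrm c (\<pi> q) v"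
proof -
  let ?z = "Ext c q (s *\<^sub>R v)"
  obtain c' where b': "based c' ?z" using based_exists Ext(2)[OF b] by blast
  obtain u where u: "nrm c' (\<pi> ?z) u = nrm c (\<pi> q) v" "\<And>r. Ext c' ?z (r *\<^sub>R u) = Ext c q ((s + r) *\<^sub>R v)"
    using Ext_reparam[OF b b'] by blast
  have "Ext c q (t *\<^sub>R v) = Ext c' ?z ((t - s) *\<^sub>R u)" unfolding u(2) by simp
  then show ?thesis using dist_ray[OF b', of "(t - s) *\<^sub>R u"] nrm_scale[of c' "\<pi> ?z" "t - s" u] b' u(1) st by simp
qed

text \<open>Connects the distance with the given topology of \<open>Mt\<close>, which its definition
  does not mention: in the continuous coordinates \<open>Log c p\<close> it is a norm.\<close>

lemma dist_tendsto_0: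
  assumes F: "(f \<longlongrightarrow> p) F" and p: "p \<in> points Mt" and f: "eventually (\<lambda>x. f x \<in> points Mt) F"
  shows "((\<lambda>x. dt p (f x)) \<longlongrightarrow> 0) F"
proof -
  obtain c where b: "based c p" using based_exists[OF p] by blast
  have "((\<lambda>x. Log c p (f x)) \<longlongrightarrow> Log c p p) F"
    by (rule continuous_on_tendsto_compose[OF Log(1)[OF b] F p f])
  then have "((\<lambda>x. nrm c (\<pi> p) (Log c p (f x))) \<longlongrightarrow> nrm c (\<pi> p) (Log c p p)) F"
    using b by (intro continuous_on_tendsto_compose[OF nrm_cont]) auto
  moreover have "nrm c (\<pi> p) (Log c p p) = 0" using Log(4)[OF b] nrm_eq_0 b by simp
  moreover have "eventually (\<lambda>x. nrm c (\<pi> p) (Log c p (f x)) = dt p (f x)) F"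
    using f by eventually_elim (use dist_ray[OF b] Log(3)[OF b] in metis)
  ultimately show ?thesis using Lim_transform_eventually by simp
qed

lemma dist_tendsto:
  assumes F: "(f \<longlongrightarrow> p) F" "p \<in> points Mt" "eventually (\<lambda>x. f x \<in> points Mt) F"
    and G: "(g \<longlongrightarrow> q) F" "q \<in> points Mt" "eventually (\<lambda>x. g x \<in> points Mt) F"
  shows "((\<lambda>x. dt (f x) (g x)) \<longlongrightarrow> dt p q) F"
proof -
  have "((\<lambda>x. dt p (f x) + dt q (g x)) \<longlongrightarrow> 0 + 0) F" by (intro tendsto_add dist_tendsto_0 F G)
  moreover have "eventually (\<lambda>x. norm (dt (f x) (g x) - dt p q) \<le> dt p (f x) + dt q (g x)) F"
    using F(3) G(3)
  proof eventually_elim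
    case (elim x)
    have "dt (f x) (g x) \<le> dt (f x) p + (dt p q + dt q (g x))"
      using dist_triangle_dt[of "f x" p "g x"] dist_triangle_dt[of p q "g x"] elim F(2) G(2) by linarith
    moreover have "dt p q \<le> dt p (f x) + (dt (f x) (g x) + dt (g x) q)"
      using dist_triangle_dt[of p "f x" q] dist_triangle_dt[of "f x" "g x" q] elim F(2) G(2) by linarith
    ultimately show ?case using dist_sym elim F(2) G(2) by (simp add: abs_le_iff)
  qed
  ultimately have "((\<lambda>x. dt (f x) (g x) - dt p q) \<longlongrightarrow> 0) F" by (simp add: Lim_null_comparison)
  then show ?thesis by (simp add: LIM_zero_iff)
qed

lemma dist_cont:
  assumes "continuous_on S f" "f ` S \<subseteq> points Mt" "continuous_on S g" "g ` S \<subseteq> points Mt"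
  shows "continuous_on S (\<lambda>x. dt (f x) (g x))"
  unfolding continuous_on_def
proof
  fix x assume x: "x \<in> S"
  have ev: "eventually (\<lambda>y. y \<in> S) (at x within S)" by (simp add: eventually_at_filter)
  show "((\<lambda>x. dt (f x) (g x)) \<longlongrightarrow> dt (f x) (g x)) (at x within S)"
    by (rule dist_tendsto) (use assms x ev in \<open>auto simp: continuous_on_def elim!: eventually_mono\<close>)
qed

end

section \<open>Lifted curves and asymptotic rays\<close>

context hadamard_base
begin

text \<open>\<open>exp_map\<close> admits geodesics on any open interval around
  \<open>{0..1}\<close>; by uniqueness all of them end where the complete geodesic does.\<close>

lemma exp_map_eq:
  assumes c: "c \<in> charts_at M p" and v: "v \<in> tangent_space M p"
  shows "exp_map M p (tscale t v) = Exp c p (t *\<^sub>R v c)"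
proof -
  have cv: "coord_vec M c p (t *\<^sub>R v c) = tscale t v" using coord_vec_scale[OF c] tangent_coord_vec[OF v c] by simp
  show ?thesis unfolding exp_map_def
  proof (rule the_equality)
    show "\<exists>I \<gamma>. open I \<and> is_interval I \<and> {0..1} \<subseteq> I \<and> geodesic_on M I \<gamma> \<and>
        \<gamma> 0 = p \<and> velocity M \<gamma> 0 = tscale t v \<and> \<gamma> 1 = Exp c p (t *\<^sub>R v c)"
      using geo[OF c, of "t *\<^sub>R v c"] cv by (intro exI[of _ UNIV] exI[of _ "geo c p (t *\<^sub>R v c)"]) (simp add: Exp_def is_interval_univ)
  next
    fix q assume "\<exists>I \<gamma>. open I \<and> is_interval I \<and> {0..1} \<subseteq> I \<and> geodesic_on M I \<gamma> \<and>
        \<gamma> 0 = p \<and> velocity M \<gamma> 0 = tscale t v \<and> \<gamma> 1 = q"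
    then obtain I \<gamma> where I: "open I" "is_interval I" "{0..1} \<subseteq> I" "geodesic_on M I \<gamma>" "\<gamma> 0 = p"
      "velocity M \<gamma> 0 = tscale t v" "\<gamma> 1 = q" by blast
    have "0 \<in> I" "1 \<in> I" using I(3) by auto
    then have "\<gamma> 1 = geo c p (t *\<^sub>R v c) 1"
      using I cv by (intro geo_unique[OF c I(4,1) is_interval_connected]) auto
    then show "q = Exp c p (t *\<^sub>R v c)" using I(7) by (simp add: Exp_def)
  qed
qed

end

context universal_cover
begin

abbreviation lift_from :: "'c \<Rightarrow> (real \<Rightarrow> 'm) \<Rightarrow> (real \<Rightarrow> 'c) \<Rightarrow> bool" where
  "lift_from \<equiv> is_lift_from Mt \<pi>"

lemma lift_fromD:
  assumes "lift_from q g \<beta>"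
  shows "continuous_on {0..} \<beta>" "0 \<le> t \<Longrightarrow> \<beta> t \<in> points Mt" "0 \<le> t \<Longrightarrow> \<pi> (\<beta> t) = g t" "\<beta> 0 = q" "q \<in> points Mt" "\<pi> q = g 0"
  using assms by (auto simp: is_lift_from_def image_subset_iff)

lemma lift_from_unique:
  assumes "lift_from q g \<beta>" "lift_from q g \<beta>'" "0 \<le> t"
  shows "\<beta> t = \<beta>' t"
  by (rule covering_lift_unique[where T = "{0..}" and ?g1.0 = \<beta> and ?g2.0 = \<beta>' and a = 0, OF covering(1)])
    (use assms lift_fromD[OF assms(1)] lift_fromD[OF assms(2)] in auto)

lemma lift_from_exists:
  assumes g: "continuous_on {0..} g" "\<And>t. 0 \<le> t \<Longrightarrow> g t \<in> points M" and q: "q \<in> points Mt" "\<pi> q = g 0"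
  obtains \<beta> where "lift_from q g \<beta>"
proof -
  have h: "continuous_on ({0..1::real} \<times> {0..}) (\<lambda>z. g (fst z * snd z))"
    by (rule continuous_on_compose2[OF g(1)]) (auto intro!: continuous_intros)
  obtain k where k: "continuous_on ({0..1} \<times> {0..}) k" "k ` ({0..1} \<times> {0..}) \<subseteq> points Mt"
    "\<And>y. y \<in> {0..} \<Longrightarrow> k (0, y) = q" "\<And>z. z \<in> {0..1} \<times> {0..} \<Longrightarrow> \<pi> (k z) = g (fst z * snd z)"
    by (rule covering_homotopy_lift[OF covering(1) h, where f = "\<lambda>_. q"]) (use g(2) q in auto)
  have kc: "continuous_on {0..} (\<lambda>t. k (1, t))" by (rule continuous_on_compose2[OF k(1)]) (auto intro!: continuous_intros)
  have "k (0, 0) = k (1, 0)"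
  proof (rule covering_lift_unique[where T = "{0..1::real}" and ?g1.0 = "\<lambda>t. k (0, 0)" and ?g2.0 = "\<lambda>t. k (t, 0)" and a = 0, OF covering(1)])
    show "continuous_on {0..1} (\<lambda>t. k (t, 0))" by (rule continuous_on_compose2[OF k(1)]) (auto intro!: continuous_intros)
  qed (use k q in \<open>auto simp: image_subset_iff\<close>)
  then have "k (1, 0) = q" using k(3)[of 0] by simp
  then have "lift_from q g (\<lambda>t. k (1, t))" using kc k(2,4) by (auto simp: is_lift_from_def)
  then show thesis by (rule that)
qed

lemma lift_from_shift:
  assumes l: "lift_from q g \<beta>" and s: "0 \<le> s"
  shows "lift_from (\<beta> s) (\<lambda>t. g (s + t)) (\<lambda>t. \<beta> (s + t))"
  unfolding is_lift_from_def
proof (intro conjI allI impI)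
  show "continuous_on {0..} (\<lambda>t. \<beta> (s + t))"
    by (rule continuous_on_compose2[OF lift_fromD(1)[OF l]]) (use s in \<open>auto intro!: continuous_intros\<close>)
qed (use lift_fromD[OF l] s in auto)

text \<open>\<open>Ext c q' \<circ> Log c q\<close> acts as the deck transformation from
  \<open>q\<close> to \<open>q'\<close>: both \<open>Ext c q\<close> and \<open>Ext c q'\<close>
  lift the same exponential map.\<close>

lemma lift_from_change:
  assumes l: "lift_from q g \<beta>" and b: "based c q" and q': "q' \<in> points Mt" "\<pi> q' = \<pi> q"
  shows "lift_from q' g (\<lambda>t. Ext c q' (Log c q (\<beta> t)))"
proof -
  have b': "based c q'" using b q' by simp
  have Lc: "continuous_on {0..} (\<lambda>t. Log c q (\<beta> t))"
    by (rule continuous_on_compose2[OF Log(1)[OF b] lift_fromD(1)[OF l]]) (use lift_fromD(2)[OF l] in auto)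
  have "continuous_on {0..} (\<lambda>t. Ext c q' (Log c q (\<beta> t)))"
    by (rule continuous_on_compose2[OF Ext(1)[OF b'] Lc]) auto
  moreover have "\<pi> (Ext c q' (Log c q (\<beta> t))) = g t" if "0 \<le> t" for t
    using Ext(4)[OF b', of "Log c q (\<beta> t)"] Ext(4)[OF b, of "Log c q (\<beta> t)"] Log(3)[OF b lift_fromD(2)[OF l that]]
      lift_fromD(3)[OF l that] q'(2) by simp
  ultimately show ?thesis
    using Ext[OF b'] Log(4)[OF b] lift_fromD(4)[OF l] by (auto simp: is_lift_from_def)
qed

lemma lift_from_Log:
  assumes "lift_from q g \<beta>" "lift_from q' g \<beta>'" "based c q" "0 \<le> t"
  shows "Log c q' (\<beta>' t) = Log c q (\<beta> t)"
proof -
  have q': "q' \<in> points Mt" "\<pi> q' = \<pi> q" using lift_fromD(5,6)[OF assms(1)] lift_fromD(5,6)[OF assms(2)] by auto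
  have "\<beta>' t = Ext c q' (Log c q (\<beta> t))"
    by (rule lift_from_unique[OF assms(2) lift_from_change[OF assms(1,3) q'] assms(4)])
  then show ?thesis using Log(2)[of q' c] assms(3) q' by simp
qed

lemma lift_from_displacement:
  assumes l: "lift_from q g \<beta>" "lift_from q' g \<beta>'" and t: "0 \<le> t"
  shows "dt q' (\<beta>' t) = dt q (\<beta> t)"
proof -
  obtain c where b: "based c q" using based_exists lift_fromD(5)[OF l(1)] by blast
  have b': "based c q'" using b lift_fromD(5,6)[OF l(1)] lift_fromD(5,6)[OF l(2)] by simp
  have "dt q' (\<beta>' t) = nrm c (\<pi> q') (Log c q' (\<beta>' t))"
    using dist_ray[OF b'] Log(3)[OF b' lift_fromD(2)[OF l(2) t]] by metis
  also have "\<dots> = nrm c (\<pi> q) (Log c q (\<beta> t))" using lift_from_Log[OF l b t] lift_fromD(6)[OF l(1)] lift_fromD(6)[OF l(2)] by simp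
  also have "\<dots> = dt q (\<beta> t)" using dist_ray[OF b] Log(3)[OF b lift_fromD(2)[OF l(1) t]] by metis
  finally show ?thesis .
qed

text \<open>The parameter puts the comparison point at distance \<open>B * k\<close> from
  \<open>q\<close>. The hypotheses bound the distances from \<open>y\<close> to the two ends, and
  the right side of \<open>bruhat_tits\<close> becomes
  \<open>(1 - s) * ((A' * k)\<^sup>2 - (B * k)\<^sup>2)\<close>.\<close>

lemma near_ray:
  assumes b: "based c q" and yz: "y \<in> points Mt" "z \<in> points Mt" and A: "0 < B" "B < A'" and k: "0 < k" and L: "B * k \<le> dt q z"
    and up: "dt q y \<le> A' * k" and down: "B * k \<le> dt q z - dt y z"
  shows "dt y (Ext c q ((B * k / dt q z) *\<^sub>R Log c q z)) \<le> sqrt (A'\<^sup>2 - B\<^sup>2) * k"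
proof -
  define l s v where "l = dt q z" and "s = B * k / l" and "v = Log c q z"
  have q: "q \<in> points Mt" using b by simp
  have l: "l > 0" using L A k by (smt (verit, best) l_def mult_pos_pos)
  have sl: "s * l = B * k" using l by (simp add: s_def)
  have s: "0 \<le> s" "s \<le> 1" using L A k l by (simp_all add: s_def l_def)
  have z: "Ext c q v = z" unfolding v_def by (rule Log(3)[OF b yz(2)])
  have nv: "nrm c (\<pi> q) v = l" using dist_ray[OF b, of v] z by (simp add: l_def)
  have 1: "(dt y q)\<^sup>2 \<le> (A' * k)\<^sup>2" using up dist_sym[OF yz(1) q] dist_nonneg[OF q yz(1)] by (intro power_mono) auto
  have "dt y z \<le> (1 - s) * l" using down sl by (simp add: l_def algebra_simps)
  then have 2: "(dt y z)\<^sup>2 \<le> ((1 - s) * l)\<^sup>2" using dist_nonneg[OF yz] by (intro power_mono) auto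
  have "(dt y (Ext c q (s *\<^sub>R v)))\<^sup>2 \<le> (1 - s) * (dt y q)\<^sup>2 + s * (dt y z)\<^sup>2 - s * (1 - s) * l\<^sup>2"
    using bruhat_tits[OF b s yz(1), of v] z nv by simp
  also have "\<dots> \<le> (1 - s) * (A' * k)\<^sup>2 + s * ((1 - s) * l)\<^sup>2 - s * (1 - s) * l\<^sup>2"
    using 1 2 s by (intro diff_right_mono add_mono mult_left_mono) auto
  also have "\<dots> = (1 - s) * ((A' * k)\<^sup>2 - (s * l)\<^sup>2)" by (simp add: power2_eq_square algebra_simps)
  also have "\<dots> = (1 - s) * ((A'\<^sup>2 - B\<^sup>2) * k\<^sup>2)" unfolding sl by (simp add: power2_eq_square algebra_simps)
  also have "\<dots> \<le> 1 * ((A'\<^sup>2 - B\<^sup>2) * k\<^sup>2)"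
    using s A by (intro mult_right_mono mult_nonneg_nonneg) (auto intro!: power_mono)
  finally have "sqrt ((dt y (Ext c q (s *\<^sub>R v)))\<^sup>2) \<le> sqrt ((A'\<^sup>2 - B\<^sup>2) * k\<^sup>2)" by (intro real_sqrt_le_mono) simp
  then have "dt y (Ext c q (s *\<^sub>R v)) \<le> sqrt ((A'\<^sup>2 - B\<^sup>2) * k\<^sup>2)" by simp
  also have "\<dots> = sqrt (A'\<^sup>2 - B\<^sup>2) * k" using k by (simp add: real_sqrt_mult)
  finally show ?thesis by (simp add: s_def v_def l_def)
qed

text \<open>Applied with \<open>A' = A + \<epsilon>\<close> and \<open>B = A - \<epsilon>\<close>,
  \<open>near_ray\<close> compares the points up to a good time \<open>n\<close> with the ray
  towards \<open>y n\<close>. For \<open>A = 0\<close> there is no direction to speak of, and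
  \<open>v = 0\<close> works.\<close>

theorem asymptotic_ray:
  assumes b: "based c q" and y: "\<And>k::nat. y k \<in> points Mt" and A: "0 \<le> A"
    and KM: "\<And>\<epsilon>. 0 < \<epsilon> \<Longrightarrow> \<exists>K. (\<forall>k\<ge>K. dt q (y k) \<le> (A + \<epsilon>) * real k) \<and>
      (\<forall>N. \<exists>n\<ge>N. \<forall>k. K \<le> k \<and> k \<le> n \<longrightarrow> (A - \<epsilon>) * real k \<le> dt q (y n) - dt (y k) (y n))"
  obtains v where "(\<lambda>k. Log c q (y k) /\<^sub>R real k) \<longlonglongrightarrow> v"
    "\<And>\<delta>. 0 < \<delta> \<Longrightarrow> \<exists>K. \<forall>k\<ge>K. dt (y k) (Ext c q (real k *\<^sub>R v)) \<le> \<delta> * real k"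
proof -
  define V where "V k = Log c q (y k)" for k
  define L where "L k = dt q (y k)" for k
  let ?n = "nrm c (\<pi> q)"
  have c: "c \<in> charts_at M (\<pi> q)" and q: "q \<in> points Mt" using b by auto
  note nrm = nrm_nonneg[OF c] nrm_scale[OF c] nrm_triangle[OF c]
  have yV: "y k = Ext c q (V k)" for k unfolding V_def using Log(3)[OF b y] by simp
  have LV: "L k = ?n (V k)" for k unfolding L_def yV by (rule dist_ray[OF b])
  have lower: "?n (V k - a) \<le> dt (y k) (Ext c q a)" for k a
    using dist_lower[OF b, of "V k" a] dist_sym[OF y Ext(2)[OF b], of k a] yV[of k] by simp
  interpret hp: hadamard_point M c "\<pi> q" using c by unfold_locales
  obtain m where m: "m > 0" "\<And>a. m * (norm a)\<^sup>2 \<le> local_metric M c (snd c (\<pi> q)) a a"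
    using positive_definite_bound[OF hp.B0(1,2)] by blast
  have norm_le: "sqrt m * norm a \<le> ?n a" for a
    using real_sqrt_le_mono[OF m(2)[of a]] by (simp add: nrm_def real_sqrt_mult)
  show thesis
  proof (cases "A = 0")
    case True
    have small: "\<exists>K. \<forall>k\<ge>K. L k \<le> \<delta> * real k" if "0 < \<delta>" for \<delta> using KM[OF that] True by (auto simp: L_def)
    have "(\<lambda>k. V k /\<^sub>R real k) \<longlonglongrightarrow> 0"
    proof (rule LIMSEQ_I)
      fix r :: real assume r: "0 < r"
      define \<delta> where "\<delta> = sqrt m * r / 2"
      have \<delta>: "0 < \<delta>" using m r by (simp add: \<delta>_def)
      obtain K where K: "\<And>k. k \<ge> K \<Longrightarrow> L k \<le> \<delta> * real k" using small[OF \<delta>] by blast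
      have "norm (V k /\<^sub>R real k - 0) < r" if k: "k \<ge> max 1 K" for k
      proof -
        have k0: "real k > 0" using k by simp
        have "sqrt m * norm (V k) \<le> sqrt m * (r / 2 * real k)" using norm_le[of "V k"] K[of k] k LV[of k] by (simp add: \<delta>_def)
        then have "norm (V k) \<le> r / 2 * real k" using m(1) by simp
        then have "norm (V k) / real k \<le> r / 2" using k0 by (simp add: pos_divide_le_eq)
        moreover have "norm (V k /\<^sub>R real k - 0) = norm (V k) / real k" by (simp add: divide_inverse mult.commute)
        ultimately show ?thesis using r by linarith
      qed
      then show "\<exists>no. \<forall>k\<ge>no. norm (V k /\<^sub>R real k - 0) < r" by blast
    qed
    moreover have "\<exists>K. \<forall>k\<ge>K. dt (y k) (Ext c q (real k *\<^sub>R 0)) \<le> \<delta> * real k" if "0 < \<delta>" for \<delta>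
      using small[OF that] Ext(3)[OF b] dist_sym[OF q y] by (simp add: L_def)
    ultimately show ?thesis using that[of 0] unfolding V_def by blast
  next
    case False
    then have A: "A > 0" using A by simp
    \<comment> \<open>This makes \<open>n\<close> a good time: from \<open>K\<close> on, all earlier
      points are close to the ray towards \<open>y n\<close>, and \<open>y n\<close> itself has gone
      far enough.\<close>
    define G where "G \<epsilon> K n \<longleftrightarrow> (A - \<epsilon>) * real n \<le> L n \<and> (\<forall>k. K \<le> k \<and> k \<le> n \<longrightarrow>
        dt (y k) (Ext c q (((A - \<epsilon>) * real k / L n) *\<^sub>R V n)) \<le> 2 * sqrt (A * \<epsilon>) * real k)" for \<epsilon> K n
    have claim: "\<exists>K\<ge>1. \<forall>N. \<exists>n\<ge>N. G \<epsilon> K n"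
      if \<epsilon>: "0 < \<epsilon>" "\<epsilon> < A" for \<epsilon>
    proof -
      obtain K where K: "\<And>k. k \<ge> K \<Longrightarrow> L k \<le> (A + \<epsilon>) * real k"
        "\<And>N. \<exists>n\<ge>N. \<forall>k. K \<le> k \<and> k \<le> n \<longrightarrow> (A - \<epsilon>) * real k \<le> L n - dt (y k) (y n)"
        using KM[OF \<epsilon>(1)] unfolding L_def by blast
      have sq: "sqrt ((A + \<epsilon>)\<^sup>2 - (A - \<epsilon>)\<^sup>2) = 2 * sqrt (A * \<epsilon>)"
      proof -
        have "(A + \<epsilon>)\<^sup>2 - (A - \<epsilon>)\<^sup>2 = 2\<^sup>2 * (A * \<epsilon>)" by (simp add: power2_eq_square algebra_simps)
        then show ?thesis by (simp only: real_sqrt_mult real_sqrt_abs abs_numeral)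
      qed
      have "\<exists>n\<ge>N. G \<epsilon> (max 1 K) n" for N
      proof -
        obtain n where n: "n \<ge> max N (max 1 K)" "\<And>k. K \<le> k \<Longrightarrow> k \<le> n \<Longrightarrow> (A - \<epsilon>) * real k \<le> L n - dt (y k) (y n)"
          using K(2) by blast
        have Ln: "(A - \<epsilon>) * real n \<le> L n" using n(2)[of n] n(1) dist_self[OF y] by simp
        have "dt (y k) (Ext c q (((A - \<epsilon>) * real k / L n) *\<^sub>R V n)) \<le> 2 * sqrt (A * \<epsilon>) * real k" if k: "max 1 K \<le> k" "k \<le> n" for k
          unfolding sq[symmetric] L_def V_def
        proof (rule near_ray[OF b y y])
          have "(A - \<epsilon>) * real k \<le> (A - \<epsilon>) * real n" using k \<epsilon> by (intro mult_left_mono) auto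
          then show "(A - \<epsilon>) * real k \<le> dt q (y n)" using Ln by (simp add: L_def)
        qed (use \<epsilon> k K(1)[of k] n(2)[of k] in \<open>auto simp: L_def\<close>)
        then have "G \<epsilon> (max 1 K) n" using Ln unfolding G_def by blast
        then show ?thesis using n(1) by (intro exI[of _ n]) simp
      qed
      then show ?thesis by (intro exI[of _ "max 1 K"]) simp
    qed
    define w where "w k = V k /\<^sub>R real k" for k
    have nw: "?n (w k) = L k / real k" for k unfolding w_def nrm(2) LV by (simp add: divide_inverse mult.commute)
    have close: "\<exists>K\<ge>1. \<forall>j\<ge>K. \<forall>k\<ge>K. ?n (w j - w k) \<le> 4 * sqrt (A * \<epsilon>)" if \<epsilon>: "0 < \<epsilon>" "\<epsilon> < A" for \<epsilon>
    proof -
      obtain K where K: "K \<ge> 1" "\<And>N. \<exists>n\<ge>N. G \<epsilon> K n" using claim[OF \<epsilon>] by blast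
      have "?n (w j - w k) \<le> 4 * sqrt (A * \<epsilon>)" if jk: "j \<ge> K" "k \<ge> K" for j k
      proof -
        obtain n where n: "n \<ge> max j k" "\<And>k. K \<le> k \<Longrightarrow> k \<le> n \<Longrightarrow>
            dt (y k) (Ext c q (((A - \<epsilon>) * real k / L n) *\<^sub>R V n)) \<le> 2 * sqrt (A * \<epsilon>) * real k"
          using K(2) unfolding G_def by blast
        \<comment> \<open>The direction of \<open>y n\<close>, scaled to norm
          \<open>A - \<epsilon>\<close>. It serves as intermediary between \<open>w j\<close> and
          \<open>w k\<close>, both of which are close to it.\<close>
        define u where "u = ((A - \<epsilon>) / L n) *\<^sub>R V n"
        have est: "?n (w i - u) \<le> 2 * sqrt (A * \<epsilon>)" if i: "K \<le> i" "i \<le> n" for i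
        proof -
          have i0: "real i > 0" using i K(1) by simp
          have "((A - \<epsilon>) * real i / L n) *\<^sub>R V n = real i *\<^sub>R u" by (simp add: u_def)
          then have "?n (V i - real i *\<^sub>R u) \<le> 2 * sqrt (A * \<epsilon>) * real i" using lower[of i "real i *\<^sub>R u"] n(2)[OF i] by simp
          moreover have "V i - real i *\<^sub>R u = real i *\<^sub>R (w i - u)" using i0 by (simp add: w_def scaleR_diff_right)
          ultimately show ?thesis using nrm(2)[of "real i" "w i - u"] i0 by (simp add: mult.commute)
        qed
        have "w j - w k = (w j - u) + (- 1) *\<^sub>R (w k - u)" by simp
        then have "?n (w j - w k) \<le> ?n (w j - u) + ?n (w k - u)" using nrm(3)[of "w j - u" "(- 1) *\<^sub>R (w k - u)"] nrm(2)[of "- 1" "w k - u"] by simp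
        then show ?thesis using est[of j] est[of k] jk n(1) by simp
      qed
      then show ?thesis using K(1) by blast
    qed
    have "Cauchy w"
    proof (rule CauchyI)
      fix e :: real assume e: "0 < e"
      \<comment> \<open>\<open>norm\<close> is at most \<open>nrm\<close> divided by
        \<open>sqrt m\<close>, so a bound \<open>4 * d\<close> in \<open>nrm\<close> gives
        \<open>e / 2\<close> in \<open>norm\<close>.\<close>
      define d where "d = sqrt m * e / 8"
      have d: "d > 0" using e m by (simp add: d_def)
      define \<epsilon> where "\<epsilon> = min (A / 2) (d\<^sup>2 / A)"
      have \<epsilon>: "0 < \<epsilon>" "\<epsilon> < A" using A d by (auto simp: \<epsilon>_def)
      have "A * \<epsilon> \<le> A * (d\<^sup>2 / A)" using A by (intro mult_left_mono) (auto simp: \<epsilon>_def)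
      then have "sqrt (A * \<epsilon>) \<le> sqrt (d\<^sup>2)" using A by (intro real_sqrt_le_mono) simp
      then have s: "sqrt (A * \<epsilon>) \<le> d" using d by simp
      obtain K where K: "\<And>j k. j \<ge> K \<Longrightarrow> k \<ge> K \<Longrightarrow> ?n (w j - w k) \<le> 4 * sqrt (A * \<epsilon>)" using close[OF \<epsilon>] by blast
      have "norm (w j - w k) < e" if "j \<ge> K" "k \<ge> K" for j k
      proof -
        have "sqrt m * norm (w j - w k) \<le> sqrt m * (e / 2)" using norm_le[of "w j - w k"] K[OF that] s by (simp add: d_def)
        then show ?thesis using m e by simp
      qed
      then show "\<exists>K. \<forall>j\<ge>K. \<forall>k\<ge>K. norm (w j - w k) < e" by blast
    qed
    then obtain v where v: "w \<longlonglongrightarrow> v" using Cauchy_convergent convergent_def by blast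
    have nlim: "(\<lambda>k. ?n (w k)) \<longlonglongrightarrow> ?n v"
      by (rule continuous_on_tendsto_compose[OF nrm_cont[OF c] v]) auto
    \<comment> \<open>The limit direction has the drift as its speed; this allows division by
      \<open>?n (w n)\<close> in the limit below.\<close>
    have "?n v = A"
    proof (rule antisym)
      show "?n v \<le> A"
      proof (rule field_le_epsilon)
        fix \<epsilon> :: real assume "0 < \<epsilon>"
        then obtain K where K: "\<And>k. k \<ge> K \<Longrightarrow> L k \<le> (A + \<epsilon>) * real k" using KM[of \<epsilon>] unfolding L_def by blast
        show "?n v \<le> A + \<epsilon>"
        proof (rule LIMSEQ_le_const2[OF nlim], intro exI allI impI)
          fix k assume "max 1 K \<le> k"
          then show "?n (w k) \<le> A + \<epsilon>" unfolding nw using K[of k] by (simp add: pos_divide_le_eq)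
        qed
      qed
      show "A \<le> ?n v"
      proof (rule ccontr)
        assume "\<not> A \<le> ?n v"
        define \<epsilon> where "\<epsilon> = min (A / 2) ((A - ?n v) / 2)"
        have \<epsilon>: "0 < \<epsilon>" "\<epsilon> < A" "?n v < A - \<epsilon>" using A \<open>\<not> A \<le> ?n v\<close> by (auto simp: \<epsilon>_def min_def field_simps)
        obtain N where N: "\<And>n. n \<ge> N \<Longrightarrow> ?n (w n) < A - \<epsilon>"
          using order_tendstoD(2)[OF nlim \<epsilon>(3)] by (auto simp: eventually_sequentially)
        obtain n where n: "n \<ge> max 1 N" "(A - \<epsilon>) * real n \<le> L n" using claim[OF \<epsilon>(1,2)] unfolding G_def by blast
        then show False using N[of n] unfolding nw by (simp add: pos_divide_less_eq)
      qed
    qed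
    \<comment> \<open>For fixed \<open>k\<close>, the comparison points on the rays towards
      \<open>y n\<close> converge to \<open>Ext c q (r *\<^sub>R v)\<close>, and the estimate passes
      to the limit because it holds at infinitely many \<open>n\<close>. From there to
      \<open>Ext c q (real k *\<^sub>R v)\<close> the distance is
      \<open>\<epsilon> * k\<close>.\<close>
    have key: "\<exists>K. \<forall>k\<ge>K. dt (y k) (Ext c q (real k *\<^sub>R v)) \<le> (2 * sqrt (A * \<epsilon>) + \<epsilon>) * real k" if \<epsilon>: "0 < \<epsilon>" "\<epsilon> < A" for \<epsilon>
    proof -
      obtain K where K: "K \<ge> 1" "\<And>N. \<exists>n\<ge>N. G \<epsilon> K n" using claim[OF \<epsilon>] by blast
      have "dt (y k) (Ext c q (real k *\<^sub>R v)) \<le> (2 * sqrt (A * \<epsilon>) + \<epsilon>) * real k" if k: "k \<ge> K" for k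
      proof -
        define r where "r = (A - \<epsilon>) * real k / A"
        have "(\<lambda>n. ((A - \<epsilon>) * real k / ?n (w n)) *\<^sub>R w n) \<longlonglongrightarrow> ((A - \<epsilon>) * real k / ?n v) *\<^sub>R v"
          using v nlim A \<open>?n v = A\<close> by (intro tendsto_intros) auto
        moreover have "eventually (\<lambda>n. ((A - \<epsilon>) * real k / ?n (w n)) *\<^sub>R w n = ((A - \<epsilon>) * real k / L n) *\<^sub>R V n) sequentially"
          using eventually_gt_at_top[of 0]
        proof eventually_elim
          case (elim n)
          then show ?case unfolding nw by (simp add: w_def)
        qed
        ultimately have lim: "(\<lambda>n. ((A - \<epsilon>) * real k / L n) *\<^sub>R V n) \<longlonglongrightarrow> r *\<^sub>R v"
          unfolding r_def using Lim_transform_eventually \<open>?n v = A\<close> by fastforce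
        have "(\<lambda>n. Ext c q (((A - \<epsilon>) * real k / L n) *\<^sub>R V n)) \<longlonglongrightarrow> Ext c q (r *\<^sub>R v)"
          by (rule continuous_on_tendsto_compose[OF Ext(1)[OF b] lim]) auto
        then have dl: "(\<lambda>n. dt (y k) (Ext c q (((A - \<epsilon>) * real k / L n) *\<^sub>R V n))) \<longlonglongrightarrow> dt (y k) (Ext c q (r *\<^sub>R v))"
          using y Ext(2)[OF b] by (intro dist_tendsto) auto
        have 1: "dt (y k) (Ext c q (r *\<^sub>R v)) \<le> 2 * sqrt (A * \<epsilon>) * real k"
        proof (rule ccontr)
          assume "\<not> ?thesis"
          then have "2 * sqrt (A * \<epsilon>) * real k < dt (y k) (Ext c q (r *\<^sub>R v))" by simp
          then obtain N where N: "\<And>n. n \<ge> N \<Longrightarrow> 2 * sqrt (A * \<epsilon>) * real k < dt (y k) (Ext c q (((A - \<epsilon>) * real k / L n) *\<^sub>R V n))"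
            using order_tendstoD(1)[OF dl] by (auto simp: eventually_sequentially)
          obtain n where "n \<ge> max k N" "dt (y k) (Ext c q (((A - \<epsilon>) * real k / L n) *\<^sub>R V n)) \<le> 2 * sqrt (A * \<epsilon>) * real k"
            using K(2)[of "max k N"] k unfolding G_def by (meson max.boundedE)
          then show False using N[of n] by simp
        qed
        have r: "0 \<le> r" "r \<le> real k" using A \<epsilon> mult_right_mono[of "A - \<epsilon>" A "real k"] by (auto simp: r_def divide_simps mult.commute)
        have "dt (Ext c q (r *\<^sub>R v)) (Ext c q (real k *\<^sub>R v)) = (real k - r) * A"
          using dist_ray_points[OF b r, of v] \<open>?n v = A\<close> by simp
        also have "\<dots> = \<epsilon> * real k" using A by (simp add: r_def field_simps)
        finally have 2: "dt (Ext c q (r *\<^sub>R v)) (Ext c q (real k *\<^sub>R v)) = \<epsilon> * real k" .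
        show ?thesis
          using dist_triangle_dt[OF y Ext(2)[OF b] Ext(2)[OF b], of k "real k *\<^sub>R v" "r *\<^sub>R v"] 1 2 by (simp add: algebra_simps)
      qed
      then show ?thesis by blast
    qed
    show ?thesis
    proof (rule that)
      show "(\<lambda>k. Log c q (y k) /\<^sub>R real k) \<longlonglongrightarrow> v" using v by (simp add: w_def[abs_def] V_def)
      fix \<delta> :: real assume \<delta>: "0 < \<delta>"
      \<comment> \<open>Makes \<open>2 * sqrt (A * \<epsilon>)\<close> and \<open>\<epsilon>\<close>
        at most \<open>\<delta> / 2\<close> each.\<close>
      define \<epsilon> where "\<epsilon> = min (A / 2) (min (\<delta> / 2) ((\<delta> / 4)\<^sup>2 / A))"
      have "\<epsilon> \<le> \<delta> / 2" unfolding \<epsilon>_def by (rule order_trans[OF min.cobounded2 min.cobounded1])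
      then have \<epsilon>: "0 < \<epsilon>" "\<epsilon> < A" "\<epsilon> \<le> \<delta> / 2" using A \<delta> by (simp_all add: \<epsilon>_def)
      have "A * \<epsilon> \<le> A * ((\<delta> / 4)\<^sup>2 / A)" using A by (intro mult_left_mono) (auto simp: \<epsilon>_def)
      then have "sqrt (A * \<epsilon>) \<le> sqrt ((\<delta> / 4)\<^sup>2)" using A by (intro real_sqrt_le_mono) simp
      then have "sqrt (A * \<epsilon>) \<le> \<delta> / 4" using \<delta> by (simp only: real_sqrt_abs)
      then have le: "2 * sqrt (A * \<epsilon>) + \<epsilon> \<le> \<delta>" using \<epsilon>(3) by simp
      obtain K where K: "\<And>k. k \<ge> K \<Longrightarrow> dt (y k) (Ext c q (real k *\<^sub>R v)) \<le> (2 * sqrt (A * \<epsilon>) + \<epsilon>) * real k" using key[OF \<epsilon>(1,2)] by blast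
      have "dt (y k) (Ext c q (real k *\<^sub>R v)) \<le> \<delta> * real k" if "k \<ge> K" for k
        using K[OF that] mult_right_mono[OF le, of "real k"] by simp
      then show "\<exists>K. \<forall>k\<ge>K. dt (y k) (Ext c q (real k *\<^sub>R v)) \<le> \<delta> * real k" by blast
    qed
  qed
qed

end

section \<open>The displacement process of a flow\<close>

locale measured_flow =
  fixes N :: "('n::{t2_space,second_countable_topology}, 'd::euclidean_space) mfd"
    and f :: "real \<Rightarrow> 'n \<Rightarrow> 'n" and \<mu> :: "'n measure"
  assumes flow: "C1_flow N f" and prob: "prob_space \<mu>" and sets_\<mu>: "sets \<mu> = sets (restrict_space borel (points N))"
    and compact_support: "compact (measure_support \<mu>)" and preserves: "flow_preserves f \<mu>"
begin

lemma
  shows flow_cont: "continuous_on (UNIV \<times> points N) (\<lambda>z. f (fst z) (snd z))"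
    and flow_in: "x \<in> points N \<Longrightarrow> f t x \<in> points N"
    and flow_0: "x \<in> points N \<Longrightarrow> f 0 x = x"
    and flow_add: "x \<in> points N \<Longrightarrow> f (s + t) x = f s (f t x)"
proof -
  have *: "continuous_on (UNIV \<times> points N) (\<lambda>(t, x). f t x)" "(\<lambda>(t, x). f t x) ` (UNIV \<times> points N) \<subseteq> points N"
    using flow unfolding C1_flow_def C_map_def by (simp_all add: prod_mfd_def real_line_def)
  then show "continuous_on (UNIV \<times> points N) (\<lambda>z. f (fst z) (snd z))" "x \<in> points N \<Longrightarrow> f t x \<in> points N"
    by (simp_all add: case_prod_unfold image_subset_iff)
  show "x \<in> points N \<Longrightarrow> f 0 x = x" "x \<in> points N \<Longrightarrow> f (s + t) x = f s (f t x)"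
    using flow unfolding C1_flow_def by auto
qed

lemma flow_cont_at: "continuous_on (points N) (f t)"
proof -
  have "continuous_on (points N) (\<lambda>x. (t, x))" by (intro continuous_intros)
  from continuous_on_compose2[OF flow_cont this] show ?thesis by auto
qed

lemma space_\<mu>: "space \<mu> = points N"
  using sets_eq_imp_space_eq[OF sets_\<mu>] by (simp add: space_restrict_space)

abbreviation "supp \<equiv> measure_support \<mu>"

lemma supp_subset: "supp \<subseteq> points N" by (auto simp: measure_support_def space_\<mu>)

lemma open_meas: "open U \<Longrightarrow> U \<inter> points N \<in> sets \<mu>"
  unfolding sets_\<mu> sets_restrict_space by (rule image_eqI[of _ _ U]) auto

text \<open>A countable base writes the complement of the support as a countable union of null open
  sets.\<close>

lemma AE_supp: "supp \<in> sets \<mu>" "AE x in \<mu>. x \<in> supp"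
proof -
  obtain B :: "'n set set" where B: "countable B" "topological_basis B" using ex_countable_basis by blast
  define Z where "Z = {U \<in> B. emeasure \<mu> (U \<inter> points N) = 0}"
  have Zo: "U \<in> Z \<Longrightarrow> open U" for U using B(2) topological_basis_open by (auto simp: Z_def)
  have eq: "points N - supp = (\<Union>U\<in>Z. U \<inter> points N)"
  proof (intro equalityI subsetI)
    fix x assume x: "x \<in> points N - supp"
    then obtain U where U: "open U" "x \<in> U" "emeasure \<mu> (U \<inter> points N) = 0" by (auto simp: measure_support_def space_\<mu>)
    obtain U' where U': "U' \<in> B" "x \<in> U'" "U' \<subseteq> U" using topological_basisE[OF B(2) U(1,2)] by blast
    have "emeasure \<mu> (U' \<inter> points N) \<le> emeasure \<mu> (U \<inter> points N)" using U' U open_meas by (intro emeasure_mono) auto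
    then show "x \<in> (\<Union>U\<in>Z. U \<inter> points N)" using U U' x by (auto simp: Z_def)
  next
    fix x assume "x \<in> (\<Union>U\<in>Z. U \<inter> points N)"
    then show "x \<in> points N - supp" using Zo by (auto simp: measure_support_def space_\<mu> Z_def)
  qed
  have "countable Z" using B(1) by (auto simp: Z_def intro: countable_subset)
  then have null: "(\<Union>U\<in>Z. U \<inter> points N) \<in> null_sets \<mu>"
    using open_meas Zo by (intro null_sets_UN') (auto simp: null_sets_def Z_def)
  then have "points N - (points N - supp) \<in> sets \<mu>" unfolding eq using sets.compl_sets[of _ \<mu>] space_\<mu> by (metis null_setsD2)
  then show "supp \<in> sets \<mu>" using supp_subset by (simp add: double_diff)
  show "AE x in \<mu>. x \<in> supp"
    using AE_not_in[OF null] unfolding eq[symmetric] by (rule AE_mp) (auto simp: space_\<mu> intro!: AE_I2)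
qed

text \<open>The preimage of a neighbourhood of \<open>f t x\<close> is a neighbourhood of
  \<open>x\<close> of the same measure.\<close>

lemma supp_flow:
  assumes x: "x \<in> supp"
  shows "f t x \<in> supp"
  unfolding measure_support_def
proof (intro CollectI conjI allI impI)
  have xN: "x \<in> points N" using x supp_subset by blast
  show "f t x \<in> space \<mu>" using flow_in[OF xN] space_\<mu> by simp
  fix U assume U: "open U \<and> f t x \<in> U"
  obtain O' where O': "open O'" "points N \<inter> f t -` U = O' \<inter> points N"
    using continuous_on_open_invariant[of "points N" "f t"] flow_cont_at U by (metis Int_commute)
  have m: "f t \<in> measurable \<mu> \<mu>" "distr \<mu> \<mu> (f t) = \<mu>" using preserves by (auto simp: flow_preserves_def)
  have "emeasure \<mu> (U \<inter> space \<mu>) = emeasure (distr \<mu> \<mu> (f t)) (U \<inter> points N)" using m(2) space_\<mu> by simp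
  also have "\<dots> = emeasure \<mu> (f t -` (U \<inter> points N) \<inter> space \<mu>)"
    using U by (intro emeasure_distr[OF m(1)] open_meas) auto
  also have "f t -` (U \<inter> points N) \<inter> space \<mu> = O' \<inter> points N" using O'(2) flow_in space_\<mu> by auto
  finally have "emeasure \<mu> (U \<inter> space \<mu>) = emeasure \<mu> (O' \<inter> space \<mu>)" by (simp add: space_\<mu>)
  moreover have "x \<in> O'" using O'(2) U xN by blast
  ultimately show "emeasure \<mu> (U \<inter> space \<mu>) > 0" using x O'(1) by (auto simp: measure_support_def)
qed

lemma supp_flow_iff: "x \<in> points N \<Longrightarrow> f t x \<in> supp \<longleftrightarrow> x \<in> supp"
  using supp_flow[of x t] supp_flow[of "f t x" "- t"] flow_add[of x "- t" t] flow_0[of x] by auto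

end

locale lifted_flow = universal_cover M Mt \<pi> + measured_flow N f \<mu>
  for M :: "('m::{t2_space,second_countable_topology}, 'e::euclidean_space) riem_mfd"
    and Mt :: "('c::{t2_space,second_countable_topology}, 'e) riem_mfd" and \<pi> :: "'c \<Rightarrow> 'm"
    and N :: "('n::{t2_space,second_countable_topology}, 'd::euclidean_space) mfd"
    and f :: "real \<Rightarrow> 'n \<Rightarrow> 'n" and \<mu> :: "'n measure" +
  fixes h :: "'n \<Rightarrow> 'm"
  assumes h: "C_map 1 N M h"
begin

lemma h_cont: "continuous_on (points N) h" and h_in: "x \<in> points N \<Longrightarrow> h x \<in> points M"
  using h by (auto simp: C_map_def)

lemma orbit_cont: "continuous_on ({0..} \<times> points N) (\<lambda>z. h (f (fst z) (snd z)))"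
  by (rule continuous_on_compose2[OF h_cont continuous_on_subset[OF flow_cont]]) (use flow_in in auto)

abbreviation orbit :: "'n \<Rightarrow> real \<Rightarrow> 'm" where "orbit x \<equiv> \<lambda>t. h (f t x)"

lemma orbit_lift_exists:
  assumes x: "x \<in> points N" and q: "q \<in> points Mt" "\<pi> q = h x"
  obtains \<beta> where "lift_from q (orbit x) \<beta>"
proof (rule lift_from_exists)
  have "continuous_on {0..} (\<lambda>t::real. (t, x))" by (intro continuous_intros)
  from continuous_on_compose2[OF orbit_cont this] show "continuous_on {0..} (orbit x)" using x by auto
qed (use assms flow_in h_in flow_0 that in auto)

text \<open>By \<open>lift_from_displacement\<close> the value does not depend on the lift that is
  chosen.\<close>

definition disp :: "real \<Rightarrow> 'n \<Rightarrow> real" where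
  "disp t x = (SOME r. \<exists>q \<beta>. lift_from q (orbit x) \<beta> \<and> r = dt q (\<beta> t))"

lemma disp_eq:
  assumes l: "lift_from q (orbit x) \<beta>" and t: "0 \<le> t"
  shows "disp t x = dt q (\<beta> t)"
proof -
  have "\<exists>r q \<beta>. lift_from q (orbit x) \<beta> \<and> r = dt q (\<beta> t)" using l by blast
  then have "\<exists>q \<beta>. lift_from q (orbit x) \<beta> \<and> disp t x = dt q (\<beta> t)" unfolding disp_def by (rule someI_ex)
  then show ?thesis using lift_from_displacement[OF l _ t] by metis
qed

lemma disp_between:
  assumes x: "x \<in> points N" and l: "lift_from q (orbit x) \<beta>" and st: "0 \<le> s" "0 \<le> t"
  shows "dt (\<beta> s) (\<beta> (s + t)) = disp t (f s x)"
proof -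
  have "lift_from (\<beta> s) (orbit (f s x)) (\<lambda>t. \<beta> (s + t))"
    using lift_from_shift[OF l st(1)] flow_add[OF x, of _ s] by (simp add: add.commute)
  from disp_eq[OF this st(2)] show ?thesis by simp
qed

text \<open>A local inverse of \<open>\<pi>\<close> supplies starting points that depend
  continuously on \<open>x\<close>, and \<open>covering_homotopy_lift\<close> then lifts all nearby
  orbits at once. The factor \<open>R\<close> serves both uses: \<open>R = 1\<close> for bounds on
  the unit interval, and a fixed time \<open>R\<close> for measurability.\<close>

lemma disp_cont:
  assumes R: "0 \<le> R"
  shows "continuous_on ({0..1} \<times> points N) (\<lambda>z. disp (R * fst z) (snd z))"
  unfolding continuous_on_eq_continuous_within
proof
  fix z0 assume z0: "z0 \<in> {0..1::real} \<times> points N"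
  define x0 where "x0 = snd z0"
  have x0: "x0 \<in> points N" using z0 by (auto simp: x0_def)
  obtain q0 where q0: "q0 \<in> points Mt" "\<pi> q0 = h x0" using proj_surj[OF h_in[OF x0]] by blast
  obtain T u \<rho> where T: "q0 \<in> T" "openin (top_of_set (points Mt)) T" "\<pi> q0 \<in> u"
    "openin (top_of_set (points M)) u" "homeomorphism T u \<pi> \<rho>"
    using covering_space_local_homeomorphism[OF covering(1) q0(1)] by metis
  have "openin (top_of_set (points N)) (points N \<inter> h -` u)"
    using h_in by (intro continuous_openin_preimage[OF h_cont _ T(4)]) auto
  then obtain O' where O': "open O'" "points N \<inter> h -` u = points N \<inter> O'" unfolding openin_open by blast
  define U where "U = points N \<inter> h -` u"
  have hu: "h ` U \<subseteq> u" by (auto simp: U_def)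
  have hU: "continuous_on U h" using h_cont by (rule continuous_on_subset) (auto simp: U_def)
  have \<rho>: "continuous_on u \<rho>" "\<rho> ` u = T" "\<And>p. p \<in> u \<Longrightarrow> \<pi> (\<rho> p) = p" using T(5) by (auto simp: homeomorphism_def)
  have TM: "T \<subseteq> points Mt" using T(2) openin_imp_subset by blast
  define s where "s x = \<rho> (h x)" for x
  have s: "continuous_on U s" "s ` U \<subseteq> points Mt" "\<And>x. x \<in> U \<Longrightarrow> \<pi> (s x) = h x"
    unfolding s_def using continuous_on_compose2[OF \<rho>(1) hU hu] \<rho>(2,3) hu TM by auto
  have H: "continuous_on ({0..1::real} \<times> U) (\<lambda>z. h (f (R * fst z) (snd z)))"
  proof -
    have "continuous_on ({0..1} \<times> U) (\<lambda>z. (R * fst z, snd z))" by (intro continuous_intros)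
    moreover have "(\<lambda>z. (R * fst z, snd z)) ` ({0..1} \<times> U) \<subseteq> {0..} \<times> points N" using R by (auto simp: U_def)
    ultimately show ?thesis using continuous_on_compose2[OF orbit_cont] by fastforce
  qed
  obtain k where k: "continuous_on ({0..1} \<times> U) k" "k ` ({0..1} \<times> U) \<subseteq> points Mt"
    "\<And>y. y \<in> U \<Longrightarrow> k (0, y) = s y" "\<And>z. z \<in> {0..1} \<times> U \<Longrightarrow> \<pi> (k z) = h (f (R * fst z) (snd z))"
    by (rule covering_homotopy_lift[OF covering(1) H _ s(1,2)]) (use s(3) flow_0 flow_in h_in in \<open>auto simp: U_def\<close>)
  have eq: "disp (R * t) x = dt (s x) (k (t, x))" if t: "t \<in> {0..1}" and x: "x \<in> U" for t x
  proof -
    have xN: "x \<in> points N" "s x \<in> points Mt" using x s(2) by (auto simp: U_def)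
    obtain \<beta> where \<beta>: "lift_from (s x) (orbit x) \<beta>" using orbit_lift_exists[OF xN s(3)[OF x]] by blast
    have "k (t, x) = \<beta> (R * t)"
    proof (rule covering_lift_unique[where T = "{0..1}" and ?g1.0 = "\<lambda>t. k (t, x)" and ?g2.0 = "\<lambda>t. \<beta> (R * t)" and a = 0, OF covering(1)])
      show "continuous_on {0..1} (\<lambda>t. k (t, x))" by (rule continuous_on_compose2[OF k(1)]) (use x in \<open>auto intro!: continuous_intros\<close>)
      show "continuous_on {0..1} (\<lambda>t. \<beta> (R * t))"
        by (rule continuous_on_compose2[OF lift_fromD(1)[OF \<beta>]]) (use R in \<open>auto intro!: continuous_intros\<close>)
    qed (use x t k R lift_fromD[OF \<beta>] in \<open>auto simp: image_subset_iff\<close>)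
    then show ?thesis using disp_eq[OF \<beta>, of "R * t"] R t by simp
  qed
  have z0U: "z0 \<in> {0..1} \<times> U" using z0 T(3) q0(2) by (auto simp: U_def x0_def mem_Times_iff)
  have "continuous_on ({0..1} \<times> U) (\<lambda>z. dt (s (snd z)) (k z))"
  proof (rule dist_cont[OF _ _ k(1,2)])
    show "continuous_on ({0..1} \<times> U) (\<lambda>z. s (snd z))" by (rule continuous_on_compose2[OF s(1)]) (auto intro!: continuous_intros)
  qed (use s(2) in auto)
  then have "continuous_on ({0..1} \<times> U) (\<lambda>z. disp (R * fst z) (snd z))"
    by (rule continuous_on_eq) (use eq in auto)
  then have "continuous (at z0 within {0..1} \<times> U) (\<lambda>z. disp (R * fst z) (snd z))"
    unfolding continuous_on_eq_continuous_within using z0U by (rule bspec)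
  moreover have "at z0 within {0..1} \<times> U = at z0 within {0..1} \<times> points N"
    by (rule at_within_nhd[where S = "UNIV \<times> O'"]) (use z0U O' in \<open>auto simp: U_def intro: open_Times\<close>)
  ultimately show "continuous (at z0 within {0..1} \<times> points N) (\<lambda>z. disp (R * fst z) (snd z))" by simp
qed

lemma disp_bounded:
  obtains C where "0 \<le> C" "\<And>t x. 0 \<le> t \<Longrightarrow> t \<le> 1 \<Longrightarrow> x \<in> supp \<Longrightarrow> disp t x \<le> C"
proof -
  have "continuous_on ({0..1} \<times> supp) (\<lambda>z. disp (1 * fst z) (snd z))"
    by (rule continuous_on_subset[OF disp_cont]) (use supp_subset in auto)
  moreover have "compact ({0..1::real} \<times> supp)" using compact_support by (intro compact_Times) auto
  ultimately have "bounded ((\<lambda>z. disp (1 * fst z) (snd z)) ` ({0..1} \<times> supp))"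
    by (intro compact_imp_bounded compact_continuous_image)
  then obtain C where C: "C > 0" "\<forall>y\<in>(\<lambda>z. disp (1 * fst z) (snd z)) ` ({0..1} \<times> supp). norm y \<le> C" by (auto simp: bounded_pos)
  have "disp t x \<le> C" if "0 \<le> t" "t \<le> 1" "x \<in> supp" for t x
  proof -
    have "disp t x \<in> (\<lambda>z. disp (1 * fst z) (snd z)) ` ({0..1} \<times> supp)" using that by (intro image_eqI[of _ _ "(t, x)"]) auto
    then have "norm (disp t x) \<le> C" using C(2) by blast
    then show ?thesis by simp
  qed
  then show thesis using C(1) by (intro that[of C]) auto
qed

lemma disp_measurable: "0 \<le> t \<Longrightarrow> disp t \<in> borel_measurable \<mu>"
proof -
  assume t: "0 \<le> t"
  have "continuous_on (points N) (\<lambda>x. disp (t * fst (1::real, x)) (snd (1::real, x)))"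
    by (rule continuous_on_compose2[OF disp_cont[OF t]]) (auto intro!: continuous_intros)
  then have "disp t \<in> borel_measurable (restrict_space borel (points N))"
    by (intro borel_measurable_continuous_on_restrict) simp
  then show ?thesis using measurable_cong_sets[OF sets_\<mu> refl] by blast
qed

lemma AE_sublinear:
  "AE x in \<mu>. x \<in> supp \<and> (\<exists>A\<ge>0. \<forall>\<epsilon>>0. \<exists>K. (\<forall>k\<ge>K. disp (real k) x \<le> (A + \<epsilon>) * real k) \<and>
     (\<forall>N. \<exists>n\<ge>N. \<forall>k. K \<le> k \<and> k \<le> n \<longrightarrow> (A - \<epsilon>) * real k \<le> disp (real n) x - disp (real (n - k)) (f (real k) x)))"
proof -
  obtain C where C: "0 \<le> C" "\<And>t x. 0 \<le> t \<Longrightarrow> t \<le> 1 \<Longrightarrow> x \<in> supp \<Longrightarrow> disp t x \<le> C" using disp_bounded by blast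
  \<comment> \<open>The bound \<open>C\<close> is available on the support only, whereas the process
    must satisfy its inequalities everywhere. Setting it to 0 elsewhere preserves them because the
    support is invariant.\<close>
  define a where "a n x = (if x \<in> supp then disp (real n) x else 0)" for n :: nat and x
  have pow: "x \<in> points N \<Longrightarrow> (f 1 ^^ m) x = f (real m) x" for m x
  proof (induction m)
    case (Suc m)
    then show ?case using flow_add[of x 1 "real m"] by (simp add: add.commute)
  qed (simp add: flow_0)
  have lift: "\<exists>q \<beta>. lift_from q (orbit x) \<beta>" if "x \<in> supp" for x
  proof -
    have x: "x \<in> points N" using that supp_subset by blast
    obtain q where "q \<in> points Mt" "\<pi> q = h x" using proj_surj[OF h_in[OF x]] by blast
    then show ?thesis using orbit_lift_exists[OF x] by metis
  qed
  have disp0: "disp 0 x = 0" if x: "x \<in> supp" for x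
    using lift[OF x] disp_eq[of _ x _ 0] lift_fromD(4,5) dist_self by (metis order_refl)
  have tri: "disp (s + t) x \<le> disp s x + disp t (f s x)" "disp t (f s x) \<le> disp s x + disp (s + t) x"
    "disp s x \<le> disp (s + t) x + disp t (f s x)" "0 \<le> disp s x"
    if x: "x \<in> supp" and st: "0 \<le> s" "0 \<le> t" for s t x
  proof -
    obtain q \<beta> where l: "lift_from q (orbit x) \<beta>" using lift[OF x] by blast
    have xN: "x \<in> points N" using x supp_subset by blast
    have p: "q \<in> points Mt" "\<beta> s \<in> points Mt" "\<beta> (s + t) \<in> points Mt" using lift_fromD[OF l] st by auto
    have d: "disp s x = dt q (\<beta> s)" "disp (s + t) x = dt q (\<beta> (s + t))" "disp t (f s x) = dt (\<beta> s) (\<beta> (s + t))"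
      using disp_eq[OF l] disp_between[OF xN l] st by auto
    show "disp (s + t) x \<le> disp s x + disp t (f s x)" unfolding d by (rule dist_triangle_dt[OF p])
    show "disp t (f s x) \<le> disp s x + disp (s + t) x"
      unfolding d using dist_triangle_dt[OF p(2,1,3)] dist_sym[OF p(1,2)] by simp
    show "disp s x \<le> disp (s + t) x + disp t (f s x)"
      unfolding d using dist_triangle_dt[OF p(1,3,2)] dist_sym[OF p(2,3)] by simp
    show "0 \<le> disp s x" unfolding d by (rule dist_nonneg[OF p(1,2)])
  qed
  interpret subadditive_process \<mu> "f 1" a C
  proof (intro subadditive_process.intro measure_preserving.intro measure_preserving_axioms.intro subadditive_process_axioms.intro prob)
    show "f 1 \<in> measurable \<mu> \<mu>" "distr \<mu> \<mu> (f 1) = \<mu>" using preserves by (auto simp: flow_preserves_def)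
    have [measurable]: "supp \<in> sets \<mu>" "disp (real n) \<in> borel_measurable \<mu>" for n using AE_supp(1) disp_measurable by auto
    show "a n \<in> borel_measurable \<mu>" for n unfolding a_def[abs_def] by measurable
    fix m n :: nat and x assume "x \<in> space \<mu>"
    then have x: "x \<in> points N" by (simp add: space_\<mu>)
    show "0 \<le> a n x" "a 0 x = 0" "a 1 x \<le> C"
      using tri(4)[of x "real n" 0] disp0 C by (auto simp: a_def)
    show "a (m + n) x \<le> a m x + a n ((f 1 ^^ m) x)"
      using tri(1)[of x "real m" "real n"] supp_flow_iff[OF x] by (simp add: a_def pow[OF x])
    show "a n (f 1 x) \<le> a (Suc n) x + C"
      using tri(2)[of x 1 "real n"] C(1) C(2)[of 1 x] supp_flow_iff[OF x, of 1] by (cases "x \<in> supp") (simp_all add: a_def)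
    show "a n x \<le> a (Suc n) x + C"
      using tri(3)[of x "real n" 1] C(1) C(2)[of 1 "f (real n) x"] supp_flow[of x "real n"]
      by (cases "x \<in> supp") (simp_all add: a_def add.commute)
  qed
  show ?thesis using karlsson_margulis AE_supp(2)
  proof eventually_elim
    case (elim x)
    then have x: "x \<in> points N" using supp_subset by blast
    have "a n x = disp (real n) x" "a n ((f 1 ^^ k) x) = disp (real n) (f (real k) x)" for n k
      using elim(2) supp_flow_iff[OF x] by (auto simp: a_def pow[OF x])
    then show ?case using elim by simp
  qed
qed

lemma ray_lift:
  assumes b: "based c q" and q: "\<pi> q = h x" and v: "v \<in> tangent_space M (h x)"
  shows "lift_from q (\<lambda>t. exp_map M (h x) (tscale t v)) (\<lambda>t. Ext c q (t *\<^sub>R v c))"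
proof -
  have "continuous_on {0..} (\<lambda>t. Ext c q (t *\<^sub>R v c))"
    by (rule continuous_on_compose2[OF Ext(1)[OF b]]) (auto intro!: continuous_intros)
  moreover have "\<pi> (Ext c q (t *\<^sub>R v c)) = exp_map M (h x) (tscale t v)" for t
    using Ext(4)[OF b] exp_map_eq[of c "h x" v] b q v by simp
  ultimately show ?thesis using Ext[OF b] by (auto simp: is_lift_from_def)
qed

text \<open>Both rays stay within o(t) of the same lifted orbit, hence of each other, but by
  \<open>dist_lower\<close> they separate at least at the speed
  \<open>nrm c (h x) (w c - v c)\<close>.\<close>

lemma rotation_vector_unique:
  assumes x: "x \<in> points N" and v: "rotation_vector Mt \<pi> M f h x v" and w: "rotation_vector Mt \<pi> M f h x w"
  shows "v = w"
proof -
  obtain q where q: "q \<in> points Mt" "\<pi> q = h x" using proj_surj[OF h_in[OF x]] by blast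
  obtain c where b: "based c q" using based_exists[OF q(1)] by blast
  have c: "c \<in> charts_at M (h x)" using b q by simp
  have ray: "\<exists>\<beta>. lift_from q (orbit x) \<beta> \<and> (\<lambda>t. dt (Ext c q (t *\<^sub>R u c)) (\<beta> t)) \<in> o[at_top](\<lambda>t. t)"
    if u: "rotation_vector Mt \<pi> M f h x u" for u
  proof -
    have ut: "u \<in> tangent_space M (h x)" using u by (simp add: rotation_vector_def)
    obtain \<alpha> \<beta> where ab: "lift_from q (\<lambda>t. exp_map M (h x) (tscale t u)) \<alpha>" "lift_from q (orbit x) \<beta>"
      "(\<lambda>t. dt (\<alpha> t) (\<beta> t)) \<in> o[at_top](\<lambda>t. t)" using u q unfolding rotation_vector_def by blast
    have "lift_from q (\<lambda>t. exp_map M (h x) (tscale t u)) (\<lambda>t. Ext c q (t *\<^sub>R u c))"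
      by (rule ray_lift[OF b q(2) ut])
    then have eq: "\<alpha> t = Ext c q (t *\<^sub>R u c)" if "0 \<le> t" for t using lift_from_unique[OF ab(1) _ that] by simp
    have ev: "eventually (\<lambda>t. dt (\<alpha> t) (\<beta> t) = dt (Ext c q (t *\<^sub>R u c)) (\<beta> t)) at_top"
      by (rule eventually_mono[OF eventually_ge_at_top[of 0]]) (simp add: eq)
    have "(\<lambda>t. dt (Ext c q (t *\<^sub>R u c)) (\<beta> t)) \<in> o[at_top](\<lambda>t. t)" using landau_o.small.in_cong[OF ev] ab(3) by (rule iffD1)
    then show ?thesis using ab(2) by blast
  qed
  obtain \<beta> where \<beta>: "lift_from q (orbit x) \<beta>" "(\<lambda>t. dt (Ext c q (t *\<^sub>R v c)) (\<beta> t)) \<in> o[at_top](\<lambda>t. t)" using ray[OF v] by blast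
  obtain \<beta>' where \<beta>': "lift_from q (orbit x) \<beta>'" "(\<lambda>t. dt (Ext c q (t *\<^sub>R w c)) (\<beta>' t)) \<in> o[at_top](\<lambda>t. t)" using ray[OF w] by blast
  let ?n = "nrm c (h x) (w c - v c)"
  have "?n \<le> \<epsilon>" if \<epsilon>: "0 < \<epsilon>" for \<epsilon>
  proof -
    have "eventually (\<lambda>t. norm (dt (Ext c q (t *\<^sub>R v c)) (\<beta> t)) \<le> \<epsilon> / 2 * norm t) at_top"
      "eventually (\<lambda>t. norm (dt (Ext c q (t *\<^sub>R w c)) (\<beta>' t)) \<le> \<epsilon> / 2 * norm t) at_top"
      using landau_o.smallD[OF \<beta>(2), of "\<epsilon> / 2"] landau_o.smallD[OF \<beta>'(2), of "\<epsilon> / 2"] \<epsilon> by auto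
    from eventually_conj[OF this(1) eventually_conj[OF this(2) eventually_gt_at_top[of 0]]]
    obtain t where elim: "norm (dt (Ext c q (t *\<^sub>R v c)) (\<beta> t)) \<le> \<epsilon> / 2 * norm t"
      "norm (dt (Ext c q (t *\<^sub>R w c)) (\<beta>' t)) \<le> \<epsilon> / 2 * norm t" "0 < t"
      using eventually_happens'[OF trivial_limit_at_top_linorder] by blast
    show ?thesis
    proof -
      have p: "Ext c q (t *\<^sub>R v c) \<in> points Mt" "Ext c q (t *\<^sub>R w c) \<in> points Mt" "\<beta> t \<in> points Mt"
        using Ext(2)[OF b] lift_fromD(2)[OF \<beta>(1)] elim by auto
      have "\<beta>' t = \<beta> t" using lift_from_unique[OF \<beta>'(1) \<beta>(1)] elim by simp
      then have "dt (Ext c q (t *\<^sub>R v c)) (\<beta> t) + dt (\<beta> t) (Ext c q (t *\<^sub>R w c)) \<le> \<epsilon> * t"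
        using elim dist_sym[OF p(2,3)] by simp
      moreover have "nrm c (h x) (t *\<^sub>R w c - t *\<^sub>R v c) \<le> dt (Ext c q (t *\<^sub>R v c)) (Ext c q (t *\<^sub>R w c))"
        using dist_lower[OF b, of "t *\<^sub>R w c" "t *\<^sub>R v c"] q(2) by simp
      moreover have "nrm c (h x) (t *\<^sub>R w c - t *\<^sub>R v c) = t * ?n"
        using nrm_scale[OF c, of t "w c - v c"] elim by (simp add: scaleR_diff_right)
      ultimately have "t * ?n \<le> t * \<epsilon>" using dist_triangle_dt[OF p(1,3,2)] by (simp add: mult.commute)
      then show ?thesis using elim by simp
    qed
  qed
  then have "?n \<le> 0" by (metis field_le_epsilon add_0)
  then have "w c - v c = 0" using nrm_nonneg[OF c] nrm_eq_0[OF c] by (metis antisym)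
  then have "v c = w c" by simp
  then show ?thesis using v w tangent_coord_vec[OF _ c] unfolding rotation_vector_def by metis
qed

text \<open>From integer to real times: in less than a unit of time the ray moves by at most
  \<open>?n\<close> and the lifted orbit by at most \<open>C\<close>, and both are negligible
  against \<open>\<delta> * t\<close>.\<close>

lemma near_lift:
  assumes x: "x \<in> supp" and b: "based c q" and l: "lift_from q (orbit x) \<beta>"
    and near: "\<And>\<delta>. 0 < \<delta> \<Longrightarrow> \<exists>K. \<forall>k\<ge>K. dt (\<beta> (real k)) (Ext c q (real k *\<^sub>R v)) \<le> \<delta> * real k"
  shows "(\<lambda>t. dt (Ext c q (t *\<^sub>R v)) (\<beta> t)) \<in> o[at_top](\<lambda>t. t)"
proof (rule landau_o.smallI)
  fix \<delta> :: real assume \<delta>: "0 < \<delta>"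
  have xN: "x \<in> points N" using x supp_subset by blast
  obtain C where C: "\<And>t x. 0 \<le> t \<Longrightarrow> t \<le> 1 \<Longrightarrow> x \<in> supp \<Longrightarrow> disp t x \<le> C" using disp_bounded by metis
  obtain K where K: "\<And>k. k \<ge> K \<Longrightarrow> dt (\<beta> (real k)) (Ext c q (real k *\<^sub>R v)) \<le> \<delta> / 2 * real k"
    using near[of "\<delta> / 2"] \<delta> by auto
  let ?n = "nrm c (\<pi> q) v"
  show "eventually (\<lambda>t. norm (dt (Ext c q (t *\<^sub>R v)) (\<beta> t)) \<le> \<delta> * norm t) at_top"
    using eventually_ge_at_top[of "max (real K + 1) ((?n + C) / (\<delta> / 2))"]
  proof eventually_elim
    case (elim t)
    then have t: "t \<ge> real K + 1" "?n + C \<le> \<delta> / 2 * t" using \<delta> by (auto simp: field_simps)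
    define k where "k = nat \<lfloor>t\<rfloor>"
    have k: "real k \<le> t" "t \<le> real k + 1" "k \<ge> K" using t(1) by (auto simp: k_def le_nat_floor)
    have t0: "0 \<le> t" using t(1) by linarith
    have p: "Ext c q (t *\<^sub>R v) \<in> points Mt" "Ext c q (real k *\<^sub>R v) \<in> points Mt" "\<beta> (real k) \<in> points Mt" "\<beta> t \<in> points Mt"
      using Ext(2)[OF b] lift_fromD(2)[OF l] t0 by auto
    have "dt (Ext c q (t *\<^sub>R v)) (Ext c q (real k *\<^sub>R v)) = (t - real k) * ?n"
      using dist_ray_points[OF b, of "real k" t v] k dist_sym[OF p(1,2)] by simp
    also have "\<dots> \<le> 1 * ?n" using k nrm_nonneg b by (intro mult_right_mono) auto
    finally have 1: "dt (Ext c q (t *\<^sub>R v)) (Ext c q (real k *\<^sub>R v)) \<le> ?n" by simp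
    have "dt (Ext c q (real k *\<^sub>R v)) (\<beta> (real k)) \<le> \<delta> / 2 * real k" using K[OF k(3)] dist_sym[OF p(2,3)] by simp
    also have "\<dots> \<le> \<delta> / 2 * t" using k \<delta> by (intro mult_left_mono) auto
    finally have 2: "dt (Ext c q (real k *\<^sub>R v)) (\<beta> (real k)) \<le> \<delta> / 2 * t" .
    have "dt (\<beta> (real k)) (\<beta> t) = disp (t - real k) (f (real k) x)"
      using disp_between[OF xN l, of "real k" "t - real k"] k by simp
    also have "\<dots> \<le> C" using k supp_flow[OF x] by (intro C) auto
    finally have 3: "dt (\<beta> (real k)) (\<beta> t) \<le> C" .
    have "dt (Ext c q (t *\<^sub>R v)) (\<beta> t) \<le> ?n + (\<delta> / 2 * t + C)"
      using dist_triangle_dt[OF p(1,2,4)] dist_triangle_dt[OF p(2,3,4)] 1 2 3 by linarith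
    also have "\<dots> \<le> \<delta> * t" using t(2) by simp
    finally show ?case using dist_nonneg[OF p(1,4)] t0 by simp
  qed
qed

lemma rotation_vector_exists:
  assumes x: "x \<in> supp" and A: "0 \<le> A"
    and KM: "\<And>\<epsilon>. 0 < \<epsilon> \<Longrightarrow> \<exists>K. (\<forall>k\<ge>K. disp (real k) x \<le> (A + \<epsilon>) * real k) \<and>
     (\<forall>N. \<exists>n\<ge>N. \<forall>k. K \<le> k \<and> k \<le> n \<longrightarrow> (A - \<epsilon>) * real k \<le> disp (real n) x - disp (real (n - k)) (f (real k) x))"
  shows "\<exists>v. rotation_vector Mt \<pi> M f h x v"
proof -
  have xN: "x \<in> points N" using x supp_subset by blast
  obtain q0 where q0: "q0 \<in> points Mt" "\<pi> q0 = h x" using proj_surj[OF h_in[OF xN]] by blast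
  obtain c where b0: "based c q0" using based_exists[OF q0(1)] by blast
  have c: "c \<in> charts_at M (h x)" using b0 q0 by simp
  obtain \<beta>0 where \<beta>0: "lift_from q0 (orbit x) \<beta>0" using orbit_lift_exists[OF xN q0] by blast
  have ray: "\<exists>v. (\<lambda>k. Log c q (\<beta> (real k)) /\<^sub>R real k) \<longlonglongrightarrow> v \<and>
      (\<forall>\<delta>>0. \<exists>K. \<forall>k\<ge>K. dt (\<beta> (real k)) (Ext c q (real k *\<^sub>R v)) \<le> \<delta> * real k)"
    if b: "based c q" and l: "lift_from q (orbit x) \<beta>" for q \<beta>
  proof -
    have d: "disp (real n) x = dt q (\<beta> (real n))" for n using disp_eq[OF l] by simp
    have d': "disp (real (n - k)) (f (real k) x) = dt (\<beta> (real k)) (\<beta> (real n))" if "k \<le> n" for n k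
      using disp_between[OF xN l, of "real k" "real (n - k)"] that by (simp add: of_nat_diff)
    have KM': "\<exists>K. (\<forall>k\<ge>K. dt q (\<beta> (real k)) \<le> (A + \<epsilon>) * real k) \<and>
      (\<forall>N. \<exists>n\<ge>N. \<forall>k. K \<le> k \<and> k \<le> n \<longrightarrow> (A - \<epsilon>) * real k \<le> dt q (\<beta> (real n)) - dt (\<beta> (real k)) (\<beta> (real n)))"
      if "0 < \<epsilon>" for \<epsilon>
      using KM[OF that] d d' by (metis (no_types, lifting))
    obtain v where "(\<lambda>k. Log c q (\<beta> (real k)) /\<^sub>R real k) \<longlonglongrightarrow> v"
      "\<And>\<delta>. 0 < \<delta> \<Longrightarrow> \<exists>K. \<forall>k\<ge>K. dt (\<beta> (real k)) (Ext c q (real k *\<^sub>R v)) \<le> \<delta> * real k"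
      by (rule asymptotic_ray[where c = c and q = q and y = "\<lambda>k. \<beta> (real k)" and A = A, OF b _ A KM']) (use lift_fromD(2)[OF l] in auto)
    then show ?thesis by blast
  qed
  obtain v where v: "(\<lambda>k. Log c q0 (\<beta>0 (real k)) /\<^sub>R real k) \<longlonglongrightarrow> v" using ray[OF b0 \<beta>0] by blast
  define V where "V = coord_vec M c (h x) v"
  have V: "V \<in> tangent_space M (h x)" "V c = v"
    unfolding V_def using coord_vec_tangent[OF c] coord_vec_self[OF c] by auto
  have "rotation_vector Mt \<pi> M f h x V" unfolding rotation_vector_def
  proof (intro conjI ballI impI V(1))
    fix q assume q: "q \<in> points Mt" "\<pi> q = h x"
    have b: "based c q" using q c by simp
    obtain \<beta> where \<beta>: "lift_from q (orbit x) \<beta>" using orbit_lift_exists[OF xN q] by blast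
    obtain w where w: "(\<lambda>k. Log c q (\<beta> (real k)) /\<^sub>R real k) \<longlonglongrightarrow> w"
      "\<And>\<delta>. 0 < \<delta> \<Longrightarrow> \<exists>K. \<forall>k\<ge>K. dt (\<beta> (real k)) (Ext c q (real k *\<^sub>R w)) \<le> \<delta> * real k" using ray[OF b \<beta>] by blast
    \<comment> \<open>All lifts have the same coordinates, so one vector serves for every point of
      the fibre.\<close>
    have "Log c q (\<beta> (real k)) = Log c q0 (\<beta>0 (real k))" for k by (rule lift_from_Log[OF \<beta>0 \<beta> b0]) simp
    then have "w = v" using LIMSEQ_unique[OF w(1)] v by simp
    then have "(\<lambda>t. dt (Ext c q (t *\<^sub>R v)) (\<beta> t)) \<in> o[at_top](\<lambda>t. t)" using near_lift[OF x b \<beta> w(2)] by simp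
    moreover have "lift_from q (\<lambda>t. exp_map M (h x) (tscale t V)) (\<lambda>t. Ext c q (t *\<^sub>R v))"
      using ray_lift[OF b q(2) V(1)] V(2) by simp
    ultimately show "\<exists>\<alpha>t \<beta>t. lift_from q (\<lambda>t. exp_map M (h x) (tscale t V)) \<alpha>t \<and>
        lift_from q (\<lambda>t. h (f t x)) \<beta>t \<and> (\<lambda>t. dt (\<alpha>t t) (\<beta>t t)) \<in> o[at_top](\<lambda>t. t)" using \<beta> by blast
  qed
  then show ?thesis by blast
qed

theorem AE_rotation_vector: "AE x in \<mu>. \<exists>!v. rotation_vector Mt \<pi> M f h x v"
  using AE_sublinear
proof eventually_elim
  case (elim x)
  then obtain A where A: "A \<ge> 0" "\<And>\<epsilon>. 0 < \<epsilon> \<Longrightarrow> \<exists>K. (\<forall>k\<ge>K. disp (real k) x \<le> (A + \<epsilon>) * real k) \<and>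
     (\<forall>N. \<exists>n\<ge>N. \<forall>k. K \<le> k \<and> k \<le> n \<longrightarrow> (A - \<epsilon>) * real k \<le> disp (real n) x - disp (real (n - k)) (f (real k) x))" by blast
  have x: "x \<in> supp" using elim by blast
  then have "x \<in> points N" using supp_subset by blast
  with rotation_vector_exists[OF x A] rotation_vector_unique show ?case by blast
qed

end

theorem theorem23:
  fixes N :: "('n::{t2_space,second_countable_topology}, 'd::euclidean_space) mfd"
    and M :: "('m::{t2_space,second_countable_topology}, 'e::euclidean_space) riem_mfd"
    and Mt :: "('c::{t2_space,second_countable_topology}, 'e) riem_mfd"
    and \<pi> :: "'c \<Rightarrow> 'm"
    and f :: "real \<Rightarrow> 'n \<Rightarrow> 'n"
    and \<mu> :: "'n measure"
    and h :: "'n \<Rightarrow> 'm"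
  assumes "manifold 1 N"
    and "C1_flow N f"
    and "prob_space \<mu>" and "sets \<mu> = sets (restrict_space borel (points N))"
    and "compact (measure_support \<mu>)"
    and "flow_preserves f \<mu>"
    and "riemannian_manifold M" and "connected (points M)"
    and "complete_riemannian M" and "nonpositive_curvature M"
    and "universal_riemannian_covering Mt \<pi> M"
    and "C_map 1 N M h"
  shows "AE x in \<mu>. \<exists>!v. rotation_vector Mt \<pi> M f h x v"
proof -
  have m: "manifold \<infinity> M" using assms(7) by (simp add: riemannian_manifold_def)
  interpret lifted_flow M Mt \<pi> N f \<mu> h
    by (intro lifted_flow.intro lifted_flow_axioms.intro universal_cover.intro universal_cover_axioms.intro hadamard_base.intro
        hadamard_base_axioms.intro riemannian.intro riemannian_axioms.intro smooth_manifold.intro measured_flow.intro) (fact m assms)+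
  show ?thesis by (rule AE_rotation_vector)
qed

end
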